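(* Let $M_{1,1}$, $M_{2,i}$ ($1\le i\le3$), $M_{3,j}$ ($1\le j\le3$), $M_{4,s}$ ($1\le s\le7$), $M_{5,t}$ ($t=1,2$) be the 16 based modules over $r(S_4)$ specified by explicit matrices in the context. Up to equivalence, the irreducible based modules of rank at most $5$ over $r(S_4)$ are precisely these 16 modules, which are pairwise inequivalent. Among them, $M_{1,1}$, $M_{2,2}$, $M_{2,3}$, $M_{3,1}$, $M_{3,2}$, $M_{3,3}$, $M_{4,1}$, $M_{4,5}$, $M_{4,7}$, $M_{5,1}$ and $M_{5,2}$ can be categorified by module categories over $\mathrm{Rep}(S_4)$, namely by the following ones: - $M_{1,1}$: $\mathrm{Rep}(\mathbb{Z}_1)$, $\mathrm{Rep}(K_4,\alpha)$; - $M_{2,2}$: $\mathrm{Rep}(\mathbb{Z}_2)$, $\mathrm{Rep}(D_4,\alpha)$; - $M_{2,3}$: $\mathrm{Rep}(\mathbb{Z}_2)$, $\mathrm{Rep}(D_4,\alpha)$; - $M_{3,1}$: $\mathrm{Rep}(\mathbb{Z}_3)$, $\mathrm{Rep}(A_4,\alpha)$; - $M_{3,2}$: $\mathrm{Rep}(S_3)$; - $M_{3,3}$: $\mathrm{Rep}(S_3)$, $\mathrm{Rep}(S_4,\alpha)$; - $M_{4,1}$: $\mathrm{Rep}(A_4)$; - $M_{4,5}$: $\mathrm{Rep}(\mathbb{Z}_4)$, $\mathrm{Rep}(K_4)$; - $M_{4,7}$: $\mathrm{Rep}(\mathbb{Z}_4)$, $\mathrm{Rep}(K_4)$; - $M_{5,1}$: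 $\mathrm{Rep}(S_4)$; - $M_{5,2}$: $\mathrm{Rep}(D_4)$. The remaining modules $M_{2,1}$, $M_{4,2}$, $M_{4,3}$, $M_{4,4}$ and $M_{4,6}$ cannot be categorified by module categories over $\mathrm{Rep}(S_4)$. Here $\alpha$ denotes, for the group $H$ in question, a 2-cocycle representing the unique nontrivial class in $H^2(H,\mathbb{C}^* )\cong\mathbb{Z}_2$.
   Context: The ring $r(S_4)$ is the Grothendieck ring of finite-dimensional complex representations of $S_4$. It is commutative and free over $\mathbb{Z}$ with basis $\{1,V_\psi,V_{\rho_1},V_{\rho_2},V_{\rho_3}\}$, the classes of the irreducible representations: trivial, sign, the 2-dimensional one, the 3-dimensional standard one (character value $1$ on transpositions), and $V_{\rho_3}=V_\psi V_{\rho_2}$. The products are determined by $V_\psi^2=1$, $V_\psi V_{\rho_1}=V_{\rho_1}$, $V_\psi V_{\rho_2}=V_{\rho_3}$, $V_{\rho_1}^2=1+V_\psi+V_{\rho_1}$, $V_{\rho_1}V_{\rho_2}=V_{\rho_2}+V_{\rho_3}$, $V_{\rho_2}^2=1+V_{\rho_1}+V_{\rho_2}+V_{\rho_3}$. All basis elements are self-dual. A $\mathbb{Z}_+$-module over $r(S_4)$ is an $r(S_4)$-module (with $1$ acting as identity) together with a fixed $\mathbb{Z}$-basis in which each basis element of $r(S_4)$ acts by a matrix with non-negative integer entries. Its rank is the size of the basis. It is a based module if, moreover, these matrices are all symmetric (the general condition $a_{il}^k=a_{i^*k}^l$, since here $i^*=i$). It is irreducible if it is nonzero and no nonempty proper subset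 of the fixed basis spans an $r(S_4)$-submodule. Two $\mathbb{Z}_+$-modules are equivalent if some bijection between their fixed bases induces an isomorphism of $r(S_4)$-modules. Categorification: for a subgroup $H\le S_4$ and a 2-cocycle $\alpha\in Z^2(H,\mathbb{C}^* )$, $\mathrm{Rep}(H,\alpha)$ is the category of finite-dimensional modules over the twisted group algebra $\mathbb{C}H_\alpha$ (basis $H$, product $g\cdot_\alpha h=\alpha(g,h)gh$); $\mathrm{Rep}(H)$ is the case $\alpha=1$. It is a module category over $\mathrm{Rep}(S_4)$ via $V\otimes N:=\mathrm{Res}^{S_4}_H(V)\otimes N$, and the indecomposable exact module categories over $\mathrm{Rep}(S_4)$ are of this form. Its Grothendieck group $r(H,\alpha)$, with basis the classes of simple objects, is a $\mathbb{Z}_+$-module over $r(S_4)$. A based module $M$ can be categorified by $\mathrm{Rep}(H,\alpha)$ if $M$ is equivalent to $r(H,\alpha)$; here the roles of the two 3-dimensional irreducible representations are regarded as symmetric, so that the names $V_{\rho_2}$ and $V_{\rho_3}$ may be exchanged when writing the action on $r(H,\alpha)$. Subgroups of $S_4$ are listed up to isomorphism: $\mathbb{Z}_n$ ($1\le n\le4$) cyclic of order $n$, $K_4$ the Klein 4-group, $S_3$, the dihedral group $D_4$ of order 8, $A_4$, $S_4$. The modules. Each is given by the matrices $(T,Q,U)$ of $(V_\psi,V_{\rho_1},V_{\rho_2})$; $V_{\rho_3}$ acts by $TU$; $E_n$ is the $n\times n$ identity matrix. $M_{1,1}$: $(1,2,3)$. $M_{2,1}$: $T=E_2$, $Q=2E_2$,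 $U=\begin{pmatrix}1&2\\2&1\end{pmatrix}$. For $M_{2,2},M_{2,3}$: $T=\begin{pmatrix}0&1\\1&0\end{pmatrix}$, $Q=\begin{pmatrix}1&1\\1&1\end{pmatrix}$, with $U=\begin{pmatrix}2&1\\1&2\end{pmatrix}$ for $M_{2,2}$ and $U=\begin{pmatrix}1&2\\2&1\end{pmatrix}$ for $M_{2,3}$. $M_{3,1}$: $T=E_3$, $Q=\begin{pmatrix}0&1&1\\1&0&1\\1&1&0\end{pmatrix}$, $U=\begin{pmatrix}1&1&1\\1&1&1\\1&1&1\end{pmatrix}$. For $M_{3,2},M_{3,3}$: $T=\begin{pmatrix}0&1&0\\1&0&0\\0&0&1\end{pmatrix}$, $Q=\begin{pmatrix}0&0&1\\0&0&1\\1&1&1\end{pmatrix}$, with $U=\begin{pmatrix}1&0&1\\0&1&1\\1&1&2\end{pmatrix}$ for $M_{3,2}$ and $U=\begin{pmatrix}0&1&1\\1&0&1\\1&1&2\end{pmatrix}$ for $M_{3,3}$. $M_{4,1}$: $T=E_4$, $Q=\begin{pmatrix}0&0&1&1\\0&2&0&0\\1&0&0&1\\1&0&1&0\end{pmatrix}$, $U=\begin{pmatrix}0&1&0&0\\1&2&1&1\\0&1&0&0\\0&1&0&0\end{pmatrix}$. $M_{4,2}$: $T=E_4$, $Q=2E_4$, $U=\begin{pmatrix}0&1&1&1\\1&0&1&1\\1&1&0&1\\1&1&1&0\end{pmatrix}$. For $M_{4,3},M_{4,4}$: $T=\begin{pmatrix}0&1&0&0\\1&0&0&0\\0&0&1&0\\0&0&0&1\end{pmatrix}$,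 $Q=\begin{pmatrix}1&1&0&0\\1&1&0&0\\0&0&2&0\\0&0&0&2\end{pmatrix}$, with $U=\begin{pmatrix}1&0&1&1\\0&1&1&1\\1&1&0&1\\1&1&1&0\end{pmatrix}$ for $M_{4,3}$ and $U=\begin{pmatrix}0&1&1&1\\1&0&1&1\\1&1&0&1\\1&1&1&0\end{pmatrix}$ for $M_{4,4}$. For $M_{4,5},M_{4,6},M_{4,7}$: $T=\begin{pmatrix}0&1&0&0\\1&0&0&0\\0&0&0&1\\0&0&1&0\end{pmatrix}$, $Q=\begin{pmatrix}1&1&0&0\\1&1&0&0\\0&0&1&1\\0&0&1&1\end{pmatrix}$, with $U=\begin{pmatrix}0&1&1&1\\1&0&1&1\\1&1&0&1\\1&1&1&0\end{pmatrix}$ for $M_{4,5}$, $U=\begin{pmatrix}0&1&1&1\\1&0&1&1\\1&1&1&0\\1&1&0&1\end{pmatrix}$ for $M_{4,6}$, $U=\begin{pmatrix}1&0&1&1\\0&1&1&1\\1&1&1&0\\1&1&0&1\end{pmatrix}$ for $M_{4,7}$. For $M_{5,1},M_{5,2}$: $T=\begin{pmatrix}0&1&0&0&0\\1&0&0&0&0\\0&0&0&1&0\\0&0&1&0&0\\0&0&0&0&1\end{pmatrix}$. $M_{5,1}$: $Q=\begin{pmatrix}0&0&0&0&1\\0&0&0&0&1\\0&0&1&1&0\\0&0&1&1&0\\1&1&0&0&1\end{pmatrix}$, $U=\begin{pmatrix}0&0&0&1&0\\0&0&1&0&0\\0&1&1&1&1\\1&0&1&1&1\\0&0&1&1&0\end{pmatrix}$.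 $M_{5,2}$: $Q=\begin{pmatrix}1&1&0&0&0\\1&1&0&0&0\\0&0&1&1&0\\0&0&1&1&0\\0&0&0&0&2\end{pmatrix}$, $U=\begin{pmatrix}0&0&0&1&1\\0&0&1&0&1\\0&1&0&0&1\\1&0&0&0&1\\1&1&1&1&1\end{pmatrix}$.
   Formalization: M_{2,1} and M_{4,2} are shown non-categorifiable only for subgroups conjugate to a listed one, with Z_2=<(12)> and K_4=<(12),(34)>; the claim fails otherwise, since <(12)(34)> gives M_{2,1} and the normal Klein group gives M_{4,2}. *)

theory Defs
  imports
    "HOL-Algebra.Sym_Groups"
    "HOL-Algebra.Elementary_Groups"
    "Jordan_Normal_Form.VS_Connect"
begin

section \<open>The ring \<open>r(S\<^sub>4)\<close> and its based modules\<close>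

text \<open>The distinguished basis \<open>1, V\<^sub>\<psi>, V\<^sub>\<rho>\<^sub>1, V\<^sub>\<rho>\<^sub>2, V\<^sub>\<rho>\<^sub>3\<close> of \<open>r(S\<^sub>4)\<close>; the product of two basis
  elements is the sum of the listed basis elements.\<close>

datatype irr = One | Psi | Rho1 | Rho2 | Rho3

fun irr_prod :: "irr \<Rightarrow> irr \<Rightarrow> irr list" where
  "irr_prod One y = [y]"
| "irr_prod x One = [x]"
| "irr_prod Psi Psi = [One]"
| "irr_prod Psi Rho1 = [Rho1]"
| "irr_prod Rho1 Psi = [Rho1]"
| "irr_prod Psi Rho2 = [Rho3]"
| "irr_prod Rho2 Psi = [Rho3]"
| "irr_prod Psi Rho3 = [Rho2]"
| "irr_prod Rho3 Psi = [Rho2]"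
| "irr_prod Rho1 Rho1 = [One, Psi, Rho1]"
| "irr_prod Rho1 Rho2 = [Rho2, Rho3]"
| "irr_prod Rho2 Rho1 = [Rho2, Rho3]"
| "irr_prod Rho1 Rho3 = [Rho2, Rho3]"
| "irr_prod Rho3 Rho1 = [Rho2, Rho3]"
| "irr_prod Rho2 Rho2 = [One, Rho1, Rho2, Rho3]"
| "irr_prod Rho3 Rho3 = [One, Rho1, Rho2, Rho3]"
| "irr_prod Rho2 Rho3 = [Psi, Rho1, Rho2, Rho3]"
| "irr_prod Rho3 Rho2 = [Psi, Rho1, Rho2, Rho3]"

text \<open>A free abelian group on a fixed basis, with a matrix for each basis element of \<open>r(S\<^sub>4)\<close>:
  \<open>zcoef M x k l\<close> is the coefficient of the basis vector \<open>k\<close> in \<open>x \<cdot> l\<close>. Only indices in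
  \<open>zbasis M\<close> are relevant.\<close>

record 'b zdata =
  zbasis :: "'b set"
  zcoef :: "irr \<Rightarrow> 'b \<Rightarrow> 'b \<Rightarrow> int"

definition zrank :: "'b zdata \<Rightarrow> nat" where
  "zrank M = card (zbasis M)"

definition zplus_module :: "'b zdata \<Rightarrow> bool" where
  "zplus_module M \<longleftrightarrow>
     finite (zbasis M) \<and>
     (\<forall>x. \<forall>k\<in>zbasis M. \<forall>l\<in>zbasis M. 0 \<le> zcoef M x k l) \<and>
     (\<forall>k\<in>zbasis M. \<forall>l\<in>zbasis M. zcoef M One k l = of_bool (k = l)) \<and>
     (\<forall>x y. \<forall>k\<in>zbasis M. \<forall>l\<in>zbasis M.
        (\<Sum>m\<in>zbasis M. zcoef M x k m * zcoef M y m l) = (\<Sum>z\<leftarrow>irr_prod x y. zcoef M z k l))"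

text \<open>The basis elements of \<open>r(S\<^sub>4)\<close> are self-dual, so the condition is symmetry.\<close>

definition based_module :: "'b zdata \<Rightarrow> bool" where
  "based_module M \<longleftrightarrow> zplus_module M \<and>
     (\<forall>x. \<forall>k\<in>zbasis M. \<forall>l\<in>zbasis M. zcoef M x k l = zcoef M x l k)"

definition zspan :: "'b set \<Rightarrow> ('b \<Rightarrow> int) set" where
  "zspan J = {v. \<forall>k. k \<notin> J \<longrightarrow> v k = 0}"

definition zact :: "'b zdata \<Rightarrow> irr \<Rightarrow> ('b \<Rightarrow> int) \<Rightarrow> 'b \<Rightarrow> int" where
  "zact M x v = (\<lambda>k. if k \<in> zbasis M then \<Sum>l\<in>zbasis M. zcoef M x k l * v l else 0)"

definition spans_submodule :: "'b zdata \<Rightarrow> 'b set \<Rightarrow> bool" where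
  "spans_submodule M J \<longleftrightarrow> (\<forall>x. \<forall>v\<in>zspan J. zact M x v \<in> zspan J)"

definition zirreducible :: "'b zdata \<Rightarrow> bool" where
  "zirreducible M \<longleftrightarrow> zbasis M \<noteq> {} \<and>
     \<not> (\<exists>J. J \<noteq> {} \<and> J \<subset> zbasis M \<and> spans_submodule M J)"

definition zequiv :: "'b zdata \<Rightarrow> 'c zdata \<Rightarrow> bool" where
  "zequiv M N \<longleftrightarrow> (\<exists>f. bij_betw f (zbasis M) (zbasis N) \<and>
     (\<forall>x. \<forall>k\<in>zbasis M. \<forall>l\<in>zbasis M. zcoef N x (f k) (f l) = zcoef M x k l))"


section \<open>The explicit modules\<close>

text \<open>The arguments are the size and the rows of the matrices of \<open>V\<^sub>\<psi>, V\<^sub>\<rho>\<^sub>1, V\<^sub>\<rho>\<^sub>2\<close>.\<close>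

definition mk_module :: "nat \<Rightarrow> int list list \<Rightarrow> int list list \<Rightarrow> int list list \<Rightarrow> nat zdata" where
  "mk_module n T Q U = \<lparr>
     zbasis = {..<n},
     zcoef = (\<lambda>x k l.
       (case x of
          One \<Rightarrow> 1\<^sub>m n
        | Psi \<Rightarrow> mat_of_rows_list n T
        | Rho1 \<Rightarrow> mat_of_rows_list n Q
        | Rho2 \<Rightarrow> mat_of_rows_list n U
        | Rho3 \<Rightarrow> mat_of_rows_list n T * mat_of_rows_list n U) $$ (k, l)) \<rparr>"

definition "M11 = mk_module 1 [[1]] [[2]] [[3]]"

definition "M21 = mk_module 2
  [[1,0],[0,1]]
  [[2,0],[0,2]]
  [[1,2],[2,1]]"

definition "M22 = mk_module 2
  [[0,1],[1,0]]
  [[1,1],[1,1]]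
  [[2,1],[1,2]]"

definition "M23 = mk_module 2
  [[0,1],[1,0]]
  [[1,1],[1,1]]
  [[1,2],[2,1]]"

definition "M31 = mk_module 3
  [[1,0,0],[0,1,0],[0,0,1]]
  [[0,1,1],[1,0,1],[1,1,0]]
  [[1,1,1],[1,1,1],[1,1,1]]"

definition "M32 = mk_module 3
  [[0,1,0],[1,0,0],[0,0,1]]
  [[0,0,1],[0,0,1],[1,1,1]]
  [[1,0,1],[0,1,1],[1,1,2]]"

definition "M33 = mk_module 3
  [[0,1,0],[1,0,0],[0,0,1]]
  [[0,0,1],[0,0,1],[1,1,1]]
  [[0,1,1],[1,0,1],[1,1,2]]"

definition "M41 = mk_module 4
  [[1,0,0,0],[0,1,0,0],[0,0,1,0],[0,0,0,1]]
  [[0,0,1,1],[0,2,0,0],[1,0,0,1],[1,0,1,0]]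
  [[0,1,0,0],[1,2,1,1],[0,1,0,0],[0,1,0,0]]"

definition "M42 = mk_module 4
  [[1,0,0,0],[0,1,0,0],[0,0,1,0],[0,0,0,1]]
  [[2,0,0,0],[0,2,0,0],[0,0,2,0],[0,0,0,2]]
  [[0,1,1,1],[1,0,1,1],[1,1,0,1],[1,1,1,0]]"

definition "M43 = mk_module 4
  [[0,1,0,0],[1,0,0,0],[0,0,1,0],[0,0,0,1]]
  [[1,1,0,0],[1,1,0,0],[0,0,2,0],[0,0,0,2]]
  [[1,0,1,1],[0,1,1,1],[1,1,0,1],[1,1,1,0]]"

definition "M44 = mk_module 4
  [[0,1,0,0],[1,0,0,0],[0,0,1,0],[0,0,0,1]]
  [[1,1,0,0],[1,1,0,0],[0,0,2,0],[0,0,0,2]]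
  [[0,1,1,1],[1,0,1,1],[1,1,0,1],[1,1,1,0]]"

definition "M45 = mk_module 4
  [[0,1,0,0],[1,0,0,0],[0,0,0,1],[0,0,1,0]]
  [[1,1,0,0],[1,1,0,0],[0,0,1,1],[0,0,1,1]]
  [[0,1,1,1],[1,0,1,1],[1,1,0,1],[1,1,1,0]]"

definition "M46 = mk_module 4
  [[0,1,0,0],[1,0,0,0],[0,0,0,1],[0,0,1,0]]
  [[1,1,0,0],[1,1,0,0],[0,0,1,1],[0,0,1,1]]
  [[0,1,1,1],[1,0,1,1],[1,1,1,0],[1,1,0,1]]"

definition "M47 = mk_module 4
  [[0,1,0,0],[1,0,0,0],[0,0,0,1],[0,0,1,0]]
  [[1,1,0,0],[1,1,0,0],[0,0,1,1],[0,0,1,1]]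
  [[1,0,1,1],[0,1,1,1],[1,1,1,0],[1,1,0,1]]"

definition "M51 = mk_module 5
  [[0,1,0,0,0],[1,0,0,0,0],[0,0,0,1,0],[0,0,1,0,0],[0,0,0,0,1]]
  [[0,0,0,0,1],[0,0,0,0,1],[0,0,1,1,0],[0,0,1,1,0],[1,1,0,0,1]]
  [[0,0,0,1,0],[0,0,1,0,0],[0,1,1,1,1],[1,0,1,1,1],[0,0,1,1,0]]"

definition "M52 = mk_module 5
  [[0,1,0,0,0],[1,0,0,0,0],[0,0,0,1,0],[0,0,1,0,0],[0,0,0,0,1]]
  [[1,1,0,0,0],[1,1,0,0,0],[0,0,1,1,0],[0,0,1,1,0],[0,0,0,0,2]]
  [[0,0,0,1,1],[0,0,1,0,1],[0,1,0,0,1],[1,0,0,0,1],[1,1,1,1,1]]"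

definition explicit_modules :: "nat zdata list" where
  "explicit_modules =
     [M11, M21, M22, M23, M31, M32, M33, M41, M42, M43, M44, M45, M46, M47, M51, M52]"


section \<open>Subgroups of \<open>S\<^sub>4\<close> and 2-cocycles\<close>

type_synonym perm4 = "nat \<Rightarrow> nat"

abbreviation S4 :: "perm4 monoid" where
  "S4 \<equiv> sym_group 4"

text \<open>\<open>S\<^sub>4\<close> acts on \<open>{1,2,3,4}\<close>. The subgroups of \<open>S\<^sub>4\<close> are listed up to isomorphism, one for each
  isomorphism type. Two types, \<open>\<int>\<^sub>2\<close> and \<open>K\<^sub>4\<close>, comprise two conjugacy classes of subgroups each, and
  the choice matters: \<open>\<int>\<^sub>2\<close> is generated by a transposition and \<open>K\<^sub>4\<close> by two disjoint transpositions.
  For the other choices, \<open>\<langle>(1 2)(3 4)\<rangle>\<close> and the normal Klein group, the sign representation restricts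
  to the trivial one, so that \<open>Rep(H)\<close> gives the modules called \<open>M21\<close> and \<open>M42\<close> above instead of \<open>M22\<close>,
  \<open>M23\<close>, \<open>M45\<close> and \<open>M47\<close>.\<close>

definition Z1_sub :: "perm4 set" where
  "Z1_sub = {id}"

definition Z2_sub :: "perm4 set" where
  "Z2_sub = generate S4 {cycle_of_list [1, 2]}"

definition Z3_sub :: "perm4 set" where
  "Z3_sub = generate S4 {cycle_of_list [1, 2, 3]}"

definition Z4_sub :: "perm4 set" where
  "Z4_sub = generate S4 {cycle_of_list [1, 2, 3, 4]}"

definition K4_sub :: "perm4 set" where
  "K4_sub = generate S4 {cycle_of_list [1, 2], cycle_of_list [3, 4]}"

definition S3_sub :: "perm4 set" where
  "S3_sub = carrier (sym_group 3)"

definition D4_sub :: "perm4 set" where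
  "D4_sub = generate S4 {cycle_of_list [1, 2, 3, 4], cycle_of_list [1, 3]}"

definition A4_sub :: "perm4 set" where
  "A4_sub = carrier (alt_group 4)"

definition S4_sub :: "perm4 set" where
  "S4_sub = carrier S4"

text \<open>Conjugate subgroups give equivalent module categories, so the list is read up to
  conjugation.\<close>

definition listed_subgroup :: "perm4 set \<Rightarrow> bool" where
  "listed_subgroup H \<longleftrightarrow>
     (\<exists>K \<in> {Z1_sub, Z2_sub, Z3_sub, Z4_sub, K4_sub, S3_sub, D4_sub, A4_sub, S4_sub}.
      \<exists>g \<in> carrier S4. H = (g <#\<^bsub>S4\<^esub> K) #>\<^bsub>S4\<^esub> (inv\<^bsub>S4\<^esub> g))"

text \<open>\<open>Z\<^sup>2(H, \<complex>\<^sup>*)\<close>, \<open>B\<^sup>2(H, \<complex>\<^sup>*)\<close> and \<open>H\<^sup>2(H, \<complex>\<^sup>*)\<close> for the trivial action. Cocycles are not assumed to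
  be normalized.\<close>

definition cocycle_group :: "perm4 set \<Rightarrow> (perm4 \<times> perm4 \<Rightarrow> complex) monoid" where
  "cocycle_group H = \<lparr>
     carrier = {\<alpha> \<in> H \<times> H \<rightarrow>\<^sub>E - {0}.
       \<forall>g\<in>H. \<forall>h\<in>H. \<forall>k\<in>H. \<alpha> (g, h) * \<alpha> (g \<circ> h, k) = \<alpha> (g, h \<circ> k) * \<alpha> (h, k)},
     mult = (\<lambda>\<alpha> \<beta>. \<lambda>p\<in>H \<times> H. \<alpha> p * \<beta> p),
     one = (\<lambda>p\<in>H \<times> H. 1) \<rparr>"

definition coboundaries :: "perm4 set \<Rightarrow> (perm4 \<times> perm4 \<Rightarrow> complex) set" where
  "coboundaries H =
     {(\<lambda>(g, h)\<in>H \<times> H. \<mu> g * \<mu> h / \<mu> (g \<circ> h)) | \<mu> :: perm4 \<Rightarrow> complex. \<forall>h\<in>H. \<mu> h \<noteq> 0}"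

definition second_cohomology ::
    "perm4 set \<Rightarrow> (perm4 \<times> perm4 \<Rightarrow> complex) set monoid" where
  "second_cohomology H = cocycle_group H Mod coboundaries H"

definition trivial_cocycle :: "perm4 set \<Rightarrow> perm4 \<times> perm4 \<Rightarrow> complex" where
  "trivial_cocycle H = \<one>\<^bsub>cocycle_group H\<^esub>"

definition nontrivial_cocycles :: "perm4 set \<Rightarrow> (perm4 \<times> perm4 \<Rightarrow> complex) set" where
  "nontrivial_cocycles H = carrier (cocycle_group H) - coboundaries H"


section \<open>The category \<open>Rep(H, \<alpha>)\<close>\<close>

text \<open>A finite-dimensional module over the twisted group algebra \<open>\<complex>H\<^sub>\<alpha>\<close>, in coordinates: \<open>\<rho> h\<close> is the
  matrix by which the basis element \<open>h\<close> of \<open>\<complex>H\<^sub>\<alpha>\<close> acts. The equation \<open>\<rho> g \<rho> h = \<alpha>(g,h) \<rho> (gh)\<close> is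
  multiplicativity; the unit of \<open>\<complex>H\<^sub>\<alpha>\<close> is \<open>\<alpha>(1,1)\<inverse> \<cdot> 1\<close>, which gives the last condition. The values of
  \<open>\<rho>\<close> outside \<open>H\<close> are irrelevant. Dimension 0 is allowed.\<close>

type_synonym rep = "perm4 \<Rightarrow> complex mat"

definition deg :: "rep \<Rightarrow> nat" where
  "deg \<rho> = dim_row (\<rho> id)"

definition twisted_module :: "perm4 set \<Rightarrow> (perm4 \<times> perm4 \<Rightarrow> complex) \<Rightarrow> rep \<Rightarrow> bool" where
  "twisted_module H \<alpha> \<rho> \<longleftrightarrow>
     (\<forall>h\<in>H. \<rho> h \<in> carrier_mat (deg \<rho>) (deg \<rho>)) \<and>
     (\<forall>g\<in>H. \<forall>h\<in>H. \<rho> g * \<rho> h = \<alpha> (g, h) \<cdot>\<^sub>m \<rho> (g \<circ> h)) \<and>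
     \<rho> id = \<alpha> (id, id) \<cdot>\<^sub>m 1\<^sub>m (deg \<rho>)"

definition rep_iso :: "perm4 set \<Rightarrow> rep \<Rightarrow> rep \<Rightarrow> bool" where
  "rep_iso H \<rho> \<sigma> \<longleftrightarrow>
     (\<exists>P. P \<in> carrier_mat (deg \<sigma>) (deg \<rho>) \<and> invertible_mat P \<and> (\<forall>h\<in>H. P * \<rho> h = \<sigma> h * P))"

definition simple_modules :: "perm4 set \<Rightarrow> (perm4 \<times> perm4 \<Rightarrow> complex) \<Rightarrow> rep set" where
  "simple_modules H \<alpha> = {\<rho>. twisted_module H \<alpha> \<rho> \<and> 0 < deg \<rho> \<and>
     (\<forall>W. subspace class_ring W (module_vec TYPE(complex) (deg \<rho>)) \<longrightarrow>
          (\<forall>h\<in>H. \<forall>w\<in>W. \<rho> h *\<^sub>v w \<in> W) \<longrightarrow>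
          W = {0\<^sub>v (deg \<rho>)} \<or> W = carrier_vec (deg \<rho>))}"

definition direct_sum :: "rep list \<Rightarrow> rep" where
  "direct_sum \<rho>s = (\<lambda>h. diag_block_mat (map (\<lambda>\<rho>. \<rho> h) \<rho>s))"

definition kronecker :: "complex mat \<Rightarrow> complex mat \<Rightarrow> complex mat" where
  "kronecker A B = mat (dim_row A * dim_row B) (dim_col A * dim_col B)
     (\<lambda>(i, j). A $$ (i div dim_row B, j div dim_col B) * B $$ (i mod dim_row B, j mod dim_col B))"

definition tensor_rep :: "rep \<Rightarrow> rep \<Rightarrow> rep" where
  "tensor_rep V N = (\<lambda>h. kronecker (V h) (N h))"

definition simple_classes :: "perm4 set \<Rightarrow> (perm4 \<times> perm4 \<Rightarrow> complex) \<Rightarrow> rep set set" where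
  "simple_classes H \<alpha> = simple_modules H \<alpha> //
     {(\<rho>, \<sigma>). \<rho> \<in> simple_modules H \<alpha> \<and> \<sigma> \<in> simple_modules H \<alpha> \<and> rep_iso H \<rho> \<sigma>}"

text \<open>The coefficient at the class \<open>K\<close> of the class of \<open>X\<close> in the Grothendieck group: the number of
  summands belonging to \<open>K\<close> in a decomposition of \<open>X\<close> as a direct sum of simple modules. It is well
  defined since \<open>\<complex>H\<^sub>\<alpha>\<close> is semisimple.\<close>

definition multiplicity ::
    "perm4 set \<Rightarrow> (perm4 \<times> perm4 \<Rightarrow> complex) \<Rightarrow> rep \<Rightarrow> rep set \<Rightarrow> nat" where
  "multiplicity H \<alpha> X K = (THE m. \<exists>\<rho>s. set \<rho>s \<subseteq> simple_modules H \<alpha> \<and>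
     rep_iso H X (direct_sum \<rho>s) \<and> m = length (filter (\<lambda>\<rho>. \<rho> \<in> K) \<rho>s))"


section \<open>The irreducible representations of \<open>S\<^sub>4\<close>\<close>

text \<open>\<open>S\<^sub>4\<close> permutes the three partitions of \<open>{1,2,3,4}\<close> into two pairs. Such a partition is labelled by
  the partner \<open>j \<in> {1,2,3}\<close> of 4; \<open>p\<close> maps the pair \<open>{j,4}\<close> to \<open>{p j, p 4}\<close>, and if this pair does not
  contain 4 then the partner of 4 is the remaining element of \<open>{1,2,3}\<close>.\<close>

definition pairing_action :: "perm4 \<Rightarrow> nat \<Rightarrow> nat" where
  "pairing_action p j =
     (if p 4 = 4 then p j else if p j = 4 then p 4 else 6 - p j - p 4)"

text \<open>\<open>V\<^sub>\<rho>\<^sub>1\<close> and \<open>V\<^sub>\<rho>\<^sub>2\<close> are the sum-zero subspaces of the permutation representations on the three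
  pairings and on \<open>{1,2,3,4}\<close>, in the bases \<open>e\<^sub>1 - e\<^sub>3, e\<^sub>2 - e\<^sub>3\<close> and \<open>e\<^sub>1 - e\<^sub>4, e\<^sub>2 - e\<^sub>4, e\<^sub>3 - e\<^sub>4\<close>. Matrix
  indices start at 0.\<close>

definition std_rep :: rep where
  "std_rep p = mat 3 3 (\<lambda>(i, j). of_bool (p (j + 1) = i + 1) - of_bool (p 4 = i + 1))"

fun irr_rep :: "irr \<Rightarrow> rep" where
  "irr_rep One p = 1\<^sub>m 1"
| "irr_rep Psi p = of_int (sign p) \<cdot>\<^sub>m 1\<^sub>m 1"
| "irr_rep Rho1 p = mat 2 2 (\<lambda>(i, j).
     of_bool (pairing_action p (j + 1) = i + 1) - of_bool (pairing_action p 3 = i + 1))"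
| "irr_rep Rho2 p = std_rep p"
| "irr_rep Rho3 p = of_int (sign p) \<cdot>\<^sub>m std_rep p"


section \<open>Categorification\<close>

text \<open>The \<open>\<int>\<^sub>+\<close>-module \<open>r(H, \<alpha>)\<close>. The representative \<open>\<rho>\<close> of the class \<open>L\<close> is immaterial.\<close>

definition grothendieck_module ::
    "perm4 set \<Rightarrow> (perm4 \<times> perm4 \<Rightarrow> complex) \<Rightarrow> rep set zdata" where
  "grothendieck_module H \<alpha> = \<lparr>
     zbasis = simple_classes H \<alpha>,
     zcoef = (\<lambda>x K L. int (multiplicity H \<alpha> (tensor_rep (irr_rep x) (SOME \<rho>. \<rho> \<in> L)) K)) \<rparr>"

definition exchange_rho :: "'b zdata \<Rightarrow> 'b zdata" where
  "exchange_rho M = \<lparr>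
     zbasis = zbasis M,
     zcoef = (\<lambda>x. zcoef M (case x of Rho2 \<Rightarrow> Rho3 | Rho3 \<Rightarrow> Rho2 | y \<Rightarrow> y)) \<rparr>"

text \<open>The roles of the two 3-dimensional irreducible representations may be exchanged.\<close>

definition categorified_by ::
    "'b zdata \<Rightarrow> perm4 set \<Rightarrow> (perm4 \<times> perm4 \<Rightarrow> complex) \<Rightarrow> bool" where
  "categorified_by M H \<alpha> \<longleftrightarrow>
     zequiv M (grothendieck_module H \<alpha>) \<or> zequiv M (exchange_rho (grothendieck_module H \<alpha>))"

abbreviation categorified_by_Rep :: "'b zdata \<Rightarrow> perm4 set \<Rightarrow> bool" where
  "categorified_by_Rep M H \<equiv> categorified_by M H (trivial_cocycle H)"

text \<open>Categorification by \<open>Rep(H, \<alpha>)\<close> for a representative \<open>\<alpha>\<close> of the nontrivial class; to be used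
  only where \<open>H\<^sup>2(H, \<complex>\<^sup>*)\<close> has order 2. The claim is made for every representative.\<close>

definition categorified_by_twisted :: "'b zdata \<Rightarrow> perm4 set \<Rightarrow> bool" where
  "categorified_by_twisted M H \<longleftrightarrow> (\<forall>\<alpha> \<in> nontrivial_cocycles H. categorified_by M H \<alpha>)"

end

theory Submission
  imports Defs "Jordan_Normal_Form.Char_Poly" "HOL-Computational_Algebra.Fundamental_Theorem_Algebra"
    "HOL-Algebra.Group_Action"
begin

text \<open>Modules over the twisted group algebra of \<open>H\<close> are semisimple, and the orthogonality relations for their
  traces hold with \<open>\<rho>(h)\<^sup>-\<^sup>1\<close> in the role of the complex conjugate of \<open>\<rho>(h)\<close>, so the structure constants of
  \<open>r(H, \<alpha>)\<close> are averages of character values. A class in \<open>H\<^sup>2(H, \<complex>\<^sup>*)\<close> for the four noncyclic groups is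
  detected by whether the lifts of two commuting involutions commute, and the nontrivial class is realised by
  the two-dimensional projective representation of \<open>S\<^sub>4\<close> by quaternions.

  For the classification, the matrix \<open>R\<close> of the regular representation is positive on an irreducible based
  module and satisfies \<open>R\<^sup>2 = 24 R\<close>. Hence it has rank one and trace 24, and its diagonal determines it. The
  diagonal, the involution \<open>V\<^sub>\<psi>\<close> and reduction modulo 3 determine the matrix of \<open>V\<^sub>\<rho>\<^sub>1\<close> and leave few
  possibilities for that of \<open>V\<^sub>\<rho>\<^sub>2\<close>.

  The diagonal entry of \<open>R\<close> at a simple module of dimension \<open>d\<close> is \<open>24 d\<^sup>2 / |H|\<close>, which fixes \<open>|H|\<close> and \<open>d\<close>
  for the modules that cannot be categorified.\<close>

section \<open>Matrices\<close>

text \<open>Structure constants are defined by a definite description over all decompositions, so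
  none can be computed before complete reducibility and uniqueness are known. Inverses replace
  conjugates because the cocycles need be neither unitary nor normalized, and because the product of
  the traces of \<rho> h and of its inverse is unchanged when \<rho> is rescaled along a coboundary.

  All simple modules are sought as \<theta> tensor \<pi> with ordinary representations \<theta> and
  one twisted module \<pi>; a finite table of values in a quadratic ring then decides both
  simplicity and the structure constants.

  The twisted claims concern every representative of the nontrivial class, so H^2 has to be bounded
  by 2 from above. Klein and dihedral groups have explicit sections in the twisted group algebra; A4
  and S4 need transfer from subgroups of coprime index.

  Modulo 3 enters because R - 1 - Psi is 2 Q + 3 S, with Q the matrix of Rho1 and S the sum of the
  two three-dimensional ones.

  The hard exclusion is \<open>M21\<close>: a dihedral group with a nontrivial class has the right
  order and dimensions, and one has to see that its module is \<open>M23\<close>.\<close>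

definition mtrace :: "'a::comm_ring_1 mat \<Rightarrow> 'a" where
  "mtrace A = (\<Sum>i<dim_row A. A $$ (i, i))"

lemma mtrace_mult:
  assumes "A \<in> carrier_mat n m" "B \<in> carrier_mat m n"
  shows "mtrace (A * B) = (\<Sum>i<n. \<Sum>k<m. A $$ (i,k) * B $$ (k,i))"
  using assms by (auto simp: mtrace_def scalar_prod_def atLeast0LessThan intro!: sum.cong)

lemma mtrace_comm:
  assumes "A \<in> carrier_mat n m" "B \<in> carrier_mat m n"
  shows "mtrace (A * B) = mtrace (B * A)"
  unfolding mtrace_mult[OF assms] mtrace_mult[OF assms(2,1)]
  by (subst sum.swap) (simp add: mult.commute)

lemma mtrace_one [simp]: "mtrace (1\<^sub>m n) = of_nat n"
  by (simp add: mtrace_def)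

lemma mtrace_smult [simp]: "mtrace (c \<cdot>\<^sub>m A) = c * mtrace A" if "A \<in> carrier_mat n n"
  using that by (simp add: mtrace_def sum_distrib_left)

text \<open>The traces of \<open>A * B\<close> and \<open>B * A\<close> agree and are the images of
  \<open>n\<close> and \<open>m\<close>; characteristic 0 separates these.\<close>

lemma inverse_mats_same_dim:
  fixes A :: "complex mat"
  assumes "A \<in> carrier_mat n m" "B \<in> carrier_mat m n" "A * B = 1\<^sub>m n" "B * A = 1\<^sub>m m"
  shows "n = m"
proof -
  have "complex_of_nat n = of_nat m" using mtrace_comm[OF assms(1,2)] assms(3,4) by simp
  then show ?thesis by simp
qed

lemma invertible_matI:
  assumes "P \<in> carrier_mat n n" "Q \<in> carrier_mat n n" "P * Q = 1\<^sub>m n" "Q * P = 1\<^sub>m n"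
  shows "invertible_mat P"
  using assms unfolding invertible_mat_def inverts_mat_def by auto

lemma invertible_matE:
  assumes "invertible_mat P" "P \<in> carrier_mat n m"
  obtains Q where "n = m" "Q \<in> carrier_mat n n" "P * Q = 1\<^sub>m n" "Q * P = 1\<^sub>m n"
proof -
  from assms(1) obtain Q where sq: "dim_row P = dim_col P" and
    PQ: "P * Q = 1\<^sub>m (dim_row P)" and QP: "Q * P = 1\<^sub>m (dim_row Q)"
    unfolding invertible_mat_def inverts_mat_def by auto
  from assms(2) have "n = dim_row P" "m = dim_col P" by auto
  moreover have "dim_col Q = dim_row P" using PQ by (metis index_mult_mat(3) index_one_mat(3))
  moreover have "dim_row Q = dim_col P" using QP by (metis index_mult_mat(3) index_one_mat(3))
  ultimately show thesis using that[of Q] sq PQ QP by (metis carrier_matI)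
qed

lemma mat_eq_if_mult_vec_eq:
  fixes A :: "'a::semiring_1 mat"
  assumes "A \<in> carrier_mat n m" "B \<in> carrier_mat n m"
    and eq: "\<And>v. v \<in> carrier_vec m \<Longrightarrow> A *\<^sub>v v = B *\<^sub>v v"
  shows "A = B"
proof (rule eq_matI)
  fix i j assume ij: "i < dim_row B" "j < dim_col B"
  then have ij: "i < n" "j < m" using assms by auto
  have "A *\<^sub>v unit_vec m j = B *\<^sub>v unit_vec m j" by (rule eq) simp
  then have "(A *\<^sub>v unit_vec m j) $ i = (B *\<^sub>v unit_vec m j) $ i" by simp
  then show "A $$ (i, j) = B $$ (i, j)" using assms(1,2) ij by simp
qed (use assms in auto)

lemma mult_unit_vec_index:
  fixes M :: "'a::semiring_1 mat"
  shows "M \<in> carrier_mat n m \<Longrightarrow> j < n \<Longrightarrow> l < m \<Longrightarrow> (M *\<^sub>v unit_vec m l) $ j = M $$ (j, l)"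
  using scalar_prod_right_unit[of l m "row M j"] by simp

lemma mult_vec_index:
  "M \<in> carrier_mat n m \<Longrightarrow> v \<in> carrier_vec m \<Longrightarrow> j < n \<Longrightarrow>
    (M *\<^sub>v v) $ j = (\<Sum>l<m. M $$ (j, l) * v $ l)"
  by (simp add: scalar_prod_def atLeast0LessThan)

lemma subspaceI_vec:
  fixes W :: "complex vec set"
  assumes "W \<subseteq> carrier_vec n" "0\<^sub>v n \<in> W" "\<And>v w. v \<in> W \<Longrightarrow> w \<in> W \<Longrightarrow> v + w \<in> W"
    "\<And>c v. v \<in> W \<Longrightarrow> c \<cdot>\<^sub>v v \<in> W"
  shows "VectorSpace.subspace class_ring W (module_vec TYPE(complex) n)"
proof -
  interpret V: vec_space "TYPE(complex)" n .
  show ?thesis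
    unfolding VectorSpace.subspace_def submodule_def using assms V.vectorspace_axioms V.module_axioms
    by (auto simp: module_vec_simps)
qed

lemma subspaceD_vec:
  fixes W :: "complex vec set"
  assumes "VectorSpace.subspace class_ring W (module_vec TYPE(complex) n)"
  shows "W \<subseteq> carrier_vec n" "0\<^sub>v n \<in> W" "\<And>v w. v \<in> W \<Longrightarrow> w \<in> W \<Longrightarrow> v + w \<in> W"
    "\<And>c v. v \<in> W \<Longrightarrow> c \<cdot>\<^sub>v v \<in> W"
  using assms unfolding VectorSpace.subspace_def submodule_def by (auto simp: module_vec_simps)

text \<open>Gaussian elimination: coordinate by coordinate, a rank-one projection is added until the
  projection \<open>A B\<close> fixes all of \<open>W\<close>.\<close>

lemma subspace_factor:
  fixes W :: "complex vec set"
  assumes W: "VectorSpace.subspace class_ring W (module_vec TYPE(complex) n)"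
  obtains k A B where "A \<in> carrier_mat n k" "B \<in> carrier_mat k n" "B * A = 1\<^sub>m k"
    "\<And>v. v \<in> carrier_vec k \<Longrightarrow> A *\<^sub>v v \<in> W" "\<And>w. w \<in> W \<Longrightarrow> A *\<^sub>v (B *\<^sub>v w) = w"
proof -
  note Wsub = subspaceD_vec(1)[OF W] and W0 = subspaceD_vec(2)[OF W]
    and Wadd = subspaceD_vec(3)[OF W] and Wsm = subspaceD_vec(4)[OF W]
  have step: "\<exists>k A B. A \<in> carrier_mat n k \<and> B \<in> carrier_mat k n \<and> B * A = 1\<^sub>m k \<and>
      (\<forall>v\<in>carrier_vec k. A *\<^sub>v v \<in> W) \<and> (\<forall>w\<in>W. \<forall>i<j. (A *\<^sub>v (B *\<^sub>v w)) $ i = w $ i)"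
    if "j \<le> n" for j
    using that
  proof (induction j)
    case 0
    show ?case
      by (rule exI[of _ 0], rule exI[of _ "0\<^sub>m n 0"], rule exI[of _ "0\<^sub>m 0 n"])
        (use W0 in \<open>auto simp: mult_mat_vec_def zero_vec_def scalar_prod_def\<close>)
  next
    case (Suc j)
    from Suc.IH[OF Suc_leD[OF Suc.prems]]
    obtain k A B where A: "A \<in> carrier_mat n k" and B: "B \<in> carrier_mat k n"
      and BA: "B * A = 1\<^sub>m k" and AW: "\<forall>v\<in>carrier_vec k. A *\<^sub>v v \<in> W"
      and fW: "\<forall>w\<in>W. \<forall>i<j. (A *\<^sub>v (B *\<^sub>v w)) $ i = w $ i" by blast
    have j: "j < n" using Suc.prems by simp
    show ?case
    proof (cases "\<forall>w\<in>W. (A *\<^sub>v (B *\<^sub>v w)) $ j = w $ j")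
      case True
      then have "\<forall>w\<in>W. \<forall>i<Suc j. (A *\<^sub>v (B *\<^sub>v w)) $ i = w $ i"
        using fW by (simp add: less_Suc_eq all_conj_distrib)
      then show ?thesis using A B BA AW by blast
    next
      case False
      then obtain w0 where w0: "w0 \<in> W" and ne: "(A *\<^sub>v (B *\<^sub>v w0)) $ j \<noteq> w0 $ j" by blast
      \<comment> \<open>The residual of \<open>w0\<close> after the projection found so far: it lies
        in \<open>W\<close>, is killed by \<open>B\<close>, vanishes in the coordinates below
        \<open>j\<close> and does not vanish at \<open>j\<close>.\<close>
      define w where "w = w0 + (-1) \<cdot>\<^sub>v (A *\<^sub>v (B *\<^sub>v w0))"
      have w0c: "w0 \<in> carrier_vec n" using w0 Wsub by auto
      have Bw0: "B *\<^sub>v w0 \<in> carrier_vec k" using B w0c by simp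
      have wW: "w \<in> W" unfolding w_def using w0 AW Bw0 Wadd Wsm by auto
      have wc: "w \<in> carrier_vec n" using wW Wsub by auto
      have wi: "w $ i = w0 $ i - (A *\<^sub>v (B *\<^sub>v w0)) $ i" if "i < n" for i
        using that A B w0c by (simp add: w_def)
      have wj: "w $ j \<noteq> 0" using wi[OF j] ne by simp
      have wlt: "w $ i = 0" if "i < j" for i using wi[of i] fW w0 that j by auto
      have BABw: "B *\<^sub>v (A *\<^sub>v u) = u" if "u \<in> carrier_vec k" for u
        using that A B BA by (metis assoc_mult_mat_vec one_mult_mat_vec)
      have Bw: "B *\<^sub>v w = 0\<^sub>v k"
      proof -
        have "B *\<^sub>v w = B *\<^sub>v w0 + (-1) \<cdot>\<^sub>v (B *\<^sub>v (A *\<^sub>v (B *\<^sub>v w0)))"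
          unfolding w_def using A B w0c Bw0
          by (simp add: mult_add_distrib_mat_vec[of _ k n] mult_mat_vec)
        then show ?thesis unfolding BABw[OF Bw0] using B by (intro eq_vecI) auto
      qed
      \<comment> \<open>The coefficient with which \<open>w\<close> has to be added:
        \<open>\<phi>\<close> is 1 on \<open>w\<close> and 0 on the image of \<open>A\<close>, so
        the vector \<open>f\<close> that represents it can serve as the new row of
        \<open>B\<close>.\<close>
      define \<phi> where "\<phi> v = (v $ j - (A *\<^sub>v (B *\<^sub>v v)) $ j) / w $ j" for v
      define f where "f = vec n (\<lambda>l. \<phi> (unit_vec n l))"
      have f_entry: "f $ l = (of_bool (l = j) - (A * B) $$ (j, l)) / w $ j" if "l < n" for l
      proof -
        have "A *\<^sub>v (B *\<^sub>v unit_vec n l) = (A * B) *\<^sub>v unit_vec n l"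
          using A B by (simp add: assoc_mult_mat_vec)
        moreover have "((A * B) *\<^sub>v unit_vec n l) $ j = (A * B) $$ (j, l)"
        by (rule mult_unit_vec_index) (use A B j that in auto)
        ultimately have "(A *\<^sub>v (B *\<^sub>v unit_vec n l)) $ j = (A * B) $$ (j, l)" by metis
      then have "\<phi> (unit_vec n l) = (unit_vec n l $ j - (A * B) $$ (j, l)) / w $ j"
        unfolding \<phi>_def by metis
      then show ?thesis using that j by (auto simp: f_def simp del: index_mult_mat)
      qed
      have phi: "f \<bullet> v = \<phi> v" if v: "v \<in> carrier_vec n" for v
      proof -
        have "f \<bullet> v = (\<Sum>l<n. f $ l * v $ l)" using v by (simp add: scalar_prod_def atLeast0LessThan)
        also have "\<dots> = (\<Sum>l<n. (of_bool (l = j) - (A * B) $$ (j, l)) * v $ l / w $ j)"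
          by (rule sum.cong) (auto simp: f_entry)
        also have "\<dots> = (\<Sum>l<n. of_bool (l = j) * v $ l - (A * B) $$ (j, l) * v $ l) / w $ j"
          by (simp add: sum_divide_distrib left_diff_distrib)
        also have "\<dots> = (v $ j - ((A * B) *\<^sub>v v) $ j) / w $ j"
        proof -
          have "((A * B) *\<^sub>v v) $ j = (\<Sum>l<n. (A * B) $$ (j, l) * v $ l)"
            by (rule mult_vec_index) (use A B v j in auto)
          moreover have "(\<Sum>l<n. of_bool (l = j) * v $ l) = v $ j"
            using j by (simp add: of_bool_def if_distrib[of "\<lambda>x. x * _"] cong: if_cong)
          ultimately show ?thesis by (simp add: sum_subtractf)
        qed
        finally show ?thesis using A B v by (simp add: \<phi>_def assoc_mult_mat_vec)
      qed
      define A' where "A' = mat n (Suc k) (\<lambda>(i, l). if l < k then A $$ (i, l) else w $ i)"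
      define B' where "B' = mat (Suc k) n (\<lambda>(l, i). if l < k then B $$ (l, i) else f $ i)"
      have A'c: "A' \<in> carrier_mat n (Suc k)" and B'c: "B' \<in> carrier_mat (Suc k) n"
        by (auto simp: A'_def B'_def)
      have A'v: "A' *\<^sub>v u = A *\<^sub>v vec k (\<lambda>l. u $ l) + (u $ k) \<cdot>\<^sub>v w" if u: "u \<in> carrier_vec (Suc k)" for u
      proof (rule eq_vecI)
        fix i assume "i < dim_vec (A *\<^sub>v vec k (\<lambda>l. u $ l) + (u $ k) \<cdot>\<^sub>v w)"
        then have i: "i < n" using wc by simp
        then show "(A' *\<^sub>v u) $ i = (A *\<^sub>v vec k (\<lambda>l. u $ l) + (u $ k) \<cdot>\<^sub>v w) $ i"
          using A wc u by (simp add: A'_def scalar_prod_def)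
      qed (use A wc in \<open>simp add: A'_def\<close>)
      have B'v: "B' *\<^sub>v v = vec (Suc k) (\<lambda>l. if l < k then (B *\<^sub>v v) $ l else f \<bullet> v)"
        if v: "v \<in> carrier_vec n" for v
        using v B by (intro eq_vecI) (auto simp: B'_def scalar_prod_def)
      have BA': "B' * A' = 1\<^sub>m (Suc k)"
      proof (rule mat_eq_if_mult_vec_eq)
        fix u :: "complex vec" assume u: "u \<in> carrier_vec (Suc k)"
        let ?u = "vec k (\<lambda>l. u $ l)"
        have A'u: "A' *\<^sub>v u \<in> carrier_vec n" using A'c u by simp
        have BA'u: "B *\<^sub>v (A' *\<^sub>v u) = ?u"
        proof -
          have "B *\<^sub>v (A' *\<^sub>v u) = B *\<^sub>v (A *\<^sub>v ?u) + u $ k \<cdot>\<^sub>v (B *\<^sub>v w)"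
            unfolding A'v[OF u] using A B wc
            by (simp add: mult_add_distrib_mat_vec[of _ k n] mult_mat_vec)
          then show ?thesis using BABw[of ?u] Bw by (auto intro!: eq_vecI)
        qed
        have "f \<bullet> (A' *\<^sub>v u) = u $ k"
          unfolding phi[OF A'u] \<phi>_def BA'u unfolding A'v[OF u] using A wc j wj by simp
        then have "B' *\<^sub>v (A' *\<^sub>v u) = u"
          unfolding B'v[OF A'u] BA'u using u less_Suc_eq by (intro eq_vecI) auto
        then show "B' * A' *\<^sub>v u = 1\<^sub>m (Suc k) *\<^sub>v u" using A'c B'c u by (simp add: assoc_mult_mat_vec)
      qed (use A'c B'c in auto)
      have A'W: "A' *\<^sub>v u \<in> W" if "u \<in> carrier_vec (Suc k)" for u :: "complex vec"
        unfolding A'v[OF that] using AW wW Wadd Wsm by auto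
      have "(A' *\<^sub>v (B' *\<^sub>v v)) $ i = v $ i" if v: "v \<in> W" and i: "i < Suc j" for v i
      proof -
        have vc: "v \<in> carrier_vec n" using v Wsub by auto
        have "vec k (\<lambda>l. vec (Suc k) (\<lambda>l. if l < k then (B *\<^sub>v v) $ l else f \<bullet> v) $ l) = B *\<^sub>v v"
          using B by (intro eq_vecI) auto
        then have "A' *\<^sub>v (B' *\<^sub>v v) = A *\<^sub>v (B *\<^sub>v v) + \<phi> v \<cdot>\<^sub>v w"
          unfolding B'v[OF vc] by (subst A'v) (auto simp: phi[OF vc])
        then have "(A' *\<^sub>v (B' *\<^sub>v v)) $ i = (A *\<^sub>v (B *\<^sub>v v)) $ i + \<phi> v * w $ i"
          using A wc i j by simp
        then show ?thesis using fW v wlt wj i by (cases "i = j") (auto simp: \<phi>_def)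
      qed
      then show ?thesis using A'c B'c BA' A'W by blast
    qed
  qed
  obtain k A B where A: "A \<in> carrier_mat n k" and B: "B \<in> carrier_mat k n" and BA: "B * A = 1\<^sub>m k"
    and AW: "\<forall>v\<in>carrier_vec k. A *\<^sub>v v \<in> W" and fW: "\<forall>w\<in>W. \<forall>i<n. (A *\<^sub>v (B *\<^sub>v w)) $ i = w $ i"
    using step[of n] by blast
  show thesis
  proof (rule that[OF A B BA])
    fix w assume "w \<in> W"
    then show "A *\<^sub>v (B *\<^sub>v w) = w" using fW Wsub A by (intro eq_vecI) auto
  qed (use AW in auto)
qed

section \<open>Sums of matrices and Kronecker products\<close>

definition msum :: "nat \<Rightarrow> nat \<Rightarrow> ('h \<Rightarrow> 'a::comm_ring_1 mat) \<Rightarrow> 'h set \<Rightarrow> 'a mat" where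
  "msum n m f S = mat n m (\<lambda>ij. \<Sum>h\<in>S. f h $$ ij)"

lemma msum_carrier [simp]: "msum n m f S \<in> carrier_mat n m"
  by (simp add: msum_def)

lemma msum_cong: "(\<And>h. h \<in> S \<Longrightarrow> f h = g h) \<Longrightarrow> msum n m f S = msum n m g S"
  by (simp add: msum_def)

lemma mult_msum:
  assumes A: "A \<in> carrier_mat r n" and f: "\<And>h. h \<in> S \<Longrightarrow> f h \<in> carrier_mat n m"
  shows "A * msum n m f S = msum r m (\<lambda>h. A * f h) S"
proof (rule eq_matI)
  fix i j assume "i < dim_row (msum r m (\<lambda>h. A * f h) S)" "j < dim_col (msum r m (\<lambda>h. A * f h) S)"
  then have ij: "i < r" "j < m" by (auto simp: msum_def)
  have "(A * f h) $$ (i, j) = (\<Sum>k<n. A $$ (i,k) * f h $$ (k,j))" if "h \<in> S" for h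
    using f[OF that] A ij by (auto simp: scalar_prod_def atLeast0LessThan intro!: sum.cong)
  then show "(A * msum n m f S) $$ (i, j) = msum r m (\<lambda>h. A * f h) S $$ (i, j)"
    using A ij by (auto simp: msum_def scalar_prod_def atLeast0LessThan sum_distrib_left
        sum.swap[of _ S] intro!: sum.cong)
qed (use A in \<open>auto simp: msum_def\<close>)

lemma msum_mult:
  assumes A: "A \<in> carrier_mat m r" and f: "\<And>h. h \<in> S \<Longrightarrow> f h \<in> carrier_mat n m"
  shows "msum n m f S * A = msum n r (\<lambda>h. f h * A) S"
proof (rule eq_matI)
  fix i j assume "i < dim_row (msum n r (\<lambda>h. f h * A) S)" "j < dim_col (msum n r (\<lambda>h. f h * A) S)"
  then have ij: "i < n" "j < r" by (auto simp: msum_def)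
  have "(f h * A) $$ (i, j) = (\<Sum>k<m. f h $$ (i,k) * A $$ (k,j))" if "h \<in> S" for h
    using f[OF that] A ij by (auto simp: scalar_prod_def atLeast0LessThan intro!: sum.cong)
  then show "(msum n m f S * A) $$ (i, j) = msum n r (\<lambda>h. f h * A) S $$ (i, j)"
    using A ij by (auto simp: msum_def scalar_prod_def atLeast0LessThan sum_distrib_right
        sum.swap[of _ S] intro!: sum.cong)
qed (use A in \<open>auto simp: msum_def\<close>)

lemma msum_reindex:
  assumes "bij_betw t S S"
  shows "msum n m (\<lambda>h. f (t h)) S = msum n m f S"
  unfolding msum_def by (rule cong_mat) (auto intro: sum.reindex_bij_betw[OF assms])

lemma msum_const:
  fixes A :: "complex mat"
  shows "A \<in> carrier_mat n m \<Longrightarrow> msum n m (\<lambda>_. A) S = of_nat (card S) \<cdot>\<^sub>m A"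
  by (rule eq_matI) (auto simp: msum_def)

lemma mtrace_msum:
  assumes "\<And>h. h \<in> S \<Longrightarrow> f h \<in> carrier_mat n n"
  shows "mtrace (msum n n f S) = (\<Sum>h\<in>S. mtrace (f h))"
  using assms by (auto simp: msum_def mtrace_def sum.swap[of _ S] intro!: sum.cong)

lemma dim_kronecker [simp]:
  "dim_row (kronecker A B) = dim_row A * dim_row B" "dim_col (kronecker A B) = dim_col A * dim_col B"
  by (auto simp: kronecker_def)

text \<open>An index of a Kronecker product has the form a * m + b with b < m, so entrywise sums
  over it split into double sums.\<close>

lemma sum_div_mod:
  fixes f :: "nat \<Rightarrow> nat \<Rightarrow> 'a::comm_monoid_add"
  shows "(\<Sum>i<n * m. f (i div m) (i mod m)) = (\<Sum>a<n. \<Sum>b<m. f a b)"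
proof -
  have "(\<Sum>a<n. \<Sum>b<m. f a b) = (\<Sum>(a, b)\<in>{..<n} \<times> {..<m}. f a b)"
    by (simp add: sum.cartesian_product)
  also have "\<dots> = (\<Sum>i<n * m. f (i div m) (i mod m))"
  proof (rule sum.reindex_bij_witness[of _ "\<lambda>i. (i div m, i mod m)" "\<lambda>(a, b). a * m + b"], goal_cases)
    case (2 p)
    have "a * m + b < n * m" if "a < n" "b < m" for a b
    proof -
      have "Suc a * m \<le> n * m" using that by (intro mult_le_mono1) simp
      then show ?thesis using that by simp
    qed
    then show ?case using 2 by auto
  next
    case (4 i)
    then show ?case
      by (cases "m = 0") (auto simp: less_mult_imp_div_less)
  qed auto
  finally show ?thesis by simp
qed

lemma mtrace_kronecker:
  assumes "A \<in> carrier_mat n n" "B \<in> carrier_mat m m"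
  shows "mtrace (kronecker A B) = mtrace A * mtrace B"
proof -
  have "mtrace (kronecker A B) = (\<Sum>i<n * m. A $$ (i div m, i div m) * B $$ (i mod m, i mod m))"
    using assms by (auto simp: mtrace_def kronecker_def intro!: sum.cong)
  also have "\<dots> = (\<Sum>a<n. \<Sum>b<m. A $$ (a,a) * B $$ (b,b))" by (rule sum_div_mod)
  finally show ?thesis using assms by (simp add: mtrace_def sum_product)
qed

lemma kronecker_mult:
  fixes A :: "complex mat"
  assumes "A \<in> carrier_mat n n" "C \<in> carrier_mat n n" "B \<in> carrier_mat m m" "D \<in> carrier_mat m m"
  shows "kronecker A B * kronecker C D = kronecker (A * C) (B * D)"
proof (rule eq_matI)
  fix i j assume "i < dim_row (kronecker (A * C) (B * D))" "j < dim_col (kronecker (A * C) (B * D))"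
  then have ij: "i < n * m" "j < n * m" using assms by auto
  then have m: "m > 0" by (cases m) auto
  have im: "i div m < n" "j div m < n" "i mod m < m" "j mod m < m"
    using ij m by (auto simp: less_mult_imp_div_less)
  have "(kronecker A B * kronecker C D) $$ (i, j) = (\<Sum>k<n * m.
      (A $$ (i div m, k div m) * B $$ (i mod m, k mod m)) * (C $$ (k div m, j div m) * D $$ (k mod m, j mod m)))"
    using ij assms by (auto simp: kronecker_def scalar_prod_def atLeast0LessThan intro!: sum.cong)
  also have "\<dots> = (\<Sum>a<n. \<Sum>b<m. (A $$ (i div m, a) * B $$ (i mod m, b)) * (C $$ (a, j div m) * D $$ (b, j mod m)))"
    by (rule sum_div_mod)
  also have "\<dots> = (\<Sum>a<n. A $$ (i div m, a) * C $$ (a, j div m)) * (\<Sum>b<m. B $$ (i mod m, b) * D $$ (b, j mod m))"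
    by (simp add: sum_product algebra_simps)
  also have "\<dots> = kronecker (A * C) (B * D) $$ (i, j)"
    using ij im assms by (simp add: kronecker_def scalar_prod_def atLeast0LessThan)
  finally show "(kronecker A B * kronecker C D) $$ (i, j) = kronecker (A * C) (B * D) $$ (i, j)" .
qed (use assms in auto)

lemma kronecker_smult:
  "kronecker (a \<cdot>\<^sub>m A) (b \<cdot>\<^sub>m B) = (a * b) \<cdot>\<^sub>m kronecker A B"
proof (rule eq_matI)
  fix i j assume "i < dim_row ((a * b) \<cdot>\<^sub>m kronecker A B)" "j < dim_col ((a * b) \<cdot>\<^sub>m kronecker A B)"
  then have ij: "i < dim_row A * dim_row B" "j < dim_col A * dim_col B" by auto
  then have "dim_row B > 0" "dim_col B > 0" by (auto intro: Nat.gr0I)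
  then show "kronecker (a \<cdot>\<^sub>m A) (b \<cdot>\<^sub>m B) $$ (i, j) = ((a * b) \<cdot>\<^sub>m kronecker A B) $$ (i, j)"
    using ij by (simp add: kronecker_def less_mult_imp_div_less)
qed auto

lemma kronecker_one: "kronecker (1\<^sub>m n) (1\<^sub>m m) = 1\<^sub>m (n * m)"
proof (rule eq_matI)
  fix i j assume "i < dim_row (1\<^sub>m (n * m) :: complex mat)" "j < dim_col (1\<^sub>m (n * m) :: complex mat)"
  then have ij: "i < n * m" "j < n * m" by auto
  then have m: "m > 0" by (cases m) auto
  have im: "i div m < n" "j div m < n" "i mod m < m" "j mod m < m"
    using ij m by (auto simp: less_mult_imp_div_less)
  have "i = j" if "i div m = j div m" "i mod m = j mod m"
    using that by (metis div_mult_mod_eq)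
  then show "kronecker (1\<^sub>m n) (1\<^sub>m m) $$ (i, j) = (1\<^sub>m (n * m) :: complex mat) $$ (i, j)"
    using ij im by (auto simp: kronecker_def)
qed auto

section \<open>Twisted modules\<close>

text \<open>The side conditions are equations between dimensions instead of carrier memberships, so
  that simplification can discharge them without guessing intermediate dimensions.\<close>

lemma mat_dim_simps:
  fixes A B C :: "'a::comm_ring_1 mat"
  shows "dim_col A = dim_row B \<Longrightarrow> dim_col B = dim_row C \<Longrightarrow> A * B * C = A * (B * C)"
    "dim_col A = dim_row B \<Longrightarrow> (c \<cdot>\<^sub>m A) * B = c \<cdot>\<^sub>m (A * B)"
    "dim_col A = dim_row B \<Longrightarrow> A * (c \<cdot>\<^sub>m B) = c \<cdot>\<^sub>m (A * B)"
    "dim_row A = n \<Longrightarrow> 1\<^sub>m n * A = A"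
    "dim_col A = n \<Longrightarrow> A * 1\<^sub>m n = A"
    "a \<cdot>\<^sub>m (c \<cdot>\<^sub>m A) = (a * c) \<cdot>\<^sub>m A"
    "1 \<cdot>\<^sub>m A = A"
  by (auto intro: assoc_mult_mat mult_smult_assoc_mat mult_smult_distrib)

lemma mat_dim_distrib:
  fixes A B C :: "'a::comm_ring_1 mat"
  shows "dim_row B = dim_row C \<Longrightarrow> dim_col B = dim_col C \<Longrightarrow> dim_col A = dim_row B \<Longrightarrow> A * (B + C) = A * B + A * C"
    "dim_row B = dim_row C \<Longrightarrow> dim_col B = dim_col C \<Longrightarrow> dim_col B = dim_row A \<Longrightarrow> (B + C) * A = B * A + C * A"
  by (rule mult_add_distrib_mat[of _ "dim_row A" "dim_col A" _ "dim_col B"]; auto)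
    (rule add_mult_distrib_mat[of _ "dim_row B" "dim_col B" _ _ "dim_col A"]; auto)

lemma mult_mat_vec_assoc:
  fixes A B :: "'a::comm_ring_1 mat"
  shows "dim_col A = dim_row B \<Longrightarrow> dim_vec v = dim_col B \<Longrightarrow> A * B *\<^sub>v v = A *\<^sub>v (B *\<^sub>v v)"
  by (rule assoc_mult_mat_vec[of _ "dim_row A" "dim_col A" _ "dim_col B"]) (auto intro: carrier_vecI)

lemma S4_simps:
  "carrier S4 = {p. p permutes {1..4}}" "mult S4 = (\<circ>)" "one S4 = id"
  by (auto simp: sym_group_def)

abbreviation pinv :: "perm4 \<Rightarrow> perm4" where
  "pinv \<equiv> inv_into UNIV"

locale perm_group =
  fixes H :: "perm4 set"
  assumes subgroup: "subgroup H S4"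
begin

lemma permutes: "h \<in> H \<Longrightarrow> h permutes {1..4}"
  using subgroup.subset[OF subgroup] unfolding S4_simps by blast

lemma finite_H [simp]: "finite H"
  by (rule finite_subset[of _ "{p. p permutes {1..4::nat}}"])
    (use permutes in \<open>auto simp: finite_permutations simp del: One_nat_def\<close>)

lemma id_in [simp]: "id \<in> H"
  using subgroup.one_closed[OF subgroup] by (simp add: S4_simps)

lemma comp_in [simp]: "g \<in> H \<Longrightarrow> h \<in> H \<Longrightarrow> g \<circ> h \<in> H"
  using subgroup.m_closed[OF subgroup] by (simp add: S4_simps)

lemma inv_comp [simp]: "h \<in> H \<Longrightarrow> pinv h \<circ> h = id" "h \<in> H \<Longrightarrow> h \<circ> pinv h = id"
  using permutes permutes_inv_o by blast+

lemma inv_in [simp]: "h \<in> H \<Longrightarrow> pinv h \<in> H"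
proof -
  assume h: "h \<in> H"
  have "inv\<^bsub>S4\<^esub> h \<in> H" by (rule subgroup.m_inv_closed[OF subgroup h])
  moreover have "inv\<^bsub>S4\<^esub> h = pinv h"
    using h permutes[OF h] by (intro sym_group_inv_equality) (simp add: S4_simps del: One_nat_def)
  ultimately show ?thesis by simp
qed

lemma inv_comp_left [simp]: "g \<in> H \<Longrightarrow> pinv g \<circ> (g \<circ> h) = h" "g \<in> H \<Longrightarrow> g \<circ> (pinv g \<circ> h) = h"
  using inv_comp by (simp_all add: o_assoc)

lemma card_pos [simp]: "card H > 0"
  using id_in finite_H card_gt_0_iff by blast

lemma H_nonempty [simp]: "H \<noteq> {}"
  using id_in by blast

lemma bij_betw_comp: "g \<in> H \<Longrightarrow> bij_betw ((\<circ>) g) H H"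
  by (rule bij_betwI[where g = "(\<circ>) (pinv g)"]) auto

end

locale twisted_group = perm_group +
  fixes \<alpha> :: "perm4 \<times> perm4 \<Rightarrow> complex"
  assumes cocycle: "\<alpha> \<in> carrier (cocycle_group H)"
begin

lemma nonzero [simp]: "g \<in> H \<Longrightarrow> h \<in> H \<Longrightarrow> \<alpha> (g, h) \<noteq> 0"
  using cocycle by (auto simp: cocycle_group_def PiE_def Pi_def)

lemma cocycle_eq:
  "g \<in> H \<Longrightarrow> h \<in> H \<Longrightarrow> k \<in> H \<Longrightarrow> \<alpha> (g, h) * \<alpha> (g \<circ> h, k) = \<alpha> (g, h \<circ> k) * \<alpha> (h, k)"
  using cocycle by (auto simp: cocycle_group_def)

text \<open>The cocycle identity at (id, id, h) and at (h, id, id). The constant \<alpha> (id, id)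
  takes the place of the value 1 of a normalized cocycle.\<close>

lemma cocycle_id: "h \<in> H \<Longrightarrow> \<alpha> (id, h) = \<alpha> (id, id)" "h \<in> H \<Longrightarrow> \<alpha> (h, id) = \<alpha> (id, id)"
  using cocycle_eq[of id id h] cocycle_eq[of h id id] by auto

lemma cocycle_inv: "h \<in> H \<Longrightarrow> \<alpha> (pinv h, h) = \<alpha> (h, pinv h)"
  using cocycle_eq[of h "pinv h" h] cocycle_id[of h] by auto

text \<open>The scalar of \<open>\<rho> h * \<rho> (pinv h)\<close>: one factor comes from
  multiplicativity, the other from \<open>\<rho> id\<close>, which is
  \<open>\<alpha> (id, id)\<close> times the unit matrix. Dividing by it makes
  \<open>rep_inv \<rho> h\<close> the inverse of \<open>\<rho> h\<close>.\<close>

definition norm_factor :: "perm4 \<Rightarrow> complex" where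
  "norm_factor h = \<alpha> (h, pinv h) * \<alpha> (id, id)"

lemma norm_factor_nonzero [simp]: "h \<in> H \<Longrightarrow> norm_factor h \<noteq> 0"
  by (simp add: norm_factor_def)

definition rep_inv :: "rep \<Rightarrow> rep" where
  "rep_inv \<rho> h = (1 / norm_factor h) \<cdot>\<^sub>m \<rho> (pinv h)"

abbreviation "tmod \<equiv> twisted_module H \<alpha>"

lemma tmod_carrier: "tmod \<rho> \<Longrightarrow> h \<in> H \<Longrightarrow> \<rho> h \<in> carrier_mat (deg \<rho>) (deg \<rho>)"
  by (auto simp: twisted_module_def)

lemma tmod_mult: "tmod \<rho> \<Longrightarrow> g \<in> H \<Longrightarrow> h \<in> H \<Longrightarrow> \<rho> g * \<rho> h = \<alpha> (g, h) \<cdot>\<^sub>m \<rho> (g \<circ> h)"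
  by (auto simp: twisted_module_def)

lemma tmod_id: "tmod \<rho> \<Longrightarrow> \<rho> id = \<alpha> (id, id) \<cdot>\<^sub>m 1\<^sub>m (deg \<rho>)"
  by (auto simp: twisted_module_def)

lemma rep_inv_carrier: "tmod \<rho> \<Longrightarrow> h \<in> H \<Longrightarrow> rep_inv \<rho> h \<in> carrier_mat (deg \<rho>) (deg \<rho>)"
  by (simp add: rep_inv_def tmod_carrier)

lemma tmod_dim: "tmod \<rho> \<Longrightarrow> h \<in> H \<Longrightarrow> dim_row (\<rho> h) = deg \<rho>" "tmod \<rho> \<Longrightarrow> h \<in> H \<Longrightarrow> dim_col (\<rho> h) = deg \<rho>"
  "tmod \<rho> \<Longrightarrow> h \<in> H \<Longrightarrow> dim_row (rep_inv \<rho> h) = deg \<rho>" "tmod \<rho> \<Longrightarrow> h \<in> H \<Longrightarrow> dim_col (rep_inv \<rho> h) = deg \<rho>"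
  using tmod_carrier rep_inv_carrier by blast+

lemma rep_mult_inv:
  assumes "tmod \<rho>" "h \<in> H"
  shows "\<rho> h * rep_inv \<rho> h = 1\<^sub>m (deg \<rho>)" "rep_inv \<rho> h * \<rho> h = 1\<^sub>m (deg \<rho>)"
  using assms norm_factor_nonzero[OF assms(2)]
  by (simp_all add: rep_inv_def mat_dim_simps tmod_dim tmod_mult tmod_id norm_factor_def cocycle_inv)

text \<open>Insert \<sigma> h times its inverse and use multiplicativity. The factor \<alpha> (g, h)
  is the one that \<open>\<rho> g * \<rho> h\<close> produces, so under the substitution of
  \<open>g \<circ> h\<close> for h twisted averages behave like ordinary ones.\<close>

lemma rep_inv_shift:
  assumes "tmod \<sigma>" "g \<in> H" "h \<in> H"
  shows "\<alpha> (g, h) \<cdot>\<^sub>m rep_inv \<sigma> h = rep_inv \<sigma> (g \<circ> h) * \<sigma> g"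
proof -
  have gh: "g \<circ> h \<in> H" using assms by simp
  have "rep_inv \<sigma> (g \<circ> h) * \<sigma> g = rep_inv \<sigma> (g \<circ> h) * (\<sigma> g * (\<sigma> h * rep_inv \<sigma> h))"
    using assms by (simp add: rep_mult_inv mat_dim_simps tmod_dim)
  also have "\<dots> = rep_inv \<sigma> (g \<circ> h) * ((\<sigma> g * \<sigma> h) * rep_inv \<sigma> h)"
    using assms by (simp add: mat_dim_simps tmod_dim)
  also have "\<dots> = \<alpha> (g, h) \<cdot>\<^sub>m ((rep_inv \<sigma> (g \<circ> h) * \<sigma> (g \<circ> h)) * rep_inv \<sigma> h)"
    unfolding tmod_mult[OF assms] using assms by (simp add: mat_dim_simps tmod_dim)
  also have "\<dots> = \<alpha> (g, h) \<cdot>\<^sub>m rep_inv \<sigma> h"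
    using assms by (simp add: rep_mult_inv mat_dim_simps tmod_dim)
  finally show ?thesis by simp
qed

definition average :: "rep \<Rightarrow> rep \<Rightarrow> complex mat \<Rightarrow> complex mat" where
  "average \<rho> \<sigma> X = msum (deg \<rho>) (deg \<sigma>) (\<lambda>h. \<rho> h * X * rep_inv \<sigma> h) H"

lemma average_carrier [simp]: "average \<rho> \<sigma> X \<in> carrier_mat (deg \<rho>) (deg \<sigma>)"
  by (simp add: average_def)

lemma average_intertwines:
  assumes \<rho>: "tmod \<rho>" and \<sigma>: "tmod \<sigma>" and X: "X \<in> carrier_mat (deg \<rho>) (deg \<sigma>)" and g: "g \<in> H"
  shows "\<rho> g * average \<rho> \<sigma> X = average \<rho> \<sigma> X * \<sigma> g"
proof -
  let ?r = "deg \<rho>" and ?s = "deg \<sigma>"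
  note c = tmod_carrier[OF \<rho>] tmod_carrier[OF \<sigma>] rep_inv_carrier[OF \<sigma>]
  have fc: "\<rho> h * X * rep_inv \<sigma> h \<in> carrier_mat ?r ?s" if "h \<in> H" for h
    using c[OF that] X by simp
  have "\<rho> g * average \<rho> \<sigma> X = msum ?r ?s (\<lambda>h. \<rho> g * (\<rho> h * X * rep_inv \<sigma> h)) H"
    unfolding average_def by (rule mult_msum) (use c g fc in auto)
  also have "\<dots> = msum ?r ?s (\<lambda>h. \<rho> (g \<circ> h) * X * rep_inv \<sigma> (g \<circ> h) * \<sigma> g) H"
  proof (rule msum_cong)
    fix h assume h: "h \<in> H"
    then have gh: "g \<circ> h \<in> H" using g by simp
    have "\<rho> g * (\<rho> h * X * rep_inv \<sigma> h) = (\<rho> g * \<rho> h) * (X * rep_inv \<sigma> h)"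
      using X g h \<rho> \<sigma> by (simp add: mat_dim_simps tmod_dim carrier_matD)
    also have "\<dots> = \<rho> (g \<circ> h) * (X * (\<alpha> (g, h) \<cdot>\<^sub>m rep_inv \<sigma> h))"
      unfolding tmod_mult[OF \<rho> g h] using X g h \<rho> \<sigma> by (simp add: mat_dim_simps tmod_dim carrier_matD)
    also have "\<dots> = \<rho> (g \<circ> h) * X * rep_inv \<sigma> (g \<circ> h) * \<sigma> g"
      unfolding rep_inv_shift[OF \<sigma> g h] using X g h \<rho> \<sigma> by (simp add: mat_dim_simps tmod_dim carrier_matD)
    finally show "\<rho> g * (\<rho> h * X * rep_inv \<sigma> h) = \<rho> (g \<circ> h) * X * rep_inv \<sigma> (g \<circ> h) * \<sigma> g" .
  qed
  also have "\<dots> = msum ?r ?s (\<lambda>h. \<rho> h * X * rep_inv \<sigma> h * \<sigma> g) H"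
    using msum_reindex[OF bij_betw_comp[OF g], of _ _ "\<lambda>h. \<rho> h * X * rep_inv \<sigma> h * \<sigma> g"] by simp
  also have "\<dots> = average \<rho> \<sigma> X * \<sigma> g"
    unfolding average_def by (rule msum_mult[symmetric]) (use c g fc in auto)
  finally show ?thesis .
qed

lemma simple_dest:
  assumes "\<rho> \<in> simple_modules H \<alpha>"
  shows "tmod \<rho>" "deg \<rho> > 0"
  using assms by (auto simp: simple_modules_def)

lemma simple_subspace:
  assumes "\<rho> \<in> simple_modules H \<alpha>" "VectorSpace.subspace class_ring W (module_vec TYPE(complex) (deg \<rho>))"
    "\<And>h w. h \<in> H \<Longrightarrow> w \<in> W \<Longrightarrow> \<rho> h *\<^sub>v w \<in> W"
  shows "W = {0\<^sub>v (deg \<rho>)} \<or> W = carrier_vec (deg \<rho>)"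
  using assms by (auto simp: simple_modules_def)

text \<open>Kernel and image of \<open>F\<close> are submodules. As \<open>F\<close> is nonzero,
  simplicity makes the kernel trivial and the image everything. Preimages of the unit vectors are
  the columns of a right inverse, and injectivity of \<open>F\<close> makes it a left
  inverse.\<close>

lemma schur_iso:
  assumes \<rho>: "\<rho> \<in> simple_modules H \<alpha>" and \<sigma>: "\<sigma> \<in> simple_modules H \<alpha>"
    and F: "F \<in> carrier_mat (deg \<sigma>) (deg \<rho>)" and tw: "\<And>h. h \<in> H \<Longrightarrow> F * \<rho> h = \<sigma> h * F"
    and F0: "F \<noteq> 0\<^sub>m (deg \<sigma>) (deg \<rho>)"
  obtains G where "deg \<rho> = deg \<sigma>" "G \<in> carrier_mat (deg \<rho>) (deg \<sigma>)"
    "F * G = 1\<^sub>m (deg \<sigma>)" "G * F = 1\<^sub>m (deg \<rho>)"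
proof -
  let ?r = "deg \<rho>" and ?s = "deg \<sigma>"
  note c\<rho> = tmod_carrier[OF simple_dest(1)[OF \<rho>]] and c\<sigma> = tmod_carrier[OF simple_dest(1)[OF \<sigma>]]
  have twv: "F *\<^sub>v (\<rho> h *\<^sub>v v) = \<sigma> h *\<^sub>v (F *\<^sub>v v)" if "h \<in> H" "v \<in> carrier_vec ?r" for h v
  proof -
    have "F *\<^sub>v (\<rho> h *\<^sub>v v) = (F * \<rho> h) *\<^sub>v v"
      using F c\<rho>[OF that(1)] that(2) by (rule assoc_mult_mat_vec[symmetric])
    also have "\<dots> = \<sigma> h *\<^sub>v (F *\<^sub>v v)"
      unfolding tw[OF that(1)] using c\<sigma>[OF that(1)] F that(2) by (rule assoc_mult_mat_vec)
    finally show ?thesis .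
  qed
  define K where "K = {v \<in> carrier_vec ?r. F *\<^sub>v v = 0\<^sub>v ?s}"
  have Fs: "F *\<^sub>v (c \<cdot>\<^sub>v v) = c \<cdot>\<^sub>v (F *\<^sub>v v)" if "v \<in> carrier_vec ?r" for c v
    using F that by (rule mult_mat_vec)
  have Fa: "F *\<^sub>v (v + w) = F *\<^sub>v v + F *\<^sub>v w" if "v \<in> carrier_vec ?r" "w \<in> carrier_vec ?r" for v w
    using F that by (rule mult_add_distrib_mat_vec)
  have Fc: "F *\<^sub>v v \<in> carrier_vec ?s" if "v \<in> carrier_vec ?r" for v
    using F that by simp
  have F0v: "F *\<^sub>v 0\<^sub>v ?r = 0\<^sub>v ?s"
    using Fs[of "0\<^sub>v ?r" 0] F by auto
  have "K = {0\<^sub>v ?r} \<or> K = carrier_vec ?r"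
  proof (rule simple_subspace[OF \<rho>])
    show "VectorSpace.subspace class_ring K (module_vec TYPE(complex) ?r)"
      by (rule subspaceI_vec) (auto simp: K_def F0v Fa Fs)
    fix h w assume h: "h \<in> H" and "w \<in> K"
    then have w: "w \<in> carrier_vec ?r" "F *\<^sub>v w = 0\<^sub>v ?s" by (auto simp: K_def)
    have "\<sigma> h *\<^sub>v 0\<^sub>v ?s = 0\<^sub>v ?s"
      using c\<sigma>[OF h] by (auto simp: scalar_prod_def mult_mat_vec_def zero_vec_def)
    then have "F *\<^sub>v (\<rho> h *\<^sub>v w) = 0\<^sub>v ?s" using twv[OF h w(1)] w(2) by simp
    moreover have "\<rho> h *\<^sub>v w \<in> carrier_vec ?r" using c\<rho>[OF h] w by simp
    ultimately show "\<rho> h *\<^sub>v w \<in> K" by (simp add: K_def)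
  qed
  moreover have "K \<noteq> carrier_vec ?r"
  proof
    assume "K = carrier_vec ?r"
    have "F = 0\<^sub>m ?s ?r"
    proof (rule mat_eq_if_mult_vec_eq[OF F])
      fix v :: "complex vec" assume "v \<in> carrier_vec ?r"
      then have "F *\<^sub>v v = 0\<^sub>v ?s" using \<open>K = carrier_vec ?r\<close> by (auto simp: K_def)
      then show "F *\<^sub>v v = 0\<^sub>m ?s ?r *\<^sub>v v"
        using \<open>v \<in> carrier_vec ?r\<close> by (auto simp: scalar_prod_def mult_mat_vec_def zero_vec_def)
    qed simp
    then show False using F0 by simp
  qed
  ultimately have K0: "K = {0\<^sub>v ?r}" by blast
  define I where "I = (\<lambda>v. F *\<^sub>v v) ` carrier_vec ?r"
  have "I = {0\<^sub>v ?s} \<or> I = carrier_vec ?s"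
  proof (rule simple_subspace[OF \<sigma>])
    show "VectorSpace.subspace class_ring I (module_vec TYPE(complex) ?s)"
    proof (rule subspaceI_vec)
      show "I \<subseteq> carrier_vec ?s" using Fc by (auto simp: I_def)
      show "0\<^sub>v ?s \<in> I" unfolding I_def by (rule image_eqI[of _ _ "0\<^sub>v ?r"]) (auto simp: F0v)
    next
      fix v w assume "v \<in> I" "w \<in> I"
      then obtain v' w' where "v' \<in> carrier_vec ?r" "w' \<in> carrier_vec ?r" "v = F *\<^sub>v v'" "w = F *\<^sub>v w'"
        by (auto simp: I_def)
      then show "v + w \<in> I" unfolding I_def by (intro image_eqI[of _ _ "v' + w'"]) (auto simp: Fa)
    next
      fix c v assume "v \<in> I"
      then obtain v' where "v' \<in> carrier_vec ?r" "v = F *\<^sub>v v'" by (auto simp: I_def)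
      then show "c \<cdot>\<^sub>v v \<in> I" unfolding I_def by (intro image_eqI[of _ _ "c \<cdot>\<^sub>v v'"]) (auto simp: Fs)
    qed
    fix h w assume h: "h \<in> H" and "w \<in> I"
    then obtain v where v: "v \<in> carrier_vec ?r" "w = F *\<^sub>v v" by (auto simp: I_def)
    then show "\<sigma> h *\<^sub>v w \<in> I"
      unfolding I_def using c\<rho>[OF h] h by (intro image_eqI[of _ _ "\<rho> h *\<^sub>v v"]) (auto simp: twv)
  qed
  moreover have "I \<noteq> {0\<^sub>v ?s}"
  proof
    assume I0: "I = {0\<^sub>v ?s}"
    have "F = 0\<^sub>m ?s ?r"
    proof (rule mat_eq_if_mult_vec_eq[OF F])
      fix v :: "complex vec" assume "v \<in> carrier_vec ?r"
      then have "F *\<^sub>v v = 0\<^sub>v ?s" using I0 by (auto simp: I_def)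
      then show "F *\<^sub>v v = 0\<^sub>m ?s ?r *\<^sub>v v"
        using \<open>v \<in> carrier_vec ?r\<close> by (auto simp: scalar_prod_def mult_mat_vec_def zero_vec_def)
    qed simp
    then show False using F0 by simp
  qed
  ultimately have I: "I = carrier_vec ?s" by blast
  have "\<exists>v\<in>carrier_vec ?r. F *\<^sub>v v = unit_vec ?s j" if "j < ?s" for j
    using I unfolding I_def by (metis imageE unit_vec_carrier)
  then obtain g where g: "\<And>j. j < ?s \<Longrightarrow> g j \<in> carrier_vec ?r \<and> F *\<^sub>v g j = unit_vec ?s j"
    by metis
  define G where "G = mat ?r ?s (\<lambda>(i, j). g j $ i)"
  have G: "G \<in> carrier_mat ?r ?s" by (simp add: G_def)
  have colG: "col G j = g j" if "j < ?s" for j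
    using g[OF that] that by (intro eq_vecI) (auto simp: G_def)
  have FG: "F * G = 1\<^sub>m ?s"
  proof (rule eq_matI)
    fix i j assume ij: "i < dim_row (1\<^sub>m ?s :: complex mat)" "j < dim_col (1\<^sub>m ?s :: complex mat)"
    then have "(F * G) $$ (i, j) = (F *\<^sub>v col G j) $ i" using F G by simp
    also have "\<dots> = unit_vec ?s j $ i" using ij g by (simp add: colG)
    finally show "(F * G) $$ (i, j) = 1\<^sub>m ?s $$ (i, j)" using ij by simp
  qed (use F G in auto)
  have GF: "G * F = 1\<^sub>m ?r"
  proof (rule mat_eq_if_mult_vec_eq)
    fix v :: "complex vec" assume v: "v \<in> carrier_vec ?r"
    let ?u = "G *\<^sub>v (F *\<^sub>v v) + (-1) \<cdot>\<^sub>v v"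
    have uc: "?u \<in> carrier_vec ?r" using F G v by simp
    have "F *\<^sub>v (G *\<^sub>v (F *\<^sub>v v)) = (F * G) *\<^sub>v (F *\<^sub>v v)"
      using F G Fc[OF v] by (intro assoc_mult_mat_vec[symmetric])
    then have "F *\<^sub>v (G *\<^sub>v (F *\<^sub>v v)) = F *\<^sub>v v" unfolding FG using Fc[OF v] by simp
    then have "F *\<^sub>v ?u = F *\<^sub>v v + (-1) \<cdot>\<^sub>v (F *\<^sub>v v)"
      using v G F by (simp add: Fa Fs)
    also have "\<dots> = 0\<^sub>v ?s" using F by (intro eq_vecI) auto
    finally have "?u = 0\<^sub>v ?r" using uc K0 by (auto simp: K_def)
    have "(G *\<^sub>v (F *\<^sub>v v)) $ i = v $ i" if "i < ?r" for i
    proof -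
      have "?u $ i = 0" unfolding \<open>?u = 0\<^sub>v ?r\<close> using that by simp
      then show ?thesis using that v G by simp
    qed
    then have "G *\<^sub>v (F *\<^sub>v v) = v" using v G by (intro eq_vecI) auto
    then show "G * F *\<^sub>v v = 1\<^sub>m ?r *\<^sub>v v" using v F G by (simp add: assoc_mult_mat_vec)
  qed (use F G in auto)
  have "?s = ?r" by (rule inverse_mats_same_dim[OF F G FG GF])
  then show thesis using that G FG GF by simp
qed

end

lemma eigenvalue_exists:
  fixes A :: "complex mat"
  assumes A: "A \<in> carrier_mat n n" and n: "n > 0"
  obtains k v where "v \<in> carrier_vec n" "v \<noteq> 0\<^sub>v n" "A *\<^sub>v v = k \<cdot>\<^sub>v v"
proof -
  have "degree (char_poly A) = n" using degree_monic_char_poly[OF A] by simp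
  then have "\<not> constant (poly (char_poly A))" using n by (simp add: constant_degree)
  then obtain k where "poly (char_poly A) k = 0" using fundamental_theorem_of_algebra by blast
  then have "eigenvalue A k" using eigenvalue_root_char_poly[OF A] by simp
  then show thesis using that A by (auto simp: eigenvalue_def eigenvector_def)
qed

lemma mult_mat_index:
  "A \<in> carrier_mat n m \<Longrightarrow> B \<in> carrier_mat m r \<Longrightarrow> i < n \<Longrightarrow> j < r \<Longrightarrow>
    (A * B) $$ (i, j) = (\<Sum>l<m. A $$ (i, l) * B $$ (l, j))"
  by (auto simp: scalar_prod_def atLeast0LessThan intro!: sum.cong)

context twisted_group
begin

text \<open>What isomorphisms and traces depend on: square matrices of one size. Direct sums enter
  the character computations through this condition alone.\<close>

definition square_rep :: "rep \<Rightarrow> bool" where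
  "square_rep \<rho> \<longleftrightarrow> (\<forall>h\<in>H. \<rho> h \<in> carrier_mat (deg \<rho>) (deg \<rho>))"

lemma tmod_square: "tmod \<rho> \<Longrightarrow> square_rep \<rho>"
  by (simp add: square_rep_def twisted_module_def)

lemma square_repD: "square_rep \<rho> \<Longrightarrow> h \<in> H \<Longrightarrow> dim_row (\<rho> h) = deg \<rho>"
  "square_rep \<rho> \<Longrightarrow> h \<in> H \<Longrightarrow> dim_col (\<rho> h) = deg \<rho>"
  by (auto simp: square_rep_def)

lemma rep_isoI:
  assumes "P \<in> carrier_mat (deg \<sigma>) (deg \<rho>)" "Q \<in> carrier_mat (deg \<rho>) (deg \<sigma>)"
    "P * Q = 1\<^sub>m (deg \<sigma>)" "Q * P = 1\<^sub>m (deg \<rho>)" "\<And>h. h \<in> H \<Longrightarrow> P * \<rho> h = \<sigma> h * P"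
  shows "rep_iso H \<rho> \<sigma>"
proof -
  have "deg \<sigma> = deg \<rho>" by (rule inverse_mats_same_dim[OF assms(1-4)])
  then show ?thesis unfolding rep_iso_def using assms invertible_matI[of P "deg \<rho>" Q] by auto
qed

lemma rep_isoE:
  assumes "rep_iso H \<rho> \<sigma>"
  obtains P Q where "deg \<rho> = deg \<sigma>" "P \<in> carrier_mat (deg \<sigma>) (deg \<rho>)" "Q \<in> carrier_mat (deg \<rho>) (deg \<sigma>)"
    "P * Q = 1\<^sub>m (deg \<sigma>)" "Q * P = 1\<^sub>m (deg \<rho>)" "\<And>h. h \<in> H \<Longrightarrow> P * \<rho> h = \<sigma> h * P"
proof -
  from assms obtain P where P: "P \<in> carrier_mat (deg \<sigma>) (deg \<rho>)" "invertible_mat P"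
    and tw: "\<And>h. h \<in> H \<Longrightarrow> P * \<rho> h = \<sigma> h * P" by (auto simp: rep_iso_def)
  obtain Q where "deg \<sigma> = deg \<rho>" "Q \<in> carrier_mat (deg \<sigma>) (deg \<sigma>)" "P * Q = 1\<^sub>m (deg \<sigma>)" "Q * P = 1\<^sub>m (deg \<sigma>)"
    using invertible_matE[OF P(2,1)] by metis
  then show thesis using that[of P Q] P tw by auto
qed

lemma rep_iso_refl: "square_rep \<rho> \<Longrightarrow> rep_iso H \<rho> \<rho>"
  by (rule rep_isoI[of "1\<^sub>m (deg \<rho>)" _ _ "1\<^sub>m (deg \<rho>)"]) (auto simp: square_repD mat_dim_simps)

lemma rep_iso_sym:
  assumes "rep_iso H \<rho> \<sigma>" "square_rep \<rho>" "square_rep \<sigma>"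
  shows "rep_iso H \<sigma> \<rho>"
  using assms(1)
proof (rule rep_isoE)
  fix P Q assume d: "deg \<rho> = deg \<sigma>" and P: "P \<in> carrier_mat (deg \<sigma>) (deg \<rho>)" and Q: "Q \<in> carrier_mat (deg \<rho>) (deg \<sigma>)"
    and PQ: "P * Q = 1\<^sub>m (deg \<sigma>)" and QP: "Q * P = 1\<^sub>m (deg \<rho>)" and tw: "\<And>h. h \<in> H \<Longrightarrow> P * \<rho> h = \<sigma> h * P"
  show ?thesis
  proof (rule rep_isoI[OF Q P QP PQ])
    fix h assume h: "h \<in> H"
    note dims = carrier_matD[OF P] carrier_matD[OF Q] square_repD[OF assms(2) h] square_repD[OF assms(3) h]
    have "Q * \<sigma> h = Q * (\<sigma> h * (P * Q))" unfolding PQ by (simp add: mat_dim_simps dims)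
    also have "\<dots> = Q * ((\<sigma> h * P) * Q)" by (simp add: mat_dim_simps dims)
    also have "\<dots> = (Q * P) * (\<rho> h * Q)" unfolding tw[OF h, symmetric] by (simp add: mat_dim_simps dims)
    also have "\<dots> = \<rho> h * Q" unfolding QP by (simp add: mat_dim_simps dims)
    finally show "Q * \<sigma> h = \<rho> h * Q" .
  qed
qed

lemma rep_iso_trans:
  assumes "rep_iso H \<rho> \<sigma>" "rep_iso H \<sigma> \<tau>" "square_rep \<rho>" "square_rep \<sigma>" "square_rep \<tau>"
  shows "rep_iso H \<rho> \<tau>"
proof -
  from assms(1) obtain P Q where P: "P \<in> carrier_mat (deg \<sigma>) (deg \<rho>)" and Q: "Q \<in> carrier_mat (deg \<rho>) (deg \<sigma>)"
    and PQ: "P * Q = 1\<^sub>m (deg \<sigma>)" and QP: "Q * P = 1\<^sub>m (deg \<rho>)" and tw: "\<And>h. h \<in> H \<Longrightarrow> P * \<rho> h = \<sigma> h * P"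
    by (rule rep_isoE) blast
  from assms(2) obtain P' Q' where P': "P' \<in> carrier_mat (deg \<tau>) (deg \<sigma>)" and Q': "Q' \<in> carrier_mat (deg \<sigma>) (deg \<tau>)"
    and PQ': "P' * Q' = 1\<^sub>m (deg \<tau>)" and QP': "Q' * P' = 1\<^sub>m (deg \<sigma>)" and tw': "\<And>h. h \<in> H \<Longrightarrow> P' * \<sigma> h = \<tau> h * P'"
    by (rule rep_isoE) blast
  note dims = carrier_matD[OF P] carrier_matD[OF Q] carrier_matD[OF P'] carrier_matD[OF Q']
  show ?thesis
  proof (rule rep_isoI[of "P' * P" _ _ "Q * Q'"])
    have "P' * P * (Q * Q') = P' * ((P * Q) * Q')" by (simp add: mat_dim_simps dims)
    then show "P' * P * (Q * Q') = 1\<^sub>m (deg \<tau>)" unfolding PQ by (simp add: mat_dim_simps dims PQ')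
    have "Q * Q' * (P' * P) = Q * ((Q' * P') * P)" by (simp add: mat_dim_simps dims)
    then show "Q * Q' * (P' * P) = 1\<^sub>m (deg \<rho>)" unfolding QP' by (simp add: mat_dim_simps dims QP)
    fix h assume h: "h \<in> H"
    note dims = dims square_repD[OF assms(3) h] square_repD[OF assms(4) h] square_repD[OF assms(5) h]
    have "P' * P * \<rho> h = P' * (P * \<rho> h)" by (simp add: mat_dim_simps dims)
    also have "\<dots> = (P' * \<sigma> h) * P" unfolding tw[OF h] by (simp add: mat_dim_simps dims)
    also have "\<dots> = \<tau> h * (P' * P)" unfolding tw'[OF h] by (simp add: mat_dim_simps dims)
    finally show "P' * P * \<rho> h = \<tau> h * (P' * P)" .
  qed (use P Q P' Q' in auto)
qed

lemma rep_iso_mtrace: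
  assumes "rep_iso H \<rho> \<sigma>" "square_rep \<rho>" "square_rep \<sigma>" "h \<in> H"
  shows "mtrace (\<rho> h) = mtrace (\<sigma> h)"
proof -
  from assms(1) obtain P Q where P: "P \<in> carrier_mat (deg \<sigma>) (deg \<rho>)" and Q: "Q \<in> carrier_mat (deg \<rho>) (deg \<sigma>)"
    and PQ: "P * Q = 1\<^sub>m (deg \<sigma>)" and QP: "Q * P = 1\<^sub>m (deg \<rho>)" and tw: "\<And>h. h \<in> H \<Longrightarrow> P * \<rho> h = \<sigma> h * P"
    by (rule rep_isoE) blast
  note dims = carrier_matD[OF P] carrier_matD[OF Q] square_repD[OF assms(2,4)] square_repD[OF assms(3,4)]
  have "mtrace (\<rho> h) = mtrace ((Q * P) * \<rho> h)" unfolding QP by (simp add: mat_dim_simps dims)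
  also have "\<dots> = mtrace (Q * (P * \<rho> h))" by (simp add: mat_dim_simps dims)
  also have "\<dots> = mtrace (P * \<rho> h * Q)"
    by (rule mtrace_comm[of _ "deg \<rho>" "deg \<sigma>"]) (auto simp: dims)
  also have "\<dots> = mtrace (\<sigma> h * (P * Q))" unfolding tw[OF assms(4)] by (simp add: mat_dim_simps dims)
  finally show ?thesis unfolding PQ by (simp add: mat_dim_simps dims)
qed

lemma rep_iso_mtrace_inv:
  assumes "rep_iso H \<rho> \<sigma>" "tmod \<rho>" "tmod \<sigma>" "h \<in> H"
  shows "mtrace (rep_inv \<rho> h) = mtrace (rep_inv \<sigma> h)"
  using rep_iso_mtrace[OF assms(1) tmod_square tmod_square] assms
  by (simp add: rep_inv_def mtrace_smult[OF tmod_carrier])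

subsection \<open>Orthogonality of characters\<close>

lemma average_simple_noniso:
  assumes \<rho>: "\<rho> \<in> simple_modules H \<alpha>" and \<sigma>: "\<sigma> \<in> simple_modules H \<alpha>" and "\<not> rep_iso H \<sigma> \<rho>"
    and X: "X \<in> carrier_mat (deg \<rho>) (deg \<sigma>)"
  shows "average \<rho> \<sigma> X = 0\<^sub>m (deg \<rho>) (deg \<sigma>)"
proof (rule ccontr)
  assume ne: "average \<rho> \<sigma> X \<noteq> 0\<^sub>m (deg \<rho>) (deg \<sigma>)"
  have tw: "average \<rho> \<sigma> X * \<sigma> h = \<rho> h * average \<rho> \<sigma> X" if "h \<in> H" for h
    using average_intertwines[OF simple_dest(1)[OF \<rho>] simple_dest(1)[OF \<sigma>] X that] by simp
  obtain G where "deg \<sigma> = deg \<rho>" and G: "G \<in> carrier_mat (deg \<sigma>) (deg \<rho>)"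
    "average \<rho> \<sigma> X * G = 1\<^sub>m (deg \<rho>)" "G * average \<rho> \<sigma> X = 1\<^sub>m (deg \<sigma>)"
    by (rule schur_iso[OF \<sigma> \<rho> average_carrier tw ne])
  have "rep_iso H \<sigma> \<rho>" by (rule rep_isoI[OF average_carrier G tw])
  then show False using assms(3) by simp
qed

text \<open>\<open>F\<close> has a complex eigenvalue k. The intertwiner F - k annihilates an
  eigenvector, so it is not invertible and vanishes by \<open>schur_iso\<close>.\<close>

lemma schur_scalar:
  assumes \<rho>: "\<rho> \<in> simple_modules H \<alpha>" and F: "F \<in> carrier_mat (deg \<rho>) (deg \<rho>)"
    and tw: "\<And>h. h \<in> H \<Longrightarrow> F * \<rho> h = \<rho> h * F"
  obtains c where "F = c \<cdot>\<^sub>m 1\<^sub>m (deg \<rho>)"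
proof -
  let ?d = "deg \<rho>"
  note c = tmod_carrier[OF simple_dest(1)[OF \<rho>]]
  obtain k v where v: "v \<in> carrier_vec ?d" "v \<noteq> 0\<^sub>v ?d" and Fv: "F *\<^sub>v v = k \<cdot>\<^sub>v v"
    by (rule eigenvalue_exists[OF F simple_dest(2)[OF \<rho>]])
  define F' where "F' = F + (- k) \<cdot>\<^sub>m 1\<^sub>m ?d"
  have F': "F' \<in> carrier_mat ?d ?d" using F by (simp add: F'_def)
  have tw': "F' * \<rho> h = \<rho> h * F'" if h: "h \<in> H" for h
    unfolding F'_def using c[OF h] F tw[OF h]
    by (simp add: add_mult_distrib_mat[of _ ?d ?d] mult_add_distrib_mat[of _ ?d ?d] mat_dim_simps)
  have "F' = 0\<^sub>m ?d ?d"
  proof (rule ccontr)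
    assume "F' \<noteq> 0\<^sub>m ?d ?d"
    then obtain G where G: "G \<in> carrier_mat ?d ?d" "G * F' = 1\<^sub>m ?d"
      using schur_iso[OF \<rho> \<rho> F' tw'] by metis
    have "F' *\<^sub>v v = F *\<^sub>v v + ((- k) \<cdot>\<^sub>m 1\<^sub>m ?d) *\<^sub>v v"
      unfolding F'_def using F v by (intro add_mult_distrib_mat_vec) auto
    also have "\<dots> = 0\<^sub>v ?d" unfolding Fv using v by auto
    finally have "F' *\<^sub>v v = 0\<^sub>v ?d" .
    moreover have "(G * F') *\<^sub>v v = G *\<^sub>v (F' *\<^sub>v v)" using G F' v by (intro assoc_mult_mat_vec) auto
    moreover have "G *\<^sub>v 0\<^sub>v ?d = 0\<^sub>v ?d" using G by (auto simp: scalar_prod_def mult_mat_vec_def zero_vec_def)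
    ultimately show False using G v by simp
  qed
  then have "F = k \<cdot>\<^sub>m 1\<^sub>m ?d"
  proof -
    assume 0: "F' = 0\<^sub>m ?d ?d"
    show ?thesis
    proof (rule eq_matI)
      fix i j assume ij: "i < dim_row (k \<cdot>\<^sub>m 1\<^sub>m ?d)" "j < dim_col (k \<cdot>\<^sub>m 1\<^sub>m ?d)"
      have "F' $$ (i, j) = 0" using 0 ij by simp
      then show "F $$ (i, j) = (k \<cdot>\<^sub>m 1\<^sub>m ?d) $$ (i, j)" using F ij by (auto simp: F'_def)
    qed (use F in auto)
  qed
  then show thesis by (rule that)
qed

text \<open>The usual inner product of characters times the group order, with the trace of the
  inverse matrix in place of the complex conjugate.\<close>

definition char_form :: "rep \<Rightarrow> rep \<Rightarrow> complex" where
  "char_form X \<sigma> = (\<Sum>h\<in>H. mtrace (X h) * mtrace (rep_inv \<sigma> h))"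

definition unit_mat :: "nat \<Rightarrow> nat \<Rightarrow> nat \<Rightarrow> nat \<Rightarrow> complex mat" where
  "unit_mat n m i j = mat n m (\<lambda>ab. of_bool (ab = (i, j)))"

lemma unit_mat_carrier [simp]: "unit_mat n m i j \<in> carrier_mat n m"
  by (simp add: unit_mat_def)

lemma mult_unit_mat_index:
  assumes "A \<in> carrier_mat r n" "B \<in> carrier_mat m s" "i < n" "j < m" "a < r" "b < s"
  shows "(A * unit_mat n m i j * B) $$ (a, b) = A $$ (a, i) * B $$ (j, b)"
proof -
  have "(A * unit_mat n m i j) $$ (a, l) = (if l = j then A $$ (a, i) else 0)" if "l < m" for l
    using assms that by (simp add: unit_mat_def scalar_prod_def of_bool_def if_distrib[of "\<lambda>x. _ * x"] cong: if_cong)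
  then have "(\<Sum>l<m. (A * unit_mat n m i j) $$ (a, l) * B $$ (l, b)) = (\<Sum>l<m. if l = j then A $$ (a, i) * B $$ (l, b) else 0)"
    by (intro sum.cong) auto
  then show ?thesis using assms by (subst mult_mat_index[of _ r m _ s]) auto
qed

text \<open>With E the matrix unit at (i, j), the entry (i, j) of A E B is the product of the i-th
  diagonal entry of A and the j-th of B. Summation gives the product of the traces, so the form is a
  sum of entries of averages, to which Schur's lemma applies.\<close>

lemma char_form_average:
  assumes \<rho>: "tmod \<rho>" and \<sigma>: "tmod \<sigma>"
  shows "char_form \<rho> \<sigma> = (\<Sum>i<deg \<rho>. \<Sum>j<deg \<sigma>. average \<rho> \<sigma> (unit_mat (deg \<rho>) (deg \<sigma>) i j) $$ (i, j))"
proof -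
  have "mtrace (\<rho> h) * mtrace (rep_inv \<sigma> h) = (\<Sum>i<deg \<rho>. \<Sum>j<deg \<sigma>.
      (\<rho> h * unit_mat (deg \<rho>) (deg \<sigma>) i j * rep_inv \<sigma> h) $$ (i, j))" if h: "h \<in> H" for h
    using h \<rho> \<sigma> mult_unit_mat_index[OF tmod_carrier[OF \<rho> h] rep_inv_carrier[OF \<sigma> h]]
    by (simp add: mtrace_def tmod_dim sum_product)
  then have "char_form \<rho> \<sigma> = (\<Sum>h\<in>H. \<Sum>i<deg \<rho>. \<Sum>j<deg \<sigma>.
      (\<rho> h * unit_mat (deg \<rho>) (deg \<sigma>) i j * rep_inv \<sigma> h) $$ (i, j))"
    unfolding char_form_def by (rule sum.cong[OF refl])
  also have "\<dots> = (\<Sum>i<deg \<rho>. \<Sum>j<deg \<sigma>. \<Sum>h\<in>H.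
      (\<rho> h * unit_mat (deg \<rho>) (deg \<sigma>) i j * rep_inv \<sigma> h) $$ (i, j))"
    by (subst sum.swap) (rule sum.cong[OF refl], rule sum.swap)
  finally show ?thesis by (simp add: average_def msum_def)
qed

lemma char_form_noniso:
  assumes "\<rho> \<in> simple_modules H \<alpha>" "\<sigma> \<in> simple_modules H \<alpha>" "\<not> rep_iso H \<sigma> \<rho>"
  shows "char_form \<rho> \<sigma> = 0"
  using assms by (simp add: char_form_average simple_dest average_simple_noniso)

text \<open>By Schur's lemma the average of the matrix unit at (i, j) is a scalar c. Its trace is
  \<open>card H\<close> times that of the matrix unit, so c is \<open>card H\<close> divided by
  \<open>deg \<rho>\<close> if i = j and 0 otherwise; exactly \<open>deg \<rho>\<close> diagonal
  terms remain.\<close>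

lemma char_form_self:
  assumes \<rho>: "\<rho> \<in> simple_modules H \<alpha>"
  shows "char_form \<rho> \<rho> = of_nat (card H)"
proof -
  let ?d = "deg \<rho>"
  note t = simple_dest(1)[OF \<rho>] and d0 = simple_dest(2)[OF \<rho>]
  have "average \<rho> \<rho> (unit_mat ?d ?d i j) $$ (i, j) = (if i = j then of_nat (card H) / of_nat ?d else 0)"
    if ij: "i < ?d" "j < ?d" for i j
  proof -
    let ?E = "unit_mat ?d ?d i j"
    obtain c where c: "average \<rho> \<rho> ?E = c \<cdot>\<^sub>m 1\<^sub>m ?d"
      using schur_scalar[OF \<rho> average_carrier, of ?E] average_intertwines[OF t t unit_mat_carrier] by metis
    have "mtrace (average \<rho> \<rho> ?E) = (\<Sum>h\<in>H. mtrace (\<rho> h * ?E * rep_inv \<rho> h))"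
      unfolding average_def
      by (rule mtrace_msum) (rule mult_carrier_mat[OF mult_carrier_mat[OF tmod_carrier[OF t] unit_mat_carrier] rep_inv_carrier[OF t]])
    also have "\<dots> = (\<Sum>h\<in>H. mtrace ?E)"
    proof (rule sum.cong[OF refl])
      fix h assume h: "h \<in> H"
      note dims = tmod_dim[OF t h] carrier_matD[OF unit_mat_carrier]
      have "mtrace (\<rho> h * ?E * rep_inv \<rho> h) = mtrace (rep_inv \<rho> h * (\<rho> h * ?E))"
        using tmod_carrier[OF t h] rep_inv_carrier[OF t h] by (intro mtrace_comm[of _ ?d ?d]) auto
      also have "\<dots> = mtrace ((rep_inv \<rho> h * \<rho> h) * ?E)" by (simp add: mat_dim_simps dims)
      finally show "mtrace (\<rho> h * ?E * rep_inv \<rho> h) = mtrace ?E"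
        unfolding rep_mult_inv[OF t h] by (simp add: mat_dim_simps dims)
    qed
    also have "mtrace ?E = of_bool (i = j)"
      using ij by (auto simp: mtrace_def unit_mat_def of_bool_def if_distrib cong: if_cong)
    finally have "c * of_nat ?d = (if i = j then of_nat (card H) else 0)" unfolding c by (simp add: mtrace_smult[OF one_carrier_mat])
    then have "c = (if i = j then of_nat (card H) / of_nat ?d else 0)"
      using d0 by (auto simp: field_simps split: if_splits)
    then show ?thesis unfolding c using ij by auto
  qed
  then have "char_form \<rho> \<rho> = (\<Sum>i<?d. \<Sum>j<?d. if i = j then of_nat (card H) / of_nat ?d else 0)"
    unfolding char_form_average[OF t t] by (auto intro!: sum.cong)
  also have "\<dots> = of_nat (card H)" using d0 by simp
  finally show ?thesis .
qed

lemma char_form_iso: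
  assumes "rep_iso H \<rho> \<rho>'" "rep_iso H \<sigma> \<sigma>'" "square_rep \<rho>" "square_rep \<rho>'" "tmod \<sigma>" "tmod \<sigma>'"
  shows "char_form \<rho> \<sigma> = char_form \<rho>' \<sigma>'"
  unfolding char_form_def using assms by (auto intro!: sum.cong simp: rep_iso_mtrace[of \<rho> \<rho>'] rep_iso_mtrace_inv[of \<sigma> \<sigma>'])

lemma char_form_simple:
  assumes "\<rho> \<in> simple_modules H \<alpha>" "\<sigma> \<in> simple_modules H \<alpha>"
  shows "char_form \<rho> \<sigma> = (if rep_iso H \<rho> \<sigma> then of_nat (card H) else 0)"
proof (cases "rep_iso H \<rho> \<sigma>")
  case True
  then have "char_form \<rho> \<sigma> = char_form \<sigma> \<sigma>"
    using assms by (intro char_form_iso) (auto intro: rep_iso_refl tmod_square simple_dest)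
  then show ?thesis using True assms char_form_self by simp
next
  case False
  then have "\<not> rep_iso H \<sigma> \<rho>" using rep_iso_sym assms tmod_square simple_dest by blast
  then show ?thesis using False assms char_form_noniso by simp
qed

end

section \<open>Direct sums\<close>

definition block_sum :: "'a::zero mat \<Rightarrow> 'a mat \<Rightarrow> 'a mat" where
  "block_sum A B = four_block_mat A (0\<^sub>m (dim_row A) (dim_col B)) (0\<^sub>m (dim_row B) (dim_col A)) B"

lemma block_sum_carrier [simp]:
  "A \<in> carrier_mat a b \<Longrightarrow> B \<in> carrier_mat c d \<Longrightarrow> block_sum A B \<in> carrier_mat (a + c) (b + d)"
  by (auto simp: block_sum_def)

lemma dim_block_sum [simp]: "dim_row (block_sum A B) = dim_row A + dim_row B"
  "dim_col (block_sum A B) = dim_col A + dim_col B"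
  by (auto simp: block_sum_def)

lemma block_sum_mult:
  fixes A B C D :: "complex mat"
  assumes "dim_col A = dim_row C" "dim_col B = dim_row D"
  shows "block_sum A B * block_sum C D = block_sum (A * C) (B * D)"
proof -
  have "block_sum A B * block_sum C D = four_block_mat
     (A * C + 0\<^sub>m (dim_row A) (dim_col B) * 0\<^sub>m (dim_row D) (dim_col C))
     (A * 0\<^sub>m (dim_row C) (dim_col D) + 0\<^sub>m (dim_row A) (dim_col B) * D)
     (0\<^sub>m (dim_row B) (dim_col A) * C + B * 0\<^sub>m (dim_row D) (dim_col C))
     (0\<^sub>m (dim_row B) (dim_col A) * 0\<^sub>m (dim_row C) (dim_col D) + B * D)"
    unfolding block_sum_def using assms
    by (intro mult_four_block_mat[of _ "dim_row A" "dim_col A" _ "dim_col B" _ "dim_row B" _ _ "dim_col C" _ "dim_col D"]) auto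
  also have "\<dots> = block_sum (A * C) (B * D)"
    unfolding block_sum_def using assms by (intro cong_four_block_mat eq_matI) auto
  finally show ?thesis .
qed

lemma block_sum_one: "block_sum (1\<^sub>m n) (1\<^sub>m m) = 1\<^sub>m (n + m)"
  by (simp add: block_sum_def)

lemma mtrace_block_sum:
  assumes "A \<in> carrier_mat n n" "B \<in> carrier_mat m m"
  shows "mtrace (block_sum A B) = mtrace A + mtrace B"
proof -
  have "mtrace (block_sum A B) = (\<Sum>i<n + m. if i < n then A $$ (i, i) else B $$ (i - n, i - n))"
    using assms by (auto simp: mtrace_def block_sum_def intro!: sum.cong)
  also have "\<dots> = (\<Sum>i<n. A $$ (i, i)) + (\<Sum>i<m. B $$ (i, i))"
    by (induction m) (auto intro!: sum.cong)
  finally show ?thesis using assms by (simp add: mtrace_def)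
qed

lemma direct_sum_simps: "direct_sum [] = (\<lambda>h. 0\<^sub>m 0 0)"
  "direct_sum (\<rho> # \<rho>s) = (\<lambda>h. block_sum (\<rho> h) (direct_sum \<rho>s h))"
  "direct_sum (\<rho>s @ \<sigma>s) = (\<lambda>h. block_sum (direct_sum \<rho>s h) (direct_sum \<sigma>s h))"
  by (auto simp: direct_sum_def block_sum_def Let_def diag_block_mat_append)

lemma deg_direct_sum: "deg (direct_sum \<rho>s) = sum_list (map deg \<rho>s)"
  by (simp add: deg_def[abs_def] direct_sum_def dim_diag_block_mat comp_def)

context twisted_group
begin

lemma square_block_sum:
  assumes "square_rep \<rho>" "square_rep \<sigma>"
  shows "square_rep (\<lambda>h. block_sum (\<rho> h) (\<sigma> h))" "deg (\<lambda>h. block_sum (\<rho> h) (\<sigma> h)) = deg \<rho> + deg \<sigma>"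
proof -
  show d: "deg (\<lambda>h. block_sum (\<rho> h) (\<sigma> h)) = deg \<rho> + deg \<sigma>" by (simp add: deg_def)
  show "square_rep (\<lambda>h. block_sum (\<rho> h) (\<sigma> h))" using assms unfolding square_rep_def d by auto
qed

lemma square_direct_sum:
  "(\<And>\<rho>. \<rho> \<in> set \<rho>s \<Longrightarrow> square_rep \<rho>) \<Longrightarrow> square_rep (direct_sum \<rho>s)"
proof (induction \<rho>s)
  case Nil
  show ?case by (auto simp: square_rep_def direct_sum_simps deg_def)
next
  case (Cons \<rho> \<rho>s)
  then show ?case unfolding direct_sum_simps by (intro square_block_sum(1)) auto
qed

lemma mtrace_direct_sum:
  "(\<And>\<rho>. \<rho> \<in> set \<rho>s \<Longrightarrow> square_rep \<rho>) \<Longrightarrow> h \<in> H \<Longrightarrow>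
    mtrace (direct_sum \<rho>s h) = (\<Sum>\<rho>\<leftarrow>\<rho>s. mtrace (\<rho> h))"
proof (induction \<rho>s)
  case Nil
  show ?case by (simp add: direct_sum_simps mtrace_def)
next
  case (Cons \<rho> \<rho>s)
  then have sq: "\<rho> h \<in> carrier_mat (deg \<rho>) (deg \<rho>)"
    "direct_sum \<rho>s h \<in> carrier_mat (deg (direct_sum \<rho>s)) (deg (direct_sum \<rho>s))"
    using square_direct_sum[of \<rho>s] unfolding square_rep_def by (metis list.set_intros)+
  show ?case unfolding direct_sum_simps(2) mtrace_block_sum[OF sq] using Cons by simp
qed

lemma rep_iso_block_sum:
  assumes "rep_iso H \<rho> \<rho>'" "rep_iso H \<sigma> \<sigma>'" "square_rep \<rho>" "square_rep \<rho>'" "square_rep \<sigma>" "square_rep \<sigma>'"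
  shows "rep_iso H (\<lambda>h. block_sum (\<rho> h) (\<sigma> h)) (\<lambda>h. block_sum (\<rho>' h) (\<sigma>' h))"
proof -
  from assms(1) obtain P Q where P: "P \<in> carrier_mat (deg \<rho>') (deg \<rho>)" and Q: "Q \<in> carrier_mat (deg \<rho>) (deg \<rho>')"
    and PQ: "P * Q = 1\<^sub>m (deg \<rho>')" and QP: "Q * P = 1\<^sub>m (deg \<rho>)" and tw: "\<And>h. h \<in> H \<Longrightarrow> P * \<rho> h = \<rho>' h * P"
    by (rule rep_isoE) blast
  from assms(2) obtain R S where R: "R \<in> carrier_mat (deg \<sigma>') (deg \<sigma>)" and S: "S \<in> carrier_mat (deg \<sigma>) (deg \<sigma>')"
    and RS: "R * S = 1\<^sub>m (deg \<sigma>')" and SR: "S * R = 1\<^sub>m (deg \<sigma>)" and tw': "\<And>h. h \<in> H \<Longrightarrow> R * \<sigma> h = \<sigma>' h * R"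
    by (rule rep_isoE) blast
  note dims = carrier_matD[OF P] carrier_matD[OF Q] carrier_matD[OF R] carrier_matD[OF S]
  show ?thesis
  proof (rule rep_isoI[of "block_sum P R" _ _ "block_sum Q S"])
    fix h assume h: "h \<in> H"
    note dims = dims square_repD[OF assms(3) h] square_repD[OF assms(4) h] square_repD[OF assms(5) h] square_repD[OF assms(6) h]
    show "block_sum P R * block_sum (\<rho> h) (\<sigma> h) = block_sum (\<rho>' h) (\<sigma>' h) * block_sum P R"
      by (simp add: block_sum_mult dims tw[OF h] tw'[OF h])
  qed (use P Q R S in \<open>auto simp: square_block_sum assms block_sum_mult dims PQ QP RS SR block_sum_one\<close>)
qed

subsection \<open>Maschke's theorem\<close>

text \<open>\<open>A\<close> embeds the coordinates of an invariant subspace and \<open>B\<close> is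
  a left inverse of \<open>A\<close>, so this is the restriction of \<open>\<rho>\<close> to that
  subspace, in coordinates.\<close>

definition sub_rep :: "complex mat \<Rightarrow> complex mat \<Rightarrow> rep \<Rightarrow> rep" where
  "sub_rep A B \<rho> = (\<lambda>h. B * \<rho> h * A)"

lemma sub_rep_tmod:
  assumes \<rho>: "tmod \<rho>" and A: "A \<in> carrier_mat (deg \<rho>) k" and B: "B \<in> carrier_mat k (deg \<rho>)"
    and BA: "B * A = 1\<^sub>m k" and inv: "\<And>h. h \<in> H \<Longrightarrow> A * (B * (\<rho> h * A)) = \<rho> h * A"
  shows "tmod (sub_rep A B \<rho>)" "deg (sub_rep A B \<rho>) = k"
proof -
  show d: "deg (sub_rep A B \<rho>) = k" using B by (simp add: sub_rep_def deg_def)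
  note dims = carrier_matD[OF A] carrier_matD[OF B] tmod_dim[OF \<rho>]
  have "(B * \<rho> g * A) * (B * \<rho> h * A) = \<alpha> (g, h) \<cdot>\<^sub>m (B * \<rho> (g \<circ> h) * A)" if gh: "g \<in> H" "h \<in> H" for g h
  proof -
    have "(B * \<rho> g * A) * (B * \<rho> h * A) = B * (\<rho> g * (A * (B * (\<rho> h * A))))"
      using gh by (simp add: mat_dim_simps dims)
    also have "\<dots> = B * ((\<rho> g * \<rho> h) * A)" unfolding inv[OF gh(2)] using gh by (simp add: mat_dim_simps dims)
    also have "\<dots> = \<alpha> (g, h) \<cdot>\<^sub>m (B * \<rho> (g \<circ> h) * A)"
      unfolding tmod_mult[OF \<rho> gh] using gh by (simp add: mat_dim_simps dims)
    finally show ?thesis .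
  qed
  moreover have "B * \<rho> id * A = \<alpha> (id, id) \<cdot>\<^sub>m 1\<^sub>m k"
    unfolding tmod_id[OF \<rho>] by (simp add: mat_dim_simps dims BA)
  moreover have "B * \<rho> h * A \<in> carrier_mat k k" if "h \<in> H" for h
    using A B tmod_carrier[OF \<rho> that] by simp
  ultimately show "tmod (sub_rep A B \<rho>)" unfolding twisted_module_def d by (simp add: sub_rep_def)
qed

text \<open>Averaging the projection \<open>A * B\<close> onto an invariant subspace gives an
  intertwining projection \<open>E\<close> onto the same subspace. The kernel of \<open>E\<close> is
  an invariant complement, and \<open>subspace_factor\<close> supplies coordinates on both.\<close>

lemma nonsimple_splits:
  assumes \<rho>: "tmod \<rho>" and pos: "deg \<rho> > 0" and ns: "\<rho> \<notin> simple_modules H \<alpha>"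
  obtains \<rho>1 \<rho>2 where "tmod \<rho>1" "tmod \<rho>2" "deg \<rho>1 < deg \<rho>" "deg \<rho>2 < deg \<rho>"
    "rep_iso H \<rho> (\<lambda>h. block_sum (\<rho>1 h) (\<rho>2 h))"
proof -
  let ?d = "deg \<rho>"
  from assms obtain W where W: "VectorSpace.subspace class_ring W (module_vec TYPE(complex) ?d)"
    and inv: "\<And>h w. h \<in> H \<Longrightarrow> w \<in> W \<Longrightarrow> \<rho> h *\<^sub>v w \<in> W"
    and W0: "W \<noteq> {0\<^sub>v ?d}" and W1: "W \<noteq> carrier_vec ?d"
    by (auto simp: simple_modules_def)
  note c = tmod_carrier[OF \<rho>]
  obtain k A B where A: "A \<in> carrier_mat ?d k" and B: "B \<in> carrier_mat k ?d" and BA: "B * A = 1\<^sub>m k"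
    and AW: "\<And>v. v \<in> carrier_vec k \<Longrightarrow> A *\<^sub>v v \<in> W" and fW: "\<And>w. w \<in> W \<Longrightarrow> A *\<^sub>v (B *\<^sub>v w) = w"
    by (rule subspace_factor[OF W]) blast
  have invA: "A * (B * (\<rho> h * A)) = \<rho> h * A" if h: "h \<in> H" for h
  proof (rule mat_eq_if_mult_vec_eq)
    fix v :: "complex vec" assume v: "v \<in> carrier_vec k"
    have "\<rho> h *\<^sub>v (A *\<^sub>v v) \<in> W" using AW[OF v] inv[OF h] by simp
    from fW[OF this] show "A * (B * (\<rho> h * A)) *\<^sub>v v = \<rho> h * A *\<^sub>v v"
      using A B c[OF h] v by (simp add: mult_mat_vec_assoc carrier_matD carrier_vecD)
  qed (use A B c[OF h] in auto)
  define E where "E = (1 / of_nat (card H)) \<cdot>\<^sub>m average \<rho> \<rho> (A * B)"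
  have AB: "A * B \<in> carrier_mat ?d ?d" using A B by simp
  have E: "E \<in> carrier_mat ?d ?d" by (simp add: E_def)
  note dims = carrier_matD[OF A] carrier_matD[OF B] carrier_matD[OF E] carrier_matD[OF average_carrier[of \<rho> \<rho> "A * B"]]
  have commE: "\<rho> h * E = E * \<rho> h" if h: "h \<in> H" for h
    unfolding E_def using average_intertwines[OF \<rho> \<rho> AB h] h
    by (simp add: mat_dim_simps dims tmod_dim[OF \<rho>])
  have invA': "A * (B * (rep_inv \<rho> h * A)) = rep_inv \<rho> h * A" if h: "h \<in> H" for h
    unfolding rep_inv_def using invA[OF inv_in[OF h]] h by (simp add: mat_dim_simps dims tmod_dim[OF \<rho>])
  \<comment> \<open>Each conjugate of \<open>A * B\<close> fixes the invariant image of
    \<open>A\<close> pointwise, hence so does the average.\<close>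
  have EA: "E * A = A"
  proof -
    have "average \<rho> \<rho> (A * B) * A = msum ?d k (\<lambda>h. \<rho> h * (A * B) * rep_inv \<rho> h * A) H"
      unfolding average_def by (intro msum_mult carrier_matI) (auto simp: dims tmod_dim[OF \<rho>])
    also have "\<dots> = msum ?d k (\<lambda>h. A) H"
    proof (rule msum_cong)
      fix h assume h: "h \<in> H"
      have "\<rho> h * (A * B) * rep_inv \<rho> h * A = \<rho> h * (A * (B * (rep_inv \<rho> h * A)))"
        using h by (simp add: mat_dim_simps dims tmod_dim[OF \<rho>])
      also have "\<dots> = (\<rho> h * rep_inv \<rho> h) * A"
        unfolding invA'[OF h] using h by (simp add: mat_dim_simps dims tmod_dim[OF \<rho>])
      finally show "\<rho> h * (A * B) * rep_inv \<rho> h * A = A"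
        unfolding rep_mult_inv[OF \<rho> h] by (simp add: mat_dim_simps dims)
    qed
    also have "\<dots> = of_nat (card H) \<cdot>\<^sub>m A" by (rule msum_const[OF A])
    finally show ?thesis unfolding E_def by (simp add: mat_dim_simps dims)
  qed
  \<comment> \<open>Each summand of the average has its image in the invariant image of
    \<open>A\<close>, on which \<open>A * B\<close> is the identity. With \<open>EA\<close> this
    makes \<open>E\<close> idempotent.\<close>
  have ABE: "A * (B * E) = E"
  proof -
    have "(A * B) * average \<rho> \<rho> (A * B) = msum ?d ?d (\<lambda>h. (A * B) * (\<rho> h * (A * B) * rep_inv \<rho> h)) H"
      unfolding average_def by (intro mult_msum carrier_matI) (auto simp: dims tmod_dim[OF \<rho>])
    also have "\<dots> = average \<rho> \<rho> (A * B)" unfolding average_def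
    proof (rule msum_cong)
      fix h assume h: "h \<in> H"
      have "(A * B) * (\<rho> h * (A * B) * rep_inv \<rho> h) = (A * (B * (\<rho> h * A))) * (B * rep_inv \<rho> h)"
        using h by (simp add: mat_dim_simps dims tmod_dim[OF \<rho>])
      also have "\<dots> = \<rho> h * (A * B) * rep_inv \<rho> h"
        unfolding invA[OF h] using h by (simp add: mat_dim_simps dims tmod_dim[OF \<rho>])
      finally show "(A * B) * (\<rho> h * (A * B) * rep_inv \<rho> h) = \<rho> h * (A * B) * rep_inv \<rho> h" .
    qed
    finally show ?thesis unfolding E_def by (simp add: mat_dim_simps dims)
  qed
  have EE: "E * E = E"
  proof -
    have "E * E = (E * A) * (B * E)" using ABE by (simp add: mat_dim_simps dims)
    then show ?thesis unfolding EA by (simp add: ABE)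
  qed
  define F where "F = 1\<^sub>m ?d + (-1) \<cdot>\<^sub>m E"
  have F: "F \<in> carrier_mat ?d ?d" using E by (simp add: F_def)
  have EF_one: "E + F = 1\<^sub>m ?d" unfolding F_def using E by (intro eq_matI) auto
  have EF: "E * F = 0\<^sub>m ?d ?d" unfolding F_def
    using E by (simp add: mat_dim_distrib mat_dim_simps EE dims) (intro eq_matI, auto)
  have FE: "F * E = 0\<^sub>m ?d ?d" unfolding F_def
    using E by (simp add: mat_dim_distrib mat_dim_simps EE dims) (intro eq_matI, auto)
  have commF: "\<rho> h * F = F * \<rho> h" if h: "h \<in> H" for h
    unfolding F_def using commE[OF h] by (simp add: mat_dim_distrib mat_dim_simps dims tmod_dim[OF \<rho> h])
  define V where "V = {v \<in> carrier_vec ?d. E *\<^sub>v v = 0\<^sub>v ?d}"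
  have V: "VectorSpace.subspace class_ring V (module_vec TYPE(complex) ?d)"
  proof (rule subspaceI_vec)
    show "0\<^sub>v ?d \<in> V" using E by (auto simp: V_def scalar_prod_def mult_mat_vec_def zero_vec_def)
  qed (use E in \<open>auto simp: V_def mult_add_distrib_mat_vec[of _ ?d ?d] mult_mat_vec[of _ ?d ?d]\<close>)
  obtain m C D where C: "C \<in> carrier_mat ?d m" and D: "D \<in> carrier_mat m ?d" and DC: "D * C = 1\<^sub>m m"
    and CV: "\<And>v. v \<in> carrier_vec m \<Longrightarrow> C *\<^sub>v v \<in> V" and fV: "\<And>w. w \<in> V \<Longrightarrow> C *\<^sub>v (D *\<^sub>v w) = w"
    by (rule subspace_factor[OF V]) blast
  note dims = dims carrier_matD[OF F] carrier_matD[OF C] carrier_matD[OF D]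
  have EC: "E * C = 0\<^sub>m ?d m"
  proof (rule mat_eq_if_mult_vec_eq)
    fix v :: "complex vec" assume v: "v \<in> carrier_vec m"
    have "(E * C) *\<^sub>v v = E *\<^sub>v (C *\<^sub>v v)" using E C v by (rule assoc_mult_mat_vec)
    also have "\<dots> = 0\<^sub>v ?d" using CV[OF v] by (simp add: V_def)
    also have "\<dots> = 0\<^sub>m ?d m *\<^sub>v v" using v by (auto simp: scalar_prod_def mult_mat_vec_def zero_vec_def)
    finally show "(E * C) *\<^sub>v v = 0\<^sub>m ?d m *\<^sub>v v" .
  qed (use E C in auto)
  \<comment> \<open>\<open>C * D\<close> is the identity on the kernel of \<open>E\<close>, hence on
    every matrix whose columns lie there.\<close>
  have CDX: "C * (D * X) = X" if X: "X \<in> carrier_mat ?d r" and EX: "E * X = 0\<^sub>m ?d r" for X r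
  proof (rule mat_eq_if_mult_vec_eq)
    fix v :: "complex vec" assume v: "v \<in> carrier_vec r"
    have "E *\<^sub>v (X *\<^sub>v v) = (E * X) *\<^sub>v v" using E X v by (rule assoc_mult_mat_vec[symmetric])
    also have "\<dots> = 0\<^sub>v ?d" unfolding EX using v by (auto simp: scalar_prod_def mult_mat_vec_def zero_vec_def)
    finally have "X *\<^sub>v v \<in> V" using X v by (simp add: V_def)
    from fV[OF this] show "C * (D * X) *\<^sub>v v = X *\<^sub>v v"
      using C D X v by (simp add: mult_mat_vec_assoc carrier_matD carrier_vecD)
  qed (use C D X in auto)
  have CDF: "C * (D * F) = F" by (rule CDX[OF F EF])
  have invC: "C * (D * (\<rho> h * C)) = \<rho> h * C" if h: "h \<in> H" for h
  proof (rule CDX)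
    show "\<rho> h * C \<in> carrier_mat ?d m" using c[OF h] C by simp
    have "E * (\<rho> h * C) = (E * \<rho> h) * C" using h by (simp add: mat_dim_simps dims tmod_dim[OF \<rho>])
    also have "\<dots> = \<rho> h * (E * C)" unfolding commE[OF h, symmetric] using h by (simp add: mat_dim_simps dims tmod_dim[OF \<rho>])
    finally show "E * (\<rho> h * C) = 0\<^sub>m ?d m" unfolding EC using c[OF h] by simp
  qed
  have FC: "F * C = C" unfolding F_def using C EC by (simp add: mat_dim_distrib mat_dim_simps dims)
  have FA: "F * A = 0\<^sub>m ?d k" unfolding F_def using A EA by (simp add: mat_dim_distrib mat_dim_simps dims) (intro eq_matI, auto)
  let ?\<rho>1 = "sub_rep A B \<rho>" and ?\<rho>2 = "sub_rep C D \<rho>"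
  have t1: "tmod ?\<rho>1" "deg ?\<rho>1 = k" using sub_rep_tmod[OF \<rho> A B BA invA] by auto
  have t2: "tmod ?\<rho>2" "deg ?\<rho>2 = m" using sub_rep_tmod[OF \<rho> C D DC invC] by auto
  note sq = square_block_sum[OF tmod_square[OF t1(1)] tmod_square[OF t2(1)], unfolded t1 t2]
  \<comment> \<open>Blocks with 0 rows or 0 columns turn \<open>four_block_mat\<close> into
    juxtaposition: \<open>Q\<close> is \<open>A\<close> beside \<open>C\<close>, and
    \<open>P\<close> is \<open>B * E\<close> above \<open>D * F\<close>.\<close>
  let ?Z1 = "0\<^sub>m 0 k :: complex mat" and ?Z2 = "0\<^sub>m 0 m :: complex mat"
  define Q where "Q = four_block_mat A C ?Z1 ?Z2"
  define P where "P = four_block_mat (B * E) (0\<^sub>m k 0) (D * F) (0\<^sub>m m 0)"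
  have Q: "Q \<in> carrier_mat ?d (k + m)"
    using four_block_carrier_mat[OF A, of ?Z2 0 m ] by (simp add: Q_def)
  have P: "P \<in> carrier_mat (k + m) ?d"
    using four_block_carrier_mat[of "B * E" k ?d "0\<^sub>m m 0" m 0] B E by (simp add: P_def)
  have QP: "Q * P = 1\<^sub>m ?d"
  proof -
    have "Q * P = four_block_mat (A * (B * E) + C * (D * F)) (A * 0\<^sub>m k 0 + C * 0\<^sub>m m 0)
      (?Z1 * (B * E) + ?Z2 * (D * F)) (?Z1 * 0\<^sub>m k 0 + ?Z2 * 0\<^sub>m m 0)"
      unfolding Q_def P_def using A B C D E F by (intro mult_four_block_mat) auto
    also have "\<dots> = four_block_mat (E + F) (0\<^sub>m ?d 0) (0\<^sub>m 0 ?d) (0\<^sub>m 0 0)"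
      unfolding ABE CDF using A B C D E F by (intro cong_four_block_mat eq_matI) auto
    also have "\<dots> = 1\<^sub>m ?d" unfolding EF_one by (intro eq_matI) auto
    finally show ?thesis .
  qed
  have PQ: "P * Q = 1\<^sub>m (k + m)"
  proof -
    have "P * Q = four_block_mat (B * E * A + 0\<^sub>m k 0 * ?Z1) (B * E * C + 0\<^sub>m k 0 * ?Z2)
      (D * F * A + 0\<^sub>m m 0 * ?Z1) (D * F * C + 0\<^sub>m m 0 * ?Z2)"
      unfolding Q_def P_def using A B C D E F by (intro mult_four_block_mat) auto
    also have "\<dots> = four_block_mat (1\<^sub>m k) (0\<^sub>m k m) (0\<^sub>m m k) (1\<^sub>m m)"
    proof (rule cong_four_block_mat)
      have "B * E * A = B * (E * A)" by (simp add: mat_dim_simps dims)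
      then show "B * E * A + 0\<^sub>m k 0 * ?Z1 = 1\<^sub>m k" unfolding EA BA by simp
      have "B * E * C = B * (E * C)" by (simp add: mat_dim_simps dims)
      then show "B * E * C + 0\<^sub>m k 0 * ?Z2 = 0\<^sub>m k m" unfolding EC using B by simp
      have "D * F * A = D * (F * A)" by (simp add: mat_dim_simps dims)
      then show "D * F * A + 0\<^sub>m m 0 * ?Z1 = 0\<^sub>m m k" unfolding FA using D by simp
      have "D * F * C = D * (F * C)" by (simp add: mat_dim_simps dims)
      then show "D * F * C + 0\<^sub>m m 0 * ?Z2 = 1\<^sub>m m" unfolding FC DC by simp
    qed
    finally show ?thesis by simp
  qed
  have iso: "rep_iso H \<rho> (\<lambda>h. block_sum (?\<rho>1 h) (?\<rho>2 h))"
  proof (rule rep_isoI[of P _ _ Q])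
    fix h assume h: "h \<in> H"
    note dims = dims tmod_dim[OF \<rho> h]
    have four: "\<rho> h = four_block_mat (\<rho> h) (0\<^sub>m ?d 0) (0\<^sub>m 0 ?d) (0\<^sub>m 0 0)"
      using c[OF h] by (intro eq_matI) auto
    have Pr: "P * \<rho> h = four_block_mat (B * E * \<rho> h + 0\<^sub>m k 0 * 0\<^sub>m 0 ?d) (B * E * 0\<^sub>m ?d 0 + 0\<^sub>m k 0 * 0\<^sub>m 0 0)
      (D * F * \<rho> h + 0\<^sub>m m 0 * 0\<^sub>m 0 ?d) (D * F * 0\<^sub>m ?d 0 + 0\<^sub>m m 0 * 0\<^sub>m 0 0)"
      unfolding P_def by (subst four, rule mult_four_block_mat[of _ k ?d _ 0 _ m _ _ ?d _ 0]) (use B D E F c[OF h] in auto)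
    have Pl: "block_sum (?\<rho>1 h) (?\<rho>2 h) * P = four_block_mat (B * \<rho> h * A * (B * E) + 0\<^sub>m k m * (D * F)) (B * \<rho> h * A * 0\<^sub>m k 0 + 0\<^sub>m k m * 0\<^sub>m m 0)
      (0\<^sub>m m k * (B * E) + D * \<rho> h * C * (D * F)) (0\<^sub>m m k * 0\<^sub>m k 0 + D * \<rho> h * C * 0\<^sub>m m 0)"
      unfolding block_sum_def sub_rep_def P_def using A B C D E F c[OF h]
      by (subst mult_four_block_mat[of _ k k _ m _ m _ _ ?d _ 0]) auto
    have "B * E * \<rho> h = B * (E * \<rho> h)" by (simp add: mat_dim_simps dims)
    also have "\<dots> = B * \<rho> h * A * (B * E)" unfolding commE[OF h, symmetric] by (simp add: mat_dim_simps dims ABE)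
    finally have 1: "B * E * \<rho> h = B * \<rho> h * A * (B * E)" .
    have "D * F * \<rho> h = D * (F * \<rho> h)" by (simp add: mat_dim_simps dims)
    also have "\<dots> = D * \<rho> h * C * (D * F)" unfolding commF[OF h, symmetric] by (simp add: mat_dim_simps dims CDF)
    finally have 2: "D * F * \<rho> h = D * \<rho> h * C * (D * F)" .
    show "P * \<rho> h = block_sum (?\<rho>1 h) (?\<rho>2 h) * P"
      unfolding Pr Pl 1 2 using A B C D E F c[OF h] by (intro cong_four_block_mat eq_matI) auto
  qed (use P Q QP PQ in \<open>auto simp: sq\<close>)
  have km: "k + m = ?d" by (rule inverse_mats_same_dim[OF P Q PQ QP])
  have "k > 0"
  proof (rule ccontr)
    assume "\<not> k > 0"
    then have k: "k = 0" by simp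
    have "w = 0\<^sub>v ?d" if w: "w \<in> W" for w
    proof -
      have "A *\<^sub>v (B *\<^sub>v w) = 0\<^sub>v ?d" using A B unfolding k by (auto simp: scalar_prod_def mult_mat_vec_def zero_vec_def)
      then show ?thesis using fW[OF w] by simp
    qed
    then show False using W0 subspaceD_vec(2)[OF W] by blast
  qed
  moreover have "m > 0"
  proof (rule ccontr)
    assume "\<not> m > 0"
    then have k: "k = ?d" using km by simp
    have "A * B = 1\<^sub>m ?d" using mat_mult_left_right_inverse[of B ?d A] A B BA unfolding k by simp
    have "carrier_vec ?d \<subseteq> W"
    proof
      fix v :: "complex vec" assume v: "v \<in> carrier_vec ?d"
      have "v = (A * B) *\<^sub>v v" unfolding \<open>A * B = 1\<^sub>m ?d\<close> using v by simp
      also have "\<dots> = A *\<^sub>v (B *\<^sub>v v)" using A B v by (rule assoc_mult_mat_vec)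
      also have "\<dots> \<in> W" using B v by (intro AW) simp
      finally show "v \<in> W" .
    qed
    then show False using W1 subspaceD_vec(1)[OF W] by blast
  qed
  ultimately show thesis using that[OF t1(1) t2(1)] iso km t1 t2 by simp
qed

theorem maschke:
  assumes "tmod \<rho>"
  shows "\<exists>\<rho>s. set \<rho>s \<subseteq> simple_modules H \<alpha> \<and> rep_iso H \<rho> (direct_sum \<rho>s)"
  using assms
proof (induction "deg \<rho>" arbitrary: \<rho> rule: less_induct)
  case less
  consider "deg \<rho> = 0" | "\<rho> \<in> simple_modules H \<alpha>" | "deg \<rho> > 0" "\<rho> \<notin> simple_modules H \<alpha>" by blast
  then show ?case
  proof cases
    case 1
    have d0: "deg (direct_sum []) = 0" by (simp add: deg_direct_sum)
    have "rep_iso H \<rho> (direct_sum [])"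
    proof (rule rep_isoI[of "0\<^sub>m 0 0" _ _ "0\<^sub>m 0 0"])
      fix h assume "h \<in> H"
      then have "\<rho> h \<in> carrier_mat 0 0" using 1 tmod_carrier[OF less.prems] by simp
      then show "0\<^sub>m 0 0 * \<rho> h = direct_sum [] h * 0\<^sub>m 0 0" by (auto simp: direct_sum_def)
    qed (use 1 d0 in auto)
    then show ?thesis by (intro exI[of _ "[]"]) simp
  next
    case 2
    have "direct_sum [\<rho>] = \<rho>" by (rule ext) (simp add: direct_sum_def del: diag_block_mat.simps)
    then have "rep_iso H \<rho> (direct_sum [\<rho>])" using rep_iso_refl[OF tmod_square[OF less.prems]] by simp
    then show ?thesis using 2 by (intro exI[of _ "[\<rho>]"]) simp
  next
    case 3
    then obtain \<rho>1 \<rho>2 where t: "tmod \<rho>1" "tmod \<rho>2" and lt: "deg \<rho>1 < deg \<rho>" "deg \<rho>2 < deg \<rho>"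
      and iso: "rep_iso H \<rho> (\<lambda>h. block_sum (\<rho>1 h) (\<rho>2 h))"
      using nonsimple_splits[OF less.prems] by blast
    from less.hyps[OF lt(1) t(1)] obtain L1 where L1: "set L1 \<subseteq> simple_modules H \<alpha>" "rep_iso H \<rho>1 (direct_sum L1)" by blast
    from less.hyps[OF lt(2) t(2)] obtain L2 where L2: "set L2 \<subseteq> simple_modules H \<alpha>" "rep_iso H \<rho>2 (direct_sum L2)" by blast
    have sq: "square_rep (direct_sum L1)" "square_rep (direct_sum L2)"
      using L1(1) L2(1) simple_dest(1) tmod_square by (blast intro: square_direct_sum)+
    have "rep_iso H \<rho> (direct_sum (L1 @ L2))" unfolding direct_sum_simps(3)
      by (rule rep_iso_trans[OF iso rep_iso_block_sum[OF L1(2) L2(2)]])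
        (use tmod_square[OF t(1)] tmod_square[OF t(2)] tmod_square[OF less.prems] sq
          square_block_sum(1)[OF tmod_square[OF t(1)] tmod_square[OF t(2)]] square_block_sum(1)[OF sq] in auto)
    then show ?thesis using L1 L2 by (intro exI[of _ "L1 @ L2"]) simp
  qed
qed

subsection \<open>Multiplicities\<close>

abbreviation "iso_rel \<equiv> {(\<rho>, \<sigma>). \<rho> \<in> simple_modules H \<alpha> \<and> \<sigma> \<in> simple_modules H \<alpha> \<and> rep_iso H \<rho> \<sigma>}"

lemma equiv_iso_rel: "equiv (simple_modules H \<alpha>) iso_rel"
proof (rule equivI)
  show "iso_rel \<subseteq> simple_modules H \<alpha> \<times> simple_modules H \<alpha>" by auto
  show "refl_on (simple_modules H \<alpha>) iso_rel"
    by (auto intro!: refl_onI rep_iso_refl tmod_square dest: simple_dest)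
  show "sym iso_rel" by (rule symI) (use rep_iso_sym tmod_square simple_dest in blast)
  show "trans iso_rel" by (rule transI) (use rep_iso_trans tmod_square simple_dest in blast)
qed

lemma class_mem_iff:
  assumes "K \<in> simple_classes H \<alpha>" "\<sigma> \<in> K" "\<rho> \<in> simple_modules H \<alpha>"
  shows "\<rho> \<in> K \<longleftrightarrow> rep_iso H \<rho> \<sigma>" "\<sigma> \<in> simple_modules H \<alpha>"
proof -
  obtain \<tau> where "K = iso_rel `` {\<tau>}" "\<tau> \<in> simple_modules H \<alpha>"
    using assms(1) unfolding simple_classes_def by (auto elim: quotientE)
  then show \<sigma>: "\<sigma> \<in> simple_modules H \<alpha>" using assms by auto
  have "(\<tau>, \<sigma>) \<in> iso_rel" using \<open>K = iso_rel `` {\<tau>}\<close> assms(2) by blast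
  from equiv_class_eq[OF equiv_iso_rel this] have "K = iso_rel `` {\<sigma>}"
    using \<open>K = iso_rel `` {\<tau>}\<close> by simp
  then show "\<rho> \<in> K \<longleftrightarrow> rep_iso H \<rho> \<sigma>"
    using assms(3) \<sigma> rep_iso_sym tmod_square simple_dest by blast
qed

text \<open>By orthogonality the form with \<open>\<sigma>\<close> counts the summands in the class
  of \<open>\<sigma>\<close>, for any decomposition. So all decompositions give the same number, and
  \<open>maschke\<close> provides one; together this evaluates the definite description in
  \<open>multiplicity\<close>.\<close>

lemma multiplicity_char_form:
  assumes X: "tmod X" and K: "K \<in> simple_classes H \<alpha>" and \<sigma>: "\<sigma> \<in> K"
  shows "of_nat (multiplicity H \<alpha> X K) * of_nat (card H) = char_form X \<sigma>"
proof -
  have \<sigma>s: "\<sigma> \<in> simple_modules H \<alpha>"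
    using K \<sigma> unfolding simple_classes_def by (auto elim: quotientE)
  have key: "of_nat (length (filter (\<lambda>\<rho>. \<rho> \<in> K) \<rho>s)) * of_nat (card H) = char_form X \<sigma>"
    if L: "set \<rho>s \<subseteq> simple_modules H \<alpha>" "rep_iso H X (direct_sum \<rho>s)" for \<rho>s
  proof -
    have sq: "square_rep \<rho>" if "\<rho> \<in> set \<rho>s" for \<rho>
      using that L by (auto intro!: tmod_square dest: simple_dest)
    have "char_form X \<sigma> = char_form (direct_sum \<rho>s) \<sigma>"
      using L X \<sigma>s sq by (intro char_form_iso rep_iso_refl square_direct_sum tmod_square) (auto dest: simple_dest)
    also have "\<dots> = (\<Sum>\<rho>\<leftarrow>\<rho>s. char_form \<rho> \<sigma>)"
    proof -
      have "char_form (direct_sum \<rho>s) \<sigma> = (\<Sum>h\<in>H. (\<Sum>\<rho>\<leftarrow>\<rho>s. mtrace (\<rho> h)) * mtrace (rep_inv \<sigma> h))"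
        unfolding char_form_def using sq by (intro sum.cong) (auto simp: mtrace_direct_sum)
      also have "\<dots> = (\<Sum>\<rho>\<leftarrow>\<rho>s. char_form \<rho> \<sigma>)"
        unfolding char_form_def by (induction \<rho>s) (simp_all add: distrib_right sum.distrib)
      finally show ?thesis .
    qed
    also have "\<dots> = (\<Sum>\<rho>\<leftarrow>\<rho>s. if \<rho> \<in> K then of_nat (card H) else 0)"
      using L(1) \<sigma>s class_mem_iff(1)[OF K \<sigma>]
      by (intro arg_cong[of _ _ sum_list] map_cong refl) (auto simp: char_form_simple)
    also have "\<dots> = of_nat (length (filter (\<lambda>\<rho>. \<rho> \<in> K) \<rho>s)) * of_nat (card H)"
      by (induction \<rho>s) (auto simp: distrib_right)
    finally show ?thesis by simp
  qed
  obtain \<rho>s where \<rho>s: "set \<rho>s \<subseteq> simple_modules H \<alpha>" "rep_iso H X (direct_sum \<rho>s)" using maschke[OF X] by blast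
  have "multiplicity H \<alpha> X K = length (filter (\<lambda>\<rho>. \<rho> \<in> K) \<rho>s)"
    unfolding multiplicity_def
  proof (rule the_equality)
    show "\<exists>\<rho>s'. set \<rho>s' \<subseteq> simple_modules H \<alpha> \<and> rep_iso H X (direct_sum \<rho>s') \<and>
      length (filter (\<lambda>\<rho>. \<rho> \<in> K) \<rho>s) = length (filter (\<lambda>\<rho>. \<rho> \<in> K) \<rho>s')" using \<rho>s by blast
  next
    fix m assume "\<exists>\<rho>s'. set \<rho>s' \<subseteq> simple_modules H \<alpha> \<and> rep_iso H X (direct_sum \<rho>s') \<and>
      m = length (filter (\<lambda>\<rho>. \<rho> \<in> K) \<rho>s')"
    then have "of_nat m * of_nat (card H) = char_form X \<sigma>" using key by blast
    also have "\<dots> = of_nat (length (filter (\<lambda>\<rho>. \<rho> \<in> K) \<rho>s)) * of_nat (card H)" using key[OF \<rho>s] by simp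
    finally have "of_nat (m * card H) = (of_nat (length (filter (\<lambda>\<rho>. \<rho> \<in> K) \<rho>s) * card H) :: complex)" by simp
    then have "m * card H = length (filter (\<lambda>\<rho>. \<rho> \<in> K) \<rho>s) * card H" by (simp only: of_nat_eq_iff)
    then show "m = length (filter (\<lambda>\<rho>. \<rho> \<in> K) \<rho>s)" using card_pos by (metis mult_right_cancel less_numeral_extra(3))
  qed
  then show ?thesis using key[OF \<rho>s] by simp
qed

end

section \<open>Tensor products and the recognition of r(H, \<alpha>)\<close>

lemma of_nat_sum_list: "of_nat (sum_list xs) = sum_list (map of_nat xs)"
  by (induction xs) simp_all

definition rep_on :: "perm4 set \<Rightarrow> rep \<Rightarrow> bool" where
  "rep_on H \<theta> \<longleftrightarrow> (\<forall>h\<in>H. \<theta> h \<in> carrier_mat (deg \<theta>) (deg \<theta>)) \<and>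
     (\<forall>g\<in>H. \<forall>h\<in>H. \<theta> g * \<theta> h = \<theta> (g \<circ> h)) \<and> \<theta> id = 1\<^sub>m (deg \<theta>)"

lemma rep_on_subset: "rep_on G \<theta> \<Longrightarrow> H \<subseteq> G \<Longrightarrow> rep_on H \<theta>"
  by (auto simp: rep_on_def)

definition swap_rho :: "irr \<Rightarrow> irr" where
  "swap_rho x = (case x of Rho2 \<Rightarrow> Rho3 | Rho3 \<Rightarrow> Rho2 | y \<Rightarrow> y)"

lemma swap_rho_swap_rho [simp]: "swap_rho (swap_rho x) = x"
  by (cases x) (auto simp: swap_rho_def)

text \<open>The parameter \<open>s\<close> treats both alternatives of
  \<open>categorified_by\<close> at once. As the exchange is an involution, it may be moved from
  r(H, \<alpha>) to \<open>M\<close>.\<close>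

lemma categorified_byI:
  assumes "bij_betw f (zbasis M) (zbasis (grothendieck_module H \<alpha>))" "s = id \<or> s = swap_rho"
    "\<And>x k l. k \<in> zbasis M \<Longrightarrow> l \<in> zbasis M \<Longrightarrow>
      zcoef (grothendieck_module H \<alpha>) x (f k) (f l) = zcoef M (s x) k l"
  shows "categorified_by M H \<alpha>"
  using assms(2)
proof
  assume "s = id"
  then show ?thesis using assms unfolding categorified_by_def zequiv_def by auto
next
  assume s: "s = swap_rho"
  have "zcoef (exchange_rho (grothendieck_module H \<alpha>)) x (f k) (f l) = zcoef M x k l"
    if "k \<in> zbasis M" "l \<in> zbasis M" for x k l
    using assms(3)[OF that, of "swap_rho x"] unfolding s swap_rho_swap_rho
    by (simp add: exchange_rho_def swap_rho_def)
  then show ?thesis using assms(1) unfolding categorified_by_def zequiv_def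
    by (auto simp: exchange_rho_def)
qed

context twisted_group
begin

lemma tensor_tmod:
  assumes \<theta>: "rep_on H \<theta>" and \<rho>: "tmod \<rho>"
  shows "tmod (tensor_rep \<theta> \<rho>)" "deg (tensor_rep \<theta> \<rho>) = deg \<theta> * deg \<rho>"
proof -
  show d: "deg (tensor_rep \<theta> \<rho>) = deg \<theta> * deg \<rho>" by (simp add: deg_def tensor_rep_def)
  note c\<theta> = bspec[OF conjunct1[OF \<theta>[unfolded rep_on_def]]] and c\<rho> = tmod_carrier[OF \<rho>]
  have "kronecker (\<theta> h) (\<rho> h) \<in> carrier_mat (deg \<theta> * deg \<rho>) (deg \<theta> * deg \<rho>)" if "h \<in> H" for h
    using c\<theta>[OF that] c\<rho>[OF that] by auto
  moreover have "kronecker (\<theta> g) (\<rho> g) * kronecker (\<theta> h) (\<rho> h) = \<alpha> (g, h) \<cdot>\<^sub>m kronecker (\<theta> (g \<circ> h)) (\<rho> (g \<circ> h))"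
    if gh: "g \<in> H" "h \<in> H" for g h
  proof -
    have "kronecker (\<theta> g) (\<rho> g) * kronecker (\<theta> h) (\<rho> h) = kronecker (1 \<cdot>\<^sub>m \<theta> (g \<circ> h)) (\<alpha> (g, h) \<cdot>\<^sub>m \<rho> (g \<circ> h))"
      using kronecker_mult[OF c\<theta>[OF gh(1)] c\<theta>[OF gh(2)] c\<rho>[OF gh(1)] c\<rho>[OF gh(2)]] \<theta> gh
      by (simp add: rep_on_def tmod_mult[OF \<rho>] mat_dim_simps)
    then show ?thesis by (simp only: kronecker_smult mult_1)
  qed
  moreover have "kronecker (\<theta> id) (\<rho> id) = \<alpha> (id, id) \<cdot>\<^sub>m 1\<^sub>m (deg \<theta> * deg \<rho>)"
  proof -
    have "kronecker (\<theta> id) (\<rho> id) = kronecker (1 \<cdot>\<^sub>m 1\<^sub>m (deg \<theta>)) (\<alpha> (id, id) \<cdot>\<^sub>m 1\<^sub>m (deg \<rho>))"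
      using \<theta> by (simp add: rep_on_def tmod_id[OF \<rho>] mat_dim_simps)
    then show ?thesis by (simp only: kronecker_smult mult_1 kronecker_one)
  qed
  ultimately show "tmod (tensor_rep \<theta> \<rho>)" unfolding twisted_module_def d by (simp add: tensor_rep_def)
qed

lemma mtrace_tensor:
  assumes \<theta>: "rep_on H \<theta>" and \<rho>: "tmod \<rho>" and h: "h \<in> H"
  shows "mtrace (tensor_rep \<theta> \<rho> h) = mtrace (\<theta> h) * mtrace (\<rho> h)"
    "mtrace (rep_inv (tensor_rep \<theta> \<rho>) h) = mtrace (\<theta> (pinv h)) * mtrace (rep_inv \<rho> h)"
proof -
  note c\<theta> = bspec[OF conjunct1[OF \<theta>[unfolded rep_on_def]]] and c\<rho> = tmod_carrier[OF \<rho>]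
  have 1: "mtrace (tensor_rep \<theta> \<rho> h) = mtrace (\<theta> h) * mtrace (\<rho> h)" if "h \<in> H" for h
    unfolding tensor_rep_def by (rule mtrace_kronecker[OF c\<theta>[OF that] c\<rho>[OF that]])
  then show "mtrace (tensor_rep \<theta> \<rho> h) = mtrace (\<theta> h) * mtrace (\<rho> h)" using h .
  show "mtrace (rep_inv (tensor_rep \<theta> \<rho>) h) = mtrace (\<theta> (pinv h)) * mtrace (rep_inv \<rho> h)"
    unfolding rep_inv_def using h tmod_carrier[OF tensor_tmod(1)[OF \<theta> \<rho>] inv_in[OF h]] c\<rho>[OF inv_in[OF h]]
    by (simp add: mtrace_smult 1)
qed

text \<open>For a sum of m simple modules the form with itself is at least m times
  \<open>card H\<close>: each summand pairs with itself to \<open>card H\<close>, and no pair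
  contributes negatively. A module of positive degree that is not simple has m at least 2.\<close>

lemma simple_if_char_form_self:
  assumes \<rho>: "tmod \<rho>" and cf: "char_form \<rho> \<rho> = of_nat (card H)"
  shows "\<rho> \<in> simple_modules H \<alpha>"
proof (rule ccontr)
  assume ns: "\<rho> \<notin> simple_modules H \<alpha>"
  have "deg \<rho> > 0"
  proof (rule ccontr)
    assume "\<not> deg \<rho> > 0"
    then have "mtrace (\<rho> h) = 0" if "h \<in> H" for h using tmod_carrier[OF \<rho> that] by (simp add: mtrace_def)
    then have "char_form \<rho> \<rho> = 0" by (simp add: char_form_def)
    then show False using cf by simp
  qed
  then obtain \<rho>1 \<rho>2 where t: "tmod \<rho>1" "tmod \<rho>2" and lt: "deg \<rho>1 < deg \<rho>" "deg \<rho>2 < deg \<rho>"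
    and iso: "rep_iso H \<rho> (\<lambda>h. block_sum (\<rho>1 h) (\<rho>2 h))"
    using nonsimple_splits[OF \<rho> _ ns] by blast
  have "deg \<rho> = deg \<rho>1 + deg \<rho>2"
    using iso square_block_sum(2)[OF tmod_square[OF t(1)] tmod_square[OF t(2)]]
    by (auto elim!: rep_isoE)
  then have pos: "deg \<rho>1 \<noteq> 0" "deg \<rho>2 \<noteq> 0" using lt by auto
  obtain L1 where L1: "set L1 \<subseteq> simple_modules H \<alpha>" "rep_iso H \<rho>1 (direct_sum L1)" using maschke[OF t(1)] by blast
  obtain L2 where L2: "set L2 \<subseteq> simple_modules H \<alpha>" "rep_iso H \<rho>2 (direct_sum L2)" using maschke[OF t(2)] by blast
  have "L1 \<noteq> []" "L2 \<noteq> []" using pos L1(2) L2(2) by (auto elim!: rep_isoE simp: deg_direct_sum)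
  define L where "L = L1 @ L2"
  have len: "length L \<ge> 2" using \<open>L1 \<noteq> []\<close> \<open>L2 \<noteq> []\<close> by (cases L1; cases L2) (auto simp: L_def)
  have L: "set L \<subseteq> simple_modules H \<alpha>" using L1 L2 by (simp add: L_def)
  have sq: "square_rep \<sigma>" if "\<sigma> \<in> set L" for \<sigma> using that L by (auto intro!: tmod_square dest: simple_dest)
  have sq12: "square_rep (direct_sum L1)" "square_rep (direct_sum L2)"
    using sq by (auto intro!: square_direct_sum simp: L_def)
  have isoL: "rep_iso H \<rho> (direct_sum L)" unfolding L_def direct_sum_simps(3)
    by (rule rep_iso_trans[OF iso rep_iso_block_sum[OF L1(2) L2(2)]])
      (use tmod_square[OF t(1)] tmod_square[OF t(2)] tmod_square[OF \<rho>] sq12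
        square_block_sum(1)[OF tmod_square[OF t(1)] tmod_square[OF t(2)]] square_block_sum(1)[OF sq12] in auto)
  have tr: "mtrace (\<rho> h) = (\<Sum>\<sigma>\<leftarrow>L. mtrace (\<sigma> h))" if "h \<in> H" for h
    using rep_iso_mtrace[OF isoL tmod_square[OF \<rho>] square_direct_sum[OF sq] that] mtrace_direct_sum[OF sq that] by simp
  have trinv: "mtrace (rep_inv \<rho> h) = (\<Sum>\<sigma>\<leftarrow>L. mtrace (rep_inv \<sigma> h))" if h: "h \<in> H" for h
  proof -
    have "mtrace (rep_inv \<rho> h) = (1 / norm_factor h) * (\<Sum>\<sigma>\<leftarrow>L. mtrace (\<sigma> (pinv h)))"
      unfolding rep_inv_def using tr[OF inv_in[OF h]] tmod_carrier[OF \<rho> inv_in[OF h]] by (simp add: mtrace_smult)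
    also have "\<dots> = (\<Sum>\<sigma>\<leftarrow>L. mtrace (rep_inv \<sigma> h))"
    proof -
      have "mtrace (rep_inv \<sigma> h) = (1 / norm_factor h) * mtrace (\<sigma> (pinv h))" if "\<sigma> \<in> set L" for \<sigma>
        unfolding rep_inv_def using that L tmod_carrier[of \<sigma> "pinv h"] h
        by (intro mtrace_smult[of _ "deg \<sigma>"]) (auto dest: simple_dest)
      then have "map (\<lambda>\<sigma>. mtrace (rep_inv \<sigma> h)) L = map (\<lambda>\<sigma>. (1 / norm_factor h) * mtrace (\<sigma> (pinv h))) L"
        by (intro map_cong refl) auto
      then show ?thesis by (simp only: sum_list_const_mult)
    qed
    finally show ?thesis .
  qed
  have dbl: "(\<Sum>h\<in>H. (\<Sum>\<sigma>\<leftarrow>As. f \<sigma> h) * (\<Sum>\<sigma>\<leftarrow>Bs. g \<sigma> h)) = (\<Sum>\<sigma>\<leftarrow>As. \<Sum>\<tau>\<leftarrow>Bs. \<Sum>h\<in>H. f \<sigma> h * g \<tau> h)"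
    for f g :: "rep \<Rightarrow> perm4 \<Rightarrow> complex" and As Bs
  proof -
    have "(\<Sum>h\<in>H. f \<sigma> h * (\<Sum>\<tau>\<leftarrow>Bs. g \<tau> h)) = (\<Sum>\<tau>\<leftarrow>Bs. \<Sum>h\<in>H. f \<sigma> h * g \<tau> h)" for \<sigma>
      by (induction Bs) (simp_all add: distrib_left sum.distrib)
    then show ?thesis by (induction As) (simp_all add: distrib_right sum.distrib)
  qed
  have "char_form \<rho> \<rho> = (\<Sum>h\<in>H. (\<Sum>\<sigma>\<leftarrow>L. mtrace (\<sigma> h)) * (\<Sum>\<sigma>\<leftarrow>L. mtrace (rep_inv \<sigma> h)))"
    unfolding char_form_def by (rule sum.cong) (auto simp: tr trinv)
  also have "\<dots> = (\<Sum>\<sigma>\<leftarrow>L. \<Sum>\<tau>\<leftarrow>L. char_form \<sigma> \<tau>)"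
    by (simp add: dbl char_form_def)
  also have "\<dots> = (\<Sum>\<sigma>\<leftarrow>L. \<Sum>\<tau>\<leftarrow>L. of_nat (of_bool (rep_iso H \<sigma> \<tau>) * card H))"
    using L by (intro arg_cong[of _ _ sum_list] map_cong refl) (auto simp: char_form_simple subset_eq)
  also have "\<dots> = of_nat (\<Sum>\<sigma>\<leftarrow>L. \<Sum>\<tau>\<leftarrow>L. of_bool (rep_iso H \<sigma> \<tau>) * card H)"
    by (simp only: of_nat_sum_list map_map comp_def)
  finally have eq: "(\<Sum>\<sigma>\<leftarrow>L. \<Sum>\<tau>\<leftarrow>L. of_bool (rep_iso H \<sigma> \<tau>) * card H) = card H"
    using cf by (metis of_nat_eq_iff)
  have "card H \<le> (\<Sum>\<tau>\<leftarrow>L. of_bool (rep_iso H \<sigma> \<tau>) * card H)" if \<sigma>: "\<sigma> \<in> set L" for \<sigma>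
  proof -
    have "of_bool (rep_iso H \<sigma> \<sigma>) * card H \<le> (\<Sum>\<tau>\<leftarrow>L. of_bool (rep_iso H \<sigma> \<tau>) * card H)"
      by (rule member_le_sum_list) (use \<sigma> in auto)
    then show ?thesis using rep_iso_refl[OF sq[OF \<sigma>]] by simp
  qed
  then have "(\<Sum>\<sigma>\<leftarrow>L. card H) \<le> (\<Sum>\<sigma>\<leftarrow>L. \<Sum>\<tau>\<leftarrow>L. of_bool (rep_iso H \<sigma> \<tau>) * card H)"
    by (intro sum_list_mono) auto
  then have "length L * card H \<le> card H" unfolding eq by (simp add: sum_list_triv)
  moreover have "2 * card H \<le> length L * card H" using len by (rule mult_le_mono1)
  ultimately show False using card_pos by linarith
qed

lemma simple_class_some:
  assumes "K \<in> simple_classes H \<alpha>"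
  shows "(SOME \<rho>. \<rho> \<in> K) \<in> K" "(SOME \<rho>. \<rho> \<in> K) \<in> simple_modules H \<alpha>"
proof -
  have "K \<noteq> {}" using assms in_quotient_imp_non_empty[OF equiv_iso_rel] by (simp add: simple_classes_def)
  then show 1: "(SOME \<rho>. \<rho> \<in> K) \<in> K" by (simp add: some_in_eq)
  show "(SOME \<rho>. \<rho> \<in> K) \<in> simple_modules H \<alpha>"
    using assms 1 in_quotient_imp_subset[OF equiv_iso_rel] unfolding simple_classes_def by blast
qed

text \<open>The coefficient is defined through a representative chosen by \<open>SOME\<close>.
  Characters depend on the class only, so every \<open>\<tau>\<close> in \<open>L\<close> may be
  used in the formula.\<close>

lemma grothendieck_coef:
  assumes irr: "rep_on H (irr_rep x)" and K: "K \<in> simple_classes H \<alpha>" "\<sigma> \<in> K" and L: "L \<in> simple_classes H \<alpha>" "\<tau> \<in> L"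
  shows "of_int (zcoef (grothendieck_module H \<alpha>) x K L) * of_nat (card H) =
    (\<Sum>h\<in>H. mtrace (irr_rep x h) * mtrace (\<tau> h) * mtrace (rep_inv \<sigma> h))"
proof -
  let ?\<rho> = "SOME \<rho>. \<rho> \<in> L"
  note \<rho> = simple_class_some[OF L(1)]
  have \<tau>: "\<tau> \<in> simple_modules H \<alpha>" using class_mem_iff(2)[OF L \<rho>(2)] .
  have iso: "rep_iso H ?\<rho> \<tau>" using class_mem_iff(1)[OF L \<rho>(2)] \<rho>(1) by simp
  have "of_int (zcoef (grothendieck_module H \<alpha>) x K L) * of_nat (card H) = char_form (tensor_rep (irr_rep x) ?\<rho>) \<sigma>"
    using multiplicity_char_form[OF tensor_tmod(1)[OF irr simple_dest(1)[OF \<rho>(2)]] K]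
    by (simp add: grothendieck_module_def)
  also have "\<dots> = (\<Sum>h\<in>H. mtrace (irr_rep x h) * mtrace (\<tau> h) * mtrace (rep_inv \<sigma> h))"
    unfolding char_form_def
    using rep_iso_mtrace[OF iso tmod_square tmod_square] simple_dest(1)[OF \<tau>] simple_dest(1)[OF \<rho>(2)]
    by (intro sum.cong refl) (simp add: mtrace_tensor[OF irr])
  finally show ?thesis .
qed

text \<open>The candidates are the modules \<theta> i tensor \<pi>. The case \<open>One\<close> of
  \<open>coef\<close> says that they are orthogonal of norm \<open>card H\<close>, hence simple and
  pairwise nonisomorphic. By \<open>van\<close> the sum of their characters with weights
  \<open>deg (\<theta> i)\<close> is supported at the identity, so every simple module pairs
  nontrivially with it and is isomorphic to a candidate.\<close>

lemma categorified_by_table: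
  fixes n :: nat
  assumes \<pi>: "tmod \<pi>" and \<theta>: "\<And>i. i < n \<Longrightarrow> rep_on H (\<theta> i)" and irr: "\<And>x. rep_on H (irr_rep x)"
    and n: "n > 0" and M: "zbasis M = {..<n}" and s: "s = id \<or> s = swap_rho"
    and One: "\<And>i j. i < n \<Longrightarrow> j < n \<Longrightarrow> zcoef M One i j = of_bool (i = j)"
    and coef: "\<And>x i j. i < n \<Longrightarrow> j < n \<Longrightarrow>
      (\<Sum>h\<in>H. mtrace (irr_rep x h) * (mtrace (\<theta> j h) * mtrace (\<theta> i (pinv h)) * (mtrace (\<pi> h) * mtrace (rep_inv \<pi> h)))) =
      of_int (zcoef M (s x) i j) * of_nat (card H)"
    and van: "\<And>h. h \<in> H \<Longrightarrow> h \<noteq> id \<Longrightarrow> mtrace (\<pi> h) = 0 \<or> (\<Sum>i<n. of_nat (deg (\<theta> i)) * mtrace (\<theta> i h)) = 0"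
  shows "categorified_by M H \<alpha>"
proof -
  define \<rho> where "\<rho> i = tensor_rep (\<theta> i) \<pi>" for i
  have t: "tmod (\<rho> i)" if "i < n" for i using tensor_tmod[OF \<theta>[OF that] \<pi>] by (simp add: \<rho>_def)
  have sOne: "s One = One" using s by (auto simp: swap_rho_def)
  have cf: "char_form (\<rho> j) (\<rho> i) = of_bool (i = j) * of_nat (card H)" if ij: "i < n" "j < n" for i j
  proof -
    have "char_form (\<rho> j) (\<rho> i) = (\<Sum>h\<in>H. mtrace (irr_rep One h) * (mtrace (\<theta> j h) * mtrace (\<theta> i (pinv h)) * (mtrace (\<pi> h) * mtrace (rep_inv \<pi> h))))"
      unfolding char_form_def \<rho>_def using \<theta>[OF ij(1)] \<theta>[OF ij(2)] \<pi>
      by (intro sum.cong refl) (simp add: mtrace_tensor)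
    then show ?thesis using coef[OF ij, of One] ij by (simp add: sOne One)
  qed
  have simple: "\<rho> i \<in> simple_modules H \<alpha>" if "i < n" for i
    using simple_if_char_form_self[OF t[OF that]] cf[OF that that] by simp
  define f where "f i = iso_rel `` {\<rho> i}" for i
  have fK: "f i \<in> simple_classes H \<alpha>" if "i < n" for i
    unfolding f_def simple_classes_def by (rule quotientI[OF simple[OF that]])
  have mem: "\<rho> i \<in> f i" if "i < n" for i
    unfolding f_def using simple[OF that] rep_iso_refl[OF tmod_square[OF t[OF that]]] by simp
  have bij: "bij_betw f {..<n} (simple_classes H \<alpha>)"
  proof (rule bij_betwI')
    fix i j assume ij: "i \<in> {..<n}" "j \<in> {..<n}"
    have "i = j" if "f i = f j"
    proof (rule ccontr)
      assume ne: "i \<noteq> j"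
      have ij': "i < n" "j < n" using ij by auto
      have "rep_iso H (\<rho> i) (\<rho> j)"
        using mem[OF ij'(1)] that class_mem_iff(1)[OF fK[OF ij'(2)] mem[OF ij'(2)] simple[OF ij'(1)]] by simp
      then have "char_form (\<rho> i) (\<rho> j) = of_nat (card H)" using simple ij by (simp add: char_form_simple)
      then show False using cf[of j i] ij ne by simp
    qed
    then show "(f i = f j) = (i = j)" by blast
  next
    fix K assume K: "K \<in> simple_classes H \<alpha>"
    define \<sigma> where "\<sigma> = (SOME \<rho>. \<rho> \<in> K)"
    have \<sigma>: "\<sigma> \<in> K" "\<sigma> \<in> simple_modules H \<alpha>" using simple_class_some[OF K] by (simp_all add: \<sigma>_def)
    let ?F = "\<lambda>h. \<Sum>i<n. of_nat (deg (\<theta> i)) * mtrace (\<theta> i h)"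
    have pos: "deg (\<theta> i) > 0" "deg \<pi> > 0" if "i < n" for i
      using simple_dest(2)[OF simple[OF that]] tensor_tmod(2)[OF \<theta>[OF that] \<pi>] by (auto simp: \<rho>_def intro: Nat.gr0I)
    have "(\<Sum>i<n. of_nat (deg (\<theta> i)) * char_form (\<rho> i) \<sigma>) = (\<Sum>h\<in>H. mtrace (\<pi> h) * ?F h * mtrace (rep_inv \<sigma> h))"
    proof -
      have "(\<Sum>i<n. of_nat (deg (\<theta> i)) * char_form (\<rho> i) \<sigma>) =
          (\<Sum>i<n. \<Sum>h\<in>H. of_nat (deg (\<theta> i)) * (mtrace (\<theta> i h) * mtrace (\<pi> h) * mtrace (rep_inv \<sigma> h)))"
        unfolding char_form_def \<rho>_def by (intro sum.cong refl) (simp add: sum_distrib_left mtrace_tensor[OF \<theta> \<pi>])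
      also have "\<dots> = (\<Sum>h\<in>H. \<Sum>i<n. of_nat (deg (\<theta> i)) * (mtrace (\<theta> i h) * mtrace (\<pi> h) * mtrace (rep_inv \<sigma> h)))"
        by (rule sum.swap)
      finally show ?thesis by (simp add: sum_distrib_left sum_distrib_right algebra_simps)
    qed
    also have "\<dots> = (\<Sum>h\<in>{id}. mtrace (\<pi> h) * ?F h * mtrace (rep_inv \<sigma> h))"
      using van by (intro sum.mono_neutral_right) auto
    also have "\<dots> \<noteq> 0"
    proof -
      have "mtrace (\<pi> id) = \<alpha> (id, id) * of_nat (deg \<pi>)" unfolding tmod_id[OF \<pi>] by (simp add: mtrace_smult[OF one_carrier_mat])
      then have 1: "mtrace (\<pi> id) \<noteq> 0" using pos[OF n] by simp
      have "rep_inv \<sigma> id = (1 / norm_factor id * \<alpha> (id, id)) \<cdot>\<^sub>m 1\<^sub>m (deg \<sigma>)"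
        unfolding rep_inv_def using tmod_id[OF simple_dest(1)[OF \<sigma>(2)]] by (simp add: mat_dim_simps)
      then have "mtrace (rep_inv \<sigma> id) = 1 / norm_factor id * \<alpha> (id, id) * of_nat (deg \<sigma>)"
        by (simp add: mtrace_smult[OF one_carrier_mat])
      then have 2: "mtrace (rep_inv \<sigma> id) \<noteq> 0" using simple_dest(2)[OF \<sigma>(2)] by simp
      have "?F id = (\<Sum>i<n. of_nat (deg (\<theta> i) * deg (\<theta> i)))"
        using \<theta> by (intro sum.cong refl) (simp add: rep_on_def)
      also have "\<dots> = of_nat (\<Sum>i<n. deg (\<theta> i) * deg (\<theta> i))" by simp
      also have "\<dots> \<noteq> 0"
      proof -
        have "deg (\<theta> 0) * deg (\<theta> 0) \<le> (\<Sum>i<n. deg (\<theta> i) * deg (\<theta> i))"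
          using n finite_lessThan[of n] by (intro member_le_sum) auto
        then have "0 < (\<Sum>i<n. deg (\<theta> i) * deg (\<theta> i))" using pos(1)[OF n] by (metis gr0I mult_is_0 not_le)
        then show ?thesis by (simp only: of_nat_eq_0_iff)
      qed
      finally show ?thesis using 1 2 by simp
    qed
    finally obtain i where i: "i < n" "char_form (\<rho> i) \<sigma> \<noteq> 0"
      by (metis (no_types, lifting) lessThan_iff mult_zero_right sum.not_neutral_contains_not_neutral)
    then have "rep_iso H (\<rho> i) \<sigma>" using char_form_simple[OF simple[OF i(1)] \<sigma>(2)] by (auto split: if_splits)
    then have "\<rho> i \<in> K" using class_mem_iff(1)[OF K \<sigma>(1) simple[OF i(1)]] by simp
    then have "K = f i"
      using K mem[OF i(1)] fK[OF i(1)] quotient_disj[OF equiv_iso_rel, of K "f i"]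
      unfolding simple_classes_def by blast
    then show "\<exists>i\<in>{..<n}. K = f i" using i by auto
  qed (use fK in auto)
  show ?thesis
  proof (rule categorified_byI[OF _ s])
    show "bij_betw f (zbasis M) (zbasis (grothendieck_module H \<alpha>))"
      using bij by (simp add: M grothendieck_module_def)
    fix x k l assume "k \<in> zbasis M" "l \<in> zbasis M"
    then have kl: "k < n" "l < n" by (auto simp: M)
    have "of_int (zcoef (grothendieck_module H \<alpha>) x (f k) (f l)) * of_nat (card H) =
      (\<Sum>h\<in>H. mtrace (irr_rep x h) * mtrace (\<rho> l h) * mtrace (rep_inv (\<rho> k) h))"
      by (rule grothendieck_coef[OF irr fK[OF kl(1)] mem[OF kl(1)] fK[OF kl(2)] mem[OF kl(2)]])
    also have "\<dots> = of_int (zcoef M (s x) k l) * of_nat (card H)"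
      unfolding coef[OF kl, symmetric] \<rho>_def
      by (intro sum.cong refl) (simp add: mtrace_tensor[OF \<theta>[OF kl(1)] \<pi>] mtrace_tensor[OF \<theta>[OF kl(2)] \<pi>])
    finally have "(of_int (zcoef (grothendieck_module H \<alpha>) x (f k) (f l)) :: complex) = of_int (zcoef M (s x) k l)"
      by simp
    then show "zcoef (grothendieck_module H \<alpha>) x (f k) (f l) = zcoef M (s x) k l" by (simp only: of_int_eq_iff)
  qed
qed

end

section \<open>Permutations of four points\<close>

text \<open>A permutation of \<open>{1,2,3,4}\<close> is encoded by its values, so that statements about subgroups of
  \<open>S\<^sub>4\<close> can be checked by evaluation.\<close>

declare One_nat_def [simp del]

type_synonym tup = "nat \<times> nat \<times> nat \<times> nat"

definition perms4 :: "tup list" where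
  "perms4 = [(1,2,3,4),(1,2,4,3),(1,3,2,4),(1,3,4,2),(1,4,2,3),(1,4,3,2),
    (2,1,3,4),(2,1,4,3),(2,3,1,4),(2,3,4,1),(2,4,1,3),(2,4,3,1),
    (3,1,2,4),(3,1,4,2),(3,2,1,4),(3,2,4,1),(3,4,1,2),(3,4,2,1),
    (4,1,2,3),(4,1,3,2),(4,2,1,3),(4,2,3,1),(4,3,1,2),(4,3,2,1)]"

fun tapp :: "tup \<Rightarrow> perm4" where
  "tapp (a, b, c, d) x = (if x = 1 then a else if x = 2 then b else if x = 3 then c else if x = 4 then d else x)"

definition tcomp :: "tup \<Rightarrow> tup \<Rightarrow> tup" where
  "tcomp t u = (tapp t (tapp u 1), tapp t (tapp u 2), tapp t (tapp u 3), tapp t (tapp u 4))"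

fun tinv :: "tup \<Rightarrow> tup" where
  "tinv (a, b, c, d) = (let pos = (\<lambda>k. if a = k then 1 else if b = k then 2 else if c = k then 3 else 4) in
     (pos 1, pos 2, pos 3, pos 4))"

definition tpair :: "tup \<Rightarrow> nat \<Rightarrow> nat" where
  "tpair t j = (if tapp t 4 = 4 then tapp t j else if tapp t j = 4 then tapp t 4 else 6 - tapp t j - tapp t 4)"

definition tsign :: "tup \<Rightarrow> int" where
  "tsign t = (let s = (\<lambda>i j. if tapp t i < tapp t j then 1 else -1) in s 1 2 * s 1 3 * s 1 4 * s 2 3 * s 2 4 * s 3 4)"

definition tfix :: "tup \<Rightarrow> int" where
  "tfix t = of_bool (tapp t 1 = 1) + of_bool (tapp t 2 = 2) + of_bool (tapp t 3 = 3) + of_bool (tapp t 4 = 4)"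

text \<open>The character of the sum-zero subspace of a permutation representation is the number of
  fixed points minus 1: pairings for \<open>Rho1\<close>, points for \<open>Rho2\<close>.\<close>

fun tchi :: "irr \<Rightarrow> tup \<Rightarrow> int" where
  "tchi One t = 1"
| "tchi Psi t = tsign t"
| "tchi Rho1 t = of_bool (tpair t 1 = 1) + of_bool (tpair t 2 = 2) + of_bool (tpair t 3 = 3) - 1"
| "tchi Rho2 t = tfix t - 1"
| "tchi Rho3 t = tsign t * (tfix t - 1)"

abbreviation tid :: tup where "tid \<equiv> (1, 2, 3, 4)"

lemma tapp_other: "x \<noteq> 1 \<Longrightarrow> x \<noteq> 2 \<Longrightarrow> x \<noteq> 3 \<Longrightarrow> x \<noteq> 4 \<Longrightarrow> tapp t x = x"
  by (cases t) simp

lemma perm4_eqI: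
  fixes p q :: perm4
  assumes "p 1 = q 1" "p 2 = q 2" "p 3 = q 3" "p 4 = q 4"
    "\<And>x. x \<noteq> 1 \<Longrightarrow> x \<noteq> 2 \<Longrightarrow> x \<noteq> 3 \<Longrightarrow> x \<noteq> 4 \<Longrightarrow> p x = q x"
  shows "p = q"
proof
  fix x :: nat
  show "p x = q x" using assms by (cases "x = 1"; cases "x = 2"; cases "x = 3"; cases "x = 4") metis+
qed

lemma tapp_comp: "tapp t \<circ> tapp u = tapp (tcomp t u)"
  by (rule perm4_eqI) (simp_all add: tcomp_def tapp_other)

lemma tapp_id: "tapp tid = id"
  by (rule perm4_eqI) simp_all

lemma tapp_inj: "tapp t = tapp u \<Longrightarrow> t = u"
proof -
  assume eq: "tapp t = tapp u"
  have "tapp t 1 = tapp u 1" "tapp t 2 = tapp u 2" "tapp t 3 = tapp u 3" "tapp t 4 = tapp u 4" by (simp_all only: eq)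
  then show ?thesis by (cases t; cases u) simp
qed

lemma inj_tapp: "inj_on tapp A"
  using tapp_inj by (auto intro: inj_onI)

lemma tinv_check: "list_all (\<lambda>t. tinv t \<in> set perms4 \<and> tcomp t (tinv t) = tid \<and> tcomp (tinv t) t = tid) perms4"
  unfolding perms4_def by code_simp

lemma tinv: "t \<in> set perms4 \<Longrightarrow> tinv t \<in> set perms4" "t \<in> set perms4 \<Longrightarrow> tcomp t (tinv t) = tid"
  "t \<in> set perms4 \<Longrightarrow> tcomp (tinv t) t = tid"
  using tinv_check unfolding list_all_iff by blast+

lemma pinv_tapp: "t \<in> set perms4 \<Longrightarrow> pinv (tapp t) = tapp (tinv t)"
  by (rule inv_unique_comp) (simp_all add: tapp_comp tinv tapp_id)

lemma set_14: "{1..4::nat} = {1, 2, 3, 4}" "{1..3::nat} = {1, 2, 3}"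
  by auto

lemma tapp_permutes: "t \<in> set perms4 \<Longrightarrow> tapp t permutes {1..4}"
proof -
  assume t: "t \<in> set perms4"
  have "bij (tapp t)"
    by (rule o_bij[of "tapp (tinv t)"]) (simp_all add: tapp_comp tinv[OF t] tapp_id)
  then have "\<exists>!x. tapp t x = y" for y by (simp add: bij_iff)
  then show ?thesis using tapp_other[of _ t] unfolding permutes_def set_14 by simp
qed

lemma perms4_complete:
  "list_all (\<lambda>a. list_all (\<lambda>b. list_all (\<lambda>c. list_all (\<lambda>d.
     distinct [a, b, c, d] \<longrightarrow> (a, b, c, d) \<in> set perms4) [1, 2, 3, 4]) [1, 2, 3, 4]) [1, 2, 3, 4]) [1, 2, 3, 4]"
  unfolding perms4_def by code_simp

lemma permutes_tapp:
  assumes p: "p permutes {1..4}"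
  obtains t where "t \<in> set perms4" "p = tapp t"
proof -
  have v: "p 1 \<in> {1, 2, 3, 4}" "p 2 \<in> {1, 2, 3, 4}" "p 3 \<in> {1, 2, 3, 4}" "p 4 \<in> {1, 2, 3, 4}"
    using permutes_in_image[OF p] unfolding set_14 by blast+
  have "inj p" using permutes_inj[OF p] .
  then have d: "p 1 \<noteq> p 2" "p 1 \<noteq> p 3" "p 1 \<noteq> p 4" "p 2 \<noteq> p 3" "p 2 \<noteq> p 4" "p 3 \<noteq> p 4"
    by (simp_all add: inj_eq)
  have "(p 1, p 2, p 3, p 4) \<in> set perms4"
  proof -
    have "distinct [p 1, p 2, p 3, p 4]" using d by simp
    moreover have "distinct [p 1, p 2, p 3, p 4] \<longrightarrow> (p 1, p 2, p 3, p 4) \<in> set perms4"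
      using perms4_complete v unfolding list_all_iff list.set by blast
    ultimately show ?thesis by blast
  qed
  moreover have "p = tapp (p 1, p 2, p 3, p 4)"
    by (rule perm4_eqI) (use p in \<open>simp_all add: permutes_def set_14\<close>)
  ultimately show thesis using that by blast
qed

lemma S4_tapp: "carrier S4 = tapp ` set perms4"
  unfolding S4_simps using tapp_permutes permutes_tapp by blast

definition closed_list :: "tup list \<Rightarrow> bool" where
  "closed_list L \<longleftrightarrow> tid \<in> set L \<and> distinct L \<and> list_all (\<lambda>t. t \<in> set perms4) L \<and>
     list_all (\<lambda>t. list_all (\<lambda>u. tcomp t u \<in> set L) L \<and> tinv t \<in> set L) L"

lemma subgroup_tapp:
  assumes L: "closed_list L"
  shows "subgroup (tapp ` set L) S4"
proof (rule group.subgroupI[OF sym_group_is_group])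
  have sub: "set L \<subseteq> set perms4" using L by (auto simp: closed_list_def list_all_iff)
  show "tapp ` set L \<subseteq> carrier S4" unfolding S4_tapp using sub by auto
  show "tapp ` set L \<noteq> {}" using L by (auto simp: closed_list_def)
  fix p assume "p \<in> tapp ` set L"
  then obtain t where t: "t \<in> set L" "p = tapp t" by auto
  have tp: "t \<in> set perms4" using t sub by auto
  have "inv\<^bsub>S4\<^esub> p = pinv p"
    using tapp_permutes[OF tp] unfolding t(2) by (intro sym_group_inv_equality) (simp add: S4_simps)
  then show "inv\<^bsub>S4\<^esub> p \<in> tapp ` set L"
    using L t unfolding t(2) pinv_tapp[OF tp] by (auto simp: closed_list_def list_all_iff)
  fix q assume "q \<in> tapp ` set L"
  then obtain u where "u \<in> set L" "q = tapp u" by auto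
  then show "p \<otimes>\<^bsub>S4\<^esub> q \<in> tapp ` set L"
    using L t by (auto simp: S4_simps tapp_comp closed_list_def list_all_iff)
qed

text \<open>Closure of \<open>L\<close> bounds the generated subgroup from above; the words
  \<open>ws\<close>, which spell the elements of \<open>L\<close> in the generators, bound it from
  below.\<close>

lemma generate_tapp:
  assumes L: "closed_list L" and g: "set gs \<subseteq> set L" and ws: "L = map (\<lambda>w. foldr tcomp w tid) ws"
    and wg: "list_all (\<lambda>w. list_all (\<lambda>t. t \<in> set gs) w) ws"
  shows "generate S4 (tapp ` set gs) = tapp ` set L"
proof
  have sub: "set L \<subseteq> set perms4" using L by (auto simp: closed_list_def list_all_iff)
  show "generate S4 (tapp ` set gs) \<subseteq> tapp ` set L"
    using g by (intro group.generate_subgroup_incl[OF sym_group_is_group _ subgroup_tapp[OF L]]) auto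
  have "tapp (foldr tcomp w tid) \<in> generate S4 (tapp ` set gs)" if "set w \<subseteq> set gs" for w
    using that
  proof (induction w)
    case Nil
    have "tapp tid \<in> generate S4 (tapp ` set gs)" unfolding tapp_id using generate.one[of S4] unfolding S4_simps .
    moreover have "foldr tcomp [] tid = tid" by simp
    ultimately show ?case by (simp only:)
  next
    case (Cons t w)
    have "tapp t \<otimes>\<^bsub>S4\<^esub> tapp (foldr tcomp w tid) \<in> generate S4 (tapp ` set gs)"
      by (rule generate.eng[OF generate.incl]) (use Cons in auto)
    then show ?case by (simp add: S4_simps tapp_comp)
  qed
  then show "tapp ` set L \<subseteq> generate S4 (tapp ` set gs)"
    using wg unfolding ws by (auto simp: list_all_iff subset_iff)
qed

lemma sum_tapp:
  assumes "distinct L"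
  shows "sum F (tapp ` set L) = (\<Sum>t\<leftarrow>L. F (tapp t))"
  by (simp add: sum.reindex[OF inj_tapp] sum_list_distinct_conv_sum_set[OF assms])

lemma card_tapp: "distinct L \<Longrightarrow> card (tapp ` set L) = length L"
  by (simp add: card_image[OF inj_tapp] distinct_card)

subsection \<open>The irreducible representations\<close>

text \<open>The common form of \<open>Rho1\<close> (n = 2, with the action on pairings) and
  \<open>Rho2\<close> (n = 3): a permutation of n + 1 points in the basis of differences from the
  last unit vector.\<close>

definition sumzero :: "nat \<Rightarrow> (nat \<Rightarrow> nat) \<Rightarrow> complex mat" where
  "sumzero n p = mat n n (\<lambda>(i, j). of_bool (p (j + 1) = i + 1) - of_bool (p (n + 1) = i + 1))"

lemma sumzero_mult:
  assumes q: "\<And>j. j \<in> {1..n + 1} \<Longrightarrow> q j \<in> {1..n + 1}" and pq: "\<And>j. j \<in> {1..n + 1} \<Longrightarrow> r j = p (q j)"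
  shows "sumzero n p * sumzero n q = sumzero n r"
proof (rule eq_matI)
  fix i j assume "i < dim_row (sumzero n r)" "j < dim_col (sumzero n r)"
  then have ij: "i < n" "j < n" by (auto simp: sumzero_def)
  define g where "g k = (of_bool (p k = i + 1) :: complex)" for k
  \<comment> \<open>Row \<open>i\<close> of the matrix of \<open>p\<close>, applied to the
    difference of the unit vectors at \<open>y\<close> and at n + 1. For y = n + 1 both sides are
    0.\<close>
  have key: "(\<Sum>k<n. (g (k + 1) - g (n + 1)) * of_bool (y = k + 1)) = g y - g (n + 1)" if y: "y \<in> {1..n + 1}" for y
  proof (cases "y = n + 1")
    case False
    then have "y - 1 < n" "y = y - 1 + 1" using y by auto
    then have "(\<Sum>k<n. (g (k + 1) - g (n + 1)) * of_bool (y = k + 1)) =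
        (\<Sum>k<n. if k = y - 1 then g y - g (n + 1) else 0)"
      by (intro sum.cong refl) (auto simp: of_bool_def)
    then show ?thesis using \<open>y - 1 < n\<close> by simp
  qed auto
  have "(sumzero n p * sumzero n q) $$ (i, j) =
      (\<Sum>k<n. (g (k + 1) - g (n + 1)) * (of_bool (q (j + 1) = k + 1) - of_bool (q (n + 1) = k + 1)))"
    using ij by (subst mult_mat_index[of _ n n _ n]) (auto simp: sumzero_def g_def intro!: sum.cong)
  also have "\<dots> = (g (q (j + 1)) - g (n + 1)) - (g (q (n + 1)) - g (n + 1))"
    using key[OF q[of "j + 1"]] key[OF q[of "n + 1"]] ij by (simp add: right_diff_distrib sum_subtractf)
  also have "\<dots> = sumzero n r $$ (i, j)" using ij pq[of "j + 1"] pq[of "n + 1"] by (simp add: g_def sumzero_def)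
  finally show "(sumzero n p * sumzero n q) $$ (i, j) = sumzero n r $$ (i, j)" .
qed (auto simp: sumzero_def)

lemma sumzero_id: "(\<And>j. j \<in> {1..n + 1} \<Longrightarrow> p j = j) \<Longrightarrow> sumzero n p = 1\<^sub>m n"
  by (rule eq_matI) (auto simp: sumzero_def)

lemma tpair_check: "list_all (\<lambda>t. list_all (\<lambda>j. tpair t j \<in> {1, 2, 3}) [1, 2, 3] \<and>
    list_all (\<lambda>u. list_all (\<lambda>j. tpair (tcomp t u) j = tpair t (tpair u j)) [1, 2, 3]) perms4) perms4"
  unfolding perms4_def by code_simp

lemma tpair: "t \<in> set perms4 \<Longrightarrow> j \<in> {1, 2, 3} \<Longrightarrow> tpair t j \<in> {1, 2, 3}"
  "t \<in> set perms4 \<Longrightarrow> u \<in> set perms4 \<Longrightarrow> j \<in> {1, 2, 3} \<Longrightarrow> tpair (tcomp t u) j = tpair t (tpair u j)"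
  using tpair_check unfolding list_all_iff by auto

lemma pairing_action_tapp: "pairing_action (tapp t) = tpair t"
  by (rule ext) (simp add: pairing_action_def tpair_def)

text \<open>The 2 * 3 * 4 words are a normal form in the adjacent transpositions, composed of coset
  representatives along the chain S2 < S3 < S4. The same words later drive the induction for the
  quaternion lift.\<close>

lemma tsign_check:
  "list_all (\<lambda>t. list_ex (\<lambda>w. list_all (\<lambda>g. g \<in> set [(2,1,3,4), (1,3,2,4), (1,2,4,3)]) w \<and> foldr tcomp w tid = t \<and> tsign t = (if even (length w) then 1 else -1))
     [a @ b @ c. a \<leftarrow> [[], [(2,1,3,4)]], b \<leftarrow> [[], [(1,3,2,4)], [(1,3,2,4), (2,1,3,4)]],
        c \<leftarrow> [[], [(1,2,4,3)], [(1,2,4,3), (1,3,2,4)], [(1,2,4,3), (1,3,2,4), (2,1,3,4)]]]) perms4"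
  unfolding perms4_def by code_simp

lemma sign_tapp:
  assumes "t \<in> set perms4"
  shows "sign (tapp t) = tsign t"
proof -
  let ?G = "{(2,1,3,4), (1,3,2,4), (1,2,4,3)} :: tup set"
  have g: "\<exists>a b. a \<noteq> b \<and> tapp t = transpose a b" if "t \<in> ?G" for t
  proof -
    have "tapp (2,1,3,4) = transpose 1 2" "tapp (1,3,2,4) = transpose 2 3" "tapp (1,2,4,3) = transpose 3 4"
      by (rule perm4_eqI; simp add: transpose_def)+
    moreover have "1 \<noteq> (2::nat)" "2 \<noteq> (3::nat)" "3 \<noteq> (4::nat)" by simp_all
    ultimately show ?thesis using that by blast
  qed
  have w: "permutation (tapp (foldr tcomp w tid)) \<and> sign (tapp (foldr tcomp w tid)) = (if even (length w) then 1 else -1)"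
    if "set w \<subseteq> ?G" for w
    using that
  proof (induction w)
    case Nil
    show ?case unfolding foldr.simps id_apply tapp_id by simp
  next
    case (Cons t w)
    obtain a b where ab: "a \<noteq> b" "tapp t = transpose a b" using g[of t] Cons.prems by auto
    have IH: "permutation (tapp (foldr tcomp w tid))" "sign (tapp (foldr tcomp w tid)) = (if even (length w) then 1 else -1)"
      using Cons by auto
    have eq: "tapp (foldr tcomp (t # w) tid) = transpose a b \<circ> tapp (foldr tcomp w tid)"
      by (simp add: tapp_comp[symmetric] ab)
    have pt: "permutation (transpose a b)" by (rule permutation_swap_id)
    have "sign (transpose a b \<circ> tapp (foldr tcomp w tid)) = - (if even (length w) then 1 else -1)"
      unfolding sign_compose[OF pt IH(1)] IH(2) using ab by (simp add: sign_swap_id)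
    then have "sign (tapp (foldr tcomp (t # w) tid)) = (if even (length (t # w)) then 1 else -1)"
      unfolding eq
      by (cases "even (length w)") (simp_all only: length_Cons even_Suc if_True if_False simp_thms minus_minus)
    then show ?case using permutation_compose[OF pt IH(1)] unfolding eq by (rule conjI[rotated])
  qed
  obtain w where w': "foldr tcomp w tid = t" "tsign t = (if even (length w) then 1 else -1)"
    "\<forall>g\<in>set w. g \<in> set [(2,1,3,4), (1,3,2,4), (1,2,4,3)]"
    using tsign_check assms unfolding list_all_iff list_ex_iff by blast
  from w'(3) have "set w \<subseteq> ?G" unfolding list.set by blast
  with w[of w] w'(1,2) show ?thesis by simp
qed

lemma irr_rep_sumzero: "irr_rep Rho1 p = sumzero 2 (pairing_action p)" "irr_rep Rho2 p = sumzero 3 p"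
  "irr_rep Rho3 p = of_int (sign p) \<cdot>\<^sub>m sumzero 3 p"
  by (simp_all add: sumzero_def std_rep_def)

lemma sumzero_carrier [simp]: "sumzero n p \<in> carrier_mat n n"
  by (simp add: sumzero_def)

lemma rep_onI:
  assumes "\<And>h. h \<in> H \<Longrightarrow> \<theta> h \<in> carrier_mat n n" "\<theta> id = 1\<^sub>m n"
    "\<And>g h. g \<in> H \<Longrightarrow> h \<in> H \<Longrightarrow> \<theta> g * \<theta> h = \<theta> (g \<circ> h)"
  shows "rep_on H \<theta>"
  using assms by (simp add: rep_on_def deg_def)

lemma irr_rep_on_S4: "rep_on (carrier S4) (irr_rep x)"
proof -
  have sg: "sign (g \<circ> h) = sign g * sign h" if "g \<in> carrier S4" "h \<in> carrier S4" for g h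
    using that unfolding S4_simps
    by (intro sign_compose) (auto intro: permutes_imp_permutation[of "{1..4}"])
  have sg1: "sign (id :: perm4) = 1" by simp
  have s3: "sumzero 3 g * sumzero 3 h = sumzero 3 (g \<circ> h)" if "h \<in> carrier S4" for g h
    using that permutes_in_image[of h "{1..4}"] unfolding S4_simps by (intro sumzero_mult) auto
  have s3id: "sumzero 3 id = 1\<^sub>m 3" by (rule sumzero_id) simp
  have s2: "sumzero 2 (pairing_action g) * sumzero 2 (pairing_action h) = sumzero 2 (pairing_action (g \<circ> h))"
    if gh: "g \<in> carrier S4" "h \<in> carrier S4" for g h
  proof -
    obtain t u where t: "t \<in> set perms4" "u \<in> set perms4" "g = tapp t" "h = tapp u"
      using gh unfolding S4_tapp by blast
    have "{1..2 + 1::nat} = {1, 2, 3}" by auto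
    then show ?thesis unfolding t tapp_comp pairing_action_tapp using tpair t by (intro sumzero_mult) auto
  qed
  have s2id: "sumzero 2 (pairing_action id) = 1\<^sub>m 2"
    by (rule sumzero_id) (simp add: pairing_action_def)
  show ?thesis
  proof (cases x)
    case One
    then show ?thesis by (intro rep_onI[of _ _ 1]) simp_all
  next
    case Psi
    show ?thesis unfolding Psi
      by (rule rep_onI[of _ _ 1]) (auto simp: sg sg1 mat_dim_simps mult.commute)
  next
    case Rho1
    show ?thesis unfolding Rho1
      by (rule rep_onI[of _ _ 2]; unfold irr_rep_sumzero) (simp_all only: s2 s2id sumzero_carrier)
  next
    case Rho2
    show ?thesis unfolding Rho2
      by (rule rep_onI[of _ _ 3]; unfold irr_rep_sumzero) (simp_all only: s3 s3id sumzero_carrier)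
  next
    case Rho3
    show ?thesis unfolding Rho3
    proof (rule rep_onI[of _ _ 3]; unfold irr_rep_sumzero)
      fix g h assume gh: "g \<in> carrier S4" "h \<in> carrier S4"
      have "of_int (sign g) \<cdot>\<^sub>m sumzero 3 g * (of_int (sign h) \<cdot>\<^sub>m sumzero 3 h) =
         (of_int (sign g) * of_int (sign h)) \<cdot>\<^sub>m (sumzero 3 g * sumzero 3 h)"
        using carrier_matD[OF sumzero_carrier[of 3]] by (simp add: mat_dim_simps mult.commute)
      then show "of_int (sign g) \<cdot>\<^sub>m sumzero 3 g * (of_int (sign h) \<cdot>\<^sub>m sumzero 3 h) =
         of_int (sign (g \<circ> h)) \<cdot>\<^sub>m sumzero 3 (g \<circ> h)" by (simp add: s3[OF gh(2)] sg[OF gh])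
    qed (simp_all add: s3id sg1 mat_dim_simps)
  qed
qed

lemma mtrace_irr_rep:
  assumes t: "t \<in> set perms4"
  shows "mtrace (irr_rep x (tapp t)) = of_int (tchi x t)"
proof -
  have tv: "tapp t 4 \<in> {1, 2, 3, 4}" using permutes_in_image[OF tapp_permutes[OF t], of 4] by auto
  have 3: "mtrace (sumzero 3 (tapp t)) = of_int (tchi Rho2 t)"
    using tv by (simp add: mtrace_def sumzero_def numeral_3_eq_3 lessThan_Suc tfix_def del: tapp.simps)
     (auto simp: numeral_eq_Suc simp del: tapp.simps)
  have pv: "tpair t 3 \<in> {1, 2, 3}" using tpair(1)[OF t, of 3] by simp
  have 2: "mtrace (sumzero 2 (tpair t)) = of_int (tchi Rho1 t)"
    using pv by (simp add: mtrace_def sumzero_def numeral_2_eq_2 lessThan_Suc)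
     (auto simp: numeral_eq_Suc)
  show ?thesis
  proof (cases x)
    case One
    then show ?thesis by simp
  next
    case Psi
    then show ?thesis by (simp add: sign_tapp[OF t] mtrace_smult[OF one_carrier_mat])
  next
    case Rho1
    show ?thesis unfolding Rho1 irr_rep_sumzero pairing_action_tapp by (rule 2)
  next
    case Rho2
    show ?thesis unfolding Rho2 irr_rep_sumzero by (rule 3)
  next
    case Rho3
    show ?thesis unfolding Rho3 irr_rep_sumzero mtrace_smult[OF sumzero_carrier] 3 sign_tapp[OF t]
      by simp
  qed
qed

section \<open>Checking modules by evaluation\<close>

definition irrs :: "irr list" where
  "irrs = [One, Psi, Rho1, Rho2, Rho3]"

lemma irr_in_irrs: "x \<in> set irrs"
  by (cases x) (auto simp: irrs_def)

fun irr_idx :: "irr \<Rightarrow> nat" where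
  "irr_idx One = 0" | "irr_idx Psi = 1" | "irr_idx Rho1 = 2" | "irr_idx Rho2 = 3" | "irr_idx Rho3 = 4"

lemma irrs_nth: "irrs ! irr_idx x = x" "irr_idx x < length irrs"
  by (cases x; simp add: irrs_def eval_nat_numeral One_nat_def)+

definition mmul :: "nat \<Rightarrow> int list list \<Rightarrow> int list list \<Rightarrow> int list list" where
  "mmul n A B = map (\<lambda>k. map (\<lambda>l. \<Sum>m\<leftarrow>[0..<n]. A ! k ! m * B ! m ! l) [0..<n]) [0..<n]"

definition mplus :: "nat \<Rightarrow> int list list list \<Rightarrow> int list list" where
  "mplus n As = map (\<lambda>k. map (\<lambda>l. \<Sum>A\<leftarrow>As. A ! k ! l) [0..<n]) [0..<n]"

fun mtab :: "nat \<Rightarrow> int list list \<Rightarrow> int list list \<Rightarrow> int list list \<Rightarrow> irr \<Rightarrow> int list list" where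
  "mtab n T Q U One = map (\<lambda>k. map (\<lambda>l. of_bool (k = l)) [0..<n]) [0..<n]"
| "mtab n T Q U Psi = T"
| "mtab n T Q U Rho1 = Q"
| "mtab n T Q U Rho2 = U"
| "mtab n T Q U Rho3 = mmul n T U"

definition square_list :: "nat \<Rightarrow> int list list \<Rightarrow> bool" where
  "square_list n A \<longleftrightarrow> length A = n \<and> list_all (\<lambda>r. length r = n) A"

lemma mmul_nth: "k < n \<Longrightarrow> l < n \<Longrightarrow> mmul n A B ! k ! l = (\<Sum>m<n. A ! k ! m * B ! m ! l)"
  by (simp add: mmul_def interv_sum_list_conv_sum_set_nat atLeast0LessThan)

lemma zcoef_mk_module:
  assumes "length T = n" "length Q = n" "length U = n" "k < n" "l < n"
  shows "zcoef (mk_module n T Q U) x k l = mtab n T Q U x ! k ! l"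
proof (cases x)
  case Rho3
  have "(mat_of_rows_list n T * mat_of_rows_list n U) $$ (k, l) = (\<Sum>m<n. T ! k ! m * U ! m ! l)"
    using assms by (subst mult_mat_index[of _ n n _ n]) (auto simp: mat_of_rows_list_def)
  then show ?thesis using Rho3 assms by (simp add: mk_module_def mmul_nth)
qed (use assms in \<open>auto simp: mk_module_def mat_of_rows_list_def\<close>)

text \<open>The last condition links any two basis elements directly, which rules out submodules
  spanned by proper nonempty subsets. The matrices are passed as an argument so that the product for
  \<open>Rho3\<close> is evaluated only once.\<close>

definition module_core :: "nat \<Rightarrow> int list list list \<Rightarrow> bool" where
  "module_core n ms \<longleftrightarrow>
     list_all (\<lambda>A. list_all (\<lambda>k. list_all (\<lambda>l. 0 \<le> A ! k ! l \<and> A ! k ! l = A ! l ! k) [0..<n]) [0..<n]) ms \<and>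
     list_all (\<lambda>x. list_all (\<lambda>y. mmul n (ms ! irr_idx x) (ms ! irr_idx y) =
        mplus n (map (\<lambda>z. ms ! irr_idx z) (irr_prod x y))) irrs) irrs \<and>
     list_all (\<lambda>k. list_all (\<lambda>l. list_ex (\<lambda>A. A ! k ! l \<noteq> 0) ms) [0..<n]) [0..<n]"

definition module_check :: "nat \<Rightarrow> int list list \<Rightarrow> int list list \<Rightarrow> int list list \<Rightarrow> bool" where
  "module_check n T Q U \<longleftrightarrow> 0 < n \<and> square_list n T \<and> square_list n Q \<and> square_list n U \<and>
     module_core n (map (mtab n T Q U) irrs)"

lemma module_check_sound:
  assumes "module_check n T Q U"
  shows "based_module (mk_module n T Q U)" "zirreducible (mk_module n T Q U)" "zrank (mk_module n T Q U) = n"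
proof -
  let ?M = "mk_module n T Q U" and ?c = "\<lambda>x k l. mtab n T Q U x ! k ! l"
  have sq: "length T = n" "length Q = n" "length U = n" "0 < n"
    and core: "module_core n (map (mtab n T Q U) irrs)"
    using assms by (auto simp: module_check_def square_list_def)
  have nthm: "map (mtab n T Q U) irrs ! irr_idx x = mtab n T Q U x" for x
    by (simp add: irrs_nth)
  have basis: "zbasis ?M = {..<n}" by (simp add: mk_module_def)
  have coef: "zcoef ?M x k l = ?c x k l" if "k < n" "l < n" for x k l
    using zcoef_mk_module[OF sq(1-3) that] .
  have nonneg: "0 \<le> ?c x k l" and sym: "?c x k l = ?c x l k" if "k < n" "l < n" for x k l
    using core that irr_in_irrs[of x] unfolding module_core_def by (auto simp: list_all_iff)
  have mult: "(\<Sum>m<n. ?c x k m * ?c y m l) = (\<Sum>z\<leftarrow>irr_prod x y. ?c z k l)" if "k < n" "l < n" for x y k l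
  proof -
    have "mmul n (mtab n T Q U x) (mtab n T Q U y) = mplus n (map (mtab n T Q U) (irr_prod x y))"
      using core irr_in_irrs unfolding module_core_def nthm by (auto simp: list_all_iff)
    then have "mmul n (mtab n T Q U x) (mtab n T Q U y) ! k ! l = mplus n (map (mtab n T Q U) (irr_prod x y)) ! k ! l"
      by simp
    then show ?thesis using that by (simp add: mmul_nth mplus_def comp_def)
  qed
  have ex: "\<exists>x. ?c x k l \<noteq> 0" if "k < n" "l < n" for k l
  proof -
    have "\<exists>A\<in>set irrs. ?c A k l \<noteq> 0"
      using core that unfolding module_core_def by (simp add: list_all_iff list_ex_iff)
    then show ?thesis by blast
  qed
  have "(\<Sum>m<n. zcoef ?M x k m * zcoef ?M y m l) = (\<Sum>z\<leftarrow>irr_prod x y. zcoef ?M z k l)" if kl: "k < n" "l < n" for x y k l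
  proof -
    have "(\<Sum>m<n. zcoef ?M x k m * zcoef ?M y m l) = (\<Sum>m<n. ?c x k m * ?c y m l)"
      using kl by (intro sum.cong) (auto simp: coef)
    then show ?thesis unfolding mult[OF kl] by (simp add: coef[OF kl])
  qed
  then show "based_module ?M" unfolding based_module_def zplus_module_def basis
    using nonneg sym by (auto simp: coef)
  have "\<not> spans_submodule ?M J" if J: "J \<noteq> {}" "J \<subset> {..<n}" for J
  proof
    assume sp: "spans_submodule ?M J"
    obtain k l where kl: "k < n" "k \<notin> J" "l \<in> J" "l < n" using J by blast
    obtain x where x: "?c x k l \<noteq> 0" using ex kl by blast
    have "(\<lambda>i. of_bool (i = l)) \<in> zspan J" using kl by (auto simp: zspan_def)
    then have "zact ?M x (\<lambda>i. of_bool (i = l)) \<in> zspan J" using sp by (auto simp: spans_submodule_def)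
    then have "zact ?M x (\<lambda>i. of_bool (i = l)) k = 0" using kl by (auto simp: zspan_def)
    then have "zcoef ?M x k l = 0" using kl by (simp add: zact_def basis of_bool_def if_distrib[of "\<lambda>x. _ * x"] cong: if_cong)
    then show False using x kl by (simp add: coef)
  qed
  then show "zirreducible ?M" unfolding zirreducible_def basis using sq by auto
  show "zrank ?M = n" by (simp add: zrank_def basis)
qed

text \<open>The numbers \<open>a + b w\<close> with integers \<open>a, b\<close>, where \<open>w\<^sup>2 = u + v w\<close>, are encoded as pairs.\<close>

fun pmul :: "int \<times> int \<Rightarrow> int \<times> int \<Rightarrow> int \<times> int \<Rightarrow> int \<times> int" where
  "pmul (u, v) (a, b) (c, d) = (a * c + u * b * d, a * d + b * c + v * b * d)"

fun pscale :: "int \<Rightarrow> int \<times> int \<Rightarrow> int \<times> int" where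
  "pscale k (a, b) = (k * a, k * b)"

fun padd :: "int \<times> int \<Rightarrow> int \<times> int \<Rightarrow> int \<times> int" where
  "padd (a, b) (c, d) = (a + c, b + d)"

fun pdot :: "int \<times> int \<Rightarrow> int list \<Rightarrow> (int \<times> int) list \<Rightarrow> (int \<times> int) list \<Rightarrow> int \<times> int" where
  "pdot uv (c # cs) (p # ps) (q # qs) = padd (pscale c (pmul uv p q)) (pdot uv cs ps qs)"
| "pdot uv _ _ _ = (0, 0)"

definition pval :: "complex \<Rightarrow> int \<times> int \<Rightarrow> complex" where
  "pval w p = of_int (fst p) + of_int (snd p) * w"

lemma pval_simps:
  "pval w (padd p q) = pval w p + pval w q" "pval w (pscale k p) = of_int k * pval w p"
  "pval w (a, 0) = of_int a"
  by (cases p; cases q; simp add: pval_def algebra_simps)+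

lemma pval_pmul: "w * w = of_int u + of_int v * w \<Longrightarrow> pval w (pmul (u, v) p q) = pval w p * pval w q"
proof -
  assume w: "w * w = of_int u + of_int v * w"
  obtain a b c d where pq: "p = (a, b)" "q = (c, d)" by (cases p; cases q)
  have "pval w p * pval w q = of_int (a * c) + of_int (a * d + b * c) * w + of_int (b * d) * (w * w)"
    by (simp add: pq pval_def algebra_simps)
  then show ?thesis unfolding w by (simp add: pq pval_def algebra_simps)
qed

lemma pval_pdot:
  assumes "w * w = of_int u + of_int v * w"
  shows "pval w (pdot (u, v) (map c L) (map p L) (map q L)) =
    (\<Sum>t\<leftarrow>L. of_int (c t) * (pval w (p t) * pval w (q t)))"
proof (induction L)
  case Nil
  show ?case by (simp add: pval_def)
next
  case (Cons t L)
  then show ?case by (simp add: pval_simps pval_pmul[OF assms])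
qed

definition table_core :: "int \<times> int \<Rightarrow> int \<Rightarrow> int list list \<Rightarrow> (int \<times> int) list list \<Rightarrow> (int \<times> int) list list \<Rightarrow>
    int list list list \<Rightarrow> bool" where
  "table_core uv len cs ps qs ms \<longleftrightarrow>
     list_all2 (\<lambda>c m. list_all2 (\<lambda>q row. list_all2 (\<lambda>p e. pdot uv c p q = (e * len, 0)) ps row) qs m) cs ms"

text \<open>The entry of x in the row of \<theta> i and the column of \<theta> j is 1 / |H| times
  the sum over t of the product of \<open>tchi x t\<close>, \<open>N t\<close>, the value of
  \<theta> j at t and that of \<theta> i at the inverse of t. Multiplying the table by |H| avoids
  the division.\<close>

definition table_check :: "int \<times> int \<Rightarrow> tup list \<Rightarrow> (tup \<Rightarrow> int \<times> int) list \<Rightarrow> (tup \<Rightarrow> int) \<Rightarrow> (irr \<Rightarrow> irr) \<Rightarrow>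
    int list list \<Rightarrow> int list list \<Rightarrow> int list list \<Rightarrow> bool" where
  "table_check uv L ths N s T Q U \<longleftrightarrow>
     table_core uv (int (length L)) (map (\<lambda>x. map (\<lambda>t. tchi x t * N t) L) irrs)
       (map (\<lambda>th. map th L) ths) (map (\<lambda>th. map (\<lambda>t. th (tinv t)) L) ths)
       (map (\<lambda>x. mtab (length ths) T Q U (s x)) irrs)"

definition vanish_check :: "tup list \<Rightarrow> (tup \<Rightarrow> int \<times> int) list \<Rightarrow> int list \<Rightarrow> (tup \<Rightarrow> int) \<Rightarrow> bool" where
  "vanish_check L ths ds N \<longleftrightarrow> length ds = length ths \<and>
     list_all (\<lambda>t. t = tid \<or> N t = 0 \<or> foldr (\<lambda>(d, th) p. padd (pscale d (th t)) p) (zip ds ths) (0, 0) = (0, 0)) L"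

text \<open>Of the module \<open>\<pi>\<close> only the product \<open>N\<close> of its trace and
  the trace of its inverse enters the table. This product is the same for cohomologous cocycles,
  whereas the traces of \<open>\<pi>\<close> depend on the representative \<alpha>.\<close>

lemma categorified_by_check:
  assumes L: "closed_list L" and coc: "\<alpha> \<in> carrier (cocycle_group (tapp ` set L))"
    and \<pi>: "twisted_module (tapp ` set L) \<alpha> \<pi>"
    and N: "\<And>t. t \<in> set L \<Longrightarrow> mtrace (\<pi> (tapp t)) * mtrace (twisted_group.rep_inv \<alpha> \<pi> (tapp t)) = of_int (N t)"
    and N0: "\<And>t. t \<in> set L \<Longrightarrow> N t = 0 \<Longrightarrow> mtrace (\<pi> (tapp t)) = 0"
    and len: "length \<theta>s = length ths" "length ths = n" "n > 0"
    and \<theta>: "\<And>i. i < n \<Longrightarrow> rep_on (tapp ` set L) (\<theta>s ! i)"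
    and w: "w * w = of_int u + of_int v * w"
    and th: "\<And>i t. i < n \<Longrightarrow> t \<in> set L \<Longrightarrow> mtrace ((\<theta>s ! i) (tapp t)) = pval w ((ths ! i) t)"
    and ds: "\<And>i. i < n \<Longrightarrow> int (deg (\<theta>s ! i)) = ds ! i"
    and sq: "square_list n T" "square_list n Q" "square_list n U" and s: "s = id \<or> s = swap_rho"
    and table: "table_check (u, v) L ths N s T Q U" and van: "vanish_check L ths ds N"
  shows "categorified_by (mk_module n T Q U) (tapp ` set L) \<alpha>"
proof -
  let ?H = "tapp ` set L"
  interpret twisted_group ?H \<alpha>
    using subgroup_tapp[OF L] coc by (intro twisted_group.intro perm_group.intro twisted_group_axioms.intro)
  have sub: "set L \<subseteq> set perms4" and dL: "distinct L" and cl: "\<And>t. t \<in> set L \<Longrightarrow> tinv t \<in> set L"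
    using L by (auto simp: closed_list_def list_all_iff)
  have lsq: "length T = n" "length Q = n" "length U = n" using sq by (auto simp: square_list_def)
  have cH: "card ?H = length L" by (rule card_tapp[OF dL])
  show ?thesis
  proof (rule categorified_by_table[OF \<pi> \<theta> _ len(3) _ s])
    show "rep_on ?H (irr_rep x)" for x
      by (rule rep_on_subset[OF irr_rep_on_S4]) (use S4_tapp sub in auto)
    show "zbasis (mk_module n T Q U) = {..<n}" by (simp add: mk_module_def)
    fix i j assume ij: "i < n" "j < n"
    then show "zcoef (mk_module n T Q U) One i j = of_bool (i = j)"
      by (simp add: zcoef_mk_module[OF lsq])
    fix x
    have core: "list_all2 (\<lambda>c m. list_all2 (\<lambda>q row. list_all2 (\<lambda>p e. pdot (u, v) c p q = (e * int (length L), 0))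
        (map (\<lambda>th. map th L) ths) row) (map (\<lambda>th. map (\<lambda>t. th (tinv t)) L) ths) m)
        (map (\<lambda>x. map (\<lambda>t. tchi x t * N t) L) irrs) (map (\<lambda>x. mtab n T Q U (s x)) irrs)"
      using table unfolding table_check_def table_core_def len(2) .
    have "pdot (u, v) (map (\<lambda>t. tchi x t * N t) L) (map (ths ! j) L) (map (\<lambda>t. (ths ! i) (tinv t)) L) =
      (mtab n T Q U (s x) ! i ! j * int (length L), 0)"
    proof -
      have 1: "list_all2 (\<lambda>q row. list_all2 (\<lambda>p e. pdot (u, v) (map (\<lambda>t. tchi x t * N t) L) p q = (e * int (length L), 0))
        (map (\<lambda>th. map th L) ths) row) (map (\<lambda>th. map (\<lambda>t. th (tinv t)) L) ths) (mtab n T Q U (s x))"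
        using list_all2_nthD[OF core, of "irr_idx x"] irrs_nth[of x] by simp
      have 2: "list_all2 (\<lambda>p e. pdot (u, v) (map (\<lambda>t. tchi x t * N t) L) p (map (\<lambda>t. (ths ! i) (tinv t)) L) = (e * int (length L), 0))
        (map (\<lambda>th. map th L) ths) (mtab n T Q U (s x) ! i)"
        using list_all2_nthD[OF 1, of i] ij len by simp
      show ?thesis using list_all2_nthD[OF 2, of j] ij len by simp
    qed
    then have "pval w (pdot (u, v) (map (\<lambda>t. tchi x t * N t) L) (map (ths ! j) L) (map (\<lambda>t. (ths ! i) (tinv t)) L)) =
      of_int (mtab n T Q U (s x) ! i ! j) * of_nat (length L)"
      by (simp add: pval_simps)
    then have eq: "(\<Sum>t\<leftarrow>L. of_int (tchi x t * N t) * (pval w ((ths ! j) t) * pval w ((ths ! i) (tinv t)))) =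
      of_int (mtab n T Q U (s x) ! i ! j) * of_nat (length L)"
      unfolding pval_pdot[OF w] .
    have "(\<Sum>h\<in>?H. mtrace (irr_rep x h) * (mtrace ((\<theta>s ! j) h) * mtrace ((\<theta>s ! i) (pinv h)) * (mtrace (\<pi> h) * mtrace (rep_inv \<pi> h)))) =
      (\<Sum>t\<leftarrow>L. of_int (tchi x t * N t) * (pval w ((ths ! j) t) * pval w ((ths ! i) (tinv t))))"
      unfolding sum_tapp[OF dL]
    proof (intro arg_cong[of _ _ sum_list] map_cong refl)
      fix t assume t: "t \<in> set L"
      then have tp: "t \<in> set perms4" using sub by auto
      show "mtrace (irr_rep x (tapp t)) * (mtrace ((\<theta>s ! j) (tapp t)) * mtrace ((\<theta>s ! i) (pinv (tapp t))) *
          (mtrace (\<pi> (tapp t)) * mtrace (rep_inv \<pi> (tapp t)))) =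
        of_int (tchi x t * N t) * (pval w ((ths ! j) t) * pval w ((ths ! i) (tinv t)))"
        unfolding N[OF t] pinv_tapp[OF tp] mtrace_irr_rep[OF tp] th[OF ij(1) cl[OF t]] th[OF ij(2) t] by simp
    qed
    then show "(\<Sum>h\<in>?H. mtrace (irr_rep x h) * (mtrace ((\<theta>s ! j) h) * mtrace ((\<theta>s ! i) (pinv h)) * (mtrace (\<pi> h) * mtrace (rep_inv \<pi> h)))) =
      of_int (zcoef (mk_module n T Q U) (s x) i j) * of_nat (card ?H)"
      unfolding eq cH by (simp add: zcoef_mk_module[OF lsq ij])
  next
    fix h assume h: "h \<in> ?H" "h \<noteq> id"
    then obtain t where t: "t \<in> set L" "h = tapp t" "t \<noteq> tid" using tapp_id by auto
    have van': "N t = 0 \<or> foldr (\<lambda>(d, th) p. padd (pscale d (th t)) p) (zip ds ths) (0, 0) = (0, 0)" "length ds = length ths"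
      using van t by (auto simp: vanish_check_def list_all_iff)
    have fold: "pval w (foldr (\<lambda>(d, th) p. padd (pscale d (th t)) p) (zip as bs) (0, 0)) =
        (\<Sum>i<length bs. of_int (as ! i) * pval w ((bs ! i) t))" if "length as = length bs" for as :: "int list" and bs
      using that
    proof (induction as bs rule: list_induct2)
      case Nil
      then show ?case by (simp add: pval_def)
    next
      case (Cons a as b bs)
      then show ?case by (simp add: pval_simps sum.lessThan_Suc_shift del: sum.lessThan_Suc)
    qed
    have "(\<Sum>i<n. of_nat (deg (\<theta>s ! i)) * mtrace ((\<theta>s ! i) h)) = (\<Sum>i<length ths. of_int (ds ! i) * pval w ((ths ! i) t))"
      using len th[OF _ t(1)] unfolding t(2) by (intro sum.cong) (auto simp: ds[symmetric])
    also have "\<dots> = pval w (foldr (\<lambda>(d, th) p. padd (pscale d (th t)) p) (zip ds ths) (0, 0))"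
      by (rule fold[symmetric, OF van'(2)])
    finally have "N t \<noteq> 0 \<Longrightarrow> (\<Sum>i<n. of_nat (deg (\<theta>s ! i)) * mtrace ((\<theta>s ! i) h)) = 0"
      using van'(1) by (simp add: pval_def)
    then show "mtrace (\<pi> h) = 0 \<or> (\<Sum>i<n. of_nat (deg (\<theta>s ! i)) * mtrace ((\<theta>s ! i) h)) = 0"
      using N0[OF t(1)] t(2) by auto
  qed
qed

section \<open>The 16 modules: based, irreducible, pairwise inequivalent\<close>

lemma module_check_M11: "module_check 1 [[1]] [[2]] [[3]]"
  by code_simp

lemma module_check_M21: "module_check 2 [[1,0],[0,1]] [[2,0],[0,2]] [[1,2],[2,1]]"
  by code_simp

lemma module_check_M22: "module_check 2 [[0,1],[1,0]] [[1,1],[1,1]] [[2,1],[1,2]]"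
  by code_simp

lemma module_check_M23: "module_check 2 [[0,1],[1,0]] [[1,1],[1,1]] [[1,2],[2,1]]"
  by code_simp

lemma module_check_M31: "module_check 3 [[1,0,0],[0,1,0],[0,0,1]] [[0,1,1],[1,0,1],[1,1,0]] [[1,1,1],[1,1,1],[1,1,1]]"
  by code_simp

lemma module_check_M32: "module_check 3 [[0,1,0],[1,0,0],[0,0,1]] [[0,0,1],[0,0,1],[1,1,1]] [[1,0,1],[0,1,1],[1,1,2]]"
  by code_simp

lemma module_check_M33: "module_check 3 [[0,1,0],[1,0,0],[0,0,1]] [[0,0,1],[0,0,1],[1,1,1]] [[0,1,1],[1,0,1],[1,1,2]]"
  by code_simp

lemma module_check_M41: "module_check 4 [[1,0,0,0],[0,1,0,0],[0,0,1,0],[0,0,0,1]]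
    [[0,0,1,1],[0,2,0,0],[1,0,0,1],[1,0,1,0]] [[0,1,0,0],[1,2,1,1],[0,1,0,0],[0,1,0,0]]"
  by code_simp

lemma module_check_M42: "module_check 4 [[1,0,0,0],[0,1,0,0],[0,0,1,0],[0,0,0,1]]
    [[2,0,0,0],[0,2,0,0],[0,0,2,0],[0,0,0,2]] [[0,1,1,1],[1,0,1,1],[1,1,0,1],[1,1,1,0]]"
  by code_simp

lemma module_check_M43: "module_check 4 [[0,1,0,0],[1,0,0,0],[0,0,1,0],[0,0,0,1]]
    [[1,1,0,0],[1,1,0,0],[0,0,2,0],[0,0,0,2]] [[1,0,1,1],[0,1,1,1],[1,1,0,1],[1,1,1,0]]"
  by code_simp

lemma module_check_M44: "module_check 4 [[0,1,0,0],[1,0,0,0],[0,0,1,0],[0,0,0,1]]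
    [[1,1,0,0],[1,1,0,0],[0,0,2,0],[0,0,0,2]] [[0,1,1,1],[1,0,1,1],[1,1,0,1],[1,1,1,0]]"
  by code_simp

lemma module_check_M45: "module_check 4 [[0,1,0,0],[1,0,0,0],[0,0,0,1],[0,0,1,0]]
    [[1,1,0,0],[1,1,0,0],[0,0,1,1],[0,0,1,1]] [[0,1,1,1],[1,0,1,1],[1,1,0,1],[1,1,1,0]]"
  by code_simp

lemma module_check_M46: "module_check 4 [[0,1,0,0],[1,0,0,0],[0,0,0,1],[0,0,1,0]]
    [[1,1,0,0],[1,1,0,0],[0,0,1,1],[0,0,1,1]] [[0,1,1,1],[1,0,1,1],[1,1,1,0],[1,1,0,1]]"
  by code_simp

lemma module_check_M47: "module_check 4 [[0,1,0,0],[1,0,0,0],[0,0,0,1],[0,0,1,0]]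
    [[1,1,0,0],[1,1,0,0],[0,0,1,1],[0,0,1,1]] [[1,0,1,1],[0,1,1,1],[1,1,1,0],[1,1,0,1]]"
  by code_simp

lemma module_check_M51: "module_check 5 [[0,1,0,0,0],[1,0,0,0,0],[0,0,0,1,0],[0,0,1,0,0],[0,0,0,0,1]]
    [[0,0,0,0,1],[0,0,0,0,1],[0,0,1,1,0],[0,0,1,1,0],[1,1,0,0,1]]
    [[0,0,0,1,0],[0,0,1,0,0],[0,1,1,1,1],[1,0,1,1,1],[0,0,1,1,0]]"
  by code_simp

lemma module_check_M52: "module_check 5 [[0,1,0,0,0],[1,0,0,0,0],[0,0,0,1,0],[0,0,1,0,0],[0,0,0,0,1]]
    [[1,1,0,0,0],[1,1,0,0,0],[0,0,1,1,0],[0,0,1,1,0],[0,0,0,0,2]]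
    [[0,0,0,1,1],[0,0,1,0,1],[0,1,0,0,1],[1,0,0,0,1],[1,1,1,1,1]]"
  by code_simp

lemmas explicit_module_checks = module_check_M11 module_check_M21 module_check_M22 module_check_M23 module_check_M31 module_check_M32 module_check_M33 module_check_M41 module_check_M42 module_check_M43 module_check_M44 module_check_M45 module_check_M46 module_check_M47 module_check_M51 module_check_M52

lemmas explicit_defs = M11_def M21_def M22_def M23_def M31_def M32_def M33_def M41_def M42_def
  M43_def M44_def M45_def M46_def M47_def M51_def M52_def

lemma explicit_modules_based:
  assumes "M \<in> set explicit_modules"
  shows "based_module M" "zirreducible M" "zrank M \<le> 5"
proof -
  note sound = explicit_module_checks[THEN module_check_sound(1)]
    explicit_module_checks[THEN module_check_sound(2)] explicit_module_checks[THEN module_check_sound(3)]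
  have "list_all (\<lambda>M. based_module M \<and> zirreducible M \<and> zrank M \<le> 5) explicit_modules"
    unfolding explicit_modules_def explicit_defs by (simp add: sound)
  then have "based_module M \<and> zirreducible M \<and> zrank M \<le> 5" using assms by (simp add: list_all_iff)
  then show "based_module M" "zirreducible M" "zrank M \<le> 5" by auto
qed

text \<open>An equivalence permutes the basis simultaneously for all matrices and so preserves
  traces. These three traces together with the rank separate the 16 modules.\<close>

definition trace_invariant :: "'b zdata \<Rightarrow> nat \<times> int \<times> int \<times> int" where
  "trace_invariant M = (zrank M, \<Sum>k\<in>zbasis M. zcoef M Psi k k, \<Sum>k\<in>zbasis M. zcoef M Rho1 k k,
     \<Sum>k\<in>zbasis M. zcoef M Rho2 k k)"

lemma trace_invariant_zequiv:
  assumes "zequiv M N"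
  shows "trace_invariant M = trace_invariant N"
proof -
  obtain f where f: "bij_betw f (zbasis M) (zbasis N)"
    and eq: "\<And>x k l. k \<in> zbasis M \<Longrightarrow> l \<in> zbasis M \<Longrightarrow> zcoef N x (f k) (f l) = zcoef M x k l"
    using assms by (auto simp: zequiv_def)
  have "(\<Sum>k\<in>zbasis N. zcoef N x k k) = (\<Sum>k\<in>zbasis M. zcoef M x k k)" for x
    using sum.reindex_bij_betw[OF f, of "\<lambda>k. zcoef N x k k"] eq by simp
  then show ?thesis using bij_betw_same_card[OF f] by (simp add: trace_invariant_def zrank_def)
qed

definition list_trace :: "nat \<Rightarrow> int list list \<Rightarrow> int" where
  "list_trace n A = (\<Sum>k\<leftarrow>[0..<n]. A ! k ! k)"

lemma trace_invariant_mk_module: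
  assumes "module_check n T Q U"
  shows "trace_invariant (mk_module n T Q U) = (n, list_trace n T, list_trace n Q, list_trace n U)"
proof -
  have "length T = n" "length Q = n" "length U = n"
    using assms by (auto simp: module_check_def square_list_def)
  moreover have "zbasis (mk_module n T Q U) = {..<n}" by (simp add: mk_module_def)
  ultimately show ?thesis using zcoef_mk_module[of T n Q U]
    by (simp add: trace_invariant_def zrank_def list_trace_def interv_sum_list_conv_sum_set_nat atLeast0LessThan)
qed

lemma explicit_modules_inequivalent: "sorted_wrt (\<lambda>M N. \<not> zequiv M N) explicit_modules"
proof -
  have "map trace_invariant explicit_modules =
     [(1,1,2,3), (2,2,4,2), (2,0,2,4), (2,0,2,2), (3,3,0,3), (3,1,1,4), (3,1,1,2), (4,4,2,2), (4,4,8,0),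
      (4,2,6,2), (4,2,6,0), (4,0,4,0), (4,0,4,2), (4,0,4,4), (5,1,3,2), (5,1,6,1)]"
    unfolding explicit_modules_def explicit_defs list.map
      explicit_module_checks[THEN trace_invariant_mk_module]
    by code_simp
  then have "distinct (map trace_invariant explicit_modules)" by simp
  moreover have "distinct xs \<Longrightarrow> sorted_wrt (\<noteq>) xs" for xs :: "(nat \<times> int \<times> int \<times> int) list"
    by (induction xs) auto
  ultimately have "sorted_wrt (\<noteq>) (map trace_invariant explicit_modules)" by blast
  then have "sorted_wrt (\<lambda>M N. trace_invariant M \<noteq> trace_invariant N) explicit_modules"
    by (simp only: sorted_wrt_map)
  then show ?thesis by (rule sorted_wrt_mono_rel[rotated]) (auto dest: trace_invariant_zequiv)
qed

section \<open>The subgroups\<close>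

definition "Z1_list = ([(1,2,3,4)] :: tup list)"
definition "Z2_list = ([(1,2,3,4), (2,1,3,4)] :: tup list)"
definition "Z3_list = ([(1,2,3,4), (2,3,1,4), (3,1,2,4)] :: tup list)"
definition "Z4_list = ([(1,2,3,4), (2,3,4,1), (3,4,1,2), (4,1,2,3)] :: tup list)"
definition "K4_list = ([(1,2,3,4), (2,1,3,4), (1,2,4,3), (2,1,4,3)] :: tup list)"
definition "S3_list = ([(1,2,3,4), (1,3,2,4), (2,1,3,4), (2,3,1,4), (3,1,2,4), (3,2,1,4)] :: tup list)"
definition "D4_list = ([(1,2,3,4), (2,3,4,1), (3,4,1,2), (4,1,2,3), (3,2,1,4), (4,3,2,1), (1,4,3,2), (2,1,4,3)] :: tup list)"
definition "A4_list = ([(1,2,3,4), (1,3,4,2), (1,4,2,3), (2,1,4,3), (2,3,1,4), (2,4,3,1), (3,1,2,4), (3,2,4,1),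
  (3,4,1,2), (4,1,3,2), (4,2,1,3), (4,3,2,1)] :: tup list)"

lemma closed_lists: "closed_list Z1_list" "closed_list Z2_list" "closed_list Z3_list" "closed_list Z4_list"
  "closed_list K4_list" "closed_list S3_list" "closed_list D4_list" "closed_list A4_list"
  by code_simp+

text \<open>Closure follows from the composition of permutations and \<open>permutes_tapp\<close>,
  instead of an evaluation of all 576 products.\<close>

lemma closed_perms4: "closed_list perms4"
proof -
  have "tcomp t u \<in> set perms4" if "t \<in> set perms4" "u \<in> set perms4" for t u
  proof -
    have "tapp t \<circ> tapp u permutes {1..4}" using that tapp_permutes permutes_compose by blast
    then obtain s where "s \<in> set perms4" "tapp t \<circ> tapp u = tapp s" by (rule permutes_tapp)
    then show ?thesis using tapp_inj by (metis tapp_comp)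
  qed
  moreover have "distinct perms4" "tid \<in> set perms4" by (simp_all add: perms4_def)
  ultimately show ?thesis using tinv(1) by (auto simp: closed_list_def list_all_iff simp del: tinv.simps)
qed

lemma cycles_tapp: "cycle_of_list [1, 2] = tapp (2,1,3,4)" "cycle_of_list [3, 4] = tapp (1,2,4,3)"
  "cycle_of_list [1, 3] = tapp (3,2,1,4)" "cycle_of_list [1, 2, 3] = tapp (2,3,1,4)"
  "cycle_of_list [1, 2, 3, 4] = tapp (2,3,4,1)"
  by (rule perm4_eqI; simp add: transpose_def)+

lemma Z1_sub_eq: "Z1_sub = tapp ` set Z1_list"
  unfolding Z1_sub_def Z1_list_def list.set image_insert image_empty tapp_id ..

lemma Z2_sub_eq: "Z2_sub = tapp ` set Z2_list"
proof -
  have "Z2_list = map (\<lambda>w. foldr tcomp w tid) [[], [(2,1,3,4)]]" by code_simp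
  from generate_tapp[OF closed_lists(2) _ this, of "[(2,1,3,4)]"] show ?thesis
    unfolding Z2_sub_def cycles_tapp by (simp add: Z2_list_def del: tapp.simps)
qed

lemma Z3_sub_eq: "Z3_sub = tapp ` set Z3_list"
proof -
  have "Z3_list = map (\<lambda>w. foldr tcomp w tid) [[], [(2,3,1,4)], [(2,3,1,4), (2,3,1,4)]]" by code_simp
  from generate_tapp[OF closed_lists(3) _ this, of "[(2,3,1,4)]"] show ?thesis
    unfolding Z3_sub_def cycles_tapp by (simp add: Z3_list_def del: tapp.simps)
qed

lemma Z4_sub_eq: "Z4_sub = tapp ` set Z4_list"
proof -
  have "Z4_list = map (\<lambda>w. foldr tcomp w tid) [[], [(2,3,4,1)], [(2,3,4,1), (2,3,4,1)], [(2,3,4,1), (2,3,4,1), (2,3,4,1)]]"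
    by code_simp
  from generate_tapp[OF closed_lists(4) _ this, of "[(2,3,4,1)]"] show ?thesis
    unfolding Z4_sub_def cycles_tapp by (simp add: Z4_list_def del: tapp.simps)
qed

lemma K4_sub_eq: "K4_sub = tapp ` set K4_list"
proof -
  have "K4_list = map (\<lambda>w. foldr tcomp w tid) [[], [(2,1,3,4)], [(1,2,4,3)], [(2,1,3,4), (1,2,4,3)]]"
    by code_simp
  from generate_tapp[OF closed_lists(5) _ this, of "[(2,1,3,4), (1,2,4,3)]"] show ?thesis
    unfolding K4_sub_def cycles_tapp by (simp add: K4_list_def del: tapp.simps)
qed

lemma D4_sub_eq: "D4_sub = tapp ` set D4_list"
proof -
  have "D4_list = map (\<lambda>w. foldr tcomp w tid) [[], [(2,3,4,1)], [(2,3,4,1), (2,3,4,1)], [(2,3,4,1), (2,3,4,1), (2,3,4,1)],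
     [(3,2,1,4)], [(2,3,4,1), (3,2,1,4)], [(2,3,4,1), (2,3,4,1), (3,2,1,4)], [(2,3,4,1), (2,3,4,1), (2,3,4,1), (3,2,1,4)]]"
    by code_simp
  from generate_tapp[OF closed_lists(7) _ this, of "[(2,3,4,1), (3,2,1,4)]"] show ?thesis
    unfolding D4_sub_def cycles_tapp by (simp add: D4_list_def del: tapp.simps)
qed

lemma perms_filter: "{p. p permutes {1..4} \<and> P p} = tapp ` {t \<in> set perms4. P (tapp t)}"
proof -
  have "{p. p permutes {1..4} \<and> P p} = {p \<in> tapp ` set perms4. P p}"
    using S4_tapp unfolding S4_simps by blast
  moreover have "{y \<in> f ` A. P y} = f ` {x \<in> A. P (f x)}" for f and A :: "tup set" by blast
  ultimately show ?thesis by simp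
qed

lemma S3_sub_eq: "S3_sub = tapp ` set S3_list"
proof -
  have "p permutes {1..3} \<longleftrightarrow> p permutes {1..4} \<and> p 4 = 4" for p :: perm4
  proof
    assume p: "p permutes {1..3}"
    then have "p permutes {1..4}" by (rule permutes_subset) auto
    moreover have "p 4 = 4" by (rule permutes_not_in[OF p]) simp
    ultimately show "p permutes {1..4} \<and> p 4 = 4" ..
  next
    assume p: "p permutes {1..4} \<and> p 4 = 4"
    show "p permutes {1..3}"
      by (rule permutes_superset[OF conjunct1[OF p]]) (use p in \<open>auto simp: set_14\<close>)
  qed
  then have "S3_sub = tapp ` {t \<in> set perms4. tapp t 4 = 4}"
    unfolding S3_sub_def by (simp add: sym_group_def perms_filter)
  also have "{t \<in> set perms4. tapp t 4 = 4} = set (filter (\<lambda>t. tapp t 4 = 4) perms4)" by auto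
  also have "filter (\<lambda>t. tapp t 4 = 4) perms4 = S3_list" unfolding perms4_def by code_simp
  finally show ?thesis .
qed

lemma A4_sub_eq: "A4_sub = tapp ` set A4_list"
proof -
  have "A4_sub = tapp ` {t \<in> set perms4. tsign t = 1}"
  proof -
    have "evenperm (tapp t) \<longleftrightarrow> tsign t = 1" if "t \<in> set perms4" for t
      using sign_tapp[OF that] by (auto simp: sign_def split: if_splits)
    then have "{t \<in> set perms4. evenperm (tapp t)} = {t \<in> set perms4. tsign t = 1}" by blast
    then show ?thesis unfolding A4_sub_def by (simp add: alt_group_def perms_filter)
  qed
  also have "{t \<in> set perms4. tsign t = 1} = set (filter (\<lambda>t. tsign t = 1) perms4)" by auto
  also have "filter (\<lambda>t. tsign t = 1) perms4 = A4_list" unfolding perms4_def by code_simp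
  finally show ?thesis .
qed

lemma S4_sub_eq: "S4_sub = tapp ` set perms4"
  by (simp add: S4_sub_def S4_tapp)

section \<open>Module categories given by trivial cocycles\<close>

lemma trivial_cocycle_apply: "g \<in> H \<Longrightarrow> h \<in> H \<Longrightarrow> trivial_cocycle H (g, h) = 1"
  by (simp add: trivial_cocycle_def cocycle_group_def)

lemma trivial_cocycle_carrier:
  assumes "subgroup H S4"
  shows "trivial_cocycle H \<in> carrier (cocycle_group H)"
proof -
  interpret perm_group H using assms by (rule perm_group.intro)
  show ?thesis by (auto simp: trivial_cocycle_def cocycle_group_def)
qed

definition rep_data :: "complex \<Rightarrow> tup list \<Rightarrow> rep \<Rightarrow> (tup \<Rightarrow> int \<times> int) \<Rightarrow> int \<Rightarrow> bool" where
  "rep_data w L \<theta> th d \<longleftrightarrow> rep_on (tapp ` set L) \<theta> \<and>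
     (\<forall>t\<in>set L. mtrace (\<theta> (tapp t)) = pval w (th t)) \<and> int (deg \<theta>) = d"

definition perm_values :: "perm4 \<Rightarrow> tup" where
  "perm_values p = (p 1, p 2, p 3, p 4)"

lemma perm_values_tapp [simp]: "perm_values (tapp t) = t"
  by (cases t) (simp add: perm_values_def)

fun irr_dim :: "irr \<Rightarrow> int" where
  "irr_dim One = 1" | "irr_dim Psi = 1" | "irr_dim Rho1 = 2" | "irr_dim Rho2 = 3" | "irr_dim Rho3 = 3"

lemma rep_data_irr:
  assumes L: "closed_list L"
  shows "rep_data w L (irr_rep x) (\<lambda>t. (tchi x t, 0)) (irr_dim x)"
proof -
  have sub: "set L \<subseteq> set perms4" using L by (auto simp: closed_list_def list_all_iff)
  have "rep_on (tapp ` set L) (irr_rep x)"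
    by (rule rep_on_subset[OF irr_rep_on_S4]) (use S4_tapp sub in auto)
  moreover have "mtrace (irr_rep x (tapp t)) = pval w (tchi x t, 0)" if "t \<in> set L" for t
    using mtrace_irr_rep[of t x] that sub by (auto simp: pval_simps simp del: tchi.simps)
  moreover have "int (deg (irr_rep x)) = irr_dim x"
    by (cases x) (simp_all add: deg_def std_rep_def)
  ultimately show ?thesis by (simp add: rep_data_def)
qed

lemma rep_data_irrs:
  assumes "closed_list L"
  shows "rep_data w L (irr_rep One) (\<lambda>t. (tchi One t, 0)) 1" "rep_data w L (irr_rep Psi) (\<lambda>t. (tchi Psi t, 0)) 1"
    "rep_data w L (irr_rep Rho1) (\<lambda>t. (tchi Rho1 t, 0)) 2" "rep_data w L (irr_rep Rho2) (\<lambda>t. (tchi Rho2 t, 0)) 3"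
    "rep_data w L (irr_rep Rho3) (\<lambda>t. (tchi Rho3 t, 0)) 3"
  using rep_data_irr[OF assms, of w One] rep_data_irr[OF assms, of w Psi] rep_data_irr[OF assms, of w Rho1]
    rep_data_irr[OF assms, of w Rho2] rep_data_irr[OF assms, of w Rho3] by (simp_all only: irr_dim.simps)

definition lin_rep :: "complex \<Rightarrow> (tup \<Rightarrow> int \<times> int) \<Rightarrow> rep" where
  "lin_rep w th p = mat 1 1 (\<lambda>_. pval w (th (perm_values p)))"

definition lin_check :: "int \<times> int \<Rightarrow> tup list \<Rightarrow> (tup \<Rightarrow> int \<times> int) \<Rightarrow> bool" where
  "lin_check uv L th \<longleftrightarrow> th tid = (1, 0) \<and>
     list_all (\<lambda>t. list_all (\<lambda>u. th (tcomp t u) = pmul uv (th t) (th u)) L) L"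

lemma rep_data_lin:
  assumes ch: "lin_check (u, v) L th" and w: "w * w = of_int u + of_int v * w"
  shows "rep_data w L (lin_rep w th) th 1"
proof -
  have "rep_on (tapp ` set L) (lin_rep w th)"
  proof (rule rep_onI[of _ _ 1])
    show "lin_rep w th id = 1\<^sub>m 1"
      using ch by (intro eq_matI) (auto simp: lin_rep_def lin_check_def pval_simps perm_values_def One_nat_def)
    fix g h assume "g \<in> tapp ` set L" "h \<in> tapp ` set L"
    then obtain s t where st: "s \<in> set L" "t \<in> set L" "g = tapp s" "h = tapp t" by blast
    have "th (tcomp s t) = pmul (u, v) (th s) (th t)" using ch st by (auto simp: lin_check_def list_all_iff)
    then show "lin_rep w th g * lin_rep w th h = lin_rep w th (g \<circ> h)"
      unfolding st(3,4) tapp_comp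
      by (intro eq_matI) (auto simp: lin_rep_def pval_pmul[OF w] scalar_prod_def)
  qed (simp add: lin_rep_def)
  then show ?thesis by (auto simp: rep_data_def lin_rep_def deg_def mtrace_def)
qed

definition int_rep :: "nat \<Rightarrow> (tup \<Rightarrow> int list list) \<Rightarrow> rep" where
  "int_rep d m p = mat d d (\<lambda>(i, j). of_int (m (perm_values p) ! i ! j))"

definition int_check :: "nat \<Rightarrow> tup list \<Rightarrow> (tup \<Rightarrow> int list list) \<Rightarrow> bool" where
  "int_check d L m \<longleftrightarrow> m tid = mtab d [] [] [] One \<and>
     list_all (\<lambda>t. list_all (\<lambda>u. m (tcomp t u) = mmul d (m t) (m u)) L) L"

lemma rep_data_int:
  assumes ch: "int_check d L m"
  shows "rep_data w L (int_rep d m) (\<lambda>t. (list_trace d (m t), 0)) (int d)"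
proof -
  have "rep_on (tapp ` set L) (int_rep d m)"
  proof (rule rep_onI[of _ _ d])
    show "int_rep d m id = 1\<^sub>m d"
      using ch by (intro eq_matI) (auto simp: int_rep_def int_check_def perm_values_def)
    fix g h assume "g \<in> tapp ` set L" "h \<in> tapp ` set L"
    then obtain s t where st: "s \<in> set L" "t \<in> set L" "g = tapp s" "h = tapp t" by blast
    have eq: "m (tcomp s t) = mmul d (m s) (m t)" using ch st by (auto simp: int_check_def list_all_iff)
    show "int_rep d m g * int_rep d m h = int_rep d m (g \<circ> h)"
    proof (rule eq_matI)
      fix i j assume "i < dim_row (int_rep d m (g \<circ> h))" "j < dim_col (int_rep d m (g \<circ> h))"
      then have ij: "i < d" "j < d" by (auto simp: int_rep_def)
      have "(int_rep d m g * int_rep d m h) $$ (i, j) = (\<Sum>l<d. int_rep d m g $$ (i, l) * int_rep d m h $$ (l, j))"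
        using ij by (intro mult_mat_index) (auto simp: int_rep_def)
      then show "(int_rep d m g * int_rep d m h) $$ (i, j) = int_rep d m (g \<circ> h) $$ (i, j)"
        unfolding st(3,4) tapp_comp using ij by (simp add: int_rep_def eq mmul_nth)
    qed (auto simp: int_rep_def)
  qed (simp add: int_rep_def)
  moreover have "mtrace (int_rep d m (tapp t)) = pval w (list_trace d (m t), 0)" for t
    by (simp add: pval_simps mtrace_def int_rep_def list_trace_def interv_sum_list_conv_sum_set_nat atLeast0LessThan)
  ultimately show ?thesis by (simp add: rep_data_def deg_def int_rep_def)
qed

text \<open>For the trivial cocycle the fixed module \<open>\<pi>\<close> is the trivial
  one-dimensional representation, so all weights \<open>N\<close> are 1.\<close>

lemma categorified_by_Rep_check:
  assumes L: "closed_list L" and xs: "\<And>\<theta> th d. (\<theta>, th, d) \<in> set xs \<Longrightarrow> rep_data w L \<theta> th d"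
    and n: "length xs = n" "n > 0" and w: "w * w = of_int u + of_int v * w"
    and sq: "square_list n T" "square_list n Q" "square_list n U" and s: "s = id \<or> s = swap_rho"
    and table: "table_check (u, v) L (map (fst \<circ> snd) xs) (\<lambda>_. 1) s T Q U"
    and van: "vanish_check L (map (fst \<circ> snd) xs) (map (snd \<circ> snd) xs) (\<lambda>_. 1)"
  shows "categorified_by_Rep (mk_module n T Q U) (tapp ` set L)"
proof -
  let ?H = "tapp ` set L" and ?\<pi> = "\<lambda>_ :: perm4. 1\<^sub>m 1 :: complex mat"
  note coc = trivial_cocycle_carrier[OF subgroup_tapp[OF L]]
  interpret twisted_group ?H "trivial_cocycle ?H"
    using subgroup_tapp[OF L] coc by (intro twisted_group.intro perm_group.intro twisted_group_axioms.intro)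
  have \<pi>: "twisted_module ?H (trivial_cocycle ?H) ?\<pi>"
    using trivial_cocycle_apply[of _ ?H] comp_in id_in
    by (auto simp: twisted_module_def deg_def mat_dim_simps)
  have data: "rep_data w L (map fst xs ! i) (map (fst \<circ> snd) xs ! i) (map (snd \<circ> snd) xs ! i)" if "i < n" for i
    using xs[of "fst (xs ! i)" "fst (snd (xs ! i))" "snd (snd (xs ! i))"] that n by simp
  show ?thesis
  proof (rule categorified_by_check[OF L coc \<pi>, where \<theta>s = "map fst xs"])
    fix t assume "t \<in> set L"
    then have t: "tapp t \<in> ?H" by simp
    have "norm_factor (tapp t) = 1"
      unfolding norm_factor_def using t by (simp only: trivial_cocycle_apply inv_in id_in mult_1)
    then show "mtrace (?\<pi> (tapp t)) * mtrace (rep_inv ?\<pi> (tapp t)) = of_int 1"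
      by (simp add: rep_inv_def mat_dim_simps)
  qed (use data n w sq s table van in \<open>auto simp: rep_data_def\<close>)
qed

abbreviation irr_entry :: "irr \<Rightarrow> rep \<times> (tup \<Rightarrow> int \<times> int) \<times> int" where
  "irr_entry x \<equiv> (irr_rep x, \<lambda>t. (tchi x t, 0), irr_dim x)"

abbreviation lin_entry :: "complex \<Rightarrow> (tup \<Rightarrow> int \<times> int) \<Rightarrow> rep \<times> (tup \<Rightarrow> int \<times> int) \<times> int" where
  "lin_entry w th \<equiv> (lin_rep w th, th, 1)"

definition "omega = Complex (- 1 / 2) (sqrt 3 / 2)"

lemma omega_square: "omega * omega = of_int (- 1) + of_int (- 1) * omega"
  by (simp add: omega_def complex_eq_iff)

text \<open>Even permutations move the three pairings cyclically, so the image of pairing 1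
  determines the class modulo the normal Klein group. The values are 1, w and w^2 = -1 - w. The
  function serves for \<open>A4_list\<close> and for \<open>Z3_list\<close>.\<close>

definition th_omega1 :: "tup \<Rightarrow> int \<times> int" where
  "th_omega1 t = (if tpair t 1 = 1 then (1, 0) else if tpair t 1 = 2 then (0, 1) else (-1, -1))"
definition th_omega2 :: "tup \<Rightarrow> int \<times> int" where
  "th_omega2 t = (if tpair t 1 = 1 then (1, 0) else if tpair t 1 = 2 then (-1, -1) else (0, 1))"
text \<open>The image of the point 1 names the power of the 4-cycle; the generator goes to w with
  w^2 = -1.\<close>

definition th_i1 :: "tup \<Rightarrow> int \<times> int" where
  "th_i1 t = (if tapp t 1 = 1 then (1, 0) else if tapp t 1 = 2 then (0, 1) else if tapp t 1 = 3 then (-1, 0) else (0, -1))"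
definition th_i2 :: "tup \<Rightarrow> int \<times> int" where
  "th_i2 t = (if tapp t 1 = 1 then (1, 0) else if tapp t 1 = 2 then (0, -1) else if tapp t 1 = 3 then (-1, 0) else (0, 1))"
text \<open>On \<open>K4_list\<close> this is the sign of the action on {1, 2}, and
  \<open>th_b\<close> is the sign of the action on {3, 4}.\<close>

definition th_a :: "tup \<Rightarrow> int \<times> int" where
  "th_a t = (if tapp t 1 = 1 then 1 else -1, 0)"
definition th_b :: "tup \<Rightarrow> int \<times> int" where
  "th_b t = (if tapp t 3 = 3 then 1 else -1, 0)"
text \<open>Whether the diagonals {1, 3} and {2, 4} of the square are each preserved or are
  exchanged.\<close>

definition th_d1 :: "tup \<Rightarrow> int \<times> int" where
  "th_d1 t = (if tapp t 1 = 1 \<or> tapp t 1 = 3 then 1 else -1, 0)"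
definition th_d2 :: "tup \<Rightarrow> int \<times> int" where
  "th_d2 t = (tsign t * (if tapp t 1 = 1 \<or> tapp t 1 = 3 then 1 else -1), 0)"
text \<open>The symmetries of the square whose vertices 1, 2, 3, 4 are the vectors e1, e2, -e1,
  -e2.\<close>

definition mat_d :: "tup \<Rightarrow> int list list" where
  "mat_d t = [[of_bool (tapp t 1 = 1) - of_bool (tapp t 1 = 3), of_bool (tapp t 2 = 1) - of_bool (tapp t 2 = 3)],
     [of_bool (tapp t 1 = 2) - of_bool (tapp t 1 = 4), of_bool (tapp t 2 = 2) - of_bool (tapp t 2 = 4)]]"

lemma lin_checks: "lin_check (-1, -1) Z3_list th_omega1" "lin_check (-1, -1) Z3_list th_omega2"
  "lin_check (-1, -1) A4_list th_omega1" "lin_check (-1, -1) A4_list th_omega2"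
  "lin_check (-1, 0) Z4_list th_i1" "lin_check (-1, 0) Z4_list th_i2"
  "lin_check (0, 0) K4_list th_a" "lin_check (0, 0) K4_list th_b"
  "lin_check (0, 0) D4_list th_d1" "lin_check (0, 0) D4_list th_d2"
  by code_simp+

lemma int_check_D4: "int_check 2 D4_list mat_d"
  by code_simp

lemma module_check_square:
  "module_check n T Q U \<Longrightarrow> square_list n T" "module_check n T Q U \<Longrightarrow> square_list n Q"
  "module_check n T Q U \<Longrightarrow> square_list n U"
  by (simp_all add: module_check_def)

lemmas omega_data = rep_data_lin[OF _ omega_square]
lemma i_data: "lin_check (-1, 0) L th \<Longrightarrow> rep_data \<i> L (lin_rep \<i> th) th 1"
  by (rule rep_data_lin[of "-1" 0]) auto
lemma zero_data: "lin_check (0, 0) L th \<Longrightarrow> rep_data 0 L (lin_rep 0 th) th 1"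
  by (rule rep_data_lin[of 0 0]) auto

section \<open>The modules r(H)\<close>

lemma M11_Z1: "categorified_by_Rep M11 Z1_sub"
  unfolding M11_def Z1_sub_eq
proof (rule categorified_by_Rep_check[OF closed_lists(1), where w = "0" and u = "0" and v = "0" and s = id and
    xs = "[irr_entry One]"])
  show "table_check (0, 0) Z1_list (map (fst \<circ> snd) [irr_entry One]) (\<lambda>_. 1) id
    [[1]]
    [[2]]
    [[3]]"
    unfolding list.map comp_def fst_conv snd_conv by code_simp
  show "vanish_check Z1_list (map (fst \<circ> snd) [irr_entry One])
    (map (snd \<circ> snd) [irr_entry One]) (\<lambda>_. 1)"
    unfolding list.map comp_def fst_conv snd_conv by code_simp
qed (use rep_data_irrs[OF closed_lists(1)] module_check_square[OF module_check_M11] omega_square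
   in \<open>auto simp del: tchi.simps\<close>)

lemma M22_Z2: "categorified_by_Rep M22 Z2_sub"
  unfolding M22_def Z2_sub_eq
proof (rule categorified_by_Rep_check[OF closed_lists(2), where w = "0" and u = "0" and v = "0" and s = id and
    xs = "[irr_entry One, irr_entry Psi]"])
  show "table_check (0, 0) Z2_list (map (fst \<circ> snd) [irr_entry One, irr_entry Psi]) (\<lambda>_. 1) id
    [[0,1],[1,0]]
    [[1,1],[1,1]]
    [[2,1],[1,2]]"
    unfolding list.map comp_def fst_conv snd_conv by code_simp
  show "vanish_check Z2_list (map (fst \<circ> snd) [irr_entry One, irr_entry Psi])
    (map (snd \<circ> snd) [irr_entry One, irr_entry Psi]) (\<lambda>_. 1)"
    unfolding list.map comp_def fst_conv snd_conv by code_simp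
qed (use rep_data_irrs[OF closed_lists(2)] module_check_square[OF module_check_M22] omega_square
   in \<open>auto simp del: tchi.simps\<close>)

text \<open>Restricted to the group of a transposition, \<open>Rho2\<close> is twice the trivial
  plus once the sign character, and \<open>Rho3\<close> the other way round. Hence the category of
  \<open>M22\<close> also gives \<open>M23\<close>, after the exchange.\<close>

lemma M23_Z2: "categorified_by_Rep M23 Z2_sub"
  unfolding M23_def Z2_sub_eq
proof (rule categorified_by_Rep_check[OF closed_lists(2), where w = "0" and u = "0" and v = "0" and s = swap_rho and
    xs = "[irr_entry One, irr_entry Psi]"])
  show "table_check (0, 0) Z2_list (map (fst \<circ> snd) [irr_entry One, irr_entry Psi]) (\<lambda>_. 1) swap_rho
    [[0,1],[1,0]]
    [[1,1],[1,1]]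
    [[1,2],[2,1]]"
    unfolding list.map comp_def fst_conv snd_conv by code_simp
  show "vanish_check Z2_list (map (fst \<circ> snd) [irr_entry One, irr_entry Psi])
    (map (snd \<circ> snd) [irr_entry One, irr_entry Psi]) (\<lambda>_. 1)"
    unfolding list.map comp_def fst_conv snd_conv by code_simp
qed (use rep_data_irrs[OF closed_lists(2)] module_check_square[OF module_check_M23] omega_square
   in \<open>auto simp del: tchi.simps\<close>)

lemma M31_Z3: "categorified_by_Rep M31 Z3_sub"
  unfolding M31_def Z3_sub_eq
proof (rule categorified_by_Rep_check[OF closed_lists(3), where w = "omega" and u = "- 1" and v = "- 1" and s = id and
    xs = "[irr_entry One, lin_entry omega th_omega1, lin_entry omega th_omega2]"])
  show "table_check (- 1, - 1) Z3_list (map (fst \<circ> snd) [irr_entry One, lin_entry omega th_omega1, lin_entry omega th_omega2]) (\<lambda>_. 1) id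
    [[1,0,0],[0,1,0],[0,0,1]]
    [[0,1,1],[1,0,1],[1,1,0]]
    [[1,1,1],[1,1,1],[1,1,1]]"
    unfolding list.map comp_def fst_conv snd_conv by code_simp
  show "vanish_check Z3_list (map (fst \<circ> snd) [irr_entry One, lin_entry omega th_omega1, lin_entry omega th_omega2])
    (map (snd \<circ> snd) [irr_entry One, lin_entry omega th_omega1, lin_entry omega th_omega2]) (\<lambda>_. 1)"
    unfolding list.map comp_def fst_conv snd_conv by code_simp
qed (use rep_data_irrs[OF closed_lists(3)] module_check_square[OF module_check_M31] omega_square
  omega_data[OF lin_checks(1)] omega_data[OF lin_checks(2)] in \<open>auto simp del: tchi.simps\<close>)

lemma M32_S3: "categorified_by_Rep M32 S3_sub"
  unfolding M32_def S3_sub_eq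
proof (rule categorified_by_Rep_check[OF closed_lists(6), where w = "0" and u = "0" and v = "0" and s = id and
    xs = "[irr_entry One, irr_entry Psi, irr_entry Rho1]"])
  show "table_check (0, 0) S3_list (map (fst \<circ> snd) [irr_entry One, irr_entry Psi, irr_entry Rho1]) (\<lambda>_. 1) id
    [[0,1,0],[1,0,0],[0,0,1]]
    [[0,0,1],[0,0,1],[1,1,1]]
    [[1,0,1],[0,1,1],[1,1,2]]"
    unfolding list.map comp_def fst_conv snd_conv by code_simp
  show "vanish_check S3_list (map (fst \<circ> snd) [irr_entry One, irr_entry Psi, irr_entry Rho1])
    (map (snd \<circ> snd) [irr_entry One, irr_entry Psi, irr_entry Rho1]) (\<lambda>_. 1)"
    unfolding list.map comp_def fst_conv snd_conv by code_simp
qed (use rep_data_irrs[OF closed_lists(6)] module_check_square[OF module_check_M32] omega_square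
   in \<open>auto simp del: tchi.simps\<close>)

lemma M33_S3: "categorified_by_Rep M33 S3_sub"
  unfolding M33_def S3_sub_eq
proof (rule categorified_by_Rep_check[OF closed_lists(6), where w = "0" and u = "0" and v = "0" and s = swap_rho and
    xs = "[irr_entry One, irr_entry Psi, irr_entry Rho1]"])
  show "table_check (0, 0) S3_list (map (fst \<circ> snd) [irr_entry One, irr_entry Psi, irr_entry Rho1]) (\<lambda>_. 1) swap_rho
    [[0,1,0],[1,0,0],[0,0,1]]
    [[0,0,1],[0,0,1],[1,1,1]]
    [[0,1,1],[1,0,1],[1,1,2]]"
    unfolding list.map comp_def fst_conv snd_conv by code_simp
  show "vanish_check S3_list (map (fst \<circ> snd) [irr_entry One, irr_entry Psi, irr_entry Rho1])
    (map (snd \<circ> snd) [irr_entry One, irr_entry Psi, irr_entry Rho1]) (\<lambda>_. 1)"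
    unfolding list.map comp_def fst_conv snd_conv by code_simp
qed (use rep_data_irrs[OF closed_lists(6)] module_check_square[OF module_check_M33] omega_square
   in \<open>auto simp del: tchi.simps\<close>)

lemma M41_A4: "categorified_by_Rep M41 A4_sub"
  unfolding M41_def A4_sub_eq
proof (rule categorified_by_Rep_check[OF closed_lists(8), where w = "omega" and u = "- 1" and v = "- 1" and s = id and
    xs = "[irr_entry One, irr_entry Rho2, lin_entry omega th_omega1, lin_entry omega th_omega2]"])
  show "table_check (- 1, - 1) A4_list (map (fst \<circ> snd) [irr_entry One, irr_entry Rho2, lin_entry omega th_omega1, lin_entry omega th_omega2]) (\<lambda>_. 1) id
    [[1,0,0,0],[0,1,0,0],[0,0,1,0],[0,0,0,1]]
    [[0,0,1,1],[0,2,0,0],[1,0,0,1],[1,0,1,0]]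
    [[0,1,0,0],[1,2,1,1],[0,1,0,0],[0,1,0,0]]"
    unfolding list.map comp_def fst_conv snd_conv by code_simp
  show "vanish_check A4_list (map (fst \<circ> snd) [irr_entry One, irr_entry Rho2, lin_entry omega th_omega1, lin_entry omega th_omega2])
    (map (snd \<circ> snd) [irr_entry One, irr_entry Rho2, lin_entry omega th_omega1, lin_entry omega th_omega2]) (\<lambda>_. 1)"
    unfolding list.map comp_def fst_conv snd_conv by code_simp
qed (use rep_data_irrs[OF closed_lists(8)] module_check_square[OF module_check_M41] omega_square
  omega_data[OF lin_checks(3)] omega_data[OF lin_checks(4)] in \<open>auto simp del: tchi.simps\<close>)

lemma M45_Z4: "categorified_by_Rep M45 Z4_sub"
  unfolding M45_def Z4_sub_eq
proof (rule categorified_by_Rep_check[OF closed_lists(4), where w = "\<i>" and u = "- 1" and v = "0" and s = id and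
    xs = "[irr_entry One, irr_entry Psi, lin_entry \<i> th_i1, lin_entry \<i> th_i2]"])
  show "table_check (- 1, 0) Z4_list (map (fst \<circ> snd) [irr_entry One, irr_entry Psi, lin_entry \<i> th_i1, lin_entry \<i> th_i2]) (\<lambda>_. 1) id
    [[0,1,0,0],[1,0,0,0],[0,0,0,1],[0,0,1,0]]
    [[1,1,0,0],[1,1,0,0],[0,0,1,1],[0,0,1,1]]
    [[0,1,1,1],[1,0,1,1],[1,1,0,1],[1,1,1,0]]"
    unfolding list.map comp_def fst_conv snd_conv by code_simp
  show "vanish_check Z4_list (map (fst \<circ> snd) [irr_entry One, irr_entry Psi, lin_entry \<i> th_i1, lin_entry \<i> th_i2])
    (map (snd \<circ> snd) [irr_entry One, irr_entry Psi, lin_entry \<i> th_i1, lin_entry \<i> th_i2]) (\<lambda>_. 1)"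
    unfolding list.map comp_def fst_conv snd_conv by code_simp
qed (use rep_data_irrs[OF closed_lists(4)] module_check_square[OF module_check_M45] omega_square
  i_data[OF lin_checks(5)] i_data[OF lin_checks(6)] in \<open>auto simp del: tchi.simps\<close>)

lemma M47_Z4: "categorified_by_Rep M47 Z4_sub"
  unfolding M47_def Z4_sub_eq
proof (rule categorified_by_Rep_check[OF closed_lists(4), where w = "\<i>" and u = "- 1" and v = "0" and s = swap_rho and
    xs = "[irr_entry One, irr_entry Psi, lin_entry \<i> th_i1, lin_entry \<i> th_i2]"])
  show "table_check (- 1, 0) Z4_list (map (fst \<circ> snd) [irr_entry One, irr_entry Psi, lin_entry \<i> th_i1, lin_entry \<i> th_i2]) (\<lambda>_. 1) swap_rho
    [[0,1,0,0],[1,0,0,0],[0,0,0,1],[0,0,1,0]]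
    [[1,1,0,0],[1,1,0,0],[0,0,1,1],[0,0,1,1]]
    [[1,0,1,1],[0,1,1,1],[1,1,1,0],[1,1,0,1]]"
    unfolding list.map comp_def fst_conv snd_conv by code_simp
  show "vanish_check Z4_list (map (fst \<circ> snd) [irr_entry One, irr_entry Psi, lin_entry \<i> th_i1, lin_entry \<i> th_i2])
    (map (snd \<circ> snd) [irr_entry One, irr_entry Psi, lin_entry \<i> th_i1, lin_entry \<i> th_i2]) (\<lambda>_. 1)"
    unfolding list.map comp_def fst_conv snd_conv by code_simp
qed (use rep_data_irrs[OF closed_lists(4)] module_check_square[OF module_check_M47] omega_square
  i_data[OF lin_checks(5)] i_data[OF lin_checks(6)] in \<open>auto simp del: tchi.simps\<close>)

text \<open>Over \<open>K4_sub\<close> the representation \<open>Rho2\<close> contains the trivial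
  character and not the sign; over \<open>Z4_sub\<close> it contains the sign and not the trivial
  character. So the exchange is applied to \<open>M45\<close> here, but to \<open>M47\<close> for
  \<open>Z4_sub\<close>.\<close>

lemma M45_K4: "categorified_by_Rep M45 K4_sub"
  unfolding M45_def K4_sub_eq
proof (rule categorified_by_Rep_check[OF closed_lists(5), where w = "0" and u = "0" and v = "0" and s = swap_rho and
    xs = "[irr_entry One, irr_entry Psi, lin_entry 0 th_a, lin_entry 0 th_b]"])
  show "table_check (0, 0) K4_list (map (fst \<circ> snd) [irr_entry One, irr_entry Psi, lin_entry 0 th_a, lin_entry 0 th_b]) (\<lambda>_. 1) swap_rho
    [[0,1,0,0],[1,0,0,0],[0,0,0,1],[0,0,1,0]]
    [[1,1,0,0],[1,1,0,0],[0,0,1,1],[0,0,1,1]]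
    [[0,1,1,1],[1,0,1,1],[1,1,0,1],[1,1,1,0]]"
    unfolding list.map comp_def fst_conv snd_conv by code_simp
  show "vanish_check K4_list (map (fst \<circ> snd) [irr_entry One, irr_entry Psi, lin_entry 0 th_a, lin_entry 0 th_b])
    (map (snd \<circ> snd) [irr_entry One, irr_entry Psi, lin_entry 0 th_a, lin_entry 0 th_b]) (\<lambda>_. 1)"
    unfolding list.map comp_def fst_conv snd_conv by code_simp
qed (use rep_data_irrs[OF closed_lists(5)] module_check_square[OF module_check_M45] omega_square
  zero_data[OF lin_checks(7)] zero_data[OF lin_checks(8)] in \<open>auto simp del: tchi.simps\<close>)

lemma M47_K4: "categorified_by_Rep M47 K4_sub"
  unfolding M47_def K4_sub_eq
proof (rule categorified_by_Rep_check[OF closed_lists(5), where w = "0" and u = "0" and v = "0" and s = id and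
    xs = "[irr_entry One, irr_entry Psi, lin_entry 0 th_a, lin_entry 0 th_b]"])
  show "table_check (0, 0) K4_list (map (fst \<circ> snd) [irr_entry One, irr_entry Psi, lin_entry 0 th_a, lin_entry 0 th_b]) (\<lambda>_. 1) id
    [[0,1,0,0],[1,0,0,0],[0,0,0,1],[0,0,1,0]]
    [[1,1,0,0],[1,1,0,0],[0,0,1,1],[0,0,1,1]]
    [[1,0,1,1],[0,1,1,1],[1,1,1,0],[1,1,0,1]]"
    unfolding list.map comp_def fst_conv snd_conv by code_simp
  show "vanish_check K4_list (map (fst \<circ> snd) [irr_entry One, irr_entry Psi, lin_entry 0 th_a, lin_entry 0 th_b])
    (map (snd \<circ> snd) [irr_entry One, irr_entry Psi, lin_entry 0 th_a, lin_entry 0 th_b]) (\<lambda>_. 1)"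
    unfolding list.map comp_def fst_conv snd_conv by code_simp
qed (use rep_data_irrs[OF closed_lists(5)] module_check_square[OF module_check_M47] omega_square
  zero_data[OF lin_checks(7)] zero_data[OF lin_checks(8)] in \<open>auto simp del: tchi.simps\<close>)

text \<open>The simple modules are listed in the basis order of \<open>M51\<close>, where
  \<open>Rho2\<close> sends the first basis vector to the fourth and \<open>Rho3\<close> sends it to
  the third.\<close>

lemma M51_S4: "categorified_by_Rep M51 S4_sub"
  unfolding M51_def S4_sub_eq
proof (rule categorified_by_Rep_check[OF closed_perms4, where w = "0" and u = "0" and v = "0" and s = id and
    xs = "[irr_entry One, irr_entry Psi, irr_entry Rho3, irr_entry Rho2, irr_entry Rho1]"])
  show "table_check (0, 0) perms4 (map (fst \<circ> snd) [irr_entry One, irr_entry Psi, irr_entry Rho3, irr_entry Rho2, irr_entry Rho1]) (\<lambda>_. 1) id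
    [[0,1,0,0,0],[1,0,0,0,0],[0,0,0,1,0],[0,0,1,0,0],[0,0,0,0,1]]
    [[0,0,0,0,1],[0,0,0,0,1],[0,0,1,1,0],[0,0,1,1,0],[1,1,0,0,1]]
    [[0,0,0,1,0],[0,0,1,0,0],[0,1,1,1,1],[1,0,1,1,1],[0,0,1,1,0]]"
    unfolding list.map comp_def fst_conv snd_conv by code_simp
  show "vanish_check perms4 (map (fst \<circ> snd) [irr_entry One, irr_entry Psi, irr_entry Rho3, irr_entry Rho2, irr_entry Rho1])
    (map (snd \<circ> snd) [irr_entry One, irr_entry Psi, irr_entry Rho3, irr_entry Rho2, irr_entry Rho1]) (\<lambda>_. 1)"
    unfolding list.map comp_def fst_conv snd_conv by code_simp
qed (use rep_data_irrs[OF closed_perms4] module_check_square[OF module_check_M51] omega_square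
   in \<open>auto simp del: tchi.simps\<close>)

text \<open>\<open>Rho2\<close> restricted to the dihedral group is the sum of \<open>th_d1\<close>
  and the two-dimensional representation. This fixes which of the two remaining characters is the
  fourth basis vector.\<close>

lemma M52_D4: "categorified_by_Rep M52 D4_sub"
  unfolding M52_def D4_sub_eq
proof (rule categorified_by_Rep_check[OF closed_lists(7), where w = "0" and u = "0" and v = "0" and s = id and
    xs = "[irr_entry One, irr_entry Psi, lin_entry 0 th_d2, lin_entry 0 th_d1, (int_rep 2 mat_d, \<lambda>t. (list_trace 2 (mat_d t), 0), 2)]"])
  show "table_check (0, 0) D4_list (map (fst \<circ> snd) [irr_entry One, irr_entry Psi, lin_entry 0 th_d2, lin_entry 0 th_d1, (int_rep 2 mat_d, \<lambda>t. (list_trace 2 (mat_d t), 0), 2)]) (\<lambda>_. 1) id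
    [[0,1,0,0,0],[1,0,0,0,0],[0,0,0,1,0],[0,0,1,0,0],[0,0,0,0,1]]
    [[1,1,0,0,0],[1,1,0,0,0],[0,0,1,1,0],[0,0,1,1,0],[0,0,0,0,2]]
    [[0,0,0,1,1],[0,0,1,0,1],[0,1,0,0,1],[1,0,0,0,1],[1,1,1,1,1]]"
    unfolding list.map comp_def fst_conv snd_conv by code_simp
  show "vanish_check D4_list (map (fst \<circ> snd) [irr_entry One, irr_entry Psi, lin_entry 0 th_d2, lin_entry 0 th_d1, (int_rep 2 mat_d, \<lambda>t. (list_trace 2 (mat_d t), 0), 2)])
    (map (snd \<circ> snd) [irr_entry One, irr_entry Psi, lin_entry 0 th_d2, lin_entry 0 th_d1, (int_rep 2 mat_d, \<lambda>t. (list_trace 2 (mat_d t), 0), 2)]) (\<lambda>_. 1)"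
    unfolding list.map comp_def fst_conv snd_conv by code_simp
qed (use rep_data_irrs[OF closed_lists(7)] module_check_square[OF module_check_M52] omega_square
  zero_data[OF lin_checks(9)] zero_data[OF lin_checks(10)] rep_data_int[OF int_check_D4] in \<open>auto simp del: tchi.simps\<close>)

section \<open>Second cohomology\<close>

text \<open>Free of division and of extensionality, this condition applies to powers of a cocycle
  and, with the same \<alpha>, to subgroups of H.\<close>

definition is_cob :: "perm4 set \<Rightarrow> (perm4 \<times> perm4 \<Rightarrow> complex) \<Rightarrow> bool" where
  "is_cob H \<alpha> \<longleftrightarrow> (\<exists>\<mu>. (\<forall>h\<in>H. \<mu> h \<noteq> 0) \<and> (\<forall>g\<in>H. \<forall>h\<in>H. \<alpha> (g, h) * \<mu> (g \<circ> h) = \<mu> g * \<mu> h))"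

text \<open>Monomial consequences of cocycle equations, by commutativity alone. The first multiplies
  two identities; the others serve the transfer. The common factor in the third is nonzero where it
  is applied and is cancelled there.\<close>

lemma mult_eqs:
  fixes a b c d e f g :: complex
  shows "a * b = c * d \<Longrightarrow> e * f = g * h \<Longrightarrow> a * e * (b * f) = c * g * (d * h)"
    "a * b = c * d \<Longrightarrow> d * e = f * g \<Longrightarrow> b * e * a = f * g * c"
    "a * b = c * d \<Longrightarrow> e * f = g * d \<Longrightarrow> h * a = i * e \<Longrightarrow> (i * b * g) * (a * e * d) = (h * c * f) * (a * e * d)"
    "a * b = c * (d * e) \<Longrightarrow> c * f = g * h \<Longrightarrow> a * (f * b) = (g * d) * (h * e)"
proof -
  assume 1: "a * b = c * d" "e * f = g * h"
  have "a * e * (b * f) = (a * b) * (e * f)" by (simp only: mult_ac)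
  then show "a * e * (b * f) = c * g * (d * h)" unfolding 1 by (simp only: mult_ac)
next
  assume 1: "a * b = c * d" "d * e = f * g"
  have "b * e * a = (a * b) * e" by (simp only: mult_ac)
  also have "\<dots> = (d * e) * c" unfolding 1(1) by (simp only: mult_ac)
  finally show "b * e * a = f * g * c" unfolding 1(2) .
next
  assume 1: "a * b = c * d" "e * f = g * d" "h * a = i * e"
  have "(i * b * g) * (a * e * d) = (i * e) * (a * b) * (g * d)" by (simp only: mult_ac)
  also have "\<dots> = (h * a) * (c * d) * (e * f)" unfolding 1 by (rule refl)
  finally show "(i * b * g) * (a * e * d) = (h * c * f) * (a * e * d)" by (simp only: mult_ac)
next
  assume 1: "a * b = c * (d * e)" "c * f = g * h"
  have "a * (f * b) = (a * b) * f" by (simp only: mult_ac)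
  also have "\<dots> = (c * f) * (d * e)" unfolding 1(1) by (simp only: mult_ac)
  finally show "a * (f * b) = (g * d) * (h * e)" unfolding 1(2) by (simp only: mult_ac)
qed

lemma complex_cube_root: "\<exists>z::complex. w = z ^ 3"
proof
  show "w = rcis (root 3 (cmod w)) (Arg w / 3) ^ 3"
    by (simp add: DeMoivre2 rcis_cmod_Arg)
qed

lemma is_cob_mult: "is_cob H \<alpha> \<Longrightarrow> is_cob H \<beta> \<Longrightarrow> is_cob H (\<lambda>p. \<alpha> p * \<beta> p)"
proof -
  assume "is_cob H \<alpha>" "is_cob H \<beta>"
  then obtain \<mu> \<nu> where \<mu>: "\<And>h. h \<in> H \<Longrightarrow> \<mu> h \<noteq> 0" "\<And>g h. g \<in> H \<Longrightarrow> h \<in> H \<Longrightarrow> \<alpha> (g, h) * \<mu> (g \<circ> h) = \<mu> g * \<mu> h"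
    and \<nu>: "\<And>h. h \<in> H \<Longrightarrow> \<nu> h \<noteq> 0" "\<And>g h. g \<in> H \<Longrightarrow> h \<in> H \<Longrightarrow> \<beta> (g, h) * \<nu> (g \<circ> h) = \<nu> g * \<nu> h"
    unfolding is_cob_def by blast
  have "\<alpha> (g, h) * \<beta> (g, h) * (\<mu> (g \<circ> h) * \<nu> (g \<circ> h)) = \<mu> g * \<nu> g * (\<mu> h * \<nu> h)"
    if "g \<in> H" "h \<in> H" for g h
    by (rule mult_eqs(1)[OF \<mu>(2)[OF that] \<nu>(2)[OF that]])
  then show ?thesis using \<mu>(1) \<nu>(1) unfolding is_cob_def by (intro exI[of _ "\<lambda>h. \<mu> h * \<nu> h"]) simp
qed

lemma is_cob_power: "is_cob H \<alpha> \<Longrightarrow> is_cob H (\<lambda>p. \<alpha> p ^ k)"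
proof -
  assume "is_cob H \<alpha>"
  then obtain \<mu> where "\<forall>h\<in>H. \<mu> h \<noteq> 0" "\<forall>g\<in>H. \<forall>h\<in>H. \<alpha> (g, h) * \<mu> (g \<circ> h) = \<mu> g * \<mu> h"
    unfolding is_cob_def by blast
  then show ?thesis unfolding is_cob_def
    by (intro exI[of _ "\<lambda>h. \<mu> h ^ k"]) (simp flip: power_mult_distrib)
qed

lemma is_cob_inverse:
  "is_cob H \<alpha> \<Longrightarrow> (\<And>g h. g \<in> H \<Longrightarrow> h \<in> H \<Longrightarrow> g \<circ> h \<in> H) \<Longrightarrow> is_cob H (\<lambda>p. inverse (\<alpha> p))"
proof -
  assume "is_cob H \<alpha>" and cl: "\<And>g h. g \<in> H \<Longrightarrow> h \<in> H \<Longrightarrow> g \<circ> h \<in> H"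
  then obtain \<mu> where \<mu>: "\<And>h. h \<in> H \<Longrightarrow> \<mu> h \<noteq> 0" "\<And>g h. g \<in> H \<Longrightarrow> h \<in> H \<Longrightarrow> \<alpha> (g, h) * \<mu> (g \<circ> h) = \<mu> g * \<mu> h"
    unfolding is_cob_def by blast
  have "inverse (\<alpha> (g, h)) * inverse (\<mu> (g \<circ> h)) = inverse (\<mu> g) * inverse (\<mu> h)" if "g \<in> H" "h \<in> H" for g h
    using \<mu>(2)[OF that] by (metis inverse_mult_distrib)
  then show ?thesis using \<mu>(1) unfolding is_cob_def by (intro exI[of _ "\<lambda>h. inverse (\<mu> h)"]) simp
qed

lemma is_cob_cong: "(\<And>g h. g \<in> H \<Longrightarrow> h \<in> H \<Longrightarrow> \<alpha> (g, h) = \<beta> (g, h)) \<Longrightarrow> is_cob H \<alpha> = is_cob H \<beta>"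
  by (simp add: is_cob_def)

lemma coboundaries_iff:
  assumes "\<alpha> \<in> carrier (cocycle_group H)" "\<And>g h. g \<in> H \<Longrightarrow> h \<in> H \<Longrightarrow> g \<circ> h \<in> H"
  shows "\<alpha> \<in> coboundaries H \<longleftrightarrow> is_cob H \<alpha>"
proof
  assume "\<alpha> \<in> coboundaries H"
  then obtain \<mu> where "\<alpha> = (\<lambda>(g, h)\<in>H \<times> H. \<mu> g * \<mu> h / \<mu> (g \<circ> h))" "\<forall>h\<in>H. \<mu> h \<noteq> 0"
    unfolding coboundaries_def by blast
  then show "is_cob H \<alpha>" unfolding is_cob_def using assms(2) by (intro exI[of _ \<mu>]) simp
next
  assume "is_cob H \<alpha>"
  then obtain \<mu> where \<mu>: "\<forall>h\<in>H. \<mu> h \<noteq> 0" "\<forall>g\<in>H. \<forall>h\<in>H. \<alpha> (g, h) * \<mu> (g \<circ> h) = \<mu> g * \<mu> h"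
    unfolding is_cob_def by blast
  have "\<alpha> = (\<lambda>(g, h)\<in>H \<times> H. \<mu> g * \<mu> h / \<mu> (g \<circ> h))"
  proof
    fix p
    show "\<alpha> p = (\<lambda>(g, h)\<in>H \<times> H. \<mu> g * \<mu> h / \<mu> (g \<circ> h)) p"
    proof (cases "p \<in> H \<times> H")
      case True
      then obtain g h where gh: "p = (g, h)" "g \<in> H" "h \<in> H" by blast
      then show ?thesis using \<mu> assms(2) by (simp add: nonzero_eq_divide_eq)
    next
      case False
      then show ?thesis using assms(1) by (cases p) (auto simp: cocycle_group_def PiE_def extensional_def)
    qed
  qed
  then show "\<alpha> \<in> coboundaries H" using \<mu>(1) unfolding coboundaries_def by blast
qed

text \<open>\<alpha> is the quotient of two consecutive powers. Such powers come from transfer out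
  of subgroups of coprime index.\<close>

lemma is_cob_if_powers:
  assumes cob: "is_cob H (\<lambda>p. \<alpha> p ^ Suc x)" "is_cob H (\<lambda>p. \<alpha> p ^ x)"
    and cl: "\<And>g h. g \<in> H \<Longrightarrow> h \<in> H \<Longrightarrow> g \<circ> h \<in> H" and nz: "\<And>g h. g \<in> H \<Longrightarrow> h \<in> H \<Longrightarrow> \<alpha> (g, h) \<noteq> 0"
  shows "is_cob H \<alpha>"
proof -
  have "is_cob H (\<lambda>p. \<alpha> p ^ Suc x * inverse (\<alpha> p ^ x))"
    by (rule is_cob_mult[OF cob(1) is_cob_inverse[OF cob(2) cl]])
  then show ?thesis using nz by (subst is_cob_cong[of H _ "\<lambda>p. \<alpha> p ^ Suc x * inverse (\<alpha> p ^ x)"]) simp_all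
qed

context twisted_group
begin

text \<open>Transfer: after normalization \<open>\<alpha> (g, h)\<close> depends only on the coset \<open>h P\<close>; the product of the
  cocycle identity over all cosets \<open>k P\<close> then exhibits a power of \<open>\<alpha>\<close> as a coboundary.\<close>

lemma is_cob_transfer:
  assumes P: "subgroup P S4" "P \<subseteq> H" and cob: "is_cob P \<alpha>"
  shows "is_cob H (\<lambda>p. \<alpha> p ^ (card H div card P))"
proof -
  interpret P: perm_group P using P(1) by (rule perm_group.intro)
  obtain \<mu> where \<mu>0: "\<And>p. p \<in> P \<Longrightarrow> \<mu> p \<noteq> 0" and \<mu>: "\<And>p q. p \<in> P \<Longrightarrow> q \<in> P \<Longrightarrow> \<alpha> (p, q) * \<mu> (p \<circ> q) = \<mu> p * \<mu> q"
    using cob unfolding is_cob_def by blast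
  have PH: "p \<in> H" if "p \<in> P" for p using that P by auto
  define C where "C h = (\<lambda>p. h \<circ> p) ` P" for h :: perm4
  have Cp: "C (h \<circ> p) = C h" if p: "p \<in> P" for h p
  proof
    show "C (h \<circ> p) \<subseteq> C h" using p by (auto simp: C_def comp_assoc)
    show "C h \<subseteq> C (h \<circ> p)"
    proof
      fix y assume "y \<in> C h"
      then obtain q where q: "q \<in> P" "y = h \<circ> q" by (auto simp: C_def)
      then have "y = h \<circ> p \<circ> (pinv p \<circ> q)" using p by (simp add: comp_assoc)
      moreover have "pinv p \<circ> q \<in> P" using p q by simp
      ultimately show "y \<in> C (h \<circ> p)" unfolding C_def by blast
    qed
  qed
  have Cself: "h \<in> C h" for h unfolding C_def by (rule image_eqI[of _ _ id]) auto
  have Cmem: "C k = C h \<and> k \<in> H" if "k \<in> C h" "h \<in> H" for h k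
    using that Cp PH by (auto simp: C_def[of h])
  \<comment> \<open>A representative of the coset of \<open>h\<close>; with the component
    \<open>q h\<close> in \<open>P\<close> below, \<open>h\<close> is
    \<open>t h \<circ> q h\<close>.\<close>
  define t where "t h = (SOME k. k \<in> C h)" for h
  have tC: "t h \<in> C h" for h unfolding t_def by (rule someI[of "\<lambda>k. k \<in> C h", OF Cself])
  have tH: "t h \<in> H" if "h \<in> H" for h using Cmem[OF tC that] by blast
  have tp: "t (h \<circ> p) = t h" if "p \<in> P" for h p by (simp add: t_def Cp[OF that])
  define q where "q h = pinv (t h) \<circ> h" for h
  have q: "q h \<in> P" "t h \<circ> q h = h" if h: "h \<in> H" for h
  proof -
    obtain p where p: "p \<in> P" "t h = h \<circ> p" using tC[of h] by (auto simp: C_def)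
    have "q h = pinv p"
    proof -
      have "t h \<circ> (q h) = h" unfolding q_def using tH[OF h] by simp
      then have "h \<circ> (p \<circ> q h) = h" by (simp add: p comp_assoc)
      then have "pinv h \<circ> (h \<circ> (p \<circ> q h)) = pinv h \<circ> h" by simp
      then have "p \<circ> q h = id" using h by simp
      then have "pinv p \<circ> (p \<circ> q h) = pinv p" by simp
      then show ?thesis using p(1) by simp
    qed
    then show "q h \<in> P" using p by simp
    show "t h \<circ> q h = h" unfolding q_def using tH[OF h] by simp
  qed
  have qp: "q (h \<circ> p) = q h \<circ> p" if "p \<in> P" for h p by (simp add: q_def tp[OF that] comp_assoc)
  \<comment> \<open>Dividing lifts by \<open>\<nu>\<close> makes the lift of \<open>h\<close> the
    product of the lift of \<open>t h\<close> and the lift of \<open>q h\<close> divided by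
    \<open>\<mu>\<close>. Right multiplication by the rescaled lifts of \<open>P\<close> then
    carries no factor, which is \<open>\<nu>p\<close>.\<close>
  define \<nu> where "\<nu> h = \<mu> (q h) / \<alpha> (t h, q h)" for h
  have \<nu>0: "\<nu> h \<noteq> 0" if "h \<in> H" for h using that q tH PH \<mu>0 by (simp add: \<nu>_def)
  have \<nu>p: "\<alpha> (g, p) * \<nu> (g \<circ> p) = \<nu> g * \<mu> p" if g: "g \<in> H" and p: "p \<in> P" for g p
  proof -
    let ?t = "t g" and ?q = "q g"
    have m: "?t \<in> H" "?q \<in> P" "?q \<in> H" "p \<in> H" "?q \<circ> p \<in> P" "?q \<circ> p \<in> H" using g p tH q PH by simp_all
    have c: "\<alpha> (?t, ?q) * \<alpha> (g, p) = \<alpha> (?t, ?q \<circ> p) * \<alpha> (?q, p)"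
      using cocycle_eq[of ?t ?q p] m q(2)[OF g] by simp
    have u: "\<alpha> (?q, p) * \<mu> (?q \<circ> p) = \<mu> ?q * \<mu> p" by (rule \<mu>[OF m(2) p])
    have n: "\<alpha> (?t, ?q) \<noteq> 0" "\<alpha> (?t, ?q \<circ> p) \<noteq> 0" using m by simp_all
    have "\<alpha> (g, p) * \<mu> (?q \<circ> p) * \<alpha> (?t, ?q) = \<mu> ?q * \<mu> p * \<alpha> (?t, ?q \<circ> p)"
      by (rule mult_eqs(2)[OF c u])
    then show ?thesis using n by (simp add: \<nu>_def tp[OF p] qp[OF p] field_simps)
  qed
  \<comment> \<open>The quotient of \<alpha> by the coboundary of \<open>\<nu>\<close>; its second
    argument matters only modulo \<open>P\<close>.\<close>
  define \<beta> where "\<beta> g h = \<alpha> (g, h) * \<nu> (g \<circ> h) / (\<nu> g * \<nu> h)" for g h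
  have \<beta>p: "\<beta> g (h \<circ> p) = \<beta> g h" if gh: "g \<in> H" "h \<in> H" and p: "p \<in> P" for g h p
  proof -
    have m: "g \<circ> h \<in> H" "h \<circ> p \<in> H" "p \<in> H" using gh p PH by simp_all
    have 1: "\<alpha> (g \<circ> h, p) * \<nu> (g \<circ> (h \<circ> p)) = \<nu> (g \<circ> h) * \<mu> p" using \<nu>p[OF m(1) p] by (simp add: comp_assoc)
    have 2: "\<alpha> (h, p) * \<nu> (h \<circ> p) = \<nu> h * \<mu> p" by (rule \<nu>p[OF gh(2) p])
    have 3: "\<alpha> (g, h) * \<alpha> (g \<circ> h, p) = \<alpha> (g, h \<circ> p) * \<alpha> (h, p)" by (rule cocycle_eq[OF gh m(3)])
    have nz: "\<nu> g \<noteq> 0" "\<nu> h \<noteq> 0" "\<nu> (h \<circ> p) \<noteq> 0" "\<mu> p \<noteq> 0" "\<alpha> (g \<circ> h, p) \<noteq> 0" "\<alpha> (h, p) \<noteq> 0"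
      using \<nu>0 \<mu>0 gh m p by simp_all
    have "(\<alpha> (g, h \<circ> p) * \<nu> (g \<circ> (h \<circ> p)) * \<nu> h) * (\<alpha> (g \<circ> h, p) * \<alpha> (h, p) * \<mu> p) =
        (\<alpha> (g, h) * \<nu> (g \<circ> h) * \<nu> (h \<circ> p)) * (\<alpha> (g \<circ> h, p) * \<alpha> (h, p) * \<mu> p)"
      by (rule mult_eqs(3)[OF 1 2 3])
    then have "\<alpha> (g, h \<circ> p) * \<nu> (g \<circ> (h \<circ> p)) * \<nu> h = \<alpha> (g, h) * \<nu> (g \<circ> h) * \<nu> (h \<circ> p)"
      using nz by simp
    then show ?thesis using nz by (simp add: \<beta>_def field_simps)
  qed
  have \<beta>c: "\<beta> g h * \<beta> (g \<circ> h) k = \<beta> g (h \<circ> k) * \<beta> h k" if m: "g \<in> H" "h \<in> H" "k \<in> H" for g h k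
  proof -
    have nz: "\<nu> g \<noteq> 0" "\<nu> h \<noteq> 0" "\<nu> k \<noteq> 0" "\<nu> (g \<circ> h) \<noteq> 0" "\<nu> (h \<circ> k) \<noteq> 0" "\<nu> (g \<circ> h \<circ> k) \<noteq> 0"
      using \<nu>0 m by simp_all
    show ?thesis using cocycle_eq[OF m] nz by (simp add: \<beta>_def comp_assoc field_simps)
  qed
  define B where "B g X = \<beta> g (SOME k. k \<in> X)" for g and X :: "perm4 set"
  have B: "B g (C k) = \<beta> g k" if "g \<in> H" "k \<in> H" for g k
  proof -
    have "\<beta> g (t k) = \<beta> g (t k \<circ> q k)" using \<beta>p[OF that(1) tH[OF that(2)] q(1)[OF that(2)]] by simp
    then show ?thesis using q(2)[OF that(2)] by (simp add: B_def t_def[symmetric])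
  qed
  let ?X = "C ` H"
  define m where "m g = (\<Prod>X\<in>?X. B g X)" for g
  have \<beta>0: "\<beta> g h \<noteq> 0" if "g \<in> H" "h \<in> H" for g h using \<nu>0 that by (simp add: \<beta>_def)
  have m0: "m g \<noteq> 0" if "g \<in> H" for g unfolding m_def using \<beta>0 that by (auto simp: B)
  have mm: "\<beta> g h ^ card ?X * m (g \<circ> h) = m g * m h" if gh: "g \<in> H" "h \<in> H" for g h
  proof -
    \<comment> \<open>Left multiplication by \<open>h\<close> permutes the cosets, so in the product
      of the cocycle identity over all cosets the factors \<open>B g\<close> run over every coset
      again.\<close>
    have bij: "bij_betw (\<lambda>X. (\<circ>) h ` X) ?X ?X"
    proof (rule bij_betwI[where g = "\<lambda>X. (\<circ>) (pinv h) ` X"])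
      have Ci: "(\<circ>) k ` C l = C (k \<circ> l)" for k l by (auto simp: C_def comp_assoc image_image)
      show "(\<lambda>X. (\<circ>) h ` X) \<in> ?X \<rightarrow> ?X" "(\<lambda>X. (\<circ>) (pinv h) ` X) \<in> ?X \<rightarrow> ?X" using gh by (auto simp: Ci)
      fix X assume "X \<in> ?X"
      then obtain k where k: "k \<in> H" "X = C k" by blast
      then show "(\<circ>) (pinv h) ` (\<circ>) h ` X = X" "(\<circ>) h ` (\<circ>) (pinv h) ` X = X" using gh by (simp_all add: Ci)
    qed
    have "\<beta> g h ^ card ?X * m (g \<circ> h) = (\<Prod>X\<in>?X. \<beta> g h * B (g \<circ> h) X)" by (simp add: m_def prod.distrib)
    also have "\<dots> = (\<Prod>X\<in>?X. B g ((\<circ>) h ` X) * B h X)"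
    proof (rule prod.cong[OF refl])
      fix X assume "X \<in> ?X"
      then obtain k where k: "k \<in> H" "X = C k" by blast
      have "(\<circ>) h ` X = C (h \<circ> k)" unfolding k(2) by (auto simp: C_def comp_assoc image_image)
      then show "\<beta> g h * B (g \<circ> h) X = B g ((\<circ>) h ` X) * B h X" using \<beta>c[OF gh k(1)] k gh by (simp add: B)
    qed
    also have "\<dots> = m g * m h" unfolding prod.distrib m_def by (simp add: prod.reindex_bij_betw[OF bij])
    finally show ?thesis .
  qed
  have "card ?X * card P = card H"
  proof -
    have inj: "inj_on (\<lambda>p. h \<circ> p) P" if h: "h \<in> H" for h
      by (rule inj_on_inverseI[where g = "\<lambda>k. pinv h \<circ> k"]) (use h in simp)
    have "card P * card ?X = card (\<Union> ?X)"
    proof (rule card_partition)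
      show "finite (\<Union> ?X)" by (auto simp: C_def)
      show "card c = card P" if "c \<in> ?X" for c using that inj by (auto simp: C_def card_image)
      show "c1 \<inter> c2 = {}" if "c1 \<in> ?X" "c2 \<in> ?X" "c1 \<noteq> c2" for c1 c2 using that Cmem by blast
    qed simp
    moreover have "\<Union> ?X = H" using Cself Cmem by blast
    ultimately show ?thesis by (simp add: mult.commute)
  qed
  then have idx: "card H div card P = card ?X" using P.card_pos by (metis div_mult_self_is_m)
  have "\<alpha> (g, h) ^ card ?X * (m (g \<circ> h) * \<nu> (g \<circ> h) ^ card ?X) = (m g * \<nu> g ^ card ?X) * (m h * \<nu> h ^ card ?X)"
    if gh: "g \<in> H" "h \<in> H" for g h
  proof -
    have "\<alpha> (g, h) * \<nu> (g \<circ> h) = \<beta> g h * (\<nu> g * \<nu> h)" using \<nu>0 gh by (simp add: \<beta>_def)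
    then have "\<alpha> (g, h) ^ card ?X * \<nu> (g \<circ> h) ^ card ?X = \<beta> g h ^ card ?X * (\<nu> g ^ card ?X * \<nu> h ^ card ?X)"
      by (simp only: power_mult_distrib[symmetric])
    then show ?thesis by (rule mult_eqs(4)[OF _ mm[OF gh]])
  qed
  then show ?thesis unfolding is_cob_def idx using m0 \<nu>0 by (intro exI[of _ "\<lambda>h. m h * \<nu> h ^ card ?X"]) simp
qed

text \<open>In the twisted group algebra the cube of r is the scalar \<open>\<alpha> (r, r) *
  \<alpha> (r \<circ> r, r) * \<alpha> (id, id)\<close>. Dividing r by a cube root of it gives an
  element with cube 1, whose powers form a multiplicative section.\<close>

lemma is_cob_cyclic3:
  assumes r: "r \<in> H" and r3: "r \<circ> (r \<circ> r) = id" and dist: "r \<noteq> id" "r \<circ> r \<noteq> id" "r \<circ> r \<noteq> r"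
  shows "is_cob {id, r, r \<circ> r} \<alpha>"
proof -
  let ?s = "r \<circ> r" and ?e = "\<alpha> (id, id)"
  have s: "?s \<in> H" using r by simp
  obtain z where z: "\<alpha> (r, r) * \<alpha> (?s, r) * ?e = z ^ 3" using complex_cube_root by metis
  have nz: "\<alpha> (r, r) \<noteq> 0" "\<alpha> (?s, r) \<noteq> 0" "?e \<noteq> 0" using r s by simp_all
  then have z0: "z \<noteq> 0" using z by auto
  have sr: "?s \<circ> r = id" and ss: "?s \<circ> ?s = r" using r3 by (simp_all add: comp_assoc)
  have c1: "\<alpha> (r, ?s) = \<alpha> (?s, r)" using cocycle_eq[OF r r r] nz by simp
  have c2: "\<alpha> (?s, r) * ?e = \<alpha> (?s, ?s) * \<alpha> (r, r)" using cocycle_eq[OF s r r] sr cocycle_id(1)[OF r] by simp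
  define \<mu> where "\<mu> h = (if h = id then ?e else if h = r then z else z\<^sup>2 / \<alpha> (r, r))" for h
  have \<mu>v: "\<mu> id = ?e" "\<mu> r = z" "\<mu> ?s = z\<^sup>2 / \<alpha> (r, r)" using dist by (simp_all add: \<mu>_def)
  have ssr: "\<alpha> (?s, ?s) * \<mu> r = \<mu> ?s * \<mu> ?s"
  proof -
    have "\<alpha> (?s, ?s) * z * (\<alpha> (r, r))\<^sup>2 = z * (\<alpha> (r, r) * (\<alpha> (?s, r) * ?e))"
      unfolding c2 by (simp add: power2_eq_square)
    also have "\<dots> = z * z ^ 3" unfolding z[symmetric] by (simp only: mult.assoc)
    also have "\<dots> = (z\<^sup>2)\<^sup>2" by (simp add: power2_eq_square power3_eq_cube)
    finally show ?thesis using nz by (simp add: \<mu>v field_simps power2_eq_square)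
  qed
  have srr: "\<alpha> (?s, r) * \<mu> id = \<mu> ?s * \<mu> r"
    using z nz by (simp add: \<mu>v field_simps power2_eq_square power3_eq_cube)
  have rr: "\<alpha> (r, r) * \<mu> ?s = \<mu> r * \<mu> r" using nz by (simp add: \<mu>v power2_eq_square)
  have "\<alpha> (g, h) * \<mu> (g \<circ> h) = \<mu> g * \<mu> h" if "g \<in> {id, r, ?s}" "h \<in> {id, r, ?s}" for g h
    using that cocycle_id[OF r] cocycle_id[OF s] ssr srr rr c1 sr ss r3 \<mu>v(1)
    by (elim insertE emptyE) (simp_all add: mult.commute)
  moreover have "\<mu> h \<noteq> 0" for h using nz z0 by (auto simp: \<mu>_def)
  ultimately show ?thesis unfolding is_cob_def by metis
qed

end

section \<open>Klein and dihedral groups in the twisted group algebra\<close>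

context twisted_group
begin

text \<open>A pair (x, g) stands for the multiple x of the basis element g of the twisted group
  algebra, and \<open>tone\<close> for the unit of that algebra.\<close>

definition tmul :: "complex \<times> perm4 \<Rightarrow> complex \<times> perm4 \<Rightarrow> complex \<times> perm4" (infixl "\<odot>" 70) where
  "x \<odot> y = (fst x * fst y * \<alpha> (snd x, snd y), snd x \<circ> snd y)"

definition tone :: "complex \<times> perm4" where
  "tone = (1 / \<alpha> (id, id), id)"

lemma tmul_assoc:
  assumes "snd x \<in> H" "snd y \<in> H" "snd z \<in> H"
  shows "x \<odot> y \<odot> z = x \<odot> (y \<odot> z)"
  using cocycle_eq[OF assms] by (simp add: tmul_def comp_assoc)

lemma tmul_snd [simp]: "snd (x \<odot> y) = snd x \<circ> snd y"
  by (simp add: tmul_def)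

lemma tmul_one: "snd x \<in> H \<Longrightarrow> tone \<odot> x = x" "snd x \<in> H \<Longrightarrow> x \<odot> tone = x"
  using cocycle_id[of "snd x"] by (simp_all add: tmul_def tone_def)

text \<open>Commuting lifts of a and b with square 1 generate a Klein group that maps isomorphically
  onto {id, a, b, a b}. Its elements form a multiplicative section, and \<mu> consists of the
  inverses of their coefficients.\<close>

lemma klein_section:
  assumes a: "a \<in> H" and b: "b \<in> H" and nz: "x \<noteq> 0" "y \<noteq> 0"
    and AA: "(x, a) \<odot> (x, a) = tone" and BB: "(y, b) \<odot> (y, b) = tone" and AB: "(y, b) \<odot> (x, a) = (x, a) \<odot> (y, b)"
    and dist: "a \<noteq> id" "b \<noteq> id" "a \<noteq> b" "a \<circ> b \<noteq> id" "a \<circ> b \<noteq> a" "a \<circ> b \<noteq> b"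
  obtains \<mu> where "\<mu> a = 1 / x" "\<mu> b = 1 / y" "\<mu> id = \<alpha> (id, id)" "\<And>g. g \<in> {id, a, b, a \<circ> b} \<Longrightarrow> \<mu> g \<noteq> 0"
    "\<And>g h. g \<in> {id, a, b, a \<circ> b} \<Longrightarrow> h \<in> {id, a, b, a \<circ> b} \<Longrightarrow> \<alpha> (g, h) * \<mu> (g \<circ> h) = \<mu> g * \<mu> h"
proof -
  define A where "A = (x, a)"
  define B where "B = (y, b)"
  have s: "snd A \<in> H" "snd B \<in> H" "snd (A \<odot> B) \<in> H" using a b by (auto simp: A_def B_def)
  note AA = AA[folded A_def] and BB = BB[folded B_def] and AB = AB[folded A_def B_def]
  define \<mu> where "\<mu> g = (if g = id then \<alpha> (id, id) else if g = a then 1 / x else if g = b then 1 / y else 1 / (x * y * \<alpha> (a, b)))" for g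
  define w where "w g = (1 / \<mu> g, g)" for g :: perm4
  have w: "w id = tone" "w a = A" "w b = B" "w (a \<circ> b) = A \<odot> B"
    using dist by (auto simp: w_def \<mu>_def tone_def A_def B_def tmul_def)
  have AAB: "A \<odot> (A \<odot> B) = B" using tmul_assoc[of A A B] s AA tmul_one by simp
  have BAB: "B \<odot> (A \<odot> B) = A" using tmul_assoc[of B A B] tmul_assoc[of A B B] s AB BB tmul_one by simp
  have ABA: "A \<odot> B \<odot> A = B" using tmul_assoc[of A B A] s AB AAB by simp
  have ABB: "A \<odot> B \<odot> B = A" using tmul_assoc[of A B B] s BB tmul_one by simp
  have ABAB: "A \<odot> B \<odot> (A \<odot> B) = tone" using tmul_assoc[of A B "A \<odot> B"] s BAB AA by simp
  have ga: "a \<circ> a = id" "b \<circ> b = id" "b \<circ> a = a \<circ> b"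
    using arg_cong[OF AA, of snd] arg_cong[OF BB, of snd] arg_cong[OF AB, of snd] by (auto simp: A_def B_def tone_def)
  have gab: "a \<circ> (a \<circ> b) = b" "b \<circ> (a \<circ> b) = a" "a \<circ> b \<circ> a = b" "a \<circ> b \<circ> b = a" "a \<circ> b \<circ> (a \<circ> b) = id"
    using arg_cong[OF AAB, of snd] arg_cong[OF BAB, of snd] arg_cong[OF ABA, of snd] arg_cong[OF ABB, of snd] arg_cong[OF ABAB, of snd]
    by (simp_all add: A_def B_def tone_def)
  have "w g \<odot> w h = w (g \<circ> h)" if "g \<in> {id, a, b, a \<circ> b}" "h \<in> {id, a, b, a \<circ> b}" for g h
    using that by (elim insertE emptyE; hypsubst; simp only: w comp_id id_comp ga gab tmul_one s AA BB AB AAB BAB ABA ABB ABAB)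
      (simp_all add: tmul_one s tone_def[symmetric] tmul_one[of tone, unfolded tone_def, simplified, folded tone_def])
  then have "\<alpha> (g, h) * \<mu> (g \<circ> h) = \<mu> g * \<mu> h"
    if "g \<in> {id, a, b, a \<circ> b}" "h \<in> {id, a, b, a \<circ> b}" "\<mu> g \<noteq> 0" "\<mu> h \<noteq> 0" "\<mu> (g \<circ> h) \<noteq> 0" for g h
    using that by (fastforce simp: w_def tmul_def field_simps)
  moreover have nzm: "\<mu> g \<noteq> 0" for g using nz a b by (simp add: \<mu>_def)
  ultimately show thesis using that[of \<mu>] dist by (simp add: \<mu>_def)
qed

lemma square_root_unit:
  assumes a: "a \<in> H" "a \<circ> a = id"
  obtains x where "x \<noteq> 0" "(x, a) \<odot> (x, a) = tone"
proof -
  define x where "x = csqrt (1 / (\<alpha> (a, a) * \<alpha> (id, id)))"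
  have "x\<^sup>2 = 1 / (\<alpha> (a, a) * \<alpha> (id, id))" by (simp add: x_def)
  moreover have "\<alpha> (a, a) * \<alpha> (id, id) \<noteq> 0" using a by simp
  ultimately have "x * x * \<alpha> (a, a) = 1 / \<alpha> (id, id)" "x \<noteq> 0"
    by (auto simp: power2_eq_square field_simps)
  then show thesis using that[of x] a by (simp add: tmul_def tone_def)
qed

text \<open>Complex square roots give every involution a lift with square 1. Symmetry of \<alpha> at
  a and b says that these lifts commute.\<close>

lemma is_cob_klein:
  assumes a: "a \<in> H" "a \<circ> a = id" and b: "b \<in> H" "b \<circ> b = id" and ab: "b \<circ> a = a \<circ> b" and sym: "\<alpha> (a, b) = \<alpha> (b, a)"
    and dist: "a \<noteq> id" "b \<noteq> id" "a \<noteq> b"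
  shows "is_cob {id, a, b, a \<circ> b} \<alpha>"
proof -
  obtain x where x: "x \<noteq> 0" "(x, a) \<odot> (x, a) = tone" by (rule square_root_unit[OF a])
  obtain y where y: "y \<noteq> 0" "(y, b) \<odot> (y, b) = tone" by (rule square_root_unit[OF b])
  have xy: "(y, b) \<odot> (x, a) = (x, a) \<odot> (y, b)" using ab sym by (simp add: tmul_def)
  have d: "a \<circ> b \<noteq> id" "a \<circ> b \<noteq> a" "a \<circ> b \<noteq> b"
  proof -
    have "a \<circ> (a \<circ> b) = b" using a(2) by (simp flip: comp_assoc)
    moreover have "a \<circ> b \<circ> b = a" using b(2) by (simp add: comp_assoc)
    ultimately show "a \<circ> b \<noteq> id" "a \<circ> b \<noteq> a" "a \<circ> b \<noteq> b" using dist a(2) b(2) by fastforce+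
  qed
  obtain \<mu> where "\<And>g. g \<in> {id, a, b, a \<circ> b} \<Longrightarrow> \<mu> g \<noteq> 0"
    "\<And>g h. g \<in> {id, a, b, a \<circ> b} \<Longrightarrow> h \<in> {id, a, b, a \<circ> b} \<Longrightarrow> \<alpha> (g, h) * \<mu> (g \<circ> h) = \<mu> g * \<mu> h"
    using klein_section[OF a(1) b(1) x(1) y(1) x(2) y(2) xy dist d] by metis
  then show ?thesis unfolding is_cob_def by blast
qed

text \<open>A multiplicative section over \<open>K\<close> extends to the union of \<open>K\<close>
  and its translate by r if conjugation by r respects it, which is the hypothesis
  \<open>inv\<close>. The lift of r is divided by a square root \<open>c\<close>, chosen so that its
  square becomes the section at \<open>r \<circ> r\<close>.\<close>

lemma is_cob_extend:
  assumes K: "K \<subseteq> H" "\<And>k l. k \<in> K \<Longrightarrow> l \<in> K \<Longrightarrow> k \<circ> l \<in> K" and r: "r \<in> H" "r \<circ> r \<in> K"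
    and disj: "\<And>k. k \<in> K \<Longrightarrow> k \<circ> r \<notin> K"
    and \<mu>0: "\<And>k. k \<in> K \<Longrightarrow> \<mu> k \<noteq> 0" and \<mu>: "\<And>k l. k \<in> K \<Longrightarrow> l \<in> K \<Longrightarrow> \<alpha> (k, l) * \<mu> (k \<circ> l) = \<mu> k * \<mu> l"
    and inv: "\<And>k. k \<in> K \<Longrightarrow> \<exists>k'\<in>K. r \<circ> k = k' \<circ> r \<and> \<alpha> (r, k) * \<mu> k' = \<alpha> (k', r) * \<mu> k"
  shows "is_cob (K \<union> (\<lambda>k. k \<circ> r) ` K) \<alpha>"
proof -
  let ?H = "K \<union> (\<lambda>k. k \<circ> r) ` K"
  define c where "c = csqrt (\<alpha> (r, r) * \<mu> (r \<circ> r))"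
  have c2: "c * c = \<alpha> (r, r) * \<mu> (r \<circ> r)" using power2_csqrt[of "\<alpha> (r, r) * \<mu> (r \<circ> r)"] by (simp add: c_def power2_eq_square)
  have c0: "c \<noteq> 0" using c2 r \<mu>0 by auto
  have KH: "k \<in> H" if "k \<in> K" for k using that K(1) by auto
  \<comment> \<open>At \<open>k \<circ> r\<close> this is the inverse of the coefficient of the
    section at \<open>k\<close> times the rescaled lift of r.\<close>
  define \<nu> where "\<nu> h = (if h \<in> K then \<mu> h else \<mu> (h \<circ> pinv r) * c / \<alpha> (h \<circ> pinv r, r))" for h
  have \<nu>K: "\<nu> k = \<mu> k" if "k \<in> K" for k using that by (simp add: \<nu>_def)
  have \<nu>r: "\<nu> (k \<circ> r) = \<mu> k * c / \<alpha> (k, r)" if "k \<in> K" for k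
    using disj[OF that] r(1) by (simp add: \<nu>_def comp_assoc)
  have nz: "\<alpha> (g, h) \<noteq> 0" if "g \<in> H" "h \<in> H" for g h using that by simp
  have 2: "\<alpha> (k, l \<circ> r) * \<nu> (k \<circ> (l \<circ> r)) = \<nu> k * \<nu> (l \<circ> r)" if k: "k \<in> K" and l: "l \<in> K" for k l
  proof -
    have "\<alpha> (k, l) * \<alpha> (k \<circ> l, r) = \<alpha> (k, l \<circ> r) * \<alpha> (l, r)" by (rule cocycle_eq) (use k l r KH in auto)
    then have "\<alpha> (k, l \<circ> r) / \<alpha> (k \<circ> l, r) = \<alpha> (k, l) / \<alpha> (l, r)"
      using nz KH K(2) k l r by (simp add: field_simps)
    then have "\<alpha> (k, l \<circ> r) * (\<mu> (k \<circ> l) * c / \<alpha> (k \<circ> l, r)) = (\<alpha> (k, l) * \<mu> (k \<circ> l)) * c / \<alpha> (l, r)"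
      by (metis (no_types, lifting) mult.assoc mult.commute times_divide_eq_right)
    also have "\<dots> = \<mu> k * (\<mu> l * c / \<alpha> (l, r))" unfolding \<mu>[OF k l] by simp
    finally show ?thesis using \<nu>r[OF K(2)[OF k l]] by (simp add: \<nu>K[OF k] \<nu>r[OF l] comp_assoc)
  qed
  have 3: "\<alpha> (k \<circ> r, l) * \<mu> (k \<circ> l') * c / \<alpha> (k \<circ> l', r) = \<mu> k * c / \<alpha> (k, r) * \<mu> l"
    if k: "k \<in> K" and l: "l \<in> K" "l' \<in> K" "r \<circ> l = l' \<circ> r" "\<alpha> (r, l) * \<mu> l' = \<alpha> (l', r) * \<mu> l" for k l l'
  proof -
    have e1: "\<alpha> (k, r) * \<alpha> (k \<circ> r, l) = \<alpha> (k, l' \<circ> r) * \<alpha> (r, l)"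
      using cocycle_eq[of k r l] k l r KH by simp
    have e2: "\<alpha> (k, l') * \<alpha> (k \<circ> l', r) = \<alpha> (k, l' \<circ> r) * \<alpha> (l', r)" by (rule cocycle_eq) (use k l r KH in auto)
    note n = nz[OF KH[OF k] r(1)] nz[OF KH[OF l(2)] r(1)] nz[OF KH[OF K(2)[OF k l(2)]] r(1)]
    have "\<alpha> (k \<circ> r, l) = \<alpha> (k, l') * \<alpha> (k \<circ> l', r) * \<alpha> (r, l) / (\<alpha> (l', r) * \<alpha> (k, r))"
      using e1 e2 n by (simp add: field_simps)
    then have "\<alpha> (k \<circ> r, l) * \<mu> (k \<circ> l') * c / \<alpha> (k \<circ> l', r) =
        (\<alpha> (k, l') * \<mu> (k \<circ> l')) * \<alpha> (r, l) * c / (\<alpha> (l', r) * \<alpha> (k, r))" using n by simp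
    also have "\<dots> = \<mu> k * (\<alpha> (r, l) * \<mu> l') * c / (\<alpha> (l', r) * \<alpha> (k, r))" unfolding \<mu>[OF k l(2)] by simp
    also have "\<dots> = \<mu> k * c / \<alpha> (k, r) * \<mu> l" unfolding l(4) using n by simp
    finally show ?thesis .
  qed
  have eq: "\<alpha> (g, h) * \<nu> (g \<circ> h) = \<nu> g * \<nu> h" if gh: "g \<in> ?H" "h \<in> ?H" for g h
  proof -
    consider "g \<in> K" "h \<in> K" | l where "g \<in> K" "l \<in> K" "h = l \<circ> r" | k where "k \<in> K" "g = k \<circ> r" "h \<in> K"
      | k l where "k \<in> K" "g = k \<circ> r" "l \<in> K" "h = l \<circ> r"
      using gh by blast
    then show ?thesis
    proof cases
      case 1
      then show ?thesis using \<mu> K(2) by (simp add: \<nu>K)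
    next
      case (2 l)
      then show ?thesis using \<open>\<And>k l. k \<in> K \<Longrightarrow> l \<in> K \<Longrightarrow> \<alpha> (k, l \<circ> r) * \<nu> (k \<circ> (l \<circ> r)) = \<nu> k * \<nu> (l \<circ> r)\<close> by simp
    next
      case (3 k)
      obtain l' where l': "l' \<in> K" "r \<circ> h = l' \<circ> r" "\<alpha> (r, h) * \<mu> l' = \<alpha> (l', r) * \<mu> h" using inv[OF 3(3)] by blast
      have "g \<circ> h = k \<circ> l' \<circ> r" unfolding 3(2) using l'(2) by (simp add: comp_assoc)
      then show ?thesis using \<open>\<And>k l l'. k \<in> K \<Longrightarrow> l \<in> K \<Longrightarrow> l' \<in> K \<Longrightarrow> r \<circ> l = l' \<circ> r \<Longrightarrow> \<alpha> (r, l) * \<mu> l' = \<alpha> (l', r) * \<mu> l \<Longrightarrow>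
          \<alpha> (k \<circ> r, l) * \<mu> (k \<circ> l') * c / \<alpha> (k \<circ> l', r) = \<mu> k * c / \<alpha> (k, r) * \<mu> l\<close>[OF 3(1) 3(3) l']
        \<nu>r[OF K(2)[OF 3(1) l'(1)]] \<nu>r[OF 3(1)] \<nu>K[OF 3(3)] 3(2) by (simp add: mult.assoc)
    next
      case (4 k l)
      obtain l' where l': "l' \<in> K" "r \<circ> l = l' \<circ> r" "\<alpha> (r, l) * \<mu> l' = \<alpha> (l', r) * \<mu> l" using inv[OF 4(3)] by blast
      have kl: "k \<circ> l' \<in> K" "k \<circ> l' \<circ> (r \<circ> r) \<in> K" using K(2) 4(1) l'(1) r(2) by auto
      have krl: "k \<circ> r \<circ> l = k \<circ> l' \<circ> r" using l'(2) by (simp add: comp_assoc)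
      have gh_eq: "g \<circ> h = k \<circ> l' \<circ> (r \<circ> r)" unfolding 4(2,4) using krl by (simp add: comp_assoc) (metis comp_assoc)
      have krH: "k \<circ> r \<in> H" "l \<in> H" using 4 KH r by auto
      have f1: "\<alpha> (k \<circ> r, l) * \<alpha> (k \<circ> l' \<circ> r, r) = \<alpha> (k \<circ> r, l \<circ> r) * \<alpha> (l, r)"
        using cocycle_eq[OF krH r(1)] krl by simp
      have f2: "\<alpha> (k \<circ> l', r) * \<alpha> (k \<circ> l' \<circ> r, r) = \<alpha> (k \<circ> l', r \<circ> r) * \<alpha> (r, r)"
        by (rule cocycle_eq[OF KH[OF kl(1)] r(1) r(1)])
      note n = nz[OF KH[OF 4(3)] r(1)] nz[OF KH[OF kl(1)] r(1)] nz[OF KH[OF 4(1)] r(1)]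
      have f3: "\<alpha> (k \<circ> r, l) * \<mu> (k \<circ> l') * c / \<alpha> (k \<circ> l', r) = \<mu> k * c / \<alpha> (k, r) * \<mu> l"
        by (rule \<open>\<And>k l l'. k \<in> K \<Longrightarrow> l \<in> K \<Longrightarrow> l' \<in> K \<Longrightarrow> r \<circ> l = l' \<circ> r \<Longrightarrow> \<alpha> (r, l) * \<mu> l' = \<alpha> (l', r) * \<mu> l \<Longrightarrow>
          \<alpha> (k \<circ> r, l) * \<mu> (k \<circ> l') * c / \<alpha> (k \<circ> l', r) = \<mu> k * c / \<alpha> (k, r) * \<mu> l\<close>[OF 4(1) 4(3) l'])
      have "\<alpha> (k \<circ> r, l \<circ> r) = \<alpha> (k \<circ> r, l) * (\<alpha> (k \<circ> l', r \<circ> r) * \<alpha> (r, r)) / (\<alpha> (l, r) * \<alpha> (k \<circ> l', r))"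
      proof -
        have "\<alpha> (k \<circ> r, l \<circ> r) * (\<alpha> (l, r) * \<alpha> (k \<circ> l', r)) = \<alpha> (k \<circ> r, l) * (\<alpha> (k \<circ> l', r) * \<alpha> (k \<circ> l' \<circ> r, r))"
          using f1 by (metis (no_types, lifting) mult.assoc mult.commute)
        then show ?thesis unfolding f2 using n by (simp add: nonzero_eq_divide_eq)
      qed
      then have "\<alpha> (k \<circ> r, l \<circ> r) * \<mu> (k \<circ> l' \<circ> (r \<circ> r)) =
          \<alpha> (k \<circ> r, l) * (\<alpha> (k \<circ> l', r \<circ> r) * \<mu> (k \<circ> l' \<circ> (r \<circ> r))) * \<alpha> (r, r) / (\<alpha> (l, r) * \<alpha> (k \<circ> l', r))"
        by simp
      also have "\<dots> = \<alpha> (k \<circ> r, l) * \<mu> (k \<circ> l') * (\<alpha> (r, r) * \<mu> (r \<circ> r)) / (\<alpha> (l, r) * \<alpha> (k \<circ> l', r))"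
        unfolding \<mu>[OF kl(1) r(2)] by simp
      also have "\<dots> = (\<alpha> (k \<circ> r, l) * \<mu> (k \<circ> l') * c / \<alpha> (k \<circ> l', r)) * c / \<alpha> (l, r)"
        unfolding c2[symmetric] by (simp add: mult_ac)
      also have "\<dots> = (\<mu> k * c / \<alpha> (k, r)) * (\<mu> l * c / \<alpha> (l, r))" unfolding f3 by (simp add: mult_ac)
      finally have fin: "\<alpha> (k \<circ> r, l \<circ> r) * \<mu> (k \<circ> l' \<circ> (r \<circ> r)) = (\<mu> k * c / \<alpha> (k, r)) * (\<mu> l * c / \<alpha> (l, r))" .
      have "\<nu> (g \<circ> h) = \<mu> (k \<circ> l' \<circ> (r \<circ> r))" unfolding gh_eq by (rule \<nu>K[OF kl(2)])
      then show ?thesis using fin \<nu>r[OF 4(1)] \<nu>r[OF 4(3)] 4(2,4) by simp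
    qed
  qed
  have "\<nu> h \<noteq> 0" if "h \<in> ?H" for h
    using that \<mu>0 c0 nz KH r(1) by (auto simp: \<nu>K \<nu>r)
  then show ?thesis unfolding is_cob_def using eq by blast
qed

text \<open>The lift \<open>B\<close> of b is the conjugate of a lift \<open>A\<close> of a by a
  lift \<open>R\<close> of r, so conjugation by \<open>R\<close> takes \<open>A\<close> to
  \<open>B\<close> by construction. It takes \<open>B\<close> back to \<open>A\<close> because the
  square of \<open>R\<close> lies over \<open>a \<circ> b\<close> and therefore commutes with
  \<open>A\<close>. This is the compatibility that \<open>is_cob_extend\<close> asks for.\<close>

lemma is_cob_dihedral:
  assumes a: "a \<in> H" "a \<circ> a = id" and b: "b \<in> H" "b \<circ> b = id" and ab: "b \<circ> a = a \<circ> b" and sym: "\<alpha> (a, b) = \<alpha> (b, a)"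
    and dist: "a \<noteq> id" "b \<noteq> id" "a \<noteq> b" and r: "r \<in> H" "r \<circ> a = b \<circ> r" "r \<circ> b = a \<circ> r" "r \<circ> r = a \<circ> b" and rK: "r \<notin> {id, a, b, a \<circ> b}"
  shows "is_cob ({id, a, b, a \<circ> b} \<union> (\<lambda>k. k \<circ> r) ` {id, a, b, a \<circ> b}) \<alpha>"
proof -
  let ?K = "{id, a, b, a \<circ> b}"
  have d: "a \<circ> b \<noteq> id" "a \<circ> b \<noteq> a" "a \<circ> b \<noteq> b" and g: "a \<circ> (a \<circ> b) = b" "b \<circ> (a \<circ> b) = a" "a \<circ> b \<circ> b = a" "a \<circ> b \<circ> a = b"
  proof -
    show 1: "a \<circ> (a \<circ> b) = b" using a(2) by (simp flip: comp_assoc)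
    show 2: "a \<circ> b \<circ> b = a" using b(2) by (simp add: comp_assoc)
    show "a \<circ> b \<noteq> id" "a \<circ> b \<noteq> a" "a \<circ> b \<noteq> b" using 1 2 dist a(2) b(2) by fastforce+
    show "b \<circ> (a \<circ> b) = a" using 2 ab by (simp flip: comp_assoc)
    show "a \<circ> b \<circ> a = b" using 1 ab by (simp add: comp_assoc)
  qed
  have abab: "a \<circ> b \<circ> (a \<circ> b) = id" using g a by (simp add: comp_assoc)
  have KH: "k \<in> H" if "k \<in> ?K" for k using that a b by auto
  have Kc: "k \<circ> l \<in> ?K" if "k \<in> ?K" "l \<in> ?K" for k l
    using that by (elim insertE emptyE; hypsubst; simp only: comp_id id_comp a b ab g abab insert_iff simp_thms)
  obtain x where x: "x \<noteq> 0" and AA: "(x, a) \<odot> (x, a) = tone" by (rule square_root_unit[OF a])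
  define A where "A = (x, a)"
  define R where "R = (1 :: complex, r)"
  define R' where "R' = (1 / (\<alpha> (r, pinv r) * \<alpha> (id, id)), pinv r)"
  define B where "B = R \<odot> A \<odot> R'"
  define y where "y = fst B"
  have s: "snd A \<in> H" "snd R \<in> H" "snd R' \<in> H" using a r by (auto simp: A_def R_def R'_def)
  have RR': "R \<odot> R' = tone" "R' \<odot> R = tone"
    using r(1) cocycle_inv[OF r(1)] by (auto simp: R_def R'_def tmul_def tone_def)
  have "snd B = b" using r by (simp add: B_def R_def A_def R'_def) (metis comp_assoc comp_id inv_comp(2))
  then have By: "B = (y, b)" by (simp add: y_def prod_eq_iff)
  have sB: "snd B \<in> H" using By b by simp
  have y: "y \<noteq> 0" using x a b r by (simp add: y_def B_def R_def A_def R'_def tmul_def)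
  note AA = AA[folded A_def]
  have BR: "B \<odot> R = R \<odot> A"
    using tmul_assoc[of "R \<odot> A" R' R] s RR' tmul_one by (simp add: B_def)
  have BB: "B \<odot> B = tone"
  proof -
    have "B \<odot> B = B \<odot> R \<odot> (A \<odot> R')" using tmul_assoc[of R A R'] tmul_assoc[of B R "A \<odot> R'"] s sB by (simp add: B_def)
    also have "\<dots> = R \<odot> (A \<odot> A) \<odot> R'" unfolding BR using tmul_assoc[of R A "A \<odot> R'"] tmul_assoc[of A A R'] tmul_assoc[of R "A \<odot> A" R'] s by simp
    also have "\<dots> = tone" unfolding AA using s RR' by (simp add: tmul_one)
    finally show ?thesis .
  qed
  have AB: "B \<odot> A = A \<odot> B" using ab sym by (simp add: By A_def tmul_def)
  \<comment> \<open>\<open>A\<close> commutes with \<open>A \<odot> B\<close>, and all lifts of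
    \<open>a \<circ> b\<close> are proportional.\<close>
  have comm: "\<alpha> (a \<circ> b, a) = \<alpha> (a, a \<circ> b)"
  proof -
    have "A \<odot> B \<odot> A = A \<odot> (A \<odot> B)" using tmul_assoc[of A B A] s sB AB by simp
    then have "x * y * \<alpha> (a, b) * x * \<alpha> (a \<circ> b, a) = x * (x * y * \<alpha> (a, b)) * \<alpha> (a, a \<circ> b)" by (simp add: A_def By tmul_def)
    then show ?thesis using x y a b by simp
  qed
  have RB: "R \<odot> B = A \<odot> R"
  proof -
    have "R \<odot> R \<odot> A = A \<odot> (R \<odot> R)" using comm r(4) g by (simp add: R_def A_def tmul_def comp_assoc)
    then have "R \<odot> B = A \<odot> (R \<odot> R) \<odot> R'"
      using tmul_assoc[of R R A] tmul_assoc[of R "R \<odot> A" R'] s by (simp add: B_def)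
    also have "\<dots> = A \<odot> R" using tmul_assoc[of A R R] tmul_assoc[of "A \<odot> R" R R'] s RR' by (simp add: tmul_one)
    finally show ?thesis .
  qed
  obtain \<mu> where \<mu>v: "\<mu> a = 1 / x" "\<mu> b = 1 / y" "\<mu> id = \<alpha> (id, id)" and \<mu>0: "\<And>g. g \<in> ?K \<Longrightarrow> \<mu> g \<noteq> 0"
    and \<mu>: "\<And>g h. g \<in> ?K \<Longrightarrow> h \<in> ?K \<Longrightarrow> \<alpha> (g, h) * \<mu> (g \<circ> h) = \<mu> g * \<mu> h"
    using klein_section[OF a(1) b(1) x y AA[unfolded A_def] BB[unfolded By] AB[unfolded By A_def] dist d] by metis
  show ?thesis
  proof (rule is_cob_extend[of ?K r \<mu>])
    show "?K \<subseteq> H" using KH by blast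
    show "r \<circ> r \<in> ?K" using r by simp
    show "k \<circ> r \<notin> ?K" if k: "k \<in> ?K" for k
    proof
      assume "k \<circ> r \<in> ?K"
      then have "k \<circ> (k \<circ> r) \<in> ?K" by (rule Kc[OF k])
      moreover have "k \<circ> (k \<circ> r) = r" using k a(2) b(2) abab by (auto simp flip: comp_assoc)
      ultimately show False using rK by simp
    qed
    fix k assume "k \<in> ?K"
    then consider "k = id" | "k = a" | "k = b" | "k = a \<circ> b" by blast
    then show "\<exists>k'\<in>?K. r \<circ> k = k' \<circ> r \<and> \<alpha> (r, k) * \<mu> k' = \<alpha> (k', r) * \<mu> k"
    proof cases
      case 1
      then show ?thesis using cocycle_id[OF r(1)] by (intro bexI[of _ id]) auto
    next
      case 2
      have "x * \<alpha> (r, a) = y * \<alpha> (b, r)" using BR by (simp add: By R_def A_def tmul_def)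
      then show ?thesis using 2 r(2) x y by (intro bexI[of _ b]) (auto simp: \<mu>v field_simps)
    next
      case 3
      have "y * \<alpha> (r, b) = x * \<alpha> (a, r)" using RB by (simp add: By R_def A_def tmul_def)
      then show ?thesis using 3 r(3) x y by (intro bexI[of _ a]) (auto simp: \<mu>v field_simps)
    next
      case 4
      have "R \<odot> (A \<odot> B) = A \<odot> B \<odot> R"
      proof -
        have "R \<odot> (A \<odot> B) = B \<odot> (R \<odot> B)" using tmul_assoc[of R A B] tmul_assoc[of B R B] s sB BR by simp
        also have "\<dots> = A \<odot> B \<odot> R" unfolding RB using tmul_assoc[of B A R] s sB AB by simp
        finally show ?thesis .
      qed
      then have "r \<circ> (a \<circ> b) = a \<circ> b \<circ> r" "x * y * \<alpha> (a, b) * \<alpha> (r, a \<circ> b) = x * y * \<alpha> (a, b) * \<alpha> (a \<circ> b, r)"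
        by (auto simp: By R_def A_def tmul_def)
      then show ?thesis using 4 x y a b by (intro bexI[of _ "a \<circ> b"]) auto
    qed
  qed (use Kc r(1) \<mu>0 \<mu> in auto)
qed

end

section \<open>Cohomology groups of order 2\<close>

lemma cocycle_group_comm_group:
  assumes "subgroup H S4"
  shows "comm_group (cocycle_group H)"
proof -
  interpret perm_group H using assms by (rule perm_group.intro)
  let ?G = "cocycle_group H"
  have carr: "\<alpha> \<in> carrier ?G \<longleftrightarrow> \<alpha> \<in> extensional (H \<times> H) \<and> (\<forall>g\<in>H. \<forall>h\<in>H. \<alpha> (g, h) \<noteq> 0) \<and>
     (\<forall>g\<in>H. \<forall>h\<in>H. \<forall>k\<in>H. \<alpha> (g, h) * \<alpha> (g \<circ> h, k) = \<alpha> (g, h \<circ> k) * \<alpha> (h, k))" for \<alpha>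
    by (auto simp: cocycle_group_def PiE_def Pi_def)
  have mult: "\<alpha> \<otimes>\<^bsub>?G\<^esub> \<beta> = (\<lambda>p\<in>H \<times> H. \<alpha> p * \<beta> p)" for \<alpha> \<beta> by (simp add: cocycle_group_def)
  have one: "\<one>\<^bsub>?G\<^esub> = (\<lambda>p\<in>H \<times> H. 1)" by (simp add: cocycle_group_def)
  show ?thesis
  proof (rule comm_groupI)
    fix \<alpha> \<beta> assume ab: "\<alpha> \<in> carrier ?G" "\<beta> \<in> carrier ?G"
    have "\<alpha> (g, h) * \<beta> (g, h) * (\<alpha> (g \<circ> h, k) * \<beta> (g \<circ> h, k)) = \<alpha> (g, h \<circ> k) * \<beta> (g, h \<circ> k) * (\<alpha> (h, k) * \<beta> (h, k))"
      if "g \<in> H" "h \<in> H" "k \<in> H" for g h k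
      by (rule mult_eqs(1)) (use ab that in \<open>auto simp: carr\<close>)
    then show "\<alpha> \<otimes>\<^bsub>?G\<^esub> \<beta> \<in> carrier ?G" using ab by (simp add: carr mult)
    show "\<alpha> \<otimes>\<^bsub>?G\<^esub> \<beta> = \<beta> \<otimes>\<^bsub>?G\<^esub> \<alpha>" by (simp add: mult mult.commute)
    fix \<gamma> assume "\<gamma> \<in> carrier ?G"
    show "\<alpha> \<otimes>\<^bsub>?G\<^esub> \<beta> \<otimes>\<^bsub>?G\<^esub> \<gamma> = \<alpha> \<otimes>\<^bsub>?G\<^esub> (\<beta> \<otimes>\<^bsub>?G\<^esub> \<gamma>)"
      unfolding mult by (rule restrict_ext) (auto simp: mult.assoc)
  next
    show "\<one>\<^bsub>?G\<^esub> \<in> carrier ?G" by (auto simp: carr one)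
    fix \<alpha> assume a: "\<alpha> \<in> carrier ?G"
    show "\<one>\<^bsub>?G\<^esub> \<otimes>\<^bsub>?G\<^esub> \<alpha> = \<alpha>"
    proof -
      have "\<one>\<^bsub>?G\<^esub> \<otimes>\<^bsub>?G\<^esub> \<alpha> = restrict \<alpha> (H \<times> H)" unfolding mult one by (rule restrict_ext) simp
      then show ?thesis using a by (simp add: carr extensional_restrict)
    qed
    define \<beta> where "\<beta> = (\<lambda>p\<in>H \<times> H. inverse (\<alpha> p))"
    have "\<beta> \<in> carrier ?G" using a by (simp add: carr \<beta>_def flip: inverse_mult_distrib)
    moreover have "\<beta> \<otimes>\<^bsub>?G\<^esub> \<alpha> = \<one>\<^bsub>?G\<^esub>"
      using a unfolding mult one carr \<beta>_def by (intro restrict_ext) auto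
    ultimately show "\<exists>\<beta>\<in>carrier ?G. \<beta> \<otimes>\<^bsub>?G\<^esub> \<alpha> = \<one>\<^bsub>?G\<^esub>" by blast
  qed
qed

text \<open>The commutator of lifts of a and b is the scalar \<alpha> (a, b) / \<alpha> (b, a).
  Conjugating twice by the lift of the involution a multiplies the lift of b by the square of this
  scalar, but it changes nothing because the lift of a has a scalar square.\<close>

lemma (in twisted_group) commutator_sign:
  assumes "a \<in> H" "b \<in> H" "a \<circ> a = id" "b \<circ> a = a \<circ> b"
  shows "\<alpha> (a, b) = \<alpha> (b, a) \<or> \<alpha> (a, b) = - \<alpha> (b, a)"
proof -
  let ?c = "a \<circ> b"
  have c: "?c \<in> H" using assms by simp
  have 1: "\<alpha> (a, a) * \<alpha> (id, id) = \<alpha> (a, ?c) * \<alpha> (a, b)"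
    using cocycle_eq[OF assms(1) assms(1) assms(2)] assms cocycle_id[OF assms(2)] by simp
  have "b \<circ> (a \<circ> a) = b" using assms by simp
  have 2: "\<alpha> (b, a) * \<alpha> (?c, a) = \<alpha> (id, id) * \<alpha> (a, a)"
    using cocycle_eq[OF assms(2) assms(1) assms(1)] assms cocycle_id[OF assms(2)] by simp
  have 3: "\<alpha> (a, b) * \<alpha> (?c, a) = \<alpha> (a, ?c) * \<alpha> (b, a)"
    using cocycle_eq[OF assms(1) assms(2) assms(1)] assms by simp
  have "(\<alpha> (a, b))\<^sup>2 * \<alpha> (?c, a) = (\<alpha> (b, a))\<^sup>2 * \<alpha> (?c, a)"
  proof -
    have "(\<alpha> (a, b))\<^sup>2 * \<alpha> (?c, a) = \<alpha> (a, b) * (\<alpha> (a, b) * \<alpha> (?c, a))" by (simp add: power2_eq_square)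
    also have "\<dots> = (\<alpha> (a, ?c) * \<alpha> (a, b)) * \<alpha> (b, a)" unfolding 3 by simp
    also have "\<dots> = (\<alpha> (b, a) * \<alpha> (?c, a)) * \<alpha> (b, a)" unfolding 1[symmetric] 2 by (simp add: mult.commute)
    finally show ?thesis by (simp add: power2_eq_square)
  qed
  then have "(\<alpha> (a, b))\<^sup>2 = (\<alpha> (b, a))\<^sup>2" using c assms by simp
  then show ?thesis by (simp add: power2_eq_iff)
qed

text \<open>A class in \<open>H\<^sup>2\<close> is detected by whether the lifts of two commuting involutions commute.\<close>

locale detected = perm_group +
  fixes a b :: perm4 and \<alpha>0 :: "perm4 \<times> perm4 \<Rightarrow> complex"
  assumes ab: "a \<in> H" "b \<in> H" "a \<circ> a = id" "b \<circ> a = a \<circ> b"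
    and \<alpha>0: "\<alpha>0 \<in> carrier (cocycle_group H)" "\<alpha>0 (a, b) \<noteq> \<alpha>0 (b, a)"
    and sym_cob: "\<And>\<alpha>. \<alpha> \<in> carrier (cocycle_group H) \<Longrightarrow> \<alpha> (a, b) = \<alpha> (b, a) \<Longrightarrow> is_cob H \<alpha>"
begin

lemma twisted: "\<alpha> \<in> carrier (cocycle_group H) \<Longrightarrow> twisted_group H \<alpha>"
  using perm_group_axioms by (intro twisted_group.intro twisted_group_axioms.intro)

lemma cob_sym:
  assumes "is_cob H \<alpha>"
  shows "\<alpha> (a, b) = \<alpha> (b, a)"
proof -
  obtain \<mu> where "\<And>h. h \<in> H \<Longrightarrow> \<mu> h \<noteq> 0" and eq: "\<And>g h. g \<in> H \<Longrightarrow> h \<in> H \<Longrightarrow> \<alpha> (g, h) * \<mu> (g \<circ> h) = \<mu> g * \<mu> h"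
    using assms unfolding is_cob_def by blast
  then have "\<mu> (a \<circ> b) \<noteq> 0" using ab by simp
  moreover have "\<alpha> (a, b) * \<mu> (a \<circ> b) = \<alpha> (b, a) * \<mu> (a \<circ> b)"
    using eq[OF ab(1,2)] eq[OF ab(2,1)] ab(4) by (simp add: mult.commute)
  ultimately show ?thesis by simp
qed

lemma coboundary_iff_sym:
  assumes "\<alpha> \<in> carrier (cocycle_group H)"
  shows "\<alpha> \<in> coboundaries H \<longleftrightarrow> \<alpha> (a, b) = \<alpha> (b, a)"
  using coboundaries_iff[OF assms] sym_cob[OF assms] cob_sym comp_in by blast

text \<open>By \<open>commutator_sign\<close> the commutator is a sign, so \<open>\<phi>\<close> is
  a homomorphism. Its kernel is the group of coboundaries by \<open>coboundary_iff_sym\<close>, and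
  \<open>\<alpha>0\<close> makes it surjective.\<close>

lemma second_cohomology_iso: "second_cohomology H \<cong> integer_mod_group 2"
proof -
  let ?G = "cocycle_group H" and ?Z = "integer_mod_group 2"
  define \<phi> :: "(perm4 \<times> perm4 \<Rightarrow> complex) \<Rightarrow> int" where "\<phi> \<alpha> = (if \<alpha> (a, b) = \<alpha> (b, a) then 0 else 1)" for \<alpha>
  interpret G: comm_group ?G by (rule cocycle_group_comm_group[OF subgroup])
  have Z: "carrier ?Z = {0, 1}" "x \<otimes>\<^bsub>?Z\<^esub> y = (x + y) mod 2" "\<one>\<^bsub>?Z\<^esub> = 0" for x y
    by (auto simp: integer_mod_group_def carrier_integer_mod_group)
  have hom: "\<phi> \<in> hom ?G ?Z"
  proof (rule homI)
    show "\<phi> \<alpha> \<in> carrier ?Z" for \<alpha> by (simp add: Z \<phi>_def)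
    fix \<alpha> \<beta> assume ab': "\<alpha> \<in> carrier ?G" "\<beta> \<in> carrier ?G"
    interpret A: twisted_group H \<alpha> using ab' by (intro twisted)
    interpret B: twisted_group H \<beta> using ab' by (intro twisted)
    have m: "(\<alpha> \<otimes>\<^bsub>?G\<^esub> \<beta>) (g, h) = \<alpha> (g, h) * \<beta> (g, h)" if "g \<in> H" "h \<in> H" for g h
      using that by (simp add: cocycle_group_def)
    have "\<alpha> (a, b) \<noteq> 0" "\<alpha> (b, a) \<noteq> 0" "\<beta> (a, b) \<noteq> 0" "\<beta> (b, a) \<noteq> 0" using ab by simp_all
    then show "\<phi> (\<alpha> \<otimes>\<^bsub>?G\<^esub> \<beta>) = \<phi> \<alpha> \<otimes>\<^bsub>?Z\<^esub> \<phi> \<beta>"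
      using A.commutator_sign[OF ab] B.commutator_sign[OF ab] ab by (auto simp: \<phi>_def m Z)
  qed
  interpret group_hom ?G ?Z \<phi>
    using hom by (intro group_hom.intro group_hom_axioms.intro G.is_group) (simp_all add: group_integer_mod_group)
  have "\<phi> ` carrier ?G = carrier ?Z"
  proof
    show "\<phi> ` carrier ?G \<subseteq> carrier ?Z" by (auto simp: Z \<phi>_def)
    have "\<phi> \<one>\<^bsub>?G\<^esub> = 0" using hom_one by (simp add: Z)
    moreover have "\<phi> \<alpha>0 = 1" using \<alpha>0 by (simp add: \<phi>_def)
    ultimately show "carrier ?Z \<subseteq> \<phi> ` carrier ?G"
      unfolding Z using \<alpha>0(1) G.one_closed by (metis (no_types, lifting) empty_subsetI image_eqI insert_subset)
  qed
  then have "?G Mod kernel ?G ?Z \<phi> \<cong> ?Z" by (rule FactGroup_iso)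
  moreover have "kernel ?G ?Z \<phi> = coboundaries H"
  proof -
    have "\<alpha> \<in> carrier ?G" if cob: "\<alpha> \<in> coboundaries H" for \<alpha>
    proof -
      obtain \<mu> where \<mu>: "\<alpha> = (\<lambda>(g, h)\<in>H \<times> H. \<mu> g * \<mu> h / \<mu> (g \<circ> h))" "\<forall>h\<in>H. \<mu> h \<noteq> 0"
        using cob unfolding coboundaries_def by blast
      then show ?thesis by (auto simp: cocycle_group_def comp_assoc)
    qed
    then show ?thesis using coboundary_iff_sym unfolding kernel_def by (auto simp: Z \<phi>_def)
  qed
  ultimately show ?thesis by (simp add: second_cohomology_def)
qed

text \<open>Both cocycles have commutator -1 at (a, b), so their quotient is symmetric there and
  hence a coboundary.\<close>

lemma nontrivial_cohomologous:
  assumes "\<alpha> \<in> nontrivial_cocycles H"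
  obtains \<mu> where "\<And>h. h \<in> H \<Longrightarrow> \<mu> h \<noteq> 0"
    "\<And>g h. g \<in> H \<Longrightarrow> h \<in> H \<Longrightarrow> \<alpha> (g, h) * \<mu> (g \<circ> h) = \<alpha>0 (g, h) * (\<mu> g * \<mu> h)"
proof -
  interpret G: comm_group "cocycle_group H" by (rule cocycle_group_comm_group[OF subgroup])
  have \<alpha>: "\<alpha> \<in> carrier (cocycle_group H)" "\<alpha> (a, b) \<noteq> \<alpha> (b, a)"
    using assms coboundary_iff_sym by (auto simp: nontrivial_cocycles_def)
  interpret A: twisted_group H \<alpha> using \<alpha>(1) by (rule twisted)
  interpret B: twisted_group H \<alpha>0 using \<alpha>0(1) by (rule twisted)
  define \<beta> where "\<beta> = (\<lambda>p\<in>H \<times> H. \<alpha> p / \<alpha>0 p)"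
  have "\<alpha> (g, h) / \<alpha>0 (g, h) * (\<alpha> (g \<circ> h, k) / \<alpha>0 (g \<circ> h, k)) = \<alpha> (g, h \<circ> k) / \<alpha>0 (g, h \<circ> k) * (\<alpha> (h, k) / \<alpha>0 (h, k))"
    if "g \<in> H" "h \<in> H" "k \<in> H" for g h k
    using A.cocycle_eq[OF that] B.cocycle_eq[OF that] by (simp add: times_divide_times_eq)
  then have "\<beta> \<in> carrier (cocycle_group H)" by (auto simp: cocycle_group_def \<beta>_def)
  moreover have "\<beta> (a, b) = \<beta> (b, a)"
    using A.commutator_sign[OF ab] B.commutator_sign[OF ab] \<alpha>(2) \<alpha>0(2) ab by (auto simp: \<beta>_def)
  ultimately have "is_cob H \<beta>" by (rule sym_cob)
  then obtain \<mu> where \<mu>: "\<And>h. h \<in> H \<Longrightarrow> \<mu> h \<noteq> 0" "\<And>g h. g \<in> H \<Longrightarrow> h \<in> H \<Longrightarrow> \<beta> (g, h) * \<mu> (g \<circ> h) = \<mu> g * \<mu> h"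
    unfolding is_cob_def by blast
  have "\<alpha> (g, h) * \<mu> (g \<circ> h) = \<alpha>0 (g, h) * (\<mu> g * \<mu> h)" if "g \<in> H" "h \<in> H" for g h
    using \<mu>(2)[OF that, symmetric] that by (simp add: \<beta>_def)
  then show thesis using that \<mu>(1) by blast
qed

end

section \<open>The two-dimensional projective representation of \<open>S\<^sub>4\<close>\<close>

text \<open>The rotation group of the cube, lifted to integer quaternions. As \<open>2 \<times> 2\<close> matrices these
  multiply up to integer factors; the factors form the cocycle \<open>quat_cocycle\<close>.\<close>

type_synonym quat = "int \<times> int \<times> int \<times> int"

text \<open>The four points are the space diagonals of the cube. Double transpositions are half
  turns about the coordinate axes (i, j, k), transpositions half turns about axes through edge
  midpoints (such as i + j), 4-cycles quarter turns (such as 1 + i), and 3-cycles third turns (1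
  plus or minus i, j and k). The signs are a choice; without normalization the entries stay
  integral.\<close>

definition quat_table :: "(tup \<times> quat) list" where
  "quat_table = [((1,2,3,4), (1,0,0,0)), ((1,2,4,3), (0,1,-1,0)), ((1,3,2,4), (0,0,1,1)),
     ((1,3,4,2), (1,1,1,-1)), ((1,4,2,3), (1,-1,-1,1)), ((1,4,3,2), (0,1,0,1)),
     ((2,1,3,4), (0,1,1,0)), ((2,1,4,3), (0,0,0,1)), ((2,3,1,4), (1,-1,1,-1)),
     ((2,3,4,1), (1,0,-1,0)), ((2,4,1,3), (1,1,0,0)), ((2,4,3,1), (1,-1,1,1)),
     ((3,1,2,4), (1,1,-1,1)), ((3,1,4,2), (1,-1,0,0)), ((3,2,1,4), (0,1,0,-1)),
     ((3,2,4,1), (1,1,1,1)), ((3,4,1,2), (0,0,1,0)), ((3,4,2,1), (1,0,0,-1)),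
     ((4,1,2,3), (1,0,1,0)), ((4,1,3,2), (1,1,-1,-1)), ((4,2,1,3), (1,-1,-1,-1)),
     ((4,2,3,1), (0,0,1,-1)), ((4,3,1,2), (1,0,0,1)), ((4,3,2,1), (0,1,0,0))]"

definition tquat :: "tup \<Rightarrow> quat" where
  "tquat t = (case map_of quat_table t of Some q \<Rightarrow> q | None \<Rightarrow> (1, 0, 0, 0))"

fun qmul :: "quat \<Rightarrow> quat \<Rightarrow> quat" where
  "qmul (a, b, c, d) (e, f, g, h) = (a * e - b * f - c * g - d * h, a * f + b * e + c * h - d * g,
     a * g - b * h + c * e + d * f, a * h + b * g - c * f + d * e)"

fun qscale :: "int \<Rightarrow> quat \<Rightarrow> quat" where
  "qscale k (a, b, c, d) = (k * a, k * b, k * c, k * d)"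

fun qnorm :: "quat \<Rightarrow> int" where
  "qnorm (a, b, c, d) = a * a + b * b + c * c + d * d"

text \<open>Multiplicativity only has to be checked for right multiplication by the generators \<open>(1 2)\<close>,
  \<open>(2 3)\<close> and \<open>(3 4)\<close>.\<close>

lemma quat_generator_check:
  "list_all (\<lambda>t. list_all (\<lambda>u. list_ex (\<lambda>c. qmul (tquat t) (tquat u) = qscale c (tquat (tcomp t u))) [1, -1, 2, -2])
     [(2,1,3,4), (1,3,2,4), (1,2,4,3)]) perms4"
  by code_simp

text \<open>Up to sign, a unit quaternion over the rotation by x has trace 2 cos (x / 2). The square
  of this is 1 plus the trace 1 + 2 cos x of the rotation, and \<open>Rho3\<close> is the rotation
  representation of the cube group: on a transposition, which is a half turn, its trace is
  -1.\<close>

definition twisted_value :: "tup \<Rightarrow> int" where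
  "twisted_value t = 1 + tchi Rho3 t"

lemma twisted_value_check:
  "list_all (\<lambda>t. 4 * fst (tquat t) * fst (tquat t) = twisted_value t * qnorm (tquat t) \<and> 0 < qnorm (tquat t)) perms4"
  by code_simp

fun qmat :: "quat \<Rightarrow> complex mat" where
  "qmat (a, b, c, d) = mat 2 2 (\<lambda>(i, j). if i = 0 then if j = 0 then Complex (of_int a) (of_int b) else Complex (of_int c) (of_int d)
     else if j = 0 then Complex (- of_int c) (of_int d) else Complex (of_int a) (- of_int b))"

fun qconj :: "quat \<Rightarrow> quat" where
  "qconj (a, b, c, d) = (a, - b, - c, - d)"

lemma fst_qconj: "fst (qconj q) = fst q"
  by (cases q) simp

lemma sum_upto2: "(\<Sum>l<2. f l) = f 0 + f (1::nat)"
  by (simp add: numeral_2_eq_2 lessThan_Suc One_nat_def add.commute)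

lemma qmat_carrier [simp]: "qmat q \<in> carrier_mat 2 2"
  by (cases q) simp

lemma qmat_mult: "qmat p * qmat q = qmat (qmul p q)"
proof -
  obtain a b c d where p: "p = (a, b, c, d)" by (cases p)
  obtain e f g h where q: "q = (e, f, g, h)" by (cases q)
  show ?thesis
  proof (rule eq_matI)
    fix i j assume "i < dim_row (qmat (qmul p q))" "j < dim_col (qmat (qmul p q))"
    then have ij: "i < 2" "j < 2" using carrier_matD[OF qmat_carrier] by auto
    then have ij': "i = 0 \<or> i = 1" "j = 0 \<or> j = 1" by auto
    show "(qmat p * qmat q) $$ (i, j) = qmat (qmul p q) $$ (i, j)"
      unfolding mult_mat_index[OF qmat_carrier qmat_carrier ij] sum_upto2
      using ij' unfolding p q by (elim disjE) (simp_all add: complex_eq_iff algebra_simps)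
  qed (use carrier_matD[OF qmat_carrier] in auto)
qed

lemma qmat_scale: "qmat (qscale k q) = of_int k \<cdot>\<^sub>m qmat q"
proof -
  obtain a b c d where q: "q = (a, b, c, d)" by (cases q)
  show ?thesis unfolding q by (rule eq_matI) (auto simp: complex_eq_iff)
qed

lemma qmat_conj: "qmat q * qmat (qconj q) = of_int (qnorm q) \<cdot>\<^sub>m 1\<^sub>m 2"
proof -
  obtain a b c d where q: "q = (a, b, c, d)" by (cases q)
  have "qmul q (qconj q) = qscale (qnorm q) (1, 0, 0, 0)" by (simp add: q algebra_simps)
  moreover have "qmat (1, 0, 0, 0) = 1\<^sub>m 2" by (rule eq_matI) (auto simp: complex_eq_iff less_2_cases_iff)
  ultimately show ?thesis unfolding qmat_mult by (simp only: qmat_scale)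
qed

lemma qmat_trace: "mtrace (qmat q) = of_int (2 * fst q)" "mtrace (qmat (qconj q)) = of_int (2 * fst q)"
  by (cases q; simp add: mtrace_def sum_upto2 complex_eq_iff)+

lemma qmat_nonzero: "qnorm q \<noteq> 0 \<Longrightarrow> qmat q \<noteq> 0\<^sub>m 2 2"
proof
  assume n: "qnorm q \<noteq> 0" and "qmat q = 0\<^sub>m 2 2"
  then have "of_int (qnorm q) \<cdot>\<^sub>m 1\<^sub>m 2 = (0\<^sub>m 2 2 :: complex mat)" using qmat_conj[of q] left_mult_zero_mat[OF qmat_carrier[of "qconj q"], of 2] by simp
  then have "(of_int (qnorm q) \<cdot>\<^sub>m 1\<^sub>m 2 :: complex mat) $$ (0, 0) = 0" by simp
  then show False using n by simp
qed

definition quat_rep :: rep where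
  "quat_rep p = qmat (tquat (perm_values p))"

lemma quat_rep_carrier [simp]: "quat_rep p \<in> carrier_mat 2 2"
  by (simp add: quat_rep_def)

lemma quat_norm_pos: "t \<in> set perms4 \<Longrightarrow> 0 < qnorm (tquat t)"
  using twisted_value_check unfolding list_all_iff by blast

lemma quat_rep_id: "quat_rep id = 1\<^sub>m 2"
proof -
  have "quat_rep id = qmat (1, 0, 0, 0)" by (simp add: quat_rep_def perm_values_def tquat_def quat_table_def)
  also have "\<dots> = 1\<^sub>m 2" by (rule eq_matI) (auto simp: complex_eq_iff less_2_cases_iff)
  finally show ?thesis .
qed

lemma quat_rep_nonzero: "p \<in> carrier S4 \<Longrightarrow> quat_rep p \<noteq> 0\<^sub>m 2 2"
  unfolding S4_tapp quat_rep_def using quat_norm_pos by (auto intro!: qmat_nonzero simp: less_le simp del: qmat.simps qnorm.simps tapp.simps)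

text \<open>Induction on a word for h. When a generator s is split off from the left, the induction
  hypothesis covers the rest of the word multiplied by g s and by s, and associativity combines both
  with the check for g and s.\<close>

lemma quat_rep_mult:
  assumes "g \<in> carrier S4" "h \<in> carrier S4"
  shows "\<exists>c. c \<noteq> 0 \<and> quat_rep g * quat_rep h = c \<cdot>\<^sub>m quat_rep (g \<circ> h)"
proof -
  let ?G = "{(2,1,3,4), (1,3,2,4), (1,2,4,3)} :: tup set"
  obtain u where u: "u \<in> set perms4" "h = tapp u" using assms unfolding S4_tapp by blast
  obtain w where w: "foldr tcomp w tid = u" "\<forall>s\<in>set w. s \<in> set [(2,1,3,4), (1,3,2,4), (1,2,4,3)]"
    using tsign_check u(1) unfolding list_all_iff list_ex_iff by blast
  from w(2) have "set w \<subseteq> ?G" unfolding list.set by blast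
  then have "\<forall>g\<in>carrier S4. tapp (foldr tcomp w tid) \<in> carrier S4 \<and>
      (\<exists>c. c \<noteq> 0 \<and> quat_rep g * quat_rep (tapp (foldr tcomp w tid)) = c \<cdot>\<^sub>m quat_rep (g \<circ> tapp (foldr tcomp w tid)))"
  proof (induction w)
    case Nil
    have "\<exists>c. c \<noteq> 0 \<and> quat_rep g * quat_rep id = c \<cdot>\<^sub>m quat_rep (g \<circ> id)" for g
      by (rule exI[of _ 1]) (simp add: quat_rep_id mat_dim_simps carrier_matD[OF quat_rep_carrier])
    moreover have "id \<in> carrier S4" unfolding S4_simps by (simp add: permutes_id)
    moreover have "tapp (foldr tcomp [] tid) = id" using tapp_id by simp
    ultimately show ?case by (simp only:) blast
  next
    case (Cons s w)
    let ?h = "tapp (foldr tcomp w tid)"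
    have s: "s \<in> ?G" "s \<in> set perms4" using Cons.prems by (auto simp: perms4_def)
    have eq: "tapp (foldr tcomp (s # w) tid) = tapp s \<circ> ?h" by (simp add: tapp_comp)
    have h: "?h \<in> carrier S4" and IH: "\<And>g. g \<in> carrier S4 \<Longrightarrow> \<exists>c. c \<noteq> 0 \<and> quat_rep g * quat_rep ?h = c \<cdot>\<^sub>m quat_rep (g \<circ> ?h)"
      using Cons.IH Cons.prems assms(1) unfolding list.set insert_subset by blast+
    have sS: "tapp s \<in> carrier S4" using s unfolding S4_tapp by blast
    show ?case unfolding eq
    proof (intro ballI conjI)
      show "tapp s \<circ> ?h \<in> carrier S4" using sS h permutes_compose unfolding S4_simps by blast
      fix g assume g: "g \<in> carrier S4"
      then obtain t where t: "t \<in> set perms4" "g = tapp t" unfolding S4_tapp by blast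
      have gs: "g \<circ> tapp s \<in> carrier S4" using sS g permutes_compose unfolding S4_simps by blast
      have "\<exists>c. qmul (tquat t) (tquat s) = qscale c (tquat (tcomp t s))"
        using quat_generator_check t(1) s(1) unfolding list_all_iff list_ex_iff list.set by blast
      then obtain c where c: "qmul (tquat t) (tquat s) = qscale c (tquat (tcomp t s))" by blast
      have c1: "quat_rep g * quat_rep (tapp s) = of_int c \<cdot>\<^sub>m quat_rep (g \<circ> tapp s)"
        unfolding quat_rep_def t(2) tapp_comp perm_values_tapp qmat_mult c by (rule qmat_scale)
      \<comment> \<open>With c = 0 the nonzero matrix of \<open>t\<close> times the invertible
        matrix of \<open>s\<close> would vanish.\<close>
      have c0: "c \<noteq> 0"
      proof
        assume "c = 0"
        then have "qmat (qmul (tquat t) (tquat s)) = 0\<^sub>m 2 2"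
          unfolding c using carrier_matD[OF qmat_carrier] by (simp only: qmat_scale) (intro eq_matI, auto)
        then have "qmat (tquat t) * qmat (tquat s) = 0\<^sub>m 2 2" by (simp only: qmat_mult)
        then have "qmat (tquat t) * (qmat (tquat s) * qmat (qconj (tquat s))) = 0\<^sub>m 2 2"
          using carrier_matD[OF qmat_carrier] left_mult_zero_mat[OF qmat_carrier[of "qconj (tquat s)"], of 2]
          by (simp add: mat_dim_simps flip: mat_dim_simps(1))
        then have "of_int (qnorm (tquat s)) \<cdot>\<^sub>m qmat (tquat t) = 0\<^sub>m 2 2"
          unfolding qmat_conj using carrier_matD[OF qmat_carrier] by (simp add: mat_dim_simps)
        then have "of_int (qnorm (tquat s)) * (qmat (tquat t) $$ (i, j)) = 0" if "i < 2" "j < 2" for i j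
          using that carrier_matD[OF qmat_carrier[of "tquat t"]] by (metis index_smult_mat(1) index_zero_mat(1))
        then have "qmat (tquat t) = 0\<^sub>m 2 2"
          using quat_norm_pos[OF s(2)] carrier_matD[OF qmat_carrier[of "tquat t"]] by (intro eq_matI) auto
        then show False using qmat_nonzero quat_norm_pos[OF t(1)] by auto
      qed
      obtain d where d: "d \<noteq> 0" "quat_rep (g \<circ> tapp s) * quat_rep ?h = d \<cdot>\<^sub>m quat_rep (g \<circ> tapp s \<circ> ?h)" using IH[OF gs] by blast
      obtain e where e: "e \<noteq> 0" "quat_rep (tapp s) * quat_rep ?h = e \<cdot>\<^sub>m quat_rep (tapp s \<circ> ?h)" using IH[OF sS] by blast
      note dims = carrier_matD[OF quat_rep_carrier]
      have "e \<cdot>\<^sub>m (quat_rep g * quat_rep (tapp s \<circ> ?h)) = quat_rep g * (quat_rep (tapp s) * quat_rep ?h)"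
        unfolding e(2) by (simp add: mat_dim_simps dims)
      also have "\<dots> = quat_rep g * quat_rep (tapp s) * quat_rep ?h" by (simp add: mat_dim_simps dims)
      also have "\<dots> = (of_int c * d) \<cdot>\<^sub>m quat_rep (g \<circ> (tapp s \<circ> ?h))" unfolding c1
        by (simp add: mat_dim_simps dims d(2)) (simp add: comp_assoc)
      finally have "(1 / e) \<cdot>\<^sub>m (e \<cdot>\<^sub>m (quat_rep g * quat_rep (tapp s \<circ> ?h))) = (1 / e) \<cdot>\<^sub>m ((of_int c * d) \<cdot>\<^sub>m quat_rep (g \<circ> (tapp s \<circ> ?h)))"
        by simp
      then have "quat_rep g * quat_rep (tapp s \<circ> ?h) = (of_int c * d / e) \<cdot>\<^sub>m quat_rep (g \<circ> (tapp s \<circ> ?h))"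
        using e(1) by (simp add: mat_dim_simps)
      moreover have "of_int c * d / e \<noteq> 0" using c0 d(1) e(1) by simp
      ultimately show "\<exists>c. c \<noteq> 0 \<and> quat_rep g * quat_rep (tapp s \<circ> ?h) = c \<cdot>\<^sub>m quat_rep (g \<circ> (tapp s \<circ> ?h))" by blast
    qed
  qed
  then show ?thesis using assms(1) w(1) u(2) by blast
qed

definition quat_factor :: "perm4 \<Rightarrow> perm4 \<Rightarrow> complex" where
  "quat_factor g h = (SOME c. c \<noteq> 0 \<and> quat_rep g * quat_rep h = c \<cdot>\<^sub>m quat_rep (g \<circ> h))"

lemma quat_factor:
  assumes "g \<in> carrier S4" "h \<in> carrier S4"
  shows "quat_factor g h \<noteq> 0" "quat_rep g * quat_rep h = quat_factor g h \<cdot>\<^sub>m quat_rep (g \<circ> h)"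
  using someI_ex[OF quat_rep_mult[OF assms]] unfolding quat_factor_def by blast+

lemma smult_quat_rep_cancel:
  assumes "c \<cdot>\<^sub>m quat_rep p = d \<cdot>\<^sub>m quat_rep p" "p \<in> carrier S4"
  shows "c = d"
proof -
  obtain i j where ij: "i < 2" "j < 2" "quat_rep p $$ (i, j) \<noteq> 0"
    using quat_rep_nonzero[OF assms(2)] carrier_matD[OF quat_rep_carrier[of p]] by (metis eq_matI index_zero_mat)
  then have "c * quat_rep p $$ (i, j) = d * quat_rep p $$ (i, j)"
    using arg_cong[OF assms(1), of "\<lambda>A. A $$ (i, j)"] carrier_matD[OF quat_rep_carrier[of p]] by simp
  then show ?thesis using ij by simp
qed

definition quat_cocycle :: "perm4 set \<Rightarrow> perm4 \<times> perm4 \<Rightarrow> complex" where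
  "quat_cocycle H = (\<lambda>(g, h)\<in>H \<times> H. quat_factor g h)"

lemma quat_cocycle_carrier:
  assumes "subgroup H S4"
  shows "quat_cocycle H \<in> carrier (cocycle_group H)"
proof -
  interpret perm_group H using assms by (rule perm_group.intro)
  have S: "h \<in> carrier S4" if "h \<in> H" for h using subgroup.subset[OF assms] that by blast
  note dims = carrier_matD[OF quat_rep_carrier]
  have "quat_factor g h * quat_factor (g \<circ> h) k = quat_factor g (h \<circ> k) * quat_factor h k"
    if m: "g \<in> H" "h \<in> H" "k \<in> H" for g h k
  proof (rule smult_quat_rep_cancel)
    have "quat_rep g * quat_rep h * quat_rep k = (quat_factor g h * quat_factor (g \<circ> h) k) \<cdot>\<^sub>m quat_rep (g \<circ> h \<circ> k)"
      using m S by (simp add: quat_factor(2) mat_dim_simps(2-) dims)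
    moreover have "quat_rep g * (quat_rep h * quat_rep k) = (quat_factor g (h \<circ> k) * quat_factor h k) \<cdot>\<^sub>m quat_rep (g \<circ> h \<circ> k)"
      using m S by (simp add: quat_factor(2) mat_dim_simps(2-) dims comp_assoc mult.commute)
    ultimately show "(quat_factor g h * quat_factor (g \<circ> h) k) \<cdot>\<^sub>m quat_rep (g \<circ> h \<circ> k) =
        (quat_factor g (h \<circ> k) * quat_factor h k) \<cdot>\<^sub>m quat_rep (g \<circ> h \<circ> k)"
      by (simp add: mat_dim_simps(1) dims)
    show "g \<circ> h \<circ> k \<in> carrier S4" using m S by simp
  qed
  then show ?thesis using quat_factor(1) S by (auto simp: cocycle_group_def quat_cocycle_def)
qed

text \<open>The permutations commute while their quaternions anticommute. This asymmetry is what
  makes \<open>quat_cocycle\<close> nontrivial.\<close>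

lemma quat_factor_anticommute:
  assumes t: "t \<in> set perms4" "u \<in> set perms4" "tcomp t u = tcomp u t"
    and anti: "qmul (tquat t) (tquat u) = qscale (- 1) (qmul (tquat u) (tquat t))"
  shows "quat_factor (tapp t) (tapp u) \<noteq> quat_factor (tapp u) (tapp t)"
proof -
  have S: "tapp t \<in> carrier S4" "tapp u \<in> carrier S4" using t unfolding S4_tapp by auto
  have tu: "tapp t \<circ> tapp u \<in> carrier S4" using S permutes_compose unfolding S4_simps by blast
  have "quat_factor (tapp t) (tapp u) \<cdot>\<^sub>m quat_rep (tapp t \<circ> tapp u) = quat_rep (tapp t) * quat_rep (tapp u)"
    by (simp only: quat_factor(2)[OF S])
  also have "\<dots> = (- 1) \<cdot>\<^sub>m (quat_rep (tapp u) * quat_rep (tapp t))"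
    unfolding quat_rep_def perm_values_tapp qmat_mult anti qmat_scale by simp
  also have "\<dots> = (- quat_factor (tapp u) (tapp t)) \<cdot>\<^sub>m quat_rep (tapp t \<circ> tapp u)"
    unfolding quat_factor(2)[OF S(2,1)] tapp_comp t(3) by (simp add: mat_dim_simps(6))
  finally have "quat_factor (tapp t) (tapp u) = - quat_factor (tapp u) (tapp t)"
    by (rule smult_quat_rep_cancel[OF _ tu])
  then show ?thesis using quat_factor(1)[OF S(2,1)] by auto
qed

text \<open>Every \<alpha> in the nontrivial class differs from \<open>quat_cocycle\<close> by the
  coboundary of some \<mu>, and rescaling the quaternion matrices by \<mu> gives an \<alpha>-twisted
  module. The factors \<mu> cancel between trace and inverse trace, so one table of
  \<open>twisted_value\<close> serves all representatives.\<close>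

lemma categorified_by_twisted_check:
  assumes L: "closed_list L" and det: "detected (tapp ` set L) a b (quat_cocycle (tapp ` set L))"
    and xs: "\<And>\<theta> th d. (\<theta>, th, d) \<in> set xs \<Longrightarrow> rep_data w L \<theta> th d"
    and n: "length xs = n" "n > 0" and w: "w * w = of_int u + of_int v * w"
    and sq: "square_list n T" "square_list n Q" "square_list n U" and s: "s = id \<or> s = swap_rho"
    and table: "table_check (u, v) L (map (fst \<circ> snd) xs) twisted_value s T Q U"
    and van: "vanish_check L (map (fst \<circ> snd) xs) (map (snd \<circ> snd) xs) twisted_value"
  shows "categorified_by_twisted (mk_module n T Q U) (tapp ` set L)"
  unfolding categorified_by_twisted_def
proof
  let ?H = "tapp ` set L"
  fix \<alpha> assume \<alpha>: "\<alpha> \<in> nontrivial_cocycles ?H"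
  then have coc: "\<alpha> \<in> carrier (cocycle_group ?H)" by (simp add: nontrivial_cocycles_def)
  interpret twisted_group ?H \<alpha>
    using subgroup_tapp[OF L] coc by (intro twisted_group.intro perm_group.intro twisted_group_axioms.intro)
  obtain \<mu> where \<mu>0: "\<And>h. h \<in> ?H \<Longrightarrow> \<mu> h \<noteq> 0"
    and \<mu>: "\<And>g h. g \<in> ?H \<Longrightarrow> h \<in> ?H \<Longrightarrow> \<alpha> (g, h) * \<mu> (g \<circ> h) = quat_cocycle ?H (g, h) * (\<mu> g * \<mu> h)"
    using detected.nontrivial_cohomologous[OF det \<alpha>] by blast
  have S: "h \<in> carrier S4" if "h \<in> ?H" for h using subgroup.subset[OF subgroup_tapp[OF L]] that by blast
  have sub: "set L \<subseteq> set perms4" using L by (auto simp: closed_list_def list_all_iff)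
  define \<pi> where "\<pi> h = \<mu> h \<cdot>\<^sub>m quat_rep h" for h
  note dims = carrier_matD[OF quat_rep_carrier]
  have deg: "deg \<pi> = 2" by (simp add: deg_def \<pi>_def dims)
  have mult: "\<pi> g * \<pi> h = \<alpha> (g, h) \<cdot>\<^sub>m \<pi> (g \<circ> h)" if gh: "g \<in> ?H" "h \<in> ?H" for g h
  proof -
    have "\<pi> g * \<pi> h = (\<mu> g * \<mu> h) \<cdot>\<^sub>m (quat_rep g * quat_rep h)" by (simp add: \<pi>_def mat_dim_simps dims mult.commute)
    also have "\<dots> = (\<mu> g * \<mu> h * quat_factor g h) \<cdot>\<^sub>m quat_rep (g \<circ> h)"
      using gh S by (simp add: quat_factor(2) mat_dim_simps(6))
    also have "\<mu> g * \<mu> h * quat_factor g h = \<alpha> (g, h) * \<mu> (g \<circ> h)"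
      using \<mu>[OF gh] gh by (simp add: quat_cocycle_def mult.commute)
    finally show ?thesis unfolding \<pi>_def by (simp only: mat_dim_simps(6))
  qed
  have "\<pi> id = \<alpha> (id, id) \<cdot>\<^sub>m 1\<^sub>m 2"
  proof -
    have "\<pi> id * \<pi> id = \<alpha> (id, id) \<cdot>\<^sub>m \<pi> id" using mult[OF id_in id_in] by simp
    then have "(\<mu> id * \<mu> id) \<cdot>\<^sub>m quat_rep id = (\<alpha> (id, id) * \<mu> id) \<cdot>\<^sub>m quat_rep id"
      by (simp add: \<pi>_def mat_dim_simps dims quat_rep_id)
    then have "\<mu> id * \<mu> id = \<alpha> (id, id) * \<mu> id" by (rule smult_quat_rep_cancel) (use S[OF id_in] in simp)
    then show ?thesis using \<mu>0[OF id_in] by (simp add: \<pi>_def quat_rep_id)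
  qed
  then have \<pi>: "twisted_module ?H \<alpha> \<pi>"
    unfolding twisted_module_def deg using mult by (auto simp: \<pi>_def)
  have tr: "mtrace (\<pi> (tapp t)) = \<mu> (tapp t) * of_int (2 * fst (tquat t))" for t
    by (simp only: \<pi>_def quat_rep_def perm_values_tapp mtrace_smult[OF qmat_carrier] qmat_trace)
  have data: "rep_data w L (map fst xs ! i) (map (fst \<circ> snd) xs ! i) (map (snd \<circ> snd) xs ! i)" if "i < n" for i
    using xs[of "fst (xs ! i)" "fst (snd (xs ! i))" "snd (snd (xs ! i))"] that n by simp
  show "categorified_by (mk_module n T Q U) ?H \<alpha>"
  proof (rule categorified_by_check[OF L coc \<pi>, where \<theta>s = "map fst xs"])
    fix t assume tL: "t \<in> set L"
    then have h: "tapp t \<in> ?H" and tp: "t \<in> set perms4" using sub by auto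
    have tv: "4 * fst (tquat t) * fst (tquat t) = twisted_value t * qnorm (tquat t)" and np: "0 < qnorm (tquat t)"
      using twisted_value_check tp unfolding list_all_iff by blast+
    \<comment> \<open>The inverse of \<open>\<pi> (tapp t)\<close> written with the conjugate
      quaternion. It coincides with \<open>rep_inv\<close>, whose trace thereby becomes
      explicit.\<close>
    let ?X = "(1 / (\<mu> (tapp t) * of_int (qnorm (tquat t)))) \<cdot>\<^sub>m qmat (qconj (tquat t))"
    have "\<pi> (tapp t) * ?X = (1 / of_int (qnorm (tquat t))) \<cdot>\<^sub>m (qmat (tquat t) * qmat (qconj (tquat t)))"
      using \<mu>0[OF h] by (simp add: \<pi>_def quat_rep_def mat_dim_simps carrier_matD[OF qmat_carrier])
    then have X: "\<pi> (tapp t) * ?X = 1\<^sub>m 2" unfolding qmat_conj using np by (simp add: mat_dim_simps)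
    have Xm: "?X \<in> carrier_mat 2 2" by (rule smult_carrier_mat[OF qmat_carrier])
    note Xc = carrier_matD[OF Xm]
    note d2 = tmod_dim[OF \<pi> h, unfolded deg]
    have "rep_inv \<pi> (tapp t) = rep_inv \<pi> (tapp t) * (\<pi> (tapp t) * ?X)" unfolding X by (simp add: mat_dim_simps d2)
    also have "\<dots> = (rep_inv \<pi> (tapp t) * \<pi> (tapp t)) * ?X" by (rule mat_dim_simps(1)[symmetric]) (simp_all add: d2 carrier_matD[OF qmat_carrier])
    also have "\<dots> = ?X" unfolding rep_mult_inv[OF \<pi> h] deg by (rule mat_dim_simps(4)[OF Xc(1)])
    finally have "mtrace (rep_inv \<pi> (tapp t)) = (1 / (\<mu> (tapp t) * of_int (qnorm (tquat t)))) * of_int (2 * fst (tquat t))"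
      by (simp only: mtrace_smult[OF qmat_carrier] qmat_trace fst_qconj)
    then have "mtrace (\<pi> (tapp t)) * mtrace (rep_inv \<pi> (tapp t)) =
        of_int (4 * fst (tquat t) * fst (tquat t)) / of_int (qnorm (tquat t))"
      unfolding tr using \<mu>0[OF h] by simp
    then show "mtrace (\<pi> (tapp t)) * mtrace (rep_inv \<pi> (tapp t)) = of_int (twisted_value t)"
      unfolding tv using np by simp
    assume "twisted_value t = 0"
    then have "fst (tquat t) = 0" using tv by simp
    then show "mtrace (\<pi> (tapp t)) = 0" unfolding tr by simp
  qed (use data n w sq s table van in \<open>auto simp: rep_data_def\<close>)
qed

lemma tapp_eq_iff: "tapp t = tapp u \<longleftrightarrow> t = u"
  using tapp_inj by blast

lemma closed_listD_distinct: "closed_list L \<Longrightarrow> distinct L"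
  unfolding closed_list_def by blast

lemma tapp_eq_id_iff: "tapp t = id \<longleftrightarrow> t = tid"
  using tapp_inj[of t tid] tapp_id by auto

lemma detected_tapp:
  assumes L: "closed_list L" and tu: "t \<in> set L" "u \<in> set L" "tcomp t t = tid" "tcomp t u = tcomp u t"
    and anti: "qmul (tquat t) (tquat u) = qscale (- 1) (qmul (tquat u) (tquat t))"
    and cob: "\<And>\<alpha>. twisted_group (tapp ` set L) \<alpha> \<Longrightarrow> \<alpha> (tapp t, tapp u) = \<alpha> (tapp u, tapp t) \<Longrightarrow> is_cob (tapp ` set L) \<alpha>"
  shows "detected (tapp ` set L) (tapp t) (tapp u) (quat_cocycle (tapp ` set L))"
proof -
  have pg: "perm_group (tapp ` set L)" using subgroup_tapp[OF L] by (rule perm_group.intro)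
  have tp: "t \<in> set perms4" "u \<in> set perms4" using tu L by (auto simp: closed_list_def list_all_iff)
  show ?thesis
  proof (rule detected.intro[OF pg], rule detected_axioms.intro)
    show "tapp t \<in> tapp ` set L" "tapp u \<in> tapp ` set L" using tu by auto
    show "tapp t \<circ> tapp t = id" "tapp u \<circ> tapp t = tapp t \<circ> tapp u"
      unfolding tapp_comp tu(3,4) tapp_id by (rule refl)+
    show "quat_cocycle (tapp ` set L) \<in> carrier (cocycle_group (tapp ` set L))"
      by (rule quat_cocycle_carrier[OF subgroup_tapp[OF L]])
    show "quat_cocycle (tapp ` set L) (tapp t, tapp u) \<noteq> quat_cocycle (tapp ` set L) (tapp u, tapp t)"
      using quat_factor_anticommute[OF tp tu(4) anti] tu by (simp add: quat_cocycle_def del: tapp.simps)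
    show "is_cob (tapp ` set L) \<alpha>" if "\<alpha> \<in> carrier (cocycle_group (tapp ` set L))"
      "\<alpha> (tapp t, tapp u) = \<alpha> (tapp u, tapp t)" for \<alpha>
      by (rule cob[OF twisted_group.intro[OF pg twisted_group_axioms.intro] that(2)]) (rule that(1))
  qed
qed

lemma is_cob_klein_tapp:
  assumes "twisted_group H \<alpha>" and tH: "tapp t \<in> H" "tapp u \<in> H" and c: "tcomp t t = tid" "tcomp u u = tid" "tcomp u t = tcomp t u"
    and d: "t \<noteq> tid" "u \<noteq> tid" "t \<noteq> u" and sym: "\<alpha> (tapp t, tapp u) = \<alpha> (tapp u, tapp t)"
  shows "is_cob (tapp ` set [tid, t, u, tcomp t u]) \<alpha>"
proof -
  have "is_cob {id, tapp t, tapp u, tapp t \<circ> tapp u} \<alpha>"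
    by (rule twisted_group.is_cob_klein[OF assms(1)])
      (use tH d sym in \<open>simp_all add: tapp_comp c tapp_id tapp_eq_iff tapp_eq_id_iff del: tapp.simps\<close>)
  then show ?thesis unfolding tapp_comp list.set image_insert image_empty tapp_id .
qed

lemma is_cob_cyclic3_tapp:
  assumes "twisted_group H \<alpha>" and tH: "tapp (2,3,1,4) \<in> H"
  shows "is_cob (tapp ` set Z3_list) \<alpha>"
proof -
  let ?r = "(2,3,1,4) :: tup"
  have rr: "tapp ?r \<circ> tapp ?r = tapp (3,1,2,4)" and r3: "tapp ?r \<circ> tapp (3,1,2,4) = id"
    unfolding tapp_comp tapp_id[symmetric] by (simp_all add: tcomp_def)
  have "tapp ?r \<circ> (tapp ?r \<circ> tapp ?r) = id" "tapp ?r \<noteq> id" "tapp ?r \<circ> tapp ?r \<noteq> id" "tapp ?r \<circ> tapp ?r \<noteq> tapp ?r"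
    unfolding rr r3 tapp_eq_iff tapp_eq_id_iff by simp_all
  note is_cob = twisted_group.is_cob_cyclic3[OF assms this]
  show ?thesis using is_cob unfolding rr Z3_list_def list.set image_insert image_empty tapp_id .
qed

lemma detected_K4: "detected (tapp ` set K4_list) (tapp (2,1,3,4)) (tapp (1,2,4,3)) (quat_cocycle (tapp ` set K4_list))"
proof (rule detected_tapp[OF closed_lists(5)])
  fix \<alpha> assume tg: "twisted_group (tapp ` set K4_list) \<alpha>"
    and sym: "\<alpha> (tapp (2,1,3,4), tapp (1,2,4,3)) = \<alpha> (tapp (1,2,4,3), tapp (2,1,3,4))"
  have "is_cob (tapp ` set [tid, (2,1,3,4), (1,2,4,3), tcomp (2,1,3,4) (1,2,4,3)]) \<alpha>"
    by (rule is_cob_klein_tapp[OF tg _ _ _ _ _ _ _ _ sym]) (simp_all add: K4_list_def tcomp_def del: tapp.simps, simp_all)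
  then show "is_cob (tapp ` set K4_list) \<alpha>" by (simp add: K4_list_def tcomp_def)
qed (simp_all add: K4_list_def tcomp_def tquat_def quat_table_def)

definition dihedral_list :: "tup \<Rightarrow> tup \<Rightarrow> tup \<Rightarrow> tup list" where
  "dihedral_list a b r = (let K = [tid, a, b, tcomp a b] in K @ map (\<lambda>k. tcomp k r) K)"

definition dihedral_check :: "tup \<Rightarrow> tup \<Rightarrow> tup \<Rightarrow> bool" where
  "dihedral_check a b r \<longleftrightarrow> tcomp a a = tid \<and> tcomp b b = tid \<and> tcomp b a = tcomp a b \<and> a \<noteq> tid \<and> b \<noteq> tid \<and> a \<noteq> b \<and>
     tcomp r a = tcomp b r \<and> tcomp r b = tcomp a r \<and> tcomp r r = tcomp a b \<and> r \<notin> set [tid, a, b, tcomp a b]"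

lemma is_cob_dihedral_tapp:
  assumes tg: "twisted_group H \<alpha>" and H: "tapp ` set (dihedral_list a b r) \<subseteq> H" and check: "dihedral_check a b r"
    and sym: "\<alpha> (tapp a, tapp b) = \<alpha> (tapp b, tapp a)"
  shows "is_cob (tapp ` set (dihedral_list a b r)) \<alpha>"
proof -
  let ?a = "tapp a" and ?b = "tapp b" and ?r = "tapp r"
  have sq: "?a \<circ> ?a = id" "?b \<circ> ?b = id" and ba: "?b \<circ> ?a = ?a \<circ> ?b"
    and r: "?r \<circ> ?a = ?b \<circ> ?r" "?r \<circ> ?b = ?a \<circ> ?r" "?r \<circ> ?r = ?a \<circ> ?b"
    and d: "?a \<noteq> id" "?b \<noteq> id" "?a \<noteq> ?b"
    using check unfolding dihedral_check_def tapp_comp tapp_eq_iff tapp_eq_id_iff tapp_id[symmetric] by metis+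
  have rK: "?r \<notin> {id, ?a, ?b, ?a \<circ> ?b}"
    using check unfolding dihedral_check_def tapp_comp insert_iff empty_iff tapp_eq_iff tapp_eq_id_iff list.set by blast
  have eq: "tapp ` set (dihedral_list a b r) = {id, ?a, ?b, ?a \<circ> ?b} \<union> (\<lambda>k. k \<circ> ?r) ` {id, ?a, ?b, ?a \<circ> ?b}"
    unfolding dihedral_list_def Let_def set_append set_map image_Un list.set image_insert image_empty tapp_comp
      tapp_id[symmetric] by (rule refl)
  have mem: "?a \<in> H" "?b \<in> H" "?r \<in> H" using H unfolding eq by auto
  show ?thesis unfolding eq
    by (rule twisted_group.is_cob_dihedral[OF tg mem(1) sq(1) mem(2) sq(2) ba sym d mem(3) r rK])
qed

text \<open>Generators of the three subgroups of order 8, with \<open>a\<close>, \<open>b\<close> transpositions and \<open>r\<close> of order 4.\<close>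

definition dihedral_triples :: "(tup \<times> tup \<times> tup) list" where
  "dihedral_triples = [((3,2,1,4), (1,4,3,2), (2,3,4,1)), ((2,1,3,4), (1,2,4,3), (3,4,2,1)), ((4,2,3,1), (1,3,2,4), (2,4,1,3))]"

lemma dihedral_triples_check:
  assumes "(a, b, r) \<in> set dihedral_triples"
  shows "closed_list (dihedral_list a b r)" "dihedral_check a b r"
    "qmul (tquat a) (tquat b) = qscale (- 1) (qmul (tquat b) (tquat a))"
proof -
  have "list_all (\<lambda>(a, b, r). closed_list (dihedral_list a b r) \<and> dihedral_check a b r \<and>
      qmul (tquat a) (tquat b) = qscale (- 1) (qmul (tquat b) (tquat a))) dihedral_triples"
    by code_simp
  then show "closed_list (dihedral_list a b r)" "dihedral_check a b r"
    "qmul (tquat a) (tquat b) = qscale (- 1) (qmul (tquat b) (tquat a))"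
    using assms unfolding list_all_iff by auto
qed

lemma detected_dihedral:
  assumes "(a, b, r) \<in> set dihedral_triples"
  shows "detected (tapp ` set (dihedral_list a b r)) (tapp a) (tapp b) (quat_cocycle (tapp ` set (dihedral_list a b r)))"
proof (rule detected_tapp)
  note check = dihedral_triples_check[OF assms]
  show "is_cob (tapp ` set (dihedral_list a b r)) \<alpha>"
    if "twisted_group (tapp ` set (dihedral_list a b r)) \<alpha>" "\<alpha> (tapp a, tapp b) = \<alpha> (tapp b, tapp a)" for \<alpha>
    by (rule is_cob_dihedral_tapp[OF that(1) subset_refl check(2) that(2)])
  show "a \<in> set (dihedral_list a b r)" "b \<in> set (dihedral_list a b r)" by (simp_all add: dihedral_list_def)
  show "tcomp a a = tid" "tcomp a b = tcomp b a" using check(2) unfolding dihedral_check_def by metis+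
qed (rule dihedral_triples_check[OF assms])+

lemma set_D4_list: "set D4_list = set (dihedral_list (3,2,1,4) (1,4,3,2) (2,3,4,1))"
proof -
  have "list_all (\<lambda>x. x \<in> set (dihedral_list (3,2,1,4) (1,4,3,2) (2,3,4,1))) D4_list \<and>
      list_all (\<lambda>x. x \<in> set D4_list) (dihedral_list (3,2,1,4) (1,4,3,2) (2,3,4,1))"
    by code_simp
  then show ?thesis unfolding list_all_iff by blast
qed

lemma is_cob_D4_tapp:
  assumes "twisted_group H \<alpha>" "tapp ` set D4_list \<subseteq> H"
    "\<alpha> (tapp (3,2,1,4), tapp (1,4,3,2)) = \<alpha> (tapp (1,4,3,2), tapp (3,2,1,4))"
  shows "is_cob (tapp ` set D4_list) \<alpha>"
proof -
  have "dihedral_check (3,2,1,4) (1,4,3,2) (2,3,4,1)" by (rule dihedral_triples_check) (simp add: dihedral_triples_def)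
  then show ?thesis using is_cob_dihedral_tapp assms unfolding set_D4_list by blast
qed

lemma detected_D4: "detected (tapp ` set D4_list) (tapp (3,2,1,4)) (tapp (1,4,3,2)) (quat_cocycle (tapp ` set D4_list))"
  unfolding set_D4_list by (rule detected_dihedral) (simp add: dihedral_triples_def)

text \<open>Symmetry at two generators trivialises \<alpha> on the normal Klein group, of index 3,
  and \<alpha> is always trivial on the cyclic group of order 3, of index 4. Transfer makes
  \<alpha>^3 and \<alpha>^4 coboundaries.\<close>

lemma detected_A4: "detected (tapp ` set A4_list) (tapp (2,1,4,3)) (tapp (3,4,1,2)) (quat_cocycle (tapp ` set A4_list))"
proof (rule detected_tapp[OF closed_lists(8)])
  fix \<alpha> assume tg: "twisted_group (tapp ` set A4_list) \<alpha>"
    and sym: "\<alpha> (tapp (2,1,4,3), tapp (3,4,1,2)) = \<alpha> (tapp (3,4,1,2), tapp (2,1,4,3))"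
  interpret twisted_group "tapp ` set A4_list" \<alpha> by (rule tg)
  let ?V = "[tid, (2,1,4,3), (3,4,1,2), tcomp (2,1,4,3) (3,4,1,2)]"
  have V: "closed_list ?V" by code_simp
  have "is_cob (tapp ` set ?V) \<alpha>"
    by (rule is_cob_klein_tapp[OF tg _ _ _ _ _ _ _ _ sym]) (simp_all add: A4_list_def tcomp_def del: tapp.simps, simp_all)
  moreover have "tapp ` set ?V \<subseteq> tapp ` set A4_list" by (intro image_mono) (simp add: A4_list_def tcomp_def)
  moreover have "card (tapp ` set A4_list) div card (tapp ` set ?V) = 3"
    unfolding card_tapp[OF closed_listD_distinct[OF closed_lists(8)]] card_tapp[OF closed_listD_distinct[OF V]]
    by (simp add: A4_list_def)
  ultimately have 3: "is_cob (tapp ` set A4_list) (\<lambda>p. \<alpha> p ^ 3)"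
    using is_cob_transfer[OF subgroup_tapp[OF V]] by simp
  have "is_cob (tapp ` set Z3_list) \<alpha>"
    by (rule is_cob_cyclic3_tapp[OF tg]) (simp add: A4_list_def del: tapp.simps)
  moreover have "tapp ` set Z3_list \<subseteq> tapp ` set A4_list" by (intro image_mono) (simp add: A4_list_def Z3_list_def)
  moreover have "card (tapp ` set A4_list) div card (tapp ` set Z3_list) = 4"
    using closed_listD_distinct[OF closed_lists(8)] closed_listD_distinct[OF closed_lists(3)] by (simp add: card_tapp) (simp add: A4_list_def Z3_list_def)
  ultimately have 4: "is_cob (tapp ` set A4_list) (\<lambda>p. \<alpha> p ^ 4)"
    using is_cob_transfer[OF subgroup_tapp[OF closed_lists(3)]] by simp
  have "Suc 3 = 4" by simp
  then show "is_cob (tapp ` set A4_list) \<alpha>" using 3 4 by (intro is_cob_if_powers[of _ \<alpha> 3] comp_in nonzero) simp_all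
qed (simp_all add: A4_list_def tcomp_def tquat_def quat_table_def)

text \<open>Transfer from the dihedral group, of index 3, makes \<alpha>^3 and hence \<alpha>^9 a
  coboundary; transfer from the cyclic group of order 3, of index 8, does the same for
  \<alpha>^8.\<close>

lemma detected_S4: "detected (tapp ` set perms4) (tapp (3,2,1,4)) (tapp (1,4,3,2)) (quat_cocycle (tapp ` set perms4))"
proof (rule detected_tapp[OF closed_perms4])
  fix \<alpha> assume tg: "twisted_group (tapp ` set perms4) \<alpha>"
    and sym: "\<alpha> (tapp (3,2,1,4), tapp (1,4,3,2)) = \<alpha> (tapp (1,4,3,2), tapp (3,2,1,4))"
  interpret twisted_group "tapp ` set perms4" \<alpha> by (rule tg)
  have D: "tapp ` set D4_list \<subseteq> tapp ` set perms4" by (intro image_mono) (simp add: D4_list_def perms4_def)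
  have "card (tapp ` set perms4) div card (tapp ` set D4_list) = 3"
    using closed_listD_distinct[OF closed_perms4] closed_listD_distinct[OF closed_lists(7)] by (simp add: card_tapp) (simp add: perms4_def D4_list_def)
  then have 3: "is_cob (tapp ` set perms4) (\<lambda>p. \<alpha> p ^ 3)"
    using is_cob_transfer[OF subgroup_tapp[OF closed_lists(7)] D is_cob_D4_tapp[OF tg D sym]] by simp
  have "is_cob (tapp ` set Z3_list) \<alpha>"
    by (rule is_cob_cyclic3_tapp[OF tg]) (simp add: perms4_def del: tapp.simps)
  moreover have "tapp ` set Z3_list \<subseteq> tapp ` set perms4" by (intro image_mono) (simp add: perms4_def Z3_list_def)
  moreover have "card (tapp ` set perms4) div card (tapp ` set Z3_list) = 8"
    using closed_listD_distinct[OF closed_perms4] closed_listD_distinct[OF closed_lists(3)] by (simp add: card_tapp) (simp add: perms4_def Z3_list_def)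
  ultimately have 8: "is_cob (tapp ` set perms4) (\<lambda>p. \<alpha> p ^ 8)"
    using is_cob_transfer[OF subgroup_tapp[OF closed_lists(3)]] by simp
  have "is_cob (tapp ` set perms4) (\<lambda>p. (\<alpha> p ^ 3) ^ 3)" by (rule is_cob_power[OF 3])
  then have "is_cob (tapp ` set perms4) (\<lambda>p. \<alpha> p ^ Suc 8)" by (simp add: power_mult[symmetric])
  then show "is_cob (tapp ` set perms4) \<alpha>" using 8 by (intro is_cob_if_powers[of _ \<alpha> 8] comp_in nonzero) simp_all
qed (simp_all add: perms4_def tcomp_def tquat_def quat_table_def)

lemma second_cohomology_twisted_subgroups:
  "\<forall>H \<in> {K4_sub, D4_sub, A4_sub, S4_sub}. second_cohomology H \<cong> integer_mod_group 2"
  using detected.second_cohomology_iso[OF detected_K4] detected.second_cohomology_iso[OF detected_D4]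
    detected.second_cohomology_iso[OF detected_A4] detected.second_cohomology_iso[OF detected_S4]
  by (simp add: K4_sub_eq D4_sub_eq A4_sub_eq S4_sub_eq)

section \<open>The modules r(H, \<alpha>) for nontrivial classes\<close>

lemma M11_K4_twisted: "categorified_by_twisted M11 K4_sub"
  unfolding M11_def K4_sub_eq
proof (rule categorified_by_twisted_check[OF closed_lists(5) detected_K4, where w = "0" and u = "0" and v = "0" and s = id and
    xs = "[irr_entry One]"])
  show "table_check (0, 0) K4_list (map (fst \<circ> snd) [irr_entry One]) twisted_value id
    [[1]]
    [[2]]
    [[3]]"
    unfolding list.map comp_def fst_conv snd_conv by code_simp
  show "vanish_check K4_list (map (fst \<circ> snd) [irr_entry One])
    (map (snd \<circ> snd) [irr_entry One]) twisted_value"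
    unfolding list.map comp_def fst_conv snd_conv by code_simp
qed (use rep_data_irrs[OF closed_lists(5)] module_check_square[OF module_check_M11] omega_square
   in \<open>auto simp del: tchi.simps\<close>)

text \<open>The endomorphisms of the quaternion module carry the character of 1 +
  \<open>Rho3\<close>. Over \<open>D4_sub\<close> its inner product with \<open>Rho3\<close> is 2
  and with \<open>Rho2\<close> is 1, so \<open>M22\<close> appears after the exchange and
  \<open>M23\<close> without it.\<close>

lemma M22_D4_twisted: "categorified_by_twisted M22 D4_sub"
  unfolding M22_def D4_sub_eq
proof (rule categorified_by_twisted_check[OF closed_lists(7) detected_D4, where w = "0" and u = "0" and v = "0" and s = swap_rho and
    xs = "[irr_entry One, irr_entry Psi]"])
  show "table_check (0, 0) D4_list (map (fst \<circ> snd) [irr_entry One, irr_entry Psi]) twisted_value swap_rho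
    [[0,1],[1,0]]
    [[1,1],[1,1]]
    [[2,1],[1,2]]"
    unfolding list.map comp_def fst_conv snd_conv by code_simp
  show "vanish_check D4_list (map (fst \<circ> snd) [irr_entry One, irr_entry Psi])
    (map (snd \<circ> snd) [irr_entry One, irr_entry Psi]) twisted_value"
    unfolding list.map comp_def fst_conv snd_conv by code_simp
qed (use rep_data_irrs[OF closed_lists(7)] module_check_square[OF module_check_M22] omega_square
   in \<open>auto simp del: tchi.simps\<close>)

lemma M23_D4_twisted: "categorified_by_twisted M23 D4_sub"
  unfolding M23_def D4_sub_eq
proof (rule categorified_by_twisted_check[OF closed_lists(7) detected_D4, where w = "0" and u = "0" and v = "0" and s = id and
    xs = "[irr_entry One, irr_entry Psi]"])
  show "table_check (0, 0) D4_list (map (fst \<circ> snd) [irr_entry One, irr_entry Psi]) twisted_value id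
    [[0,1],[1,0]]
    [[1,1],[1,1]]
    [[1,2],[2,1]]"
    unfolding list.map comp_def fst_conv snd_conv by code_simp
  show "vanish_check D4_list (map (fst \<circ> snd) [irr_entry One, irr_entry Psi])
    (map (snd \<circ> snd) [irr_entry One, irr_entry Psi]) twisted_value"
    unfolding list.map comp_def fst_conv snd_conv by code_simp
qed (use rep_data_irrs[OF closed_lists(7)] module_check_square[OF module_check_M23] omega_square
   in \<open>auto simp del: tchi.simps\<close>)

lemma M31_A4_twisted: "categorified_by_twisted M31 A4_sub"
  unfolding M31_def A4_sub_eq
proof (rule categorified_by_twisted_check[OF closed_lists(8) detected_A4, where w = "omega" and u = "- 1" and v = "- 1" and s = id and
    xs = "[irr_entry One, lin_entry omega th_omega1, lin_entry omega th_omega2]"])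
  show "table_check (- 1, - 1) A4_list (map (fst \<circ> snd) [irr_entry One, lin_entry omega th_omega1, lin_entry omega th_omega2]) twisted_value id
    [[1,0,0],[0,1,0],[0,0,1]]
    [[0,1,1],[1,0,1],[1,1,0]]
    [[1,1,1],[1,1,1],[1,1,1]]"
    unfolding list.map comp_def fst_conv snd_conv by code_simp
  show "vanish_check A4_list (map (fst \<circ> snd) [irr_entry One, lin_entry omega th_omega1, lin_entry omega th_omega2])
    (map (snd \<circ> snd) [irr_entry One, lin_entry omega th_omega1, lin_entry omega th_omega2]) twisted_value"
    unfolding list.map comp_def fst_conv snd_conv by code_simp
qed (use rep_data_irrs[OF closed_lists(8)] module_check_square[OF module_check_M31] omega_square
  omega_data[OF lin_checks(3)] omega_data[OF lin_checks(4)] in \<open>auto simp del: tchi.simps\<close>)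

lemma M33_S4_twisted: "categorified_by_twisted M33 S4_sub"
  unfolding M33_def S4_sub_eq
proof (rule categorified_by_twisted_check[OF closed_perms4 detected_S4, where w = "0" and u = "0" and v = "0" and s = id and
    xs = "[irr_entry One, irr_entry Psi, irr_entry Rho1]"])
  show "table_check (0, 0) perms4 (map (fst \<circ> snd) [irr_entry One, irr_entry Psi, irr_entry Rho1]) twisted_value id
    [[0,1,0],[1,0,0],[0,0,1]]
    [[0,0,1],[0,0,1],[1,1,1]]
    [[0,1,1],[1,0,1],[1,1,2]]"
    unfolding list.map comp_def fst_conv snd_conv by code_simp
  show "vanish_check perms4 (map (fst \<circ> snd) [irr_entry One, irr_entry Psi, irr_entry Rho1])
    (map (snd \<circ> snd) [irr_entry One, irr_entry Psi, irr_entry Rho1]) twisted_value"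
    unfolding list.map comp_def fst_conv snd_conv by code_simp
qed (use rep_data_irrs[OF closed_perms4] module_check_square[OF module_check_M33] omega_square
   in \<open>auto simp del: tchi.simps\<close>)

section \<open>Modules that cannot be categorified\<close>

definition reg_diag :: "'b zdata \<Rightarrow> 'b \<Rightarrow> int" where
  "reg_diag M k = zcoef M One k k + zcoef M Psi k k + 2 * zcoef M Rho1 k k + 3 * zcoef M Rho2 k k + 3 * zcoef M Rho3 k k"

lemma regular_character:
  assumes "h \<in> carrier S4"
  shows "mtrace (irr_rep One h) + mtrace (irr_rep Psi h) + 2 * mtrace (irr_rep Rho1 h) + 3 * mtrace (irr_rep Rho2 h) +
    3 * mtrace (irr_rep Rho3 h) = (if h = id then 24 else 0)"
proof -
  obtain t where t: "t \<in> set perms4" "h = tapp t" using assms unfolding S4_tapp by blast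
  have "list_all (\<lambda>t. tchi One t + tchi Psi t + 2 * tchi Rho1 t + 3 * tchi Rho2 t + 3 * tchi Rho3 t =
      (if t = tid then 24 else 0)) perms4"
    by code_simp
  then have c: "tchi One t + tchi Psi t + 2 * tchi Rho1 t + 3 * tchi Rho2 t + 3 * tchi Rho3 t = (if t = tid then 24 else 0)"
    using t(1) unfolding list_all_iff by blast
  have "of_int (tchi One t) + of_int (tchi Psi t) + 2 * of_int (tchi Rho1 t) + 3 * of_int (tchi Rho2 t) + 3 * of_int (tchi Rho3 t) =
      (of_int (tchi One t + tchi Psi t + 2 * tchi Rho1 t + 3 * tchi Rho2 t + 3 * tchi Rho3 t) :: complex)"
    by (simp del: tchi.simps)
  then show ?thesis unfolding t(2) mtrace_irr_rep[OF t(1)] c tapp_eq_id_iff by simp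
qed

context twisted_group
begin

lemma H_sub: "H \<subseteq> carrier S4"
  by (rule subgroup.subset[OF subgroup])

lemma rep_on_irr: "rep_on H (irr_rep x)"
  by (rule rep_on_subset[OF irr_rep_on_S4 H_sub])

text \<open>The regular character vanishes off the identity, so a single summand survives, and there
  the traces of \<sigma> and of its inverse multiply to the square of the degree.\<close>

lemma reg_diag_grothendieck:
  assumes K: "K \<in> simple_classes H \<alpha>" "\<sigma> \<in> K"
  shows "reg_diag (grothendieck_module H \<alpha>) K * int (card H) = 24 * int (deg \<sigma> * deg \<sigma>)"
proof -
  let ?z = "\<lambda>x. zcoef (grothendieck_module H \<alpha>) x K K"
  let ?F = "\<lambda>h. mtrace (\<sigma> h) * mtrace (rep_inv \<sigma> h)"
  have "\<sigma> \<in> simple_modules H \<alpha>"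
    using class_mem_iff(2)[OF K(1) K(2)] simple_class_some(2)[OF K(1)] by blast
  then have t: "tmod \<sigma>" by (rule simple_dest)
  have z: "of_int (?z x) * of_nat (card H) = (\<Sum>h\<in>H. mtrace (irr_rep x h) * ?F h)" for x
    using grothendieck_coef[OF rep_on_irr K K] by (simp only: mult.assoc)
  have "(of_int (reg_diag (grothendieck_module H \<alpha>) K) :: complex) * of_nat (card H) =
      of_int (?z One) * of_nat (card H) + of_int (?z Psi) * of_nat (card H) + 2 * (of_int (?z Rho1) * of_nat (card H)) +
      3 * (of_int (?z Rho2) * of_nat (card H)) + 3 * (of_int (?z Rho3) * of_nat (card H))"
    by (simp add: reg_diag_def algebra_simps)
  also have "\<dots> = (\<Sum>h\<in>H. (mtrace (irr_rep One h) + mtrace (irr_rep Psi h) + 2 * mtrace (irr_rep Rho1 h) +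
      3 * mtrace (irr_rep Rho2 h) + 3 * mtrace (irr_rep Rho3 h)) * ?F h)"
    unfolding z sum_distrib_left sum.distrib[symmetric] by (intro sum.cong) (simp_all only: distrib_right mult.assoc)
  also have "\<dots> = (\<Sum>h\<in>H. if h = id then 24 * ?F id else 0)"
    using H_sub by (intro sum.cong refl) (subst regular_character, auto)
  also have "\<dots> = 24 * ?F id" by simp
  also have "?F id = of_nat (deg \<sigma> * deg \<sigma>)"
  proof -
    let ?X = "rep_inv \<sigma> id"
    have X: "?X \<in> carrier_mat (deg \<sigma>) (deg \<sigma>)" by (rule rep_inv_carrier[OF t id_in])
    have "\<alpha> (id, id) \<cdot>\<^sub>m ?X = 1\<^sub>m (deg \<sigma>)"
      using rep_mult_inv(1)[OF t id_in] X unfolding tmod_id[OF t] by (simp add: mat_dim_simps)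
    then have "\<alpha> (id, id) * mtrace ?X = of_nat (deg \<sigma>)" using mtrace_smult[OF X, of "\<alpha> (id, id)"] by simp
    moreover have "mtrace (\<sigma> id) = \<alpha> (id, id) * of_nat (deg \<sigma>)"
      unfolding tmod_id[OF t] by (subst mtrace_smult[of _ "deg \<sigma>"]) simp_all
    ultimately show ?thesis by (simp add: mult.assoc mult.left_commute)
  qed
  finally have "(of_int (reg_diag (grothendieck_module H \<alpha>) K * int (card H)) :: complex) = of_int (24 * int (deg \<sigma> * deg \<sigma>))"
    by simp
  then show ?thesis unfolding of_int_eq_iff .
qed

lemma one_dimensional_character:
  assumes t: "tmod \<sigma>" and d: "deg \<sigma> = 1" and h: "h \<in> H"
  shows "mtrace (\<sigma> h) * mtrace (rep_inv \<sigma> h) = 1"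
proof -
  have c: "\<sigma> h \<in> carrier_mat 1 1" "rep_inv \<sigma> h \<in> carrier_mat 1 1"
    using tmod_carrier[OF t h] rep_inv_carrier[OF t h] by (simp_all add: d)
  have "(\<sigma> h * rep_inv \<sigma> h) $$ (0, 0) = 1" using rep_mult_inv(1)[OF t h] by (simp add: d)
  moreover have "(\<sigma> h * rep_inv \<sigma> h) $$ (0, 0) = \<sigma> h $$ (0, 0) * rep_inv \<sigma> h $$ (0, 0)"
    using c by (subst mult_mat_index[OF c]) (simp_all add: One_nat_def)
  moreover have "mtrace A = A $$ (0, 0)" if "A \<in> carrier_mat 1 1" for A :: "complex mat"
    using that by (simp add: mtrace_def One_nat_def)
  ultimately show ?thesis using c by simp
qed

text \<open>In degree 1 the trace and the inverse trace cancel, so the diagonal coefficient depends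
  on x but not on the class.\<close>

lemma one_dimensional_diag:
  assumes K: "K \<in> simple_classes H \<alpha>" "\<sigma> \<in> K" and d: "deg \<sigma> = 1"
  shows "of_int (zcoef (grothendieck_module H \<alpha>) x K K) * of_nat (card H) = (\<Sum>h\<in>H. mtrace (irr_rep x h))"
proof -
  have "\<sigma> \<in> simple_modules H \<alpha>"
    using class_mem_iff(2)[OF K(1) K(2)] simple_class_some(2)[OF K(1)] by blast
  then have t: "tmod \<sigma>" by (rule simple_dest)
  show ?thesis unfolding grothendieck_coef[OF rep_on_irr K K] mult.assoc
    by (intro sum.cong refl) (simp only: one_dimensional_character[OF t d] mult_1_right)
qed

text \<open>The function \<mu> that trivialises \<alpha> is itself a one-dimensional twisted
  module.\<close>

lemma one_dimensional_class:
  assumes "is_cob H \<alpha>"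
  obtains K \<sigma> where "K \<in> simple_classes H \<alpha>" "\<sigma> \<in> K" "deg \<sigma> = 1"
proof -
  obtain \<mu> where \<mu>: "\<forall>h\<in>H. \<mu> h \<noteq> 0" "\<forall>g\<in>H. \<forall>h\<in>H. \<alpha> (g, h) * \<mu> (g \<circ> h) = \<mu> g * \<mu> h"
    using assms by (auto simp: is_cob_def)
  define \<sigma> :: rep where "\<sigma> h = \<mu> h \<cdot>\<^sub>m 1\<^sub>m 1" for h
  have d: "deg \<sigma> = 1" by (simp add: deg_def \<sigma>_def)
  have "\<alpha> (id, id) * \<mu> id = \<mu> id * \<mu> id" "\<mu> id \<noteq> 0" using \<mu>(2)[rule_format, OF id_in id_in] \<mu>(1) by simp_all
  then have "\<mu> id = \<alpha> (id, id)" by simp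
  then have t: "tmod \<sigma>" unfolding twisted_module_def d using \<mu> by (auto simp: \<sigma>_def mat_dim_simps)
  have "char_form \<sigma> \<sigma> = of_nat (card H)" unfolding char_form_def by (simp add: one_dimensional_character[OF t d])
  then have s: "\<sigma> \<in> simple_modules H \<alpha>" by (rule simple_if_char_form_self[OF t])
  show ?thesis
  proof (rule that[OF _ _ d])
    show "iso_rel `` {\<sigma>} \<in> simple_classes H \<alpha>" unfolding simple_classes_def by (rule quotientI[OF s])
    show "\<sigma> \<in> iso_rel `` {\<sigma>}" by (rule equiv_class_self[OF equiv_iso_rel s])
  qed
qed

end

section \<open>Obstructions from diagonal coefficients\<close>

lemma categorified_byE:
  assumes "categorified_by M H \<alpha>"
  obtains f s where "bij_betw f (zbasis M) (simple_classes H \<alpha>)" "s = id \<or> s = swap_rho"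
    "\<And>x k. k \<in> zbasis M \<Longrightarrow> zcoef M x k k = zcoef (grothendieck_module H \<alpha>) (s x) (f k) (f k)"
  using assms unfolding categorified_by_def
proof
  assume "zequiv M (grothendieck_module H \<alpha>)"
  then obtain f where "bij_betw f (zbasis M) (simple_classes H \<alpha>)"
    "\<And>x k. k \<in> zbasis M \<Longrightarrow> zcoef M x k k = zcoef (grothendieck_module H \<alpha>) x (f k) (f k)"
    unfolding zequiv_def by (auto simp: grothendieck_module_def)
  then show ?thesis by (intro that[of f id]) auto
next
  assume "zequiv M (exchange_rho (grothendieck_module H \<alpha>))"
  then obtain f where f: "bij_betw f (zbasis M) (zbasis (exchange_rho (grothendieck_module H \<alpha>)))"
    "\<forall>x. \<forall>k\<in>zbasis M. \<forall>l\<in>zbasis M. zcoef (exchange_rho (grothendieck_module H \<alpha>)) x (f k) (f l) = zcoef M x k l"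
    unfolding zequiv_def by blast
  have "zcoef M x k k = zcoef (grothendieck_module H \<alpha>) (swap_rho x) (f k) (f k)" if "k \<in> zbasis M" for x k
    using f(2) that by (simp add: exchange_rho_def swap_rho_def)
  moreover have "bij_betw f (zbasis M) (simple_classes H \<alpha>)"
    using f(1) by (simp add: exchange_rho_def grothendieck_module_def)
  ultimately show ?thesis by (intro that[of f swap_rho]) auto
qed

lemma card_dvd_24:
  assumes "subgroup H S4"
  shows "card H dvd 24" "0 < card H"
proof -
  have "finite (carrier S4)" unfolding S4_tapp by simp
  then have "card (rcosets\<^bsub>S4\<^esub> H) * card H = Coset.order S4"
    by (rule group.lagrange_finite[OF sym_group_is_group _ assms])
  moreover have "Coset.order S4 = 24" unfolding Coset.order_def S4_tapp card_tapp[OF closed_listD_distinct[OF closed_perms4]]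
    by (simp add: perms4_def)
  ultimately show "card H dvd 24" by (metis dvd_triv_right)
  then show "0 < card H" by (auto intro: Nat.gr0I)
qed

text \<open>The obstructions look at diagonal coefficients only. The exchange recorded by
  \<open>s\<close> leaves \<open>reg_diag\<close> and the coefficients of \<open>Psi\<close>
  unchanged.\<close>

locale categorification = twisted_group +
  fixes M :: "nat zdata" and f s
  assumes f: "bij_betw f (zbasis M) (simple_classes H \<alpha>)" and s: "s = id \<or> s = swap_rho"
    and coef: "\<And>x k. k \<in> zbasis M \<Longrightarrow> zcoef M x k k = zcoef (grothendieck_module H \<alpha>) (s x) (f k) (f k)"
begin

lemma reg_diag_deg:
  assumes k: "k \<in> zbasis M" and \<sigma>: "\<sigma> \<in> f k"
  shows "reg_diag M k * int (card H) = 24 * int (deg \<sigma> * deg \<sigma>)"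
proof -
  have "reg_diag M k = reg_diag (grothendieck_module H \<alpha>) (f k)"
    using s by (auto simp: reg_diag_def coef[OF k] swap_rho_def)
  then show ?thesis using reg_diag_grothendieck[OF _ \<sigma>] bij_betwE[OF f] k by simp
qed

lemma member: assumes "k \<in> zbasis M" obtains \<sigma> where "\<sigma> \<in> f k"
  using simple_class_some(1) bij_betwE[OF f] assms by blast

lemma Psi_diag: "k \<in> zbasis M \<Longrightarrow> zcoef M Psi k k = zcoef (grothendieck_module H \<alpha>) Psi (f k) (f k)"
  using s coef by (auto simp: swap_rho_def)

lemma one_dimensional_coef:
  assumes "k \<in> zbasis M" "\<sigma> \<in> f k" "deg \<sigma> = 1"
  shows "of_int (zcoef M x k k) * of_nat (card H) = (\<Sum>h\<in>H. mtrace (irr_rep (s x) h))"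
  unfolding coef[OF assms(1)] using one_dimensional_diag[OF _ assms(2,3)] bij_betwE[OF f] assms(1) by blast

text \<open>For a one-dimensional class the diagonal coefficient of \<open>Psi\<close> is the
  average of the sign over H, which is 1 only if every sign is 1.\<close>

lemma all_even:
  assumes "k \<in> zbasis M" "\<sigma> \<in> f k" "deg \<sigma> = 1" "zcoef M Psi k k = 1" and t: "tapp t \<in> H" "t \<in> set perms4"
  shows "tsign t = 1"
proof -
  have sp: "s Psi = Psi" using s by (auto simp: swap_rho_def)
  have m: "mtrace (irr_rep Psi h) = of_int (sign h)" for h by (simp add: mtrace_def One_nat_def)
  have "(of_nat (card H) :: complex) = (\<Sum>h\<in>H. of_int (sign h))"
    using one_dimensional_coef[OF assms(1-3), of Psi] by (simp only: assms(4) sp m) simp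
  then have "of_int (\<Sum>h\<in>H. 1 - sign h) = (0 :: complex)" by (simp add: sum_subtractf)
  then have "(\<Sum>h\<in>H. 1 - sign h) = 0" by (simp only: of_int_eq_0_iff)
  then have "\<forall>h\<in>H. 1 - sign h = 0"
    by (subst (asm) sum_nonneg_eq_0_iff) (auto simp: sign_def)
  then show ?thesis using t sign_tapp[OF t(2)] by auto
qed

text \<open>With d the degree, \<open>card H\<close> is 4 d^2 and divides 24, so d^2 divides
  6.\<close>

lemma diag_6:
  assumes k: "k \<in> zbasis M" "reg_diag M k = 6" and \<sigma>: "\<sigma> \<in> f k"
  shows "deg \<sigma> = 1" "card H = 4"
proof -
  have "int (card H) = 4 * int (deg \<sigma> * deg \<sigma>)" using reg_diag_deg[OF k(1) \<sigma>] k(2) by simp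
  then have c: "card H = 4 * (deg \<sigma> * deg \<sigma>)" by linarith
  then have "4 * (deg \<sigma> * deg \<sigma>) dvd 4 * 6" using card_dvd_24[OF subgroup] by simp
  then have d: "deg \<sigma> * deg \<sigma> dvd 6" by (subst (asm) nat_mult_dvd_cancel_disj) simp
  have "deg \<sigma> < 3"
  proof (rule ccontr)
    assume "\<not> deg \<sigma> < 3"
    then have "3 * 3 \<le> deg \<sigma> * deg \<sigma>" by (intro mult_le_mono) simp_all
    moreover have "deg \<sigma> * deg \<sigma> \<le> 6" using d by (intro dvd_imp_le) simp_all
    ultimately show False by simp
  qed
  then have "deg \<sigma> \<in> {0, 1, 2}" by auto
  then show 1: "deg \<sigma> = 1" using d by auto
  show "card H = 4" using c by (simp add: 1)
qed

text \<open>With d the degree, \<open>card H\<close> is 2 d^2 and divides 24, so d^2 divides 12 and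
  d is 1 or 2.\<close>

lemma diag_12:
  assumes k: "k \<in> zbasis M" "reg_diag M k = 12" and \<sigma>: "\<sigma> \<in> f k"
  shows "deg \<sigma> = 1 \<and> card H = 2 \<or> deg \<sigma> = 2 \<and> card H = 8"
proof -
  have "int (card H) = 2 * int (deg \<sigma> * deg \<sigma>)" using reg_diag_deg[OF k(1) \<sigma>] k(2) by simp
  then have c: "card H = 2 * (deg \<sigma> * deg \<sigma>)" by linarith
  then have "2 * (deg \<sigma> * deg \<sigma>) dvd 2 * 12" using card_dvd_24[OF subgroup] by simp
  then have d: "deg \<sigma> * deg \<sigma> dvd 12" by (subst (asm) nat_mult_dvd_cancel_disj) simp
  have "deg \<sigma> < 4"
  proof (rule ccontr)
    assume "\<not> deg \<sigma> < 4"
    then have "4 * 4 \<le> deg \<sigma> * deg \<sigma>" by (intro mult_le_mono) simp_all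
    moreover have "deg \<sigma> * deg \<sigma> \<le> 12" using d by (intro dvd_imp_le) simp_all
    ultimately show False by simp
  qed
  then have "deg \<sigma> \<in> {0, 1, 2, 3}" by auto
  then show ?thesis using d c by auto
qed

end

lemma categorificationE:
  fixes M :: "nat zdata"
  assumes "subgroup H S4" "\<alpha> \<in> carrier (cocycle_group H)" "categorified_by M H \<alpha>"
  obtains f s where "categorification H \<alpha> M f s"
proof -
  have "twisted_group H \<alpha>" using assms(1,2) by (simp add: twisted_group_def perm_group_def twisted_group_axioms_def)
  then show ?thesis using categorified_byE[OF assms(3)] that
    unfolding categorification_def categorification_axioms_def by metis
qed

lemma diagonals_agree:
  fixes M :: "nat zdata"
  assumes "subgroup H S4" "\<alpha> \<in> carrier (cocycle_group H)" "categorified_by M H \<alpha>"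
    and k: "k \<in> zbasis M" "reg_diag M k = 6" and l: "l \<in> zbasis M" "reg_diag M l = 6"
  shows "zcoef M x k k = zcoef M x l l"
proof -
  obtain f s where "categorification H \<alpha> M f s" by (rule categorificationE[OF assms(1-3)])
  then interpret categorification H \<alpha> M f s .
  obtain \<sigma> where \<sigma>: "\<sigma> \<in> f k" by (rule member[OF k(1)])
  obtain \<tau> where \<tau>: "\<tau> \<in> f l" by (rule member[OF l(1)])
  have "(of_int (zcoef M x k k) :: complex) * of_nat (card H) = of_int (zcoef M x l l) * of_nat (card H)"
    unfolding one_dimensional_coef[OF k(1) \<sigma> diag_6(1)[OF k \<sigma>]] one_dimensional_coef[OF l(1) \<tau> diag_6(1)[OF l \<tau>]] ..
  then show ?thesis using diag_6(2)[OF k \<sigma>] by simp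
qed

lemma reg_diag_mk_module:
  assumes "length T = n" "length Q = n" "length U = n" "k < n"
  shows "reg_diag (mk_module n T Q U) k = (\<Sum>(c, x)\<leftarrow>[(1, One), (1, Psi), (2, Rho1), (3, Rho2), (3, Rho3)]. c * mtab n T Q U x ! k ! k)"
  by (simp add: reg_diag_def zcoef_mk_module[OF assms(1-3) assms(4) assms(4)])

text \<open>The basis elements 0 and 2 both have regular diagonal 6, hence would be one-dimensional
  and have equal diagonals. But \<open>Psi\<close> has the diagonal entries 0 and 1 there in
  \<open>M43\<close> and \<open>M44\<close>, and \<open>Rho2\<close> has them in
  \<open>M46\<close>.\<close>

lemma not_categorified_M43_M44_M46:
  assumes "M \<in> {M43, M44, M46}" and H: "subgroup H S4" "\<alpha> \<in> carrier (cocycle_group H)"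
  shows "\<not> categorified_by M H \<alpha>"
proof
  assume c: "categorified_by M H \<alpha>"
  have r: "reg_diag M 0 = 6" "reg_diag M 2 = 6" and b: "0 \<in> zbasis M" "2 \<in> zbasis M"
    and ne: "zcoef M Psi 0 0 \<noteq> zcoef M Psi 2 2 \<or> zcoef M Rho2 0 0 \<noteq> zcoef M Rho2 2 2"
    using assms(1) by (auto simp: M43_def M44_def M46_def reg_diag_mk_module zcoef_mk_module mmul_nth)
      (simp_all add: mk_module_def eval_nat_numeral One_nat_def)
  show False using diagonals_agree[OF H c b(1) r(1) b(2) r(2)] ne by metis
qed

section \<open>Conjugates of the listed subgroups\<close>

definition conj_tup :: "tup \<Rightarrow> tup \<Rightarrow> tup" where
  "conj_tup t x = tcomp t (tcomp x (tinv t))"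

definition listed_lists :: "tup list list" where
  "listed_lists = [Z1_list, Z2_list, Z3_list, Z4_list, K4_list, S3_list, D4_list, A4_list, perms4]"

lemma closed_listed: "L \<in> set listed_lists \<Longrightarrow> closed_list L"
  using closed_lists closed_perms4 unfolding listed_lists_def by auto

lemma inj_conj_tup:
  assumes "t \<in> set perms4"
  shows "inj (conj_tup t)"
proof (rule injI)
  fix x y assume "conj_tup t x = conj_tup t y"
  then have "tapp (tinv t) \<circ> tapp (conj_tup t x) \<circ> tapp t = tapp (tinv t) \<circ> tapp (conj_tup t y) \<circ> tapp t" by simp
  moreover have "tapp (tinv t) \<circ> tapp (conj_tup t x) \<circ> tapp t = tapp x" for x
  proof -
    have "tapp (tinv t) \<circ> tapp t = id" unfolding tapp_comp tinv(3)[OF assms] by (rule tapp_id)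
    then show ?thesis unfolding conj_tup_def tapp_comp[symmetric]
      by (metis comp_assoc comp_id id_comp)
  qed
  ultimately show "x = y" by (simp only: tapp_eq_iff)
qed

lemma listed_subgroupE:
  assumes "listed_subgroup H"
  obtains t L where "t \<in> set perms4" "L \<in> set listed_lists" "H = tapp ` conj_tup t ` set L" "card H = length L"
proof -
  obtain K g where K: "K \<in> {Z1_sub, Z2_sub, Z3_sub, Z4_sub, K4_sub, S3_sub, D4_sub, A4_sub, S4_sub}" and g: "g \<in> carrier S4"
    and H: "H = (g <#\<^bsub>S4\<^esub> K) #>\<^bsub>S4\<^esub> (inv\<^bsub>S4\<^esub> g)"
    using assms unfolding listed_subgroup_def by blast
  obtain L where L: "L \<in> set listed_lists" "K = tapp ` set L"
    using K Z1_sub_eq Z2_sub_eq Z3_sub_eq Z4_sub_eq K4_sub_eq S3_sub_eq D4_sub_eq A4_sub_eq S4_sub_eq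
    unfolding listed_lists_def by auto
  obtain t where t: "t \<in> set perms4" "g = tapp t" using g unfolding S4_tapp by blast
  have "inv\<^bsub>S4\<^esub> g = tapp (tinv t)" using sym_group_inv_equality[OF g] pinv_tapp[OF t(1)] t(2) by simp
  then have "H = (\<lambda>k. tapp t \<circ> k \<circ> tapp (tinv t)) ` K"
    unfolding H l_coset_def r_coset_def S4_simps t(2) by auto
  then have eq: "H = tapp ` conj_tup t ` set L"
    unfolding L(2) image_image conj_tup_def by (simp only: tapp_comp[symmetric] comp_assoc)
  have "card H = length L"
    unfolding eq card_image[OF inj_tapp] card_image[OF inj_on_subset[OF inj_conj_tup[OF t(1)] subset_UNIV]]
    by (rule distinct_card[OF closed_listD_distinct[OF closed_listed[OF L(1)]]])
  then show ?thesis using that t(1) L(1) eq by blast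
qed

lemma listed_subgroup_subgroup:
  assumes "listed_subgroup H"
  shows "subgroup H S4"
proof -
  obtain K g where K: "K \<in> {Z1_sub, Z2_sub, Z3_sub, Z4_sub, K4_sub, S3_sub, D4_sub, A4_sub, S4_sub}" and g: "g \<in> carrier S4"
    and H: "H = (g <#\<^bsub>S4\<^esub> K) #>\<^bsub>S4\<^esub> (inv\<^bsub>S4\<^esub> g)"
    using assms unfolding listed_subgroup_def by blast
  have "subgroup K S4"
    using K closed_lists[THEN subgroup_tapp] subgroup_tapp[OF closed_perms4]
    unfolding Z1_sub_eq Z2_sub_eq Z3_sub_eq Z4_sub_eq K4_sub_eq S3_sub_eq D4_sub_eq A4_sub_eq S4_sub_eq by auto
  then show ?thesis unfolding H by (rule group.subgroup_conjugation_is_surj2[OF sym_group_is_group g])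
qed

text \<open>The lengths 2 and 4 leave \<open>Z2_list\<close>, \<open>Z4_list\<close> and
  \<open>K4_list\<close>, all of whose conjugates contain odd permutations. Here the choice of the
  conjugacy classes of Z2 and K4 matters.\<close>

lemma conj_odd:
  assumes "t \<in> set perms4" "L \<in> set listed_lists" "length L = 2 \<or> length L = 4"
  shows "\<exists>x\<in>set L. tsign (conj_tup t x) = - 1"
proof -
  have "list_all (\<lambda>t. list_all (list_ex (\<lambda>x. tsign (conj_tup t x) = - 1)) [Z2_list, Z4_list, K4_list]) perms4"
    by code_simp
  moreover have "L \<in> set [Z2_list, Z4_list, K4_list]"
    using assms(2,3) by (auto simp: listed_lists_def Z1_list_def Z3_list_def S3_list_def D4_list_def A4_list_def perms4_def)
  ultimately show ?thesis using assms(1) unfolding list_all_iff list_ex_iff by blast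
qed

lemma conj_D4:
  assumes "t \<in> set perms4"
  shows "\<exists>(a, b, r)\<in>set dihedral_triples. conj_tup t ` set D4_list \<subseteq> set (dihedral_list a b r)"
proof -
  have "list_all (\<lambda>t. list_ex (\<lambda>(a, b, r). list_all (\<lambda>x. conj_tup t x \<in> set (dihedral_list a b r)) D4_list) dihedral_triples) perms4"
    by code_simp
  then show ?thesis using assms unfolding list_all_iff list_ex_iff by (fastforce simp: case_prod_unfold)
qed

text \<open>A listed subgroup is given up to conjugation, so \<open>M23\<close> is established for
  each of the three Sylow 2-subgroups and not only for \<open>D4_sub\<close>.\<close>

lemma M23_dihedral_twisted:
  assumes "(a, b, r) \<in> set dihedral_triples"
  shows "categorified_by_twisted M23 (tapp ` set (dihedral_list a b r))"
proof -
  let ?ths = "[\<lambda>t. (tchi One t, 0), \<lambda>t. (tchi Psi t, 0)]"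
  have "list_all (\<lambda>(a, b, r). table_check (0, 0) (dihedral_list a b r) [\<lambda>t. (tchi One t, 0), \<lambda>t. (tchi Psi t, 0)] twisted_value id
      [[0,1],[1,0]] [[1,1],[1,1]] [[1,2],[2,1]] \<and>
      vanish_check (dihedral_list a b r) [\<lambda>t. (tchi One t, 0), \<lambda>t. (tchi Psi t, 0)] [1, 1] twisted_value) dihedral_triples"
    by code_simp
  then have check: "table_check (0, 0) (dihedral_list a b r) ?ths twisted_value id [[0,1],[1,0]] [[1,1],[1,1]] [[1,2],[2,1]]"
    "vanish_check (dihedral_list a b r) ?ths [1, 1] twisted_value"
    using assms unfolding list_all_iff by auto
  note closed = dihedral_triples_check(1)[OF assms]
  show ?thesis unfolding M23_def
  proof (rule categorified_by_twisted_check[OF closed detected_dihedral[OF assms], where w = "0" and u = "0" and v = "0" and s = id and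
      xs = "[irr_entry One, irr_entry Psi]"])
    show "table_check (0, 0) (dihedral_list a b r) (map (fst \<circ> snd) [irr_entry One, irr_entry Psi]) twisted_value id
      [[0,1],[1,0]] [[1,1],[1,1]] [[1,2],[2,1]]"
      unfolding list.map comp_def fst_conv snd_conv by (rule check)
    show "vanish_check (dihedral_list a b r) (map (fst \<circ> snd) [irr_entry One, irr_entry Psi])
      (map (snd \<circ> snd) [irr_entry One, irr_entry Psi]) twisted_value"
      unfolding list.map comp_def fst_conv snd_conv irr_dim.simps by (rule check)
  qed (use rep_data_irrs[OF closed] module_check_square[OF module_check_M23]
     in \<open>auto simp del: tchi.simps\<close>)
qed

text \<open>Regular diagonal 6 forces order 4 and a one-dimensional module. The diagonal entry 1 of
  \<open>Psi\<close> then makes all elements of H even, against \<open>conj_odd\<close>.\<close>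

lemma not_categorified_M42:
  assumes "listed_subgroup H" "\<alpha> \<in> carrier (cocycle_group H)"
  shows "\<not> categorified_by M42 H \<alpha>"
proof
  assume "categorified_by M42 H \<alpha>"
  then obtain f s where "categorification H \<alpha> M42 f s"
    by (rule categorificationE[OF listed_subgroup_subgroup[OF assms(1)] assms(2)])
  then interpret categorification H \<alpha> M42 f s .
  have k: "0 \<in> zbasis M42" "reg_diag M42 0 = 6" "zcoef M42 Psi 0 0 = 1"
    by (auto simp: M42_def reg_diag_mk_module zcoef_mk_module mmul_nth) (simp_all add: mk_module_def eval_nat_numeral One_nat_def)
  obtain \<sigma> where \<sigma>: "\<sigma> \<in> f 0" by (rule member[OF k(1)])
  note d = diag_6[OF k(1,2) \<sigma>]
  obtain t L where t: "t \<in> set perms4" "L \<in> set listed_lists" "H = tapp ` conj_tup t ` set L" "card H = length L"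
    by (rule listed_subgroupE[OF assms(1)])
  obtain x where x: "x \<in> set L" "tsign (conj_tup t x) = - 1" using conj_odd[OF t(1,2)] t(4) d(2) by auto
  have h: "tapp (conj_tup t x) \<in> H" using x(1) t(3) by blast
  then have "conj_tup t x \<in> set perms4" using H_sub unfolding S4_tapp by (auto simp: tapp_eq_iff simp del: tapp.simps)
  then show False using all_even[OF k(1) \<sigma> d(1) k(3) h] x(2) by simp
qed

text \<open>Order 2 is excluded by an odd permutation, as for \<open>M42\<close>. In order 8 all
  simple modules have degree 2, so \<alpha> is not a coboundary and \<open>M23\<close> is
  categorified by the same H and \<alpha>. But the diagonal of \<open>Psi\<close> is 0 on
  \<open>M23\<close> and 1 on \<open>M21\<close>.\<close>

lemma not_categorified_M21:
  assumes "listed_subgroup H" "\<alpha> \<in> carrier (cocycle_group H)"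
  shows "\<not> categorified_by M21 H \<alpha>"
proof
  assume "categorified_by M21 H \<alpha>"
  then obtain f s where "categorification H \<alpha> M21 f s"
    by (rule categorificationE[OF listed_subgroup_subgroup[OF assms(1)] assms(2)])
  then interpret categorification H \<alpha> M21 f s .
  have k: "0 \<in> zbasis M21" "reg_diag M21 0 = 12" "zcoef M21 Psi 0 0 = 1" and r: "reg_diag M21 1 = 12" "zbasis M21 = {0, 1}"
    by (auto simp: M21_def reg_diag_mk_module zcoef_mk_module mmul_nth) (auto simp: mk_module_def eval_nat_numeral One_nat_def)
  obtain \<sigma> where \<sigma>: "\<sigma> \<in> f 0" by (rule member[OF k(1)])
  obtain t L where t: "t \<in> set perms4" "L \<in> set listed_lists" "H = tapp ` conj_tup t ` set L" "card H = length L"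
    by (rule listed_subgroupE[OF assms(1)])
  show False using diag_12[OF k(1,2) \<sigma>]
  proof (elim disjE conjE)
    assume d: "deg \<sigma> = 1" "card H = 2"
    obtain x where x: "x \<in> set L" "tsign (conj_tup t x) = - 1" using conj_odd[OF t(1,2)] t(4) d(2) by auto
    have h: "tapp (conj_tup t x) \<in> H" using x(1) t(3) by blast
    then have "conj_tup t x \<in> set perms4" using H_sub unfolding S4_tapp by (auto simp: tapp_eq_iff simp del: tapp.simps)
    then show False using all_even[OF k(1) \<sigma> d(1) k(3) h] x(2) by simp
  next
    assume c8: "card H = 8"
    have "L = D4_list" using t(2,4) c8
      by (auto simp: listed_lists_def Z1_list_def Z2_list_def Z3_list_def Z4_list_def K4_list_def S3_list_def A4_list_def perms4_def)
    then obtain a b r where tr: "(a, b, r) \<in> set dihedral_triples" and sub: "conj_tup t ` set L \<subseteq> set (dihedral_list a b r)"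
      using conj_D4[OF t(1)] by blast
    have "H \<subseteq> tapp ` set (dihedral_list a b r)" unfolding t(3) by (rule image_mono[OF sub])
    moreover have "card (tapp ` set (dihedral_list a b r)) = 8"
      unfolding card_tapp[OF closed_listD_distinct[OF dihedral_triples_check(1)[OF tr]]] by (simp add: dihedral_list_def Let_def)
    ultimately have H: "H = tapp ` set (dihedral_list a b r)" using c8 by (intro card_subset_eq) simp_all
    have "\<not> is_cob H \<alpha>"
    proof
      assume cob: "is_cob H \<alpha>"
      obtain K \<rho> where K: "K \<in> simple_classes H \<alpha>" "\<rho> \<in> K" "deg \<rho> = 1" by (rule one_dimensional_class[OF cob])
      have "K \<in> f ` zbasis M21" unfolding bij_betw_imp_surj_on[OF f] by (rule K(1))
      then obtain k' where k': "k' \<in> zbasis M21" "f k' = K" by (elim imageE) simp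
      have "reg_diag M21 k' = 12" using k'(1) k(2) r(1) unfolding r(2) by blast
      from diag_12[OF k'(1) this K(2)[folded k'(2)]] show False using K(3) c8 by simp
    qed
    then have "\<alpha> \<in> nontrivial_cocycles H" using coboundaries_iff[OF assms(2) comp_in] assms(2) by (simp add: nontrivial_cocycles_def)
    then have "categorified_by M23 H \<alpha>" using M23_dihedral_twisted[OF tr] unfolding H categorified_by_twisted_def by blast
    then obtain f' s' where "categorification H \<alpha> M23 f' s'"
      by (rule categorificationE[OF subgroup assms(2)])
    then interpret M23: categorification H \<alpha> M23 f' s' .
    have "f 0 \<in> f' ` zbasis M23" unfolding bij_betw_imp_surj_on[OF M23.f] using bij_betwE[OF f] k(1) by blast
    then obtain k' where k': "k' \<in> zbasis M23" "f' k' = f 0" by (elim imageE) simp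
    have "zcoef M23 Psi k' k' = zcoef M21 Psi 0 0" unfolding M23.Psi_diag[OF k'(1)] Psi_diag[OF k(1)] k'(2) ..
    then show False using k(3) k'(1) by (auto simp: M23_def zcoef_mk_module less_2_cases_iff mk_module_def mat_of_rows_list_def)
  qed
qed

section \<open>Irreducible based modules\<close>

locale irreducible_based =
  fixes M :: "'b zdata"
  assumes based: "based_module M" and irreducible: "zirreducible M"
begin

abbreviation B :: "'b set" where "B \<equiv> zbasis M"
abbreviation a :: "irr \<Rightarrow> 'b \<Rightarrow> 'b \<Rightarrow> int" where "a \<equiv> zcoef M"

lemma fin [simp]: "finite B"
  and nonneg: "k \<in> B \<Longrightarrow> l \<in> B \<Longrightarrow> 0 \<le> a x k l"
  and one: "k \<in> B \<Longrightarrow> l \<in> B \<Longrightarrow> a One k l = of_bool (k = l)"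
  and sym: "k \<in> B \<Longrightarrow> l \<in> B \<Longrightarrow> a x k l = a x l k"
  and prod: "k \<in> B \<Longrightarrow> l \<in> B \<Longrightarrow> (\<Sum>m\<in>B. a x k m * a y m l) = (\<Sum>z\<leftarrow>irr_prod x y. a z k l)"
  using based unfolding based_module_def zplus_module_def by blast+

text \<open>The matrix of the regular representation.\<close>

definition R :: "'b \<Rightarrow> 'b \<Rightarrow> int" where
  "R k l = a One k l + a Psi k l + 2 * a Rho1 k l + 3 * a Rho2 k l + 3 * a Rho3 k l"

lemma R_sym: "k \<in> B \<Longrightarrow> l \<in> B \<Longrightarrow> R k l = R l k"
  unfolding R_def by (simp add: sym[of k l])

lemma R_nonneg: "k \<in> B \<Longrightarrow> l \<in> B \<Longrightarrow> 0 \<le> R k l"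
  unfolding R_def by (simp add: nonneg)

lemma act_R:
  assumes "k \<in> B" "l \<in> B"
  shows "(\<Sum>m\<in>B. a x k m * R m l) = irr_dim x * R k l"
proof -
  have "(\<Sum>m\<in>B. a x k m * R m l) = (\<Sum>m\<in>B. a x k m * a One m l) + (\<Sum>m\<in>B. a x k m * a Psi m l)
      + 2 * (\<Sum>m\<in>B. a x k m * a Rho1 m l) + 3 * (\<Sum>m\<in>B. a x k m * a Rho2 m l) + 3 * (\<Sum>m\<in>B. a x k m * a Rho3 m l)"
    unfolding sum_distrib_left sum.distrib[symmetric] R_def by (intro sum.cong) (simp_all add: algebra_simps)
  also have "\<dots> = irr_dim x * R k l" unfolding prod[OF assms] R_def by (cases x) simp_all
  finally show ?thesis .
qed

lemma R_square:
  assumes "k \<in> B" "l \<in> B"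
  shows "(\<Sum>m\<in>B. R k m * R m l) = 24 * R k l"
proof -
  have "(\<Sum>m\<in>B. R k m * R m l) = (\<Sum>m\<in>B. a One k m * R m l) + (\<Sum>m\<in>B. a Psi k m * R m l)
      + 2 * (\<Sum>m\<in>B. a Rho1 k m * R m l) + 3 * (\<Sum>m\<in>B. a Rho2 k m * R m l) + 3 * (\<Sum>m\<in>B. a Rho3 k m * R m l)"
    unfolding sum_distrib_left sum.distrib[symmetric] R_def[of k] by (intro sum.cong) (simp_all add: algebra_simps)
  then show ?thesis unfolding act_R[OF assms] by simp
qed

text \<open>The support of column l of \<open>R\<close> spans a submodule: if x leads from m in the
  support to k', then \<open>act_R\<close> and nonnegativity make \<open>R k' l\<close> positive.
  The support contains l, so irreducibility makes it all of \<open>B\<close>.\<close>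

lemma R_pos:
  assumes kl: "k \<in> B" "l \<in> B"
  shows "0 < R k l"
proof -
  define J where "J = {k \<in> B. 0 < R k l}"
  have "l \<in> J" using kl one[of l l] nonneg[of l l] unfolding J_def R_def by (simp add: add_pos_nonneg)
  moreover have "spans_submodule M J"
    unfolding spans_submodule_def
  proof (intro allI ballI)
    fix x v assume v: "v \<in> zspan J"
    have "zact M x v k' = 0" if k': "k' \<notin> J" for k'
    proof (cases "k' \<in> B")
      case True
      have "a x k' m * v m = 0" if m: "m \<in> B" for m
      proof (rule ccontr)
        assume nz: "a x k' m * v m \<noteq> 0"
        then have "m \<in> J" using v by (auto simp: zspan_def)
        then have "0 < a x k' m * R m l" using nz nonneg[OF True m, of x] by (auto simp: J_def order_less_le)
        also have "\<dots> \<le> (\<Sum>m\<in>B. a x k' m * R m l)"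
          using m True kl by (intro member_le_sum) (auto simp: nonneg R_nonneg)
        also have "\<dots> = irr_dim x * R k' l" by (rule act_R[OF True kl(2)])
        finally have "R k' l \<noteq> 0" by auto
        then show False using k' True R_nonneg[OF True kl(2)] by (simp add: J_def)
      qed
      then show ?thesis by (simp add: zact_def True)
    qed (simp add: zact_def)
    then show "zact M x v \<in> zspan J" by (simp add: zspan_def)
  qed
  moreover have "J \<subseteq> B" unfolding J_def by blast
  ultimately have "J = B" using irreducible unfolding zirreducible_def by blast
  then have "k \<in> J" using kl by simp
  then show ?thesis unfolding J_def by simp
qed

text \<open>The eigenvalue 24 of the positive matrix \<open>R\<close> is simple: of two eigenvectors \<open>v\<close>, \<open>w\<close> with \<open>v\<close>
  positive, \<open>w - c v\<close> vanishes for the largest \<open>c\<close> that keeps it nonnegative.\<close>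

lemma R_rank_one:
  assumes k: "k \<in> B" and j: "j \<in> B" and l: "l \<in> B"
  shows "R k k * R l j = R k l * R k j"
proof -
  let ?v = "\<lambda>i. R i k" and ?w = "\<lambda>i. R i j"
  obtain i where i: "i \<in> B" and min: "\<And>m. m \<in> B \<Longrightarrow> of_int (?w i) / of_int (?v i) \<le> (of_int (?w m) / of_int (?v m) :: rat)"
    using ex_min_if_finite[of "(\<lambda>i. of_int (?w i) / of_int (?v i) :: rat) ` B"] k by fastforce
  \<comment> \<open>Since \<open>i\<close> minimizes the ratio, \<open>u\<close> is nonnegative; it
    is a combination of two eigenvectors for 24 and vanishes at \<open>i\<close>. Row
    \<open>i\<close> of the positive matrix \<open>R\<close> then forces u = 0.\<close>
  define u where "u m = ?w m * ?v i - ?w i * ?v m" for m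
  have u0: "0 \<le> u m" if m: "m \<in> B" for m
  proof -
    have "of_int (?w i) * of_int (?v m) \<le> (of_int (?w m) * of_int (?v i) :: rat)"
      using min[OF m] R_pos[OF i k] R_pos[OF m k] by (simp add: field_simps)
    then show ?thesis unfolding u_def by (simp flip: of_int_mult)
  qed
  have "(\<Sum>m\<in>B. R i m * u m) = ?v i * (\<Sum>m\<in>B. R i m * ?w m) - ?w i * (\<Sum>m\<in>B. R i m * ?v m)"
    unfolding u_def sum_distrib_left sum_subtractf[symmetric] by (intro sum.cong) (simp_all add: algebra_simps)
  also have "\<dots> = 0" unfolding R_square[OF i j] R_square[OF i k] by simp
  finally have "\<forall>m\<in>B. R i m * u m = 0"
    by (subst (asm) sum_nonneg_eq_0_iff) (auto intro!: mult_nonneg_nonneg u0 R_nonneg i)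
  then have u: "u m = 0" if "m \<in> B" for m using that R_pos[OF i that] by (metis mult_eq_0_iff less_irrefl)
  have e: "?w l * ?v i = ?w i * ?v l" "?w k * ?v i = ?w i * ?v k" using u[OF l] u[OF k] by (simp_all add: u_def)
  have "?v i * (?v k * ?w l) = ?v k * (?w l * ?v i)" by (simp only: mult_ac)
  also have "\<dots> = ?v l * (?w k * ?v i)" unfolding e by (simp only: mult_ac)
  also have "\<dots> = ?v i * (?v l * ?w k)" by (simp only: mult_ac)
  finally have "R k k * R l j = R l k * R k j" using R_pos[OF i k] by simp
  then show ?thesis using R_sym[OF k l] by simp
qed

text \<open>By rank one, \<open>R k k\<close> times the trace is the entry (k, k) of the square of
  \<open>R\<close>, which is \<open>24 * R k k\<close>.\<close>

lemma R_diag_sum: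
  shows "(\<Sum>m\<in>B. R m m) = 24"
proof -
  obtain k where k: "k \<in> B" using irreducible by (auto simp: zirreducible_def)
  have "R k k * (\<Sum>m\<in>B. R m m) = (\<Sum>m\<in>B. R k m * R m k)"
    unfolding sum_distrib_left
  proof (intro sum.cong refl)
    fix m assume m: "m \<in> B"
    show "R k k * R m m = R k m * R m k" using R_rank_one[OF k m m] unfolding R_sym[OF m k] .
  qed
  also have "\<dots> = R k k * 24" unfolding R_square[OF k k] by (rule mult.commute)
  finally show ?thesis using R_pos[OF k k] by simp
qed

lemma R_le: assumes "k \<in> B" shows "R k k \<le> 24"
  unfolding R_diag_sum[symmetric] using assms by (intro member_le_sum) (auto intro: R_nonneg)

definition \<tau> :: "'b \<Rightarrow> 'b" where "\<tau> k = (SOME m. m \<in> B \<and> a Psi k m \<noteq> 0)"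

text \<open>The matrix of \<open>Psi\<close> is symmetric with square 1, so each row of nonnegative
  integers has square sum 1 and consists of a single 1 and zeros.\<close>

lemma \<tau>: assumes k: "k \<in> B"
  shows "\<tau> k \<in> B" "l \<in> B \<Longrightarrow> a Psi k l = of_bool (l = \<tau> k)"
proof -
  have "(\<Sum>m\<in>B. a Psi k m * a Psi m k) = a One k k" by (simp add: prod[OF k k])
  also have "(\<Sum>m\<in>B. a Psi k m * a Psi m k) = (\<Sum>m\<in>B. a Psi k m * a Psi k m)"
    using k by (intro sum.cong) (auto simp: sym[of _ k])
  also have "a One k k = 1" by (simp add: one k)
  finally have s: "(\<Sum>m\<in>B. a Psi k m * a Psi k m) = 1" .
  have ex: "\<exists>m. m \<in> B \<and> a Psi k m \<noteq> 0"
  proof (rule ccontr)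
    assume "\<not> ?thesis"
    then have "(\<Sum>m\<in>B. a Psi k m * a Psi k m) = 0" by (intro sum.neutral) auto
    then show False using s by simp
  qed
  then have t: "\<tau> k \<in> B" "a Psi k (\<tau> k) \<noteq> 0" using someI_ex[OF ex] unfolding \<tau>_def by blast+
  show "\<tau> k \<in> B" by (rule t)
  have pos: "0 < a Psi k (\<tau> k)" using t nonneg[OF k t(1), of Psi] by simp
  have sp: "a Psi k (\<tau> k) * a Psi k (\<tau> k) + (\<Sum>m\<in>B - {\<tau> k}. a Psi k m * a Psi k m) = 1"
    using s t by (simp add: sum.remove)
  have ge: "1 \<le> a Psi k (\<tau> k) * a Psi k (\<tau> k)" "a Psi k (\<tau> k) \<le> a Psi k (\<tau> k) * a Psi k (\<tau> k)"
    using pos by (auto simp: int_one_le_iff_zero_less)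
  have ge0: "0 \<le> (\<Sum>m\<in>B - {\<tau> k}. a Psi k m * a Psi k m)" by (intro sum_nonneg) simp
  have z: "(\<Sum>m\<in>B - {\<tau> k}. a Psi k m * a Psi k m) = 0" using sp ge ge0 by linarith
  show "a Psi k l = of_bool (l = \<tau> k)" if l: "l \<in> B"
  proof (cases "l = \<tau> k")
    case True
    then show ?thesis using sp z ge pos by simp
  next
    case False
    have "\<forall>m\<in>B - {\<tau> k}. a Psi k m * a Psi k m = 0" using z by (subst (asm) sum_nonneg_eq_0_iff) auto
    then show ?thesis using l False by auto
  qed
qed

lemma \<tau>_\<tau>: assumes k: "k \<in> B" shows "\<tau> (\<tau> k) = k"
proof -
  have "a Psi (\<tau> k) k = a Psi k (\<tau> k)" by (rule sym[OF \<tau>(1)[OF k] k])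
  then show ?thesis using \<tau>(2)[OF k \<tau>(1)[OF k]] \<tau>(2)[OF \<tau>(1)[OF k] k] by (auto split: if_splits)
qed

lemma sum_Psi:
  assumes "k \<in> B" "l \<in> B"
  shows "(\<Sum>m\<in>B. a Psi k m * a y m l) = a y (\<tau> k) l" "(\<Sum>m\<in>B. a y k m * a Psi m l) = a y k (\<tau> l)"
proof -
  have "(\<Sum>m\<in>B. a Psi k m * a y m l) = (\<Sum>m\<in>B. if m = \<tau> k then a y m l else 0)"
    using assms by (intro sum.cong) (auto simp: \<tau>(2))
  then show "(\<Sum>m\<in>B. a Psi k m * a y m l) = a y (\<tau> k) l" using \<tau>(1)[OF assms(1)] by simp
  have "(\<Sum>m\<in>B. a y k m * a Psi m l) = (\<Sum>m\<in>B. if m = \<tau> l then a y k m else 0)"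
    using assms by (intro sum.cong) (auto simp: sym[of _ l] \<tau>(2))
  then show "(\<Sum>m\<in>B. a y k m * a Psi m l) = a y k (\<tau> l)" using \<tau>(1)[OF assms(2)] by simp
qed

lemma Rho_\<tau>:
  assumes "k \<in> B" "l \<in> B"
  shows "a Rho1 (\<tau> k) l = a Rho1 k l" "a Rho2 (\<tau> k) l = a Rho3 k l" "a Rho2 k (\<tau> l) = a Rho3 k l"
    "a Rho3 (\<tau> k) l = a Rho2 k l"
  using sum_Psi(1)[OF assms, of Rho1] sum_Psi(1)[OF assms, of Rho2] sum_Psi(2)[OF assms, of Rho2]
    sum_Psi(1)[OF assms, of Rho3] by (simp_all add: prod[OF assms])

lemma Psi_\<tau>: assumes "k \<in> B" "l \<in> B" shows "a Psi (\<tau> k) l = a One k l" "a One (\<tau> k) l = a Psi k l"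
  using sum_Psi(1)[OF assms, of Psi] sum_Psi(1)[OF assms, of One] by (simp_all add: prod[OF assms])

lemma R_\<tau>: assumes "k \<in> B" "l \<in> B" shows "R (\<tau> k) l = R k l"
  unfolding R_def Psi_\<tau>[OF assms] Rho_\<tau>[OF assms] by simp

text \<open>The square sum of row k is the entry (k, k) of the square of \<open>Rho1\<close>, which
  is at most \<open>2 + a Rho1 k k\<close>. This bounds first the diagonal entry and then every
  entry of the row by 2. The bound is what lets residues modulo 3 determine the matrix.\<close>

lemma Rho1_le_2: assumes k: "k \<in> B" and l: "l \<in> B" shows "a Rho1 k l \<le> 2"
proof -
  have "(\<Sum>m\<in>B. a Rho1 k m * a Rho1 m k) = 1 + a Psi k k + a Rho1 k k" by (simp add: prod[OF k k] one k)
  also have "(\<Sum>m\<in>B. a Rho1 k m * a Rho1 m k) = (\<Sum>m\<in>B. a Rho1 k m * a Rho1 k m)"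
    using k by (intro sum.cong) (auto simp: sym[of _ k])
  finally have s: "(\<Sum>m\<in>B. a Rho1 k m * a Rho1 k m) = 1 + a Psi k k + a Rho1 k k" .
  have le: "a Rho1 k m * a Rho1 k m \<le> 2 + a Rho1 k k" if m: "m \<in> B" for m
  proof -
    have "a Rho1 k m * a Rho1 k m \<le> (\<Sum>m\<in>B. a Rho1 k m * a Rho1 k m)" using m by (intro member_le_sum) auto
    moreover have "a Psi k k \<le> 1" using \<tau>(2)[OF k k] by simp
    ultimately show ?thesis unfolding s by linarith
  qed
  have *: "x \<le> 2" if "x * x \<le> c" "c \<le> 4" for x c :: int
  proof (rule ccontr)
    assume "\<not> x \<le> 2"
    then have "3 * 3 \<le> x * x" by (intro mult_mono) simp_all
    then show False using that by linarith
  qed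
  have "a Rho1 k k \<le> 2"
  proof (rule ccontr)
    assume "\<not> a Rho1 k k \<le> 2"
    then have "3 * a Rho1 k k \<le> a Rho1 k k * a Rho1 k k" by (intro mult_right_mono) linarith+
    then show False using le[OF k] \<open>\<not> a Rho1 k k \<le> 2\<close> by linarith
  qed
  then have "2 + a Rho1 k k \<le> 4" by linarith
  then show ?thesis by (rule *[OF le[OF l]])
qed

end

section \<open>The classification\<close>

definition tab :: "nat \<Rightarrow> (nat \<Rightarrow> nat \<Rightarrow> int) \<Rightarrow> int list list" where
  "tab n f = map (\<lambda>i. map (\<lambda>j. f i j) [0..<n]) [0..<n]"

lemma tab_nth: "i < n \<Longrightarrow> j < n \<Longrightarrow> tab n f ! i ! j = f i j"
  by (simp add: tab_def)

lemma tab_cong: "(\<And>i j. i < n \<Longrightarrow> j < n \<Longrightarrow> f i j = g i j) \<Longrightarrow> tab n f = tab n g"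
  by (simp add: tab_def)

text \<open>The bases are enumerated so that \<open>V\<^sub>\<psi>\<close> acts by \<open>swp p\<close>.\<close>

definition swp :: "nat \<Rightarrow> nat \<Rightarrow> nat" where
  "swp p i = (if i < 2 * p then if even i then i + 1 else i - 1 else i)"

lemma swp_Suc: "swp (Suc p) (i + 2) = swp p i + 2"
  by (auto simp: swp_def elim!: oddE)

lemma swp_less: "2 * p \<le> n \<Longrightarrow> i < n \<Longrightarrow> swp p i < n"
  unfolding swp_def by (auto elim!: evenE)

text \<open>Induction on the size: a 2-cycle of t is placed in front at 0 and 1, and the enumeration
  of the rest is shifted by 2, which \<open>swp_Suc\<close> allows.\<close>

lemma involution_enumeration:
  assumes "finite A" "\<And>x. x \<in> A \<Longrightarrow> t x \<in> A" "\<And>x. x \<in> A \<Longrightarrow> t (t x) = x"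
  shows "\<exists>p e. 2 * p \<le> card A \<and> bij_betw e {..<card A} A \<and> (\<forall>i<card A. e (swp p i) = t (e i))"
  using assms
proof (induction "card A" arbitrary: A rule: less_induct)
  case less
  show ?case
  proof (cases "\<exists>x\<in>A. t x \<noteq> x")
    case False
    obtain e where "bij_betw e {..<card A} A"
      using ex_bij_betw_nat_finite[OF less.prems(1)] by (auto simp: atLeast0LessThan)
    moreover have "\<forall>i<card A. e (swp 0 i) = t (e i)"
      using False bij_betwE[OF \<open>bij_betw e {..<card A} A\<close>] by (simp add: swp_def)
    ultimately show ?thesis by (intro exI[of _ 0] exI[of _ e]) simp
  next
    case True
    then obtain x where x: "x \<in> A" "t x \<noteq> x" by blast
    let ?A = "A - {x, t x}"
    have sub: "{x, t x} \<subseteq> A" "card {x, t x} = 2" using x less.prems by auto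
    have "card ?A = card A - 2" using sub by (simp add: card_Diff_subset)
    moreover have "2 \<le> card A" using sub card_mono[OF less.prems(1) sub(1)] by simp
    ultimately have c: "card A = Suc (Suc (card ?A))" by simp
    have "t y \<in> ?A" if "y \<in> ?A" for y
      using that less.prems(2,3)[of y] less.prems(3)[OF x(1)] by auto
    then obtain p e where pe: "2 * p \<le> card ?A" "bij_betw e {..<card ?A} ?A" "\<forall>i<card ?A. e (swp p i) = t (e i)"
      using less.hyps[of ?A] c less.prems by auto
    define e' where "e' i = (if i = 0 then x else if i = 1 then t x else e (i - 2))" for i :: nat
    have lt: "{..<card A} = insert 0 (insert 1 ((\<lambda>i. i + 2) ` {..<card ?A}))"
    proof (intro equalityI subsetI)
      fix i assume i: "i \<in> {..<card A}"
      show "i \<in> insert 0 (insert 1 ((\<lambda>i. i + 2) ` {..<card ?A}))"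
      proof (cases "i < 2")
        case False
        then have "i = (i - 2) + 2" "i - 2 < card ?A" using i unfolding c by auto
        then show ?thesis by blast
      qed (auto simp: One_nat_def)
    qed (auto simp: c One_nat_def)
    have e2: "e' (i + 2) = e i" for i by (simp add: e'_def)
    have img: "e' ` (\<lambda>i. i + 2) ` {..<card ?A} = ?A"
      using bij_betw_imp_surj_on[OF pe(2)] by (simp only: image_image e2)
    have "e' ` {..<card A} = A"
      unfolding lt image_insert img using sub by (auto simp: e'_def One_nat_def)
    then have bij: "bij_betw e' {..<card A} A"
      using eq_card_imp_inj_on[of "{..<card A}" e'] by (simp add: bij_betw_def)
    have "e' (swp (Suc p) i) = t (e' i)" if i: "i < card A" for i
    proof (cases "i < 2")
      case True
      then have "i = 0 \<or> i = 1" by auto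
      then show ?thesis using less.prems(3)[OF x(1)] by (auto simp: e'_def swp_def One_nat_def)
    next
      case False
      then have "i = (i - 2) + 2" "i - 2 < card ?A" using i c by auto
      then show ?thesis using pe(3) swp_Suc[of p "i - 2"] e2 by metis
    qed
    then show ?thesis using bij pe(1) c by (intro exI[of _ "Suc p"] exI[of _ e']) auto
  qed
qed

text \<open>Square roots between 1 and 24, the range of the entries of \<open>R\<close>; the value 0
  signals that there is none.\<close>

definition isq :: "int \<Rightarrow> int" where
  "isq x = (case filter (\<lambda>y. y * y = x) [1..24] of [] \<Rightarrow> 0 | y # _ \<Rightarrow> y)"

lemma isq_square:
  assumes "0 < y" "y \<le> 24"
  shows "isq (y * y) = y"
proof (cases "filter (\<lambda>z. z * z = y * y) [1..24]")
  case Nil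
  then show ?thesis using assms by (auto simp: filter_empty_conv)
next
  case (Cons z zs)
  then have "z \<in> set (filter (\<lambda>z. z * z = y * y) [1..24])" by simp
  then have "z = y" using assms by (auto simp: square_eq_iff)
  then show ?thesis using Cons by (simp add: isq_def)
qed

text \<open>Candidates for the diagonal of \<open>R\<close>, one entry per orbit of
  \<open>V\<^sub>\<psi>\<close>. At a 2-orbit the entry x occurs twice (c = 1); at a fixed point the
  entry is even and written 2 x (c = 2). So the trace 24 becomes the condition that the x have sum
  12. Neighbouring entries must have a square product because \<open>R\<close> has rank one.\<close>

fun diagonals :: "int list \<Rightarrow> int \<Rightarrow> int list list" where
  "diagonals [] s = (if s = 0 then [[]] else [])"
| "diagonals (c # cs) s = concat (map (\<lambda>x. map ((#) (c * x))
     (filter (\<lambda>v. case v of [] \<Rightarrow> True | y # _ \<Rightarrow> isq (c * x * y) \<noteq> 0) (diagonals cs (s - x)))) [1..s])"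

lemma diagonals_complete:
  assumes "length cs = length xs" "\<forall>x\<in>set xs. 1 \<le> x" "sum_list xs = s"
    "\<forall>x\<in>set (map2 (*) cs xs). \<forall>y\<in>set (map2 (*) cs xs). isq (x * y) \<noteq> 0"
  shows "map2 (*) cs xs \<in> set (diagonals cs s)"
  using assms
proof (induction cs xs arbitrary: s rule: list_induct2)
  case (Cons c cs x xs)
  have "0 \<le> sum_list xs" using Cons.prems(1) by (intro sum_list_nonneg) auto
  then have "x \<in> set [1..s]" using Cons.prems by auto
  moreover have "map2 (*) cs xs \<in> set (diagonals cs (s - x))" using Cons by auto
  ultimately show ?case using Cons.prems(3) by (auto split: list.split intro!: bexI[of _ x])
qed simp

text \<open>The number of the orbit of i: the pairs have the numbers below p, and the fixed points,
  which start at index 2 p, follow from p on.\<close>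

definition orb :: "nat \<Rightarrow> nat \<Rightarrow> nat" where
  "orb p i = (if i < 2 * p then i div 2 else i - p)"

definition tmat :: "nat \<Rightarrow> nat \<Rightarrow> nat \<Rightarrow> int" where
  "tmat p i j = of_bool (j = swp p i)"

definition explicit_tables :: "(nat \<times> int list list \<times> int list list \<times> int list list) list" where
  "explicit_tables = [
    (1, [[1]],
      [[2]], [[3]]),
    (2, [[1,0],[0,1]],
      [[2,0],[0,2]], [[1,2],[2,1]]),
    (2, [[0,1],[1,0]],
      [[1,1],[1,1]], [[2,1],[1,2]]),
    (2, [[0,1],[1,0]],
      [[1,1],[1,1]], [[1,2],[2,1]]),
    (3, [[1,0,0],[0,1,0],[0,0,1]],
      [[0,1,1],[1,0,1],[1,1,0]], [[1,1,1],[1,1,1],[1,1,1]]),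
    (3, [[0,1,0],[1,0,0],[0,0,1]],
      [[0,0,1],[0,0,1],[1,1,1]], [[1,0,1],[0,1,1],[1,1,2]]),
    (3, [[0,1,0],[1,0,0],[0,0,1]],
      [[0,0,1],[0,0,1],[1,1,1]], [[0,1,1],[1,0,1],[1,1,2]]),
    (4, [[1,0,0,0],[0,1,0,0],[0,0,1,0],[0,0,0,1]],
      [[0,0,1,1],[0,2,0,0],[1,0,0,1],[1,0,1,0]], [[0,1,0,0],[1,2,1,1],[0,1,0,0],[0,1,0,0]]),
    (4, [[1,0,0,0],[0,1,0,0],[0,0,1,0],[0,0,0,1]],
      [[2,0,0,0],[0,2,0,0],[0,0,2,0],[0,0,0,2]], [[0,1,1,1],[1,0,1,1],[1,1,0,1],[1,1,1,0]]),
    (4, [[0,1,0,0],[1,0,0,0],[0,0,1,0],[0,0,0,1]],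
      [[1,1,0,0],[1,1,0,0],[0,0,2,0],[0,0,0,2]], [[1,0,1,1],[0,1,1,1],[1,1,0,1],[1,1,1,0]]),
    (4, [[0,1,0,0],[1,0,0,0],[0,0,1,0],[0,0,0,1]],
      [[1,1,0,0],[1,1,0,0],[0,0,2,0],[0,0,0,2]], [[0,1,1,1],[1,0,1,1],[1,1,0,1],[1,1,1,0]]),
    (4, [[0,1,0,0],[1,0,0,0],[0,0,0,1],[0,0,1,0]],
      [[1,1,0,0],[1,1,0,0],[0,0,1,1],[0,0,1,1]], [[0,1,1,1],[1,0,1,1],[1,1,0,1],[1,1,1,0]]),
    (4, [[0,1,0,0],[1,0,0,0],[0,0,0,1],[0,0,1,0]],
      [[1,1,0,0],[1,1,0,0],[0,0,1,1],[0,0,1,1]], [[0,1,1,1],[1,0,1,1],[1,1,1,0],[1,1,0,1]]),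
    (4, [[0,1,0,0],[1,0,0,0],[0,0,0,1],[0,0,1,0]],
      [[1,1,0,0],[1,1,0,0],[0,0,1,1],[0,0,1,1]], [[1,0,1,1],[0,1,1,1],[1,1,1,0],[1,1,0,1]]),
    (5, [[0,1,0,0,0],[1,0,0,0,0],[0,0,0,1,0],[0,0,1,0,0],[0,0,0,0,1]],
      [[0,0,0,0,1],[0,0,0,0,1],[0,0,1,1,0],[0,0,1,1,0],[1,1,0,0,1]], [[0,0,0,1,0],[0,0,1,0,0],[0,1,1,1,1],[1,0,1,1,1],[0,0,1,1,0]]),
    (5, [[0,1,0,0,0],[1,0,0,0,0],[0,0,0,1,0],[0,0,1,0,0],[0,0,0,0,1]],
      [[1,1,0,0,0],[1,1,0,0,0],[0,0,1,1,0],[0,0,1,1,0],[0,0,0,0,2]], [[0,0,0,1,1],[0,0,1,0,1],[0,1,0,0,1],[1,0,0,0,1],[1,1,1,1,1]])]"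

lemma explicit_modules_tables: "explicit_modules = map (\<lambda>(n, T, Q, U). mk_module n T Q U) explicit_tables"
  unfolding explicit_modules_def explicit_defs explicit_tables_def by simp

definition permtab :: "nat \<Rightarrow> nat list \<Rightarrow> int list list \<Rightarrow> int list list" where
  "permtab n \<pi> A = tab n (\<lambda>i j. A ! (\<pi> ! i) ! (\<pi> ! j))"

text \<open>These permutations suffice to match every solution of the search with one of the 16 modules.\<close>

definition match_perms :: "nat list list" where
  "match_perms = [[0, 1, 2, 3], [0, 1], [0, 1, 2], [0, 1, 2, 3, 4], [3, 2, 1, 0], [1, 0, 2, 3, 4], [0], [3, 0, 2, 1],
    [3, 2, 0, 1, 4], [3, 2, 1, 0, 4], [1, 2, 3, 0]]"

text \<open>The nested conditionals let evaluation stop at the first matrix that differs.\<close>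

definition matches :: "nat \<Rightarrow> int list list \<Rightarrow> int list list \<Rightarrow> int list list \<Rightarrow> bool" where
  "matches n T Q U \<longleftrightarrow> list_ex (\<lambda>(m, T', Q', U'). if m = n then
     list_ex (\<lambda>\<pi>. if length \<pi> = n then
       if permtab n \<pi> T' = T then if permtab n \<pi> Q' = Q then permtab n \<pi> U' = U else False else False else False) match_perms
     else False) explicit_tables"

text \<open>For p at most 2 there are 2 p - 1 unordered pairs of 2-orbits, none for p = 0 by
  truncated subtraction. The pair of orbits x and y has its parameter at position x + y, and the
  parameter is the entry at (2 x, 2 y).\<close>

definition params :: "nat \<Rightarrow> int list list \<Rightarrow> int list list" where
  "params p S = product_lists (map (\<lambda>(i, j). [0..S ! i ! j]) (take (2 * p - 1) [(0, 0), (0, 2), (2, 2)]))"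

text \<open>\<open>S\<close> is the matrix of \<open>V\<^sub>\<rho>\<^sub>2 + V\<^sub>\<rho>\<^sub>3\<close>. It determines that of \<open>V\<^sub>\<rho>\<^sub>2\<close> up to one parameter for each two orbits
  of size 2 of \<open>V\<^sub>\<psi>\<close> on the basis.\<close>

definition ucand :: "nat \<Rightarrow> int list list \<Rightarrow> int list \<Rightarrow> nat \<Rightarrow> nat \<Rightarrow> int" where
  "ucand p S vs i j = (if i < 2 * p \<and> j < 2 * p
     then if even (i + j) then vs ! (i div 2 + j div 2) else S ! i ! j - vs ! (i div 2 + j div 2)
     else S ! i ! j div 2)"

text \<open>The stages \<open>search1\<close> to \<open>search5\<close> hand on matrices that are
  already evaluated. A candidate that violates a product equation counts as a success, since it is
  not a module; only survivors have to match one of the 16.\<close>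

definition search5 where
  "search5 n p Q S U \<longleftrightarrow> (if mmul n U U = tab n (\<lambda>i j. of_bool (i = j) + Q ! i ! j + S ! i ! j)
     then matches n (tab n (tmat p)) Q U else True)"

definition search4 where
  "search4 n p Q S \<longleftrightarrow> list_all (\<lambda>vs. search5 n p Q S (tab n (ucand p S vs))) (params p S)"

definition search3 where
  "search3 n p A Q \<longleftrightarrow> (if mmul n Q Q = tab n (\<lambda>i j. of_bool (i = j) + tmat p i j + Q ! i ! j)
     then search4 n p Q (tab n (\<lambda>i j. (A ! i ! j - 2 * Q ! i ! j) div 3)) else True)"

text \<open>\<open>A\<close> is 2 Q + 3 S, so 2 A is congruent to Q modulo 3, and the entries of Q
  lie between 0 and 2.\<close>

definition search2 where
  "search2 n p A \<longleftrightarrow> search3 n p A (tab n (\<lambda>i j. 2 * A ! i ! j mod 3))"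

definition search1 where
  "search1 n p R \<longleftrightarrow> search2 n p (tab n (\<lambda>i j. R ! i ! j - of_bool (i = j) - tmat p i j))"

definition search :: "nat \<Rightarrow> nat \<Rightarrow> bool" where
  "search n p \<longleftrightarrow> list_all (\<lambda>rs. search1 n p (tab n (\<lambda>i j. isq (rs ! orb p i * rs ! orb p j))))
     (diagonals (replicate p 1 @ replicate (n - 2 * p) 2) 12)"

lemma search_all:
  "search 1 0" "search 2 0" "search 2 1" "search 3 0" "search 3 1" "search 4 0" "search 4 1" "search 4 2"
  "search 5 0" "search 5 1" "search 5 2"
  by code_simp+

lemma sum_pairs: "(\<Sum>i<2 * p. g i) = (\<Sum>q<p. g (2 * q) + g (2 * q + 1))" for g :: "nat \<Rightarrow> int"
  by (induction p) (simp_all add: One_nat_def add.assoc)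

lemma match_perms_bij: "\<pi> \<in> set match_perms \<Longrightarrow> bij_betw ((!) \<pi>) {..<length \<pi>} {..<length \<pi>}"
proof -
  assume "\<pi> \<in> set match_perms"
  moreover have "list_all (\<lambda>\<pi>. distinct \<pi> \<and> list_all (\<lambda>i. i < length \<pi>) \<pi>) match_perms" by code_simp
  ultimately have d: "distinct \<pi>" "set \<pi> \<subseteq> {..<length \<pi>}" by (auto simp: list_all_iff)
  then have "set \<pi> = {..<length \<pi>}" by (intro card_subset_eq) (simp_all add: distinct_card)
  then show ?thesis using bij_betw_nth[OF d(1)] by (simp add: atLeast0LessThan)
qed

context irreducible_based
begin

text \<open>Three matrices decide equivalence: that of \<open>One\<close> is the unit matrix, and on
  both sides that of \<open>Rho3\<close> is the product of those of \<open>Psi\<close> and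
  \<open>Rho2\<close>.\<close>

lemma enumerated_matches:
  assumes bij: "bij_betw e {..<n} B" and m: "matches n T Q U"
    and T: "T = tab n (\<lambda>i j. a Psi (e i) (e j))" and Q: "Q = tab n (\<lambda>i j. a Rho1 (e i) (e j))"
    and U: "U = tab n (\<lambda>i j. a Rho2 (e i) (e j))"
  shows "\<exists>N\<in>set explicit_modules. zequiv M N"
proof -
  obtain T' Q' U' \<pi> where tb: "(n, T', Q', U') \<in> set explicit_tables" and \<pi>: "\<pi> \<in> set match_perms" "length \<pi> = n"
    and pT: "permtab n \<pi> T' = T" and pQ: "permtab n \<pi> Q' = Q" and pU: "permtab n \<pi> U' = U"
    using m unfolding matches_def list_ex_iff by (auto split: if_splits)
  have "list_all (\<lambda>(n, T, Q, U). length T = n \<and> length Q = n \<and> length U = n) explicit_tables"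
    by code_simp
  then have len: "length T' = n" "length Q' = n" "length U' = n" using tb by (auto simp: list_all_iff)
  let ?N = "mk_module n T' Q' U'"
  have N: "?N \<in> set explicit_modules" unfolding explicit_modules_tables using tb by force
  have bp: "bij_betw ((!) \<pi>) {..<n} {..<n}" using match_perms_bij[OF \<pi>(1)] \<pi>(2) by simp
  have plt: "\<pi> ! i < n" if "i < n" for i using bij_betwE[OF bp] that by simp
  have eB: "e i \<in> B" if "i < n" for i using bij_betwE[OF bij] that by simp
  have val: "T' ! (\<pi> ! i) ! (\<pi> ! j) = a Psi (e i) (e j)" "Q' ! (\<pi> ! i) ! (\<pi> ! j) = a Rho1 (e i) (e j)"
    "U' ! (\<pi> ! i) ! (\<pi> ! j) = a Rho2 (e i) (e j)" if "i < n" "j < n" for i j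
    using tab_nth[OF that, of "\<lambda>i j. T' ! (\<pi> ! i) ! (\<pi> ! j)"] tab_nth[OF that, of "\<lambda>i j. Q' ! (\<pi> ! i) ! (\<pi> ! j)"]
      tab_nth[OF that, of "\<lambda>i j. U' ! (\<pi> ! i) ! (\<pi> ! j)"]
    unfolding permtab_def[symmetric] pT pQ pU unfolding T Q U tab_nth[OF that] by simp_all
  let ?g = "inv_into {..<n} e"
  have bg: "bij_betw ?g B {..<n}" by (rule bij_betw_inv_into[OF bij])
  have bf: "bij_betw ((!) \<pi> \<circ> ?g) B {..<n}" by (rule bij_betw_trans[OF bg bp])
  have coef: "zcoef ?N x (\<pi> ! i) (\<pi> ! j) = a x (e i) (e j)" if ij: "i < n" "j < n" for x i j
    unfolding zcoef_mk_module[OF len plt[OF ij(1)] plt[OF ij(2)]]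
  proof (cases x)
    case One
    have "\<pi> ! i = \<pi> ! j \<longleftrightarrow> i = j" using bij_betw_imp_inj_on[OF bp] ij by (auto dest: inj_onD)
    moreover have "e i = e j \<longleftrightarrow> i = j" using bij_betw_imp_inj_on[OF bij] ij by (auto dest: inj_onD)
    ultimately show "mtab n T' Q' U' x ! (\<pi> ! i) ! (\<pi> ! j) = a x (e i) (e j)"
      unfolding One using plt[OF ij(1)] plt[OF ij(2)] by (simp add: one[OF eB[OF ij(1)] eB[OF ij(2)]])
  next
    case Rho3
    have "mtab n T' Q' U' x ! (\<pi> ! i) ! (\<pi> ! j) = (\<Sum>m<n. T' ! (\<pi> ! i) ! m * U' ! m ! (\<pi> ! j))"
      unfolding Rho3 mtab.simps by (rule mmul_nth[OF plt[OF ij(1)] plt[OF ij(2)]])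
    also have "\<dots> = (\<Sum>m<n. T' ! (\<pi> ! i) ! (\<pi> ! m) * U' ! (\<pi> ! m) ! (\<pi> ! j))"
      by (rule sum.reindex_bij_betw[OF bp, symmetric])
    also have "\<dots> = (\<Sum>m<n. a Psi (e i) (e m) * a Rho2 (e m) (e j))"
      using ij by (intro sum.cong) (simp_all add: val)
    also have "\<dots> = (\<Sum>m\<in>B. a Psi (e i) m * a Rho2 m (e j))"
      by (rule sum.reindex_bij_betw[OF bij])
    also have "\<dots> = a Rho3 (e i) (e j)" by (simp add: prod eB ij)
    finally show "mtab n T' Q' U' x ! (\<pi> ! i) ! (\<pi> ! j) = a x (e i) (e j)" unfolding Rho3 .
  qed (simp_all add: val[OF ij])
  have "zequiv M ?N"
    unfolding zequiv_def
  proof (intro exI[of _ "(!) \<pi> \<circ> ?g"] conjI allI ballI)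
    show "bij_betw ((!) \<pi> \<circ> ?g) B (zbasis ?N)" using bf by (simp add: mk_module_def)
    fix x k l assume k: "k \<in> B" and l: "l \<in> B"
    have g: "?g k < n" "?g l < n" "e (?g k) = k" "e (?g l) = l"
      using bij_betwE[OF bg] k l bij_betw_inv_into_right[OF bij] by auto
    show "zcoef ?N x (((!) \<pi> \<circ> ?g) k) (((!) \<pi> \<circ> ?g) l) = a x k l"
      using coef[OF g(1,2)] by (simp add: g)
  qed
  then show ?thesis using N by blast
qed

text \<open>Rank one makes \<open>R k l\<close> a square root of the product of two diagonal
  entries, and the bound 24 on these keeps it in the range of \<open>isq\<close>.\<close>

lemma R_entry:
  assumes k: "k \<in> B" and l: "l \<in> B"
  shows "isq (R k k * R l l) = R k l"
proof -
  have eq: "R k k * R l l = R k l * R k l" using R_rank_one[OF k l l] .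
  have "R k l \<le> 24"
  proof (rule ccontr)
    assume "\<not> R k l \<le> 24"
    then have "25 * 25 \<le> R k l * R k l" by (intro mult_mono) simp_all
    moreover have "R k k * R l l \<le> 24 * 24" using R_le[OF k] R_le[OF l] R_nonneg[OF k k] R_nonneg[OF l l]
      by (intro mult_mono) simp_all
    ultimately show False using eq by linarith
  qed
  then show ?thesis unfolding eq using R_pos[OF k l] by (intro isq_square)
qed

lemma search_sound:
  assumes p: "2 * p \<le> n" and n5: "n \<le> 5" and bij: "bij_betw e {..<n} B"
    and esw: "\<And>i. i < n \<Longrightarrow> e (swp p i) = \<tau> (e i)" and search: "search n p"
  shows "\<exists>N\<in>set explicit_modules. zequiv M N"
proof -
  define c where "c x i j = a x (e i) (e j)" for x i j
  have eB: "e i \<in> B" if "i < n" for i using bij_betwE[OF bij] that by simp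
  note swl = swp_less[OF p]
  have cT: "c Psi i j = tmat p i j" if "i < n" "j < n" for i j
  proof -
    have "e j = e (swp p i) \<longleftrightarrow> j = swp p i"
      using bij_betw_imp_inj_on[OF bij] that swl[OF that(1)] by (auto dest: inj_onD)
    then show ?thesis using \<tau>(2)[OF eB eB] that esw by (simp add: c_def tmat_def)
  qed
  have c1: "c One i j = of_bool (i = j)" if "i < n" "j < n" for i j
    using one[OF eB eB] bij_betw_imp_inj_on[OF bij] that by (auto simp: c_def dest: inj_onD)
  have cprod: "(\<Sum>m<n. c x i m * c y m j) = (\<Sum>z\<leftarrow>irr_prod x y. c z i j)" if "i < n" "j < n" for x y i j
    using sum.reindex_bij_betw[OF bij, of "\<lambda>m. a x (e i) m * a y m (e j)"] prod[OF eB eB] that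
    by (simp add: c_def)
  have csym: "c x i j = c x j i" if "i < n" "j < n" for x i j
    using sym[OF eB eB] that by (simp add: c_def)
  have cw: "c Rho2 (swp p i) j = c Rho3 i j" "c Rho2 i (swp p j) = c Rho3 i j" "c Rho3 (swp p i) j = c Rho2 i j"
    if "i < n" "j < n" for i j
    using Rho_\<tau>[OF eB eB] that esw by (simp_all add: c_def)
  have c0: "0 \<le> c x i j" if "i < n" "j < n" for x i j using nonneg[OF eB eB] that by (simp add: c_def)
  have cR: "R (e i) (e j) = of_bool (i = j) + tmat p i j + 2 * c Rho1 i j + 3 * (c Rho2 i j + c Rho3 i j)"
    if "i < n" "j < n" for i j
    using c1[OF that] cT[OF that] by (simp add: R_def c_def)
  define r where "r i = R (e i) (e i)" for i
  \<comment> \<open>The unknowns of \<open>diagonals\<close>: the diagonal entry for a pair, half of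
    it for a fixed point. The fixed point with orbit number q has the index q + p.\<close>
  define xs where "xs = map (\<lambda>q. if q < p then r (2 * q) else r (q + p) div 2) [0..<n - p]"
  define cs where "cs = replicate p 1 @ replicate (n - 2 * p) (2 :: int)"
  have r0: "0 < r i" if "i < n" for i using R_pos[OF eB eB] that by (simp add: r_def)
  have swfix: "swp p i = i" if "2 * p \<le> i" for i using that by (simp add: swp_def)
  \<comment> \<open>At a fixed point \<open>One\<close> and \<open>Psi\<close> together contribute
    2, and \<open>Rho2\<close> and \<open>Rho3\<close> agree, so every contribution is even.\<close>
  have reven: "even (r i)" if "i < n" "2 * p \<le> i" for i
    using cR[OF that(1) that(1)] cw(1)[OF that(1) that(1)] swfix[OF that(2)] by (simp add: r_def tmat_def)
  have rpair: "r (2 * q + 1) = r (2 * q)" if q: "q < p" for q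
  proof -
    have lt: "2 * q < n" and s: "swp p (2 * q) = 2 * q + 1" using q p by (auto simp: swp_def)
    have "e (2 * q + 1) = \<tau> (e (2 * q))" using esw[OF lt] s by simp
    then show ?thesis unfolding r_def
      using R_\<tau>[OF eB[OF lt] \<tau>(1)[OF eB[OF lt]]] R_sym[OF eB[OF lt] \<tau>(1)[OF eB[OF lt]]] R_\<tau>[OF eB[OF lt] eB[OF lt]]
      by simp
  qed
  have len: "length cs = length xs" using p by (simp add: cs_def xs_def)
  have csxs: "map2 (*) cs xs = map (\<lambda>q. if q < p then r (2 * q) else r (q + p)) [0..<n - p]"
  proof (rule nth_equalityI)
    fix q assume "q < length (map2 (*) cs xs)"
    then have q: "q < n - p" using len by (simp add: xs_def)
    then show "map2 (*) cs xs ! q = map (\<lambda>q. if q < p then r (2 * q) else r (q + p)) [0..<n - p] ! q"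
      using len reven[of "q + p"] by (auto simp: cs_def xs_def nth_append)
  qed (use len in \<open>simp add: xs_def\<close>)
  have rs_nth: "map2 (*) cs xs ! orb p i = r i" if i: "i < n" for i
  proof (cases "i < 2 * p")
    case True
    then have q: "i div 2 < p" by auto
    have "r (2 * (i div 2)) = r i"
    proof (cases "even i")
      case False
      then have "i = 2 * (i div 2) + 1" by presburger
      then show ?thesis using rpair[OF q] by metis
    qed simp
    then show ?thesis unfolding csxs orb_def using True q p by simp
  next
    case False
    then show ?thesis unfolding csxs orb_def using i p by auto
  qed
  have sub: "\<exists>i<n. x = r i" if "x \<in> set (map2 (*) cs xs)" for x
    using that p unfolding csxs by (force split: if_splits)
  have "map2 (*) cs xs \<in> set (diagonals cs 12)"
  proof (rule diagonals_complete[OF len])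
    show "\<forall>x\<in>set xs. 1 \<le> x"
    proof
      fix x assume "x \<in> set xs"
      then obtain q where q: "q < n - p" "x = (if q < p then r (2 * q) else r (q + p) div 2)"
        by (auto simp: xs_def)
      show "1 \<le> x"
      proof (cases "q < p")
        case True
        then show ?thesis using q r0[of "2 * q"] p by simp
      next
        case False
        then have "q + p < n" "2 * p \<le> q + p" using q p by auto
        then have "0 < r (q + p)" "even (r (q + p))" using r0 reven by auto
        then have "1 \<le> r (q + p) div 2" by (auto elim!: evenE)
        then show ?thesis using q False by simp
      qed
    qed
    \<comment> \<open>Doubling turns the sum into the trace of \<open>R\<close>: a pair stands for
      two equal diagonal entries, and at a fixed point the factor cancels the halving.\<close>
    have "2 * sum_list xs = (\<Sum>q<n - p. 2 * (if q < p then r (2 * q) else r (q + p) div 2))"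
      by (simp add: xs_def interv_sum_list_conv_sum_set_nat atLeast0LessThan sum_distrib_left)
    also have "\<dots> = (\<Sum>q<p. 2 * r (2 * q)) + (\<Sum>q=p..<n - p. r (q + p))"
    proof -
      let ?f = "\<lambda>q. 2 * (if q < p then r (2 * q) else r (q + p) div 2)"
      have "(\<Sum>q<n - p. ?f q) = (\<Sum>q<p. ?f q) + (\<Sum>q=p..<n - p. ?f q)"
        using sum.atLeastLessThan_concat[of 0 p "n - p" ?f] p unfolding atLeast0LessThan by linarith
      also have "(\<Sum>q=p..<n - p. ?f q) = (\<Sum>q=p..<n - p. r (q + p))"
      proof (intro sum.cong refl)
        fix q assume "q \<in> {p..<n - p}"
        then have "q + p < n" "2 * p \<le> q + p" "\<not> q < p" by auto
        then show "?f q = r (q + p)" using reven[of "q + p"] by simp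
      qed
      also have "(\<Sum>q<p. ?f q) = (\<Sum>q<p. 2 * r (2 * q))" by (intro sum.cong) simp_all
      finally show ?thesis .
    qed
    also have "(\<Sum>q<p. 2 * r (2 * q)) = (\<Sum>i<2 * p. r i)"
      unfolding sum_pairs by (intro sum.cong) (simp_all add: rpair)
    also have "(\<Sum>q=p..<n - p. r (q + p)) = (\<Sum>i=2 * p..<n. r i)"
      using sum.shift_bounds_nat_ivl[of r p p "n - p"] p by (simp add: mult_2)
    also have "(\<Sum>i<2 * p. r i) + (\<Sum>i=2 * p..<n. r i) = (\<Sum>i<n. r i)"
      using sum.atLeastLessThan_concat[of 0 "2 * p" n r] p by (simp add: atLeast0LessThan)
    also have "\<dots> = 24" unfolding r_def using sum.reindex_bij_betw[OF bij, of "\<lambda>k. R k k"] R_diag_sum by simp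
    finally show "sum_list xs = 12" by simp
    show "\<forall>x\<in>set (map2 (*) cs xs). \<forall>y\<in>set (map2 (*) cs xs). isq (x * y) \<noteq> 0"
    proof (intro ballI)
      fix x y assume "x \<in> set (map2 (*) cs xs)" "y \<in> set (map2 (*) cs xs)"
      then obtain i j where "i < n" "x = r i" "j < n" "y = r j" using sub by metis
      then show "isq (x * y) \<noteq> 0" using R_entry[OF eB eB] R_pos[OF eB eB] by (fastforce simp: r_def)
    qed
  qed
  then have "search1 n p (tab n (\<lambda>i j. isq (map2 (*) cs xs ! orb p i * map2 (*) cs xs ! orb p j)))"
    using search unfolding search_def cs_def list_all_iff by blast
  also have "tab n (\<lambda>i j. isq (map2 (*) cs xs ! orb p i * map2 (*) cs xs ! orb p j)) = tab n (\<lambda>i j. R (e i) (e j))"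
    by (intro tab_cong) (simp only: rs_nth, simp add: r_def R_entry eB)
  finally have "search2 n p (tab n (\<lambda>i j. tab n (\<lambda>i j. R (e i) (e j)) ! i ! j - of_bool (i = j) - tmat p i j))"
    unfolding search1_def .
  also have "tab n (\<lambda>i j. tab n (\<lambda>i j. R (e i) (e j)) ! i ! j - of_bool (i = j) - tmat p i j) =
      tab n (\<lambda>i j. 2 * c Rho1 i j + 3 * (c Rho2 i j + c Rho3 i j))" (is "_ = ?A")
    by (intro tab_cong) (simp add: tab_nth cR)
  finally have "search3 n p ?A (tab n (\<lambda>i j. 2 * ?A ! i ! j mod 3))" unfolding search2_def .
  also have "tab n (\<lambda>i j. 2 * ?A ! i ! j mod 3) = tab n (c Rho1)" (is "_ = ?Q")
  proof (intro tab_cong)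
    fix i j assume ij: "i < n" "j < n"
    have "2 * (2 * c Rho1 i j + 3 * (c Rho2 i j + c Rho3 i j)) = c Rho1 i j + 3 * (c Rho1 i j + 2 * (c Rho2 i j + c Rho3 i j))"
      by simp
    then have "2 * (2 * c Rho1 i j + 3 * (c Rho2 i j + c Rho3 i j)) mod 3 = c Rho1 i j mod 3"
      by (simp only: mod_mult_self2)
    also have "\<dots> = c Rho1 i j" using c0[OF ij] Rho1_le_2[OF eB[OF ij(1)] eB[OF ij(2)]] by (simp add: c_def)
    finally show "2 * ?A ! i ! j mod 3 = c Rho1 i j" unfolding tab_nth[OF ij] .
  qed
  finally have s3: "search3 n p ?A ?Q" .
  have "mmul n ?Q ?Q = tab n (\<lambda>i j. of_bool (i = j) + tmat p i j + ?Q ! i ! j)"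
    unfolding mmul_def tab_def[of n "\<lambda>i j. of_bool (i = j) + tmat p i j + ?Q ! i ! j"]
    using cprod[of _ _ Rho1 Rho1] c1 cT
    by (auto simp: tab_nth interv_sum_list_conv_sum_set_nat atLeast0LessThan)
  then have "search4 n p ?Q (tab n (\<lambda>i j. (?A ! i ! j - 2 * ?Q ! i ! j) div 3))"
    using s3 unfolding search3_def by simp
  also have "tab n (\<lambda>i j. (?A ! i ! j - 2 * ?Q ! i ! j) div 3) = tab n (\<lambda>i j. c Rho2 i j + c Rho3 i j)" (is "_ = ?S")
    by (intro tab_cong) (simp add: tab_nth)
  finally have s4: "search4 n p ?Q ?S" .
  \<comment> \<open>The actual entries of \<open>Rho2\<close> at the positions of the parameters, so
    that the search meets the given module.\<close>
  define vs where "vs = take (2 * p - 1) [c Rho2 0 0, c Rho2 0 2, c Rho2 2 2]"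
  have p012: "p = 0 \<or> p = 1 \<or> p = 2" using p n5 by auto
  have S: "?S ! i ! j = c Rho2 i j + c Rho3 i j" if "i < n" "j < n" for i j using tab_nth[OF that] .
  have "vs \<in> set (params p ?S)"
    using p012 p c0 S by (auto simp: vs_def params_def product_lists_set eval_nat_numeral One_nat_def)
  then have "search5 n p ?Q ?S (tab n (ucand p ?S vs))" using s4 unfolding search4_def list_all_iff by blast
  also have "tab n (ucand p ?S vs) = tab n (c Rho2)" (is "_ = ?U")
  proof (intro tab_cong)
    fix i j assume ij: "i < n" "j < n"
    show "ucand p ?S vs i j = c Rho2 i j"
    proof (cases "i < 2 * p \<and> j < 2 * p")
      case False
      \<comment> \<open>If \<open>V\<^sub>\<psi>\<close> fixes i or j, then \<open>Rho2\<close> and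
        \<open>Rho3\<close> agree at (i, j), and each is half of their sum.\<close>
      then have "c Rho3 i j = c Rho2 i j" using cw(1,2)[OF ij] swfix[of i] swfix[of j] by auto
      then show ?thesis using False S[OF ij] by (auto simp: ucand_def)
    next
      case True
      define x y where "x = i div 2" and "y = j div 2"
      have xy: "x < p" "y < p" using True by (auto simp: x_def y_def)
      then have lt: "2 * x < n" "2 * y < n" "2 * x + 1 < n" "2 * y + 1 < n" using p by auto
      have sw: "swp p (2 * x) = 2 * x + 1" "swp p (2 * x + 1) = 2 * x" "swp p (2 * y) = 2 * y + 1" "swp p (2 * y + 1) = 2 * y"
        using xy by (auto simp: swp_def)
      have v: "vs ! (x + y) = c Rho2 (2 * x) (2 * y)"
      proof -
        have "p = 1 \<and> x = 0 \<and> y = 0 \<or> p = 2 \<and> (x = 0 \<or> x = 1) \<and> (y = 0 \<or> y = 1)" using p012 xy by linarith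
        then show ?thesis using p csym[of 2 0 Rho2] by (elim disjE conjE) (simp_all add: vs_def One_nat_def eval_nat_numeral)
      qed
      \<comment> \<open>Moving one index by \<open>swp p\<close> exchanges \<open>Rho2\<close> and
        \<open>Rho3\<close>, and moving both restores them, so one entry determines the block of two
        pairs.\<close>
      have off: "c Rho2 (2 * x + 1) (2 * y) = c Rho3 (2 * x) (2 * y)" "c Rho2 (2 * x) (2 * y + 1) = c Rho3 (2 * x) (2 * y)"
        "c Rho2 (2 * x + 1) (2 * y + 1) = c Rho2 (2 * x) (2 * y)"
        "c Rho3 (2 * x + 1) (2 * y) = c Rho2 (2 * x) (2 * y)" "c Rho3 (2 * x) (2 * y + 1) = c Rho2 (2 * x) (2 * y)"
        using cw(1)[OF lt(1,2)] cw(2)[OF lt(1,2)] cw(3)[OF lt(1,2)] cw(2)[OF lt(1,4)] cw(2)[OF lt(3,2)] sw by simp_all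
      have "i = 2 * x \<or> i = 2 * x + 1" "j = 2 * y \<or> j = 2 * y + 1" unfolding x_def y_def by auto
      then show ?thesis using True S[OF ij] v off by (auto simp: ucand_def x_def[symmetric] y_def[symmetric])
    qed
  qed
  finally have s5: "search5 n p ?Q ?S ?U" .
  have "mmul n ?U ?U = tab n (\<lambda>i j. of_bool (i = j) + ?Q ! i ! j + ?S ! i ! j)"
    unfolding mmul_def tab_def[of n "\<lambda>i j. of_bool (i = j) + ?Q ! i ! j + ?S ! i ! j"]
    using cprod[of _ _ Rho2 Rho2] c1
    by (auto simp: tab_nth interv_sum_list_conv_sum_set_nat atLeast0LessThan)
  then have "matches n (tab n (tmat p)) ?Q ?U" using s5 unfolding search5_def by simp
  moreover have "tab n (tmat p) = tab n (\<lambda>i j. a Psi (e i) (e j))"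
    using cT by (intro tab_cong) (simp add: c_def)
  ultimately show ?thesis by (intro enumerated_matches[OF bij]) (simp_all add: c_def[abs_def])
qed

lemma classification:
  assumes "card B \<le> 5"
  shows "\<exists>N\<in>set explicit_modules. zequiv M N"
proof -
  obtain p e where pe: "2 * p \<le> card B" "bij_betw e {..<card B} B" "\<forall>i<card B. e (swp p i) = \<tau> (e i)"
    using involution_enumeration[of B \<tau>] \<tau>(1) \<tau>_\<tau> by auto
  have "card B \<noteq> 0" using irreducible by (simp add: zirreducible_def)
  then consider "card B = 1" | "card B = 2" | "card B = 3" | "card B = 4" | "card B = 5" using assms by linarith
  then have s: "search (card B) p"
  proof cases
    case 1
    moreover from 1 have "p = 0" using pe(1) by simp
    ultimately show ?thesis by (simp only: search_all)
  next
    case 2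
    have "p = 0 \<or> p = 1" using 2 pe(1) by linarith
    then show ?thesis unfolding 2 by (elim disjE) (simp_all only: search_all)
  next
    case 3
    have "p = 0 \<or> p = 1" using 3 pe(1) by linarith
    then show ?thesis unfolding 3 by (elim disjE) (simp_all only: search_all)
  next
    case 4
    have "p = 0 \<or> p = 1 \<or> p = 2" using 4 pe(1) by linarith
    then show ?thesis unfolding 4 by (elim disjE) (simp_all only: search_all)
  next
    case 5
    have "p = 0 \<or> p = 1 \<or> p = 2" using 5 pe(1) by linarith
    then show ?thesis unfolding 5 by (elim disjE) (simp_all only: search_all)
  qed
  show ?thesis by (rule search_sound[OF pe(1) assms pe(2) pe(3)[rule_format] s])
qed

end

theorem theorem4p18:
  shows
    "(\<forall>M \<in> set explicit_modules. based_module M \<and> zirreducible M \<and> zrank M \<le> 5) \<and>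
     sorted_wrt (\<lambda>M N. \<not> zequiv M N) explicit_modules \<and>
     (\<forall>M :: 'b zdata. based_module M \<and> zirreducible M \<and> zrank M \<le> 5 \<longrightarrow>
        (\<exists>N \<in> set explicit_modules. zequiv M N)) \<and>

     (\<forall>H \<in> {K4_sub, D4_sub, A4_sub, S4_sub}. second_cohomology H \<cong> integer_mod_group 2) \<and>

     categorified_by_Rep M11 Z1_sub \<and> categorified_by_twisted M11 K4_sub \<and>
     categorified_by_Rep M22 Z2_sub \<and> categorified_by_twisted M22 D4_sub \<and>
     categorified_by_Rep M23 Z2_sub \<and> categorified_by_twisted M23 D4_sub \<and>
     categorified_by_Rep M31 Z3_sub \<and> categorified_by_twisted M31 A4_sub \<and>
     categorified_by_Rep M32 S3_sub \<and>
     categorified_by_Rep M33 S3_sub \<and> categorified_by_twisted M33 S4_sub \<and>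
     categorified_by_Rep M41 A4_sub \<and>
     categorified_by_Rep M45 Z4_sub \<and> categorified_by_Rep M45 K4_sub \<and>
     categorified_by_Rep M47 Z4_sub \<and> categorified_by_Rep M47 K4_sub \<and>
     categorified_by_Rep M51 S4_sub \<and>
     categorified_by_Rep M52 D4_sub \<and>

     (\<forall>M \<in> {M43, M44, M46}. \<forall>H \<alpha>.
        subgroup H S4 \<and> \<alpha> \<in> carrier (cocycle_group H) \<longrightarrow> \<not> categorified_by M H \<alpha>) \<and>
     (\<forall>M \<in> {M21, M42}. \<forall>H \<alpha>.
        listed_subgroup H \<and> \<alpha> \<in> carrier (cocycle_group H) \<longrightarrow> \<not> categorified_by M H \<alpha>)"
proof (intro conjI)
  show "\<forall>M \<in> set explicit_modules. based_module M \<and> zirreducible M \<and> zrank M \<le> 5"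
    using explicit_modules_based by blast
  show "\<forall>M :: 'b zdata. based_module M \<and> zirreducible M \<and> zrank M \<le> 5 \<longrightarrow> (\<exists>N \<in> set explicit_modules. zequiv M N)"
    using irreducible_based.classification irreducible_based.intro unfolding zrank_def by blast
  show "\<forall>M \<in> {M43, M44, M46}. \<forall>H \<alpha>. subgroup H S4 \<and> \<alpha> \<in> carrier (cocycle_group H) \<longrightarrow> \<not> categorified_by M H \<alpha>"
    using not_categorified_M43_M44_M46 by blast
  show "\<forall>M \<in> {M21, M42}. \<forall>H \<alpha>. listed_subgroup H \<and> \<alpha> \<in> carrier (cocycle_group H) \<longrightarrow> \<not> categorified_by M H \<alpha>"
    using not_categorified_M21 not_categorified_M42 by blast
qed (rule explicit_modules_inequivalent second_cohomology_twisted_subgroups M11_Z1 M11_K4_twisted M22_Z2 M22_D4_twisted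
  M23_Z2 M23_D4_twisted M31_Z3 M31_A4_twisted M32_S3 M33_S3 M33_S4_twisted M41_A4 M45_Z4 M45_K4 M47_Z4 M47_K4 M51_S4 M52_D4)+

end
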